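(* Let $S$ be a $1$-dimensional complex submanifold of a complex $2$-manifold $M$, and let $f$ be a germ about $S$ of holomorphic self-map of $M$ sending $S$ into itself, such that $f|_S=\mathrm{id}_S$. Assume that $df$ acts as the identity on the normal bundle of $S$ in $M$, and that $f$ is tangential to $S$. If $p\in S$ is a singular point of $f$, not a corner, with pure order $\nu_o(f,p)=1$ and residual index $\mathrm{Ind}(f,S,p)\neq 0$, then there exist parabolic curves (that is, at least one parabolic curve) for $f$ at $p$.
   Context: All notions at $p\in S$ are defined by choosing a chart of $M$ centered at $p$ and using the local expression of $f$ as a germ at the origin $O$ of $\mathbb{C}^2$; they do not depend on the chart. Pure order, singular point, corner. Let $\mathcal{O}_2$ be the ring of germs at $O$ of holomorphic functions on $\mathbb{C}^2$. The order $\nu(g)$ of a nonzero $g\in\mathcal{O}_2$ is the least degree of a nonzero homogeneous term in its power series expansion at $O$ (and $\nu(0)=\infty$). For a germ $f\neq\mathrm{id}$ with $f(O)=O$, write $f=(z+g,\,w+h)$, put $l=\gcd(g,h)$ in $\mathcal{O}_2$, $g=l g^o$, $h=l h^o$. The pure order is $\nu_o(f,O)=\min\{\nu(g^o),\nu(h^o)\}$. The point is singular for $f$ if $\nu_o(f,O)\ge 1$. It is a corner if the germ of the fixed point set $\mathrm{Fix}(f)$ has at least two local (irreducible) components intersecting at $O$. Tangentiality and residual index. A chart $(z,w)$ centered at $p\in S$ is adapted to $S$ if $S=\{z=0\}$ in it. Since $f|_S=\mathrm{id}_S$ and $df$ acts as the identity on the normal bundle of $S$, in an adapted chart $f=(f_1,f_2)$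 with $f_1(z,w)=z+z^{\mu+2}\hat g(z,w)$, $f_2(z,w)=w+z^{\nu+1}\hat h(z,w)$, where $\mu,\nu\in\mathbb{N}\cup\{\infty\}$ ($\mathbb N$ includes $0$; $\mu=\infty$, resp. $\nu=\infty$, means $\hat g\equiv0$, resp. $\hat h\equiv 0$), and $z$ divides neither $\hat g$ nor $\hat h$ otherwise. Put $$k(w)=\lim_{z\to0}\frac{f_1(z,w)-z}{z(f_2(z,w)-w)},$$ so that $k\equiv 0$ if $\mu>\nu$, $k(w)=(\hat g/\hat h)(0,w)$ if $\mu=\nu$, and $k\equiv\infty$ if $\mu<\nu$. The map $f$ is tangential to $S$ (also called nondegenerate along $S$) if $k\not\equiv\infty$. In that case $\mathrm{Ind}(f,S,p)=\mathrm{Res}_{w=0}\,k(w)$, the residue at $0$ of the meromorphic function $k$. Parabolic curve. A parabolic curve for a germ $f$ at the origin $O\in\mathbb{C}^2$ is an injective holomorphic map $\varphi:\Delta\to\mathbb{C}^2$ such that: (i) $\Delta\subset\mathbb{C}$ is a simply connected domain with $0\in\partial\Delta$; (ii) $\varphi$ is continuous at the origin, with $\varphi(0)=O$; (iii) $\varphi(\Delta)$ is invariant under $f$, and $(f|_{\varphi(\Delta)})^k\to O$ as $k\to\infty$. A parabolic curve for $f$ at $p\in M$ is one for the expression of $f$ in a chart centered at $p$. *)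

theory Defs
  imports "HOL-Complex_Analysis.Complex_Analysis" "HOL-Library.Extended_Nat"
begin

section \<open>Holomorphic functions of two complex variables\<close>

text \<open>The real derivative is required to be complex linear, i.e. of the form
  \<open>(u, v) \<mapsto> a u + b v\<close> with complex \<open>a\<close>, \<open>b\<close>.\<close>

definition holo2_on :: "(complex \<times> complex) set \<Rightarrow> (complex \<times> complex \<Rightarrow> complex) \<Rightarrow> bool" where
  "holo2_on U g \<longleftrightarrow>
     open U \<and> (\<forall>x\<in>U. \<exists>a b. (g has_derivative (\<lambda>v. a * fst v + b * snd v)) (at x))"

definition holo_map2_on ::
    "(complex \<times> complex) set \<Rightarrow> (complex \<times> complex \<Rightarrow> complex \<times> complex) \<Rightarrow> bool" where
  "holo_map2_on U F \<longleftrightarrow> holo2_on U (\<lambda>x. fst (F x)) \<and> holo2_on U (\<lambda>x. snd (F x))"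


section \<open>Germs at the origin\<close>

text \<open>A germ in \<open>\<O>\<^sub>2\<close> is represented by a total function that is holomorphic near the origin;
  two functions represent the same germ iff they agree near the origin. All notions below
  only depend on the germ represented.\<close>

definition germ2 :: "(complex \<times> complex \<Rightarrow> complex) \<Rightarrow> bool" where
  "germ2 g \<longleftrightarrow> (\<exists>U. 0 \<in> U \<and> holo2_on U g)"

definition germ_eq :: "(complex \<times> complex \<Rightarrow> 'b) \<Rightarrow> (complex \<times> complex \<Rightarrow> 'b) \<Rightarrow> bool" where
  "germ_eq g h \<longleftrightarrow> (\<forall>\<^sub>F x in nhds 0. g x = h x)"

definition germ_dvd ::
    "(complex \<times> complex \<Rightarrow> complex) \<Rightarrow> (complex \<times> complex \<Rightarrow> complex) \<Rightarrow> bool" where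
  "germ_dvd d g \<longleftrightarrow> (\<exists>q. germ2 q \<and> germ_eq g (\<lambda>x. d x * q x))"

definition is_germ_gcd ::
    "(complex \<times> complex \<Rightarrow> complex) \<Rightarrow> (complex \<times> complex \<Rightarrow> complex) \<Rightarrow>
     (complex \<times> complex \<Rightarrow> complex) \<Rightarrow> bool" where
  "is_germ_gcd l g h \<longleftrightarrow> germ2 l \<and> germ_dvd l g \<and> germ_dvd l h \<and>
     (\<forall>d. germ2 d \<longrightarrow> germ_dvd d g \<longrightarrow> germ_dvd d h \<longrightarrow> germ_dvd d l)"

definition power_series_at_O ::
    "(complex \<times> complex \<Rightarrow> complex) \<Rightarrow> (nat \<Rightarrow> nat \<Rightarrow> complex) \<Rightarrow> bool" where
  "power_series_at_O g a \<longleftrightarrow>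
     (\<exists>r>0. \<forall>z w. cmod z < r \<longrightarrow> cmod w < r \<longrightarrow>
        ((\<lambda>(m, n). a m n * z ^ m * w ^ n) has_sum g (z, w)) UNIV)"

definition coeff_at_O :: "(complex \<times> complex \<Rightarrow> complex) \<Rightarrow> nat \<Rightarrow> nat \<Rightarrow> complex" where
  "coeff_at_O g = (THE a. power_series_at_O g a)"

text \<open>The homogeneous term of degree \<open>d\<close> is nonzero iff some coefficient with \<open>m + n = d\<close> is;
  the infimum of the empty set is \<open>\<infinity>\<close>, which covers the zero germ.\<close>

definition order_at_O :: "(complex \<times> complex \<Rightarrow> complex) \<Rightarrow> enat" where
  "order_at_O g = Inf {enat (m + n) | m n. coeff_at_O g m n \<noteq> 0}"


section \<open>Pure order, singular points, corners\<close>

text \<open>A gcd is unique up to a unit of \<open>\<O>\<^sub>2\<close>, so for \<open>F\<close> different from the identity germ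
  the value described here does not depend on the choice of \<open>l\<close>. For the identity germ
  \<open>l = 0\<close> and the description is meaningless; singular_germ excludes that case.\<close>

definition pure_order :: "(complex \<times> complex \<Rightarrow> complex \<times> complex) \<Rightarrow> enat" where
  "pure_order F = (THE n. \<exists>l g\<^sub>0 h\<^sub>0.
     is_germ_gcd l (\<lambda>x. fst (F x) - fst x) (\<lambda>x. snd (F x) - snd x) \<and>
     germ2 g\<^sub>0 \<and> germ_eq (\<lambda>x. fst (F x) - fst x) (\<lambda>x. l x * g\<^sub>0 x) \<and>
     germ2 h\<^sub>0 \<and> germ_eq (\<lambda>x. snd (F x) - snd x) (\<lambda>x. l x * h\<^sub>0 x) \<and>
     n = min (order_at_O g\<^sub>0) (order_at_O h\<^sub>0))"

definition singular_germ :: "(complex \<times> complex \<Rightarrow> complex \<times> complex) \<Rightarrow> bool" where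
  "singular_germ F \<longleftrightarrow> \<not> germ_eq F (\<lambda>x. x) \<and> 1 \<le> pure_order F"

text \<open>Germs of sets at the origin are likewise represented by sets. Note that
  \<open>nhds 0\<close> includes the origin itself.\<close>

definition germ_subset :: "(complex \<times> complex) set \<Rightarrow> (complex \<times> complex) set \<Rightarrow> bool" where
  "germ_subset A B \<longleftrightarrow> (\<forall>\<^sub>F x in nhds 0. x \<in> A \<longrightarrow> x \<in> B)"

definition germ_set_eq :: "(complex \<times> complex) set \<Rightarrow> (complex \<times> complex) set \<Rightarrow> bool" where
  "germ_set_eq A B \<longleftrightarrow> germ_subset A B \<and> germ_subset B A"

definition analytic_set_germ :: "(complex \<times> complex) set \<Rightarrow> bool" where
  "analytic_set_germ A \<longleftrightarrow>
     (\<exists>G. finite G \<and> (\<forall>g\<in>G. germ2 g) \<and> germ_set_eq A {x. \<forall>g\<in>G. g x = 0})"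

definition irreducible_set_germ :: "(complex \<times> complex) set \<Rightarrow> bool" where
  "irreducible_set_germ A \<longleftrightarrow> analytic_set_germ A \<and> 0 \<in> A \<and>
     (\<forall>B C. analytic_set_germ B \<longrightarrow> analytic_set_germ C \<longrightarrow> germ_set_eq A (B \<union> C) \<longrightarrow>
        germ_set_eq A B \<or> germ_set_eq A C)"

text \<open>The local irreducible components of an analytic germ are its maximal irreducible subgerms.\<close>

definition local_component :: "(complex \<times> complex) set \<Rightarrow> (complex \<times> complex) set \<Rightarrow> bool" where
  "local_component Z A \<longleftrightarrow> irreducible_set_germ Z \<and> germ_subset Z A \<and>
     (\<forall>Y. irreducible_set_germ Y \<longrightarrow> germ_subset Y A \<longrightarrow> germ_subset Z Y \<longrightarrow> germ_set_eq Z Y)"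

definition corner_germ :: "(complex \<times> complex \<Rightarrow> complex \<times> complex) \<Rightarrow> bool" where
  "corner_germ F \<longleftrightarrow>
     (\<exists>Z\<^sub>1 Z\<^sub>2. local_component Z\<^sub>1 {x. F x = x} \<and> local_component Z\<^sub>2 {x. F x = x} \<and>
        \<not> germ_set_eq Z\<^sub>1 Z\<^sub>2)"


section \<open>Tangentiality and residual index in an adapted chart\<close>

text \<open>\<open>z_form g e \<mu>\<close>: \<open>g = z\<^bsup>\<mu>+e\<^esup> g'\<close> with \<open>z\<close> not dividing \<open>g'\<close>, where \<open>\<mu> = \<infinity>\<close> means \<open>g = 0\<close>.\<close>

definition z_form :: "(complex \<times> complex \<Rightarrow> complex) \<Rightarrow> nat \<Rightarrow> enat \<Rightarrow> bool" where
  "z_form g e \<mu> = (case \<mu> of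
      enat m \<Rightarrow> (\<exists>g'. germ2 g' \<and> germ_eq g (\<lambda>x. fst x ^ (m + e) * g' x) \<and> \<not> germ_dvd fst g')
    | \<infinity> \<Rightarrow> germ_eq g (\<lambda>x. 0))"

text \<open>\<open>k \<equiv> \<infinity>\<close> amounts to \<open>\<mu> < \<nu>\<close>. This is not expressed through the limit, because for
  \<open>\<nu> = \<infinity>\<close> the denominator vanishes identically and HOL division yields \<open>0\<close>.\<close>

definition tangential_germ :: "(complex \<times> complex \<Rightarrow> complex \<times> complex) \<Rightarrow> bool" where
  "tangential_germ F \<longleftrightarrow>
     (\<exists>\<mu> \<nu>. z_form (\<lambda>x. fst (F x) - fst x) 2 \<mu> \<and> z_form (\<lambda>x. snd (F x) - snd x) 1 \<nu> \<and>
        \<not> \<mu> < \<nu>)"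

definition k_fun :: "(complex \<times> complex \<Rightarrow> complex \<times> complex) \<Rightarrow> complex \<Rightarrow> complex" where
  "k_fun F w = Lim (at 0) (\<lambda>z. (fst (F (z, w)) - z) / (z * (snd (F (z, w)) - w)))"

text \<open>If \<open>k\<close> has a pole at \<open>0\<close>, the value of k_fun there is irrelevant: the residue only
  depends on a punctured neighbourhood.\<close>

definition residual_index :: "(complex \<times> complex \<Rightarrow> complex \<times> complex) \<Rightarrow> complex" where
  "residual_index F = residue (k_fun F) 0"


section \<open>Complex surfaces, curves in them, and self-maps\<close>

type_synonym 'a chart = "'a set \<times> ('a \<Rightarrow> complex \<times> complex)"

definition chart_inv :: "'a chart \<Rightarrow> complex \<times> complex \<Rightarrow> 'a" where
  "chart_inv c = inv_into (fst c) (snd c)"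

definition chart_on :: "'a topology \<Rightarrow> 'a chart \<Rightarrow> bool" where
  "chart_on X c \<longleftrightarrow> openin X (fst c) \<and> open (snd c ` fst c) \<and>
     homeomorphic_map (subtopology X (fst c)) (top_of_set (snd c ` fst c)) (snd c)"

definition charts_compatible :: "'a chart \<Rightarrow> 'a chart \<Rightarrow> bool" where
  "charts_compatible c d \<longleftrightarrow>
     holo_map2_on (snd c ` (fst c \<inter> fst d)) (\<lambda>x. snd d (chart_inv c x)) \<and>
     holo_map2_on (snd d ` (fst c \<inter> fst d)) (\<lambda>x. snd c (chart_inv d x))"

text \<open>A complex 2-manifold: a Hausdorff second countable space with a holomorphic atlas.\<close>

definition complex_2_manifold :: "'a topology \<Rightarrow> 'a chart set \<Rightarrow> bool" where
  "complex_2_manifold X A \<longleftrightarrow> Hausdorff_space X \<and> second_countable X \<and>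
     (\<forall>c\<in>A. chart_on X c) \<and> (\<forall>c\<in>A. \<forall>d\<in>A. charts_compatible c d) \<and>
     (\<Union>c\<in>A. fst c) = topspace X"

text \<open>The charts of the manifold are those of the maximal atlas containing \<open>A\<close>.\<close>

definition chart_centered_at :: "'a topology \<Rightarrow> 'a chart set \<Rightarrow> 'a \<Rightarrow> 'a chart \<Rightarrow> bool" where
  "chart_centered_at X A p c \<longleftrightarrow>
     chart_on X c \<and> (\<forall>d\<in>A. charts_compatible c d) \<and> p \<in> fst c \<and> snd c p = 0"

definition adapted_chart ::
    "'a topology \<Rightarrow> 'a chart set \<Rightarrow> 'a set \<Rightarrow> 'a \<Rightarrow> 'a chart \<Rightarrow> bool" where
  "adapted_chart X A S p c \<longleftrightarrow> chart_centered_at X A p c \<and>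
     snd c ` (fst c \<inter> S) = {x \<in> snd c ` fst c. fst x = 0}"

definition complex_1_submanifold :: "'a topology \<Rightarrow> 'a chart set \<Rightarrow> 'a set \<Rightarrow> bool" where
  "complex_1_submanifold X A S \<longleftrightarrow>
     S \<subseteq> topspace X \<and> (\<forall>p\<in>S. \<exists>c. adapted_chart X A S p c)"

text \<open>\<open>f\<close> restricts to a holomorphic map from the open set \<open>N\<close> to the manifold.\<close>

definition holo_into_manifold ::
    "'a topology \<Rightarrow> 'a chart set \<Rightarrow> 'a set \<Rightarrow> ('a \<Rightarrow> 'a) \<Rightarrow> bool" where
  "holo_into_manifold X A N f \<longleftrightarrow>
     openin X N \<and> continuous_map (subtopology X N) X f \<and>
     (\<forall>c\<in>A. \<forall>d\<in>A. holo_map2_on (snd c ` {x \<in> fst c \<inter> N. f x \<in> fst d})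
                       (\<lambda>x. snd d (f (chart_inv c x))))"

text \<open>The expression of \<open>f\<close> in the chart \<open>c\<close>. It is meaningful on local_dom, the part of the
  chart that \<open>f\<close> (defined on \<open>N\<close>) maps back into the chart.\<close>

definition local_expr :: "'a chart \<Rightarrow> ('a \<Rightarrow> 'a) \<Rightarrow> complex \<times> complex \<Rightarrow> complex \<times> complex" where
  "local_expr c f = (\<lambda>x. snd c (f (chart_inv c x)))"

definition local_dom :: "'a chart \<Rightarrow> 'a set \<Rightarrow> ('a \<Rightarrow> 'a) \<Rightarrow> (complex \<times> complex) set" where
  "local_dom c N f = snd c ` {x \<in> fst c \<inter> N. f x \<in> fst c}"

text \<open>The germ of \<open>f\<close> at \<open>p \<in> S\<close>, read in a chosen chart centered at \<open>p\<close>. The notions of the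
  preceding sections do not depend on the chart (for tangentiality and residual index: on the
  adapted chart), so one chosen adapted chart serves for all of them.\<close>

definition germ_at ::
    "'a topology \<Rightarrow> 'a chart set \<Rightarrow> 'a set \<Rightarrow> ('a \<Rightarrow> 'a) \<Rightarrow> 'a \<Rightarrow>
     complex \<times> complex \<Rightarrow> complex \<times> complex" where
  "germ_at X A S f p = local_expr (SOME c. adapted_chart X A S p c) f"

text \<open>In an adapted chart the tangent line of \<open>S\<close> at \<open>p\<close> is \<open>{0} \<times> \<complex>\<close>, so the differential
  \<open>D\<close> induces the identity on the normal space iff \<open>D v - v\<close> lies in that line for all \<open>v\<close>.\<close>

definition id_on_normal_bundle ::
    "'a topology \<Rightarrow> 'a chart set \<Rightarrow> 'a set \<Rightarrow> ('a \<Rightarrow> 'a) \<Rightarrow> bool" where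
  "id_on_normal_bundle X A S f \<longleftrightarrow>
     (\<forall>p\<in>S. \<exists>D. (germ_at X A S f p has_derivative D) (at 0) \<and> (\<forall>v. D v - v \<in> {0} \<times> UNIV))"

definition tangential_to ::
    "'a topology \<Rightarrow> 'a chart set \<Rightarrow> 'a set \<Rightarrow> ('a \<Rightarrow> 'a) \<Rightarrow> bool" where
  "tangential_to X A S f \<longleftrightarrow> (\<forall>p\<in>S. tangential_germ (germ_at X A S f p))"


section \<open>Parabolic curves\<close>

text \<open>\<open>D\<close> is the set on which the local map \<open>F\<close> is defined. Convergence of the iterates on
  the curve is pointwise.\<close>

definition parabolic_curve ::
    "(complex \<times> complex) set \<Rightarrow> (complex \<times> complex \<Rightarrow> complex \<times> complex) \<Rightarrow>
     complex set \<Rightarrow> (complex \<Rightarrow> complex \<times> complex) \<Rightarrow> bool" where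
  "parabolic_curve D F \<Delta> \<phi> \<longleftrightarrow>
     open \<Delta> \<and> connected \<Delta> \<and> simply_connected \<Delta> \<and> 0 \<in> frontier \<Delta> \<and>
     inj_on \<phi> \<Delta> \<and> (\<lambda>\<zeta>. fst (\<phi> \<zeta>)) holomorphic_on \<Delta> \<and> (\<lambda>\<zeta>. snd (\<phi> \<zeta>)) holomorphic_on \<Delta> \<and>
     \<phi> 0 = 0 \<and> continuous (at 0 within insert 0 \<Delta>) \<phi> \<and>
     \<phi> ` \<Delta> \<subseteq> D \<and> F ` \<phi> ` \<Delta> \<subseteq> \<phi> ` \<Delta> \<and>
     (\<forall>x\<in>\<phi> ` \<Delta>. (\<lambda>k. (F ^^ k) x) \<longlonglongrightarrow> 0)"

definition parabolic_curve_at ::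
    "'a topology \<Rightarrow> 'a chart set \<Rightarrow> 'a set \<Rightarrow> ('a \<Rightarrow> 'a) \<Rightarrow> 'a \<Rightarrow>
     complex set \<Rightarrow> (complex \<Rightarrow> complex \<times> complex) \<Rightarrow> bool" where
  "parabolic_curve_at X A N f p \<Delta> \<phi> \<longleftrightarrow>
     (\<exists>c. chart_centered_at X A p c \<and> parabolic_curve (local_dom c N f) (local_expr c f) \<Delta> \<phi>)"

end

theory Submission
  imports Defs "HOL-Real_Asymp.Real_Asymp"
begin

text \<open>In an adapted chart \<open>f = (z + z\<^bsup>r+1\<^esup> a, w + z\<^bsup>r\<^esup> b)\<close> with \<open>r = \<nu> + 1\<close>, and \<open>k(w) = a(0,w) / b(0,w)\<close>.
  Let \<open>s\<close> and \<open>m\<close> be the orders of \<open>a(0,\<cdot>)\<close> and \<open>b(0,\<cdot>)\<close> at \<open>0\<close>; a nonzero residue forces \<open>s < m\<close>. If \<open>z\<^bsup>r\<^esup>\<close>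
  were not the gcd of the components of \<open>f - id\<close>, then \<open>a\<close> and \<open>b\<close> would vanish simultaneously along a branch
  outside the axis, which yields a second component of the fixed point set; so at a non-corner pure
  order one means that \<open>a(0) \<noteq> 0\<close> or \<open>b\<close> has a nonzero linear part. A weighted blow-up
  \<open>z = w\<^bsup>t\<^esup>(u + d)\<close>, \<open>t = s + 1\<close>, then leads to a map \<open>(x + x\<^bsup>k+1\<^esup> a, y + x\<^bsup>k\<^esup> b)\<close> with \<open>a(0) \<noteq> 0\<close>, \<open>b(0) = 0\<close>, and
  ordinary blow-ups lower the exponent \<open>Re (b\<^sub>y(0) / a(0))\<close> below \<open>1\<close>; the only obstruction is a resonance,
  where logarithms enter. In both cases a coordinate \<open>\<zeta> \<sim> x\<^bsup>-k\<^esup>\<close>, in the resonant case up to logarithmic factors,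
  turns the map into a small perturbation of \<open>(\<zeta>, c) \<mapsto> (\<zeta> + 1, c)\<close>, whose stable curve
  is found by Picard iteration on entire forward orbits.\<close>


section \<open>Holomorphic functions of two variables\<close>

text \<open>The bound 1 on the exponent is a summability threshold. With
  \<open>E = q 0 / (k * a 0)\<close> and \<open>y = c \<zeta>^(-E)\<close>, the term
  \<open>x * p\<close> of \<open>b\<close> moves \<open>c\<close> by about
  \<open>\<zeta>^(E - 1 - 1/k)\<close> per step; as \<open>\<zeta>\<close> grows linearly, this is
  summable exactly if \<open>Re E < 1/k\<close>. A blow-up must be centred where the new second
  component vanishes, and the linear equation for that centre is unsolvable only if
  \<open>q 0 = a 0\<close> and \<open>p 0 \<noteq> 0\<close>: this is the resonance. The two cases
  differ only in their weights, so one Picard scheme serves both; invariance of the curve comes from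
  uniqueness of the orbits with \<open>c\<close> tending to 0. On the algebraic side,
  \<open>corner_germ\<close> asks for maximal irreducible set germs, while the argument supplies
  only common zeros of \<open>a\<close> and \<open>b\<close> off the axis. They are turned into a
  component by counting: the zeros of \<open>b (z, _)\<close> near 0 that lie in a given analytic
  germ, taken with multiplicity, have a constant number for small nonzero \<open>z\<close>. Germs
  with extremal counts are irreducible and maximal.\<close>

lemma continuous_on_contour_integral_circlepath:
  fixes f :: "'a::topological_space \<Rightarrow> complex \<Rightarrow> complex"
  assumes "continuous_on (U \<times> sphere z r) (\<lambda>(p, u). f p u)" "0 \<le> r"
  shows "continuous_on U (\<lambda>p. contour_integral (circlepath z r) (f p))"
proof -
  have eq: "contour_integral (circlepath z r) (f p) =
      integral (cbox 0 1) (\<lambda>t. f p (circlepath z r t) * (2 * pi * \<i> * r * exp (2 * of_real pi * \<i> * t)))" for p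
    unfolding contour_integral_integral
    unfolding box_real(2)[symmetric] by (intro integral_cong) (auto simp: vector_derivative_circlepath)
  have "continuous_on (U \<times> cbox 0 (1::real)) ((\<lambda>(p, u). f p u) \<circ> (\<lambda>(p, t). (p, circlepath z r t)))"
  proof (rule continuous_on_compose)
    show "continuous_on (U \<times> cbox 0 (1::real)) (\<lambda>(p, t). (p, circlepath z r t))"
      unfolding circlepath by (auto simp: case_prod_unfold intro!: continuous_intros)
    have "circlepath z r t \<in> sphere z r" if "t \<in> {0..1}" for t
      using path_image_circlepath_nonneg[OF assms(2), of z] that by (auto simp: path_image_def)
    then show "continuous_on ((\<lambda>(p, t). (p, circlepath z r t)) ` (U \<times> cbox 0 1)) (\<lambda>(p, u). f p u)"
      by (intro continuous_on_subset[OF assms(1)]) auto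
  qed
  then have "continuous_on (U \<times> cbox 0 1)
      (\<lambda>(p, t::real). f p (circlepath z r t) * (2 * pi * \<i> * r * exp (2 * of_real pi * \<i> * t)))"
    by (auto simp: case_prod_unfold o_def intro!: continuous_intros)
  then show ?thesis
    unfolding eq by (rule integral_continuous_on_param)
qed

text \<open>Near a given point the derivative is a Cauchy integral over one fixed circle, and joint
  continuity passes from the integrand to the integral.\<close>

lemma continuous_on_deriv_param:
  fixes f :: "complex \<Rightarrow> 'b::t2_space \<Rightarrow> complex"
  assumes S: "open S"
    and cont: "continuous_on (S \<times> T) (\<lambda>(x, t). f x t)"
    and hol: "\<And>t. t \<in> T \<Longrightarrow> (\<lambda>x. f x t) holomorphic_on S"
  shows "continuous_on (S \<times> T) (\<lambda>(x, t). deriv (\<lambda>x. f x t) x)"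
proof -
  have ex: "\<exists>d>0. continuous_on (ball x d \<times> T) (\<lambda>(x, t). deriv (\<lambda>x. f x t) x) \<and> ball x d \<subseteq> S"
    if x: "x \<in> S" for x
  proof -
    obtain r where r: "0 < r" "cball x r \<subseteq> S"
      using S x by (meson open_contains_cball)
    have eq: "deriv (\<lambda>x. f x t) y = contour_integral (circlepath x r) (\<lambda>u. f u t / (u - y)\<^sup>2) / (2 * of_real pi * \<i>)"
      if "y \<in> ball x r" "t \<in> T" for y t
    proof -
      have "continuous_on (cball x r) (\<lambda>x. f x t)"
        by (rule holomorphic_on_imp_continuous_on[OF holomorphic_on_subset[OF hol[OF that(2)] r(2)]])
      moreover have "(\<lambda>x. f x t) holomorphic_on ball x r"
        using r(2) by (intro holomorphic_on_subset[OF hol[OF that(2)]]) auto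
      ultimately show ?thesis
        using Cauchy_derivative_integral_circlepath(2)[of x r "\<lambda>x. f x t" y] that
        by (auto dest!: DERIV_imp_deriv simp: field_simps)
    qed
    have "continuous_on (ball x r \<times> T) (\<lambda>p. contour_integral (circlepath x r) (\<lambda>u. f u (snd p) / (u - fst p)\<^sup>2))"
    proof (rule continuous_on_contour_integral_circlepath)
      have "continuous_on ((ball x r \<times> T) \<times> sphere x r) ((\<lambda>(x, t). f x t) \<circ> (\<lambda>q. (snd q, snd (fst q))))"
      proof (rule continuous_on_compose)
        show "continuous_on ((\<lambda>q. (snd q, snd (fst q))) ` ((ball x r \<times> T) \<times> sphere x r)) (\<lambda>(x, t). f x t)"
          using r by (intro continuous_on_subset[OF cont]) auto
      qed (intro continuous_intros)
      then show "continuous_on ((ball x r \<times> T) \<times> sphere x r) (\<lambda>(p, u). f u (snd p) / (u - fst p)\<^sup>2)"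
        unfolding case_prod_unfold o_def
        by (intro continuous_intros) auto
    qed (use r in auto)
    then have "continuous_on (ball x r \<times> T) (\<lambda>p. contour_integral (circlepath x r) (\<lambda>u. f u (snd p) / (u - fst p)\<^sup>2) / (2 * of_real pi * \<i>))"
      by (intro continuous_intros) auto
    then have "continuous_on (ball x r \<times> T) (\<lambda>(x, t). deriv (\<lambda>x. f x t) x)"
      by (rule continuous_on_eq) (auto simp: eq)
    moreover have "ball x r \<subseteq> S" using r ball_subset_cball by blast
    ultimately show ?thesis using r(1) by (intro exI[of _ r] conjI)
  qed
  show ?thesis
    unfolding continuous_on_eq_continuous_within
  proof safe
    fix x t assume xt: "x \<in> S" "t \<in> T"
    obtain d where d: "d > 0" "continuous_on (ball x d \<times> T) (\<lambda>(x, t). deriv (\<lambda>x. f x t) x)" "ball x d \<subseteq> S"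
      using ex[OF xt(1)] by (elim exE conjE)
    have "continuous (at (x, t) within ball x d \<times> T) (\<lambda>(x, t). deriv (\<lambda>x. f x t) x)"
      using d xt(2) unfolding continuous_on_eq_continuous_within by auto
    moreover have "at (x, t) within ball x d \<times> T = at (x, t) within S \<times> T"
      using d by (intro at_within_nhd[of _ "ball x d \<times> UNIV"]) (auto intro: open_Times)
    ultimately show "continuous (at (x, t) within S \<times> T) (\<lambda>(x, t). deriv (\<lambda>x. f x t) x)"
      by simp
  qed
qed

text \<open>Differentiation under the integral sign; the joint continuity of the differentiated
  integrand is supplied by \<open>continuous_on_deriv_param\<close>.\<close>

lemma holomorphic_on_contour_integral_circlepath:
  fixes f :: "complex \<Rightarrow> complex \<Rightarrow> complex"
  assumes S: "open S" and r: "0 \<le> r"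
    and cont: "continuous_on (S \<times> sphere z r) (\<lambda>(x, u). f x u)"
    and hol: "\<And>u. u \<in> sphere z r \<Longrightarrow> (\<lambda>x. f x u) holomorphic_on S"
  shows "(\<lambda>x. contour_integral (circlepath z r) (f x)) holomorphic_on S"
proof -
  let ?c = "\<lambda>t. 2 * pi * \<i> * r * exp (2 * of_real pi * \<i> * of_real t)"
  have eq: "contour_integral (circlepath z r) (f p) =
      integral (cbox 0 1) (\<lambda>t. f p (circlepath z r t) * ?c t)" for p
    unfolding contour_integral_integral
    unfolding box_real(2)[symmetric] by (intro integral_cong) (auto simp: vector_derivative_circlepath)
  have circ: "circlepath z r t \<in> sphere z r" if "t \<in> cbox 0 1" for t
    using path_image_circlepath_nonneg[OF r, of z] that by (auto simp: path_image_def)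
  have c1: "continuous_on (S \<times> cbox 0 (1::real)) (\<lambda>(p, t). g p (circlepath z r t) * ?c t)"
    if "continuous_on (S \<times> sphere z r) (\<lambda>(x, u). g x u)" for g
  proof -
    have "continuous_on (S \<times> cbox 0 (1::real)) ((\<lambda>(p, u). g p u) \<circ> (\<lambda>(p, t). (p, circlepath z r t)))"
    proof (rule continuous_on_compose)
      show "continuous_on (S \<times> cbox 0 (1::real)) (\<lambda>(p, t). (p, circlepath z r t))"
        unfolding circlepath by (auto simp: case_prod_unfold intro!: continuous_intros)
      show "continuous_on ((\<lambda>(p, t). (p, circlepath z r t)) ` (S \<times> cbox 0 1)) (\<lambda>(p, u). g p u)"
        using circ by (intro continuous_on_subset[OF that]) auto
    qed
    then show ?thesis
      by (auto simp: case_prod_unfold o_def intro!: continuous_intros)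
  qed
  have H: "(\<lambda>x. integral (cbox 0 1) (\<lambda>t. f x (circlepath z r t) * ?c t)) holomorphic_on ball y d"
    if "ball y d \<subseteq> S" for y d
  proof (rule leibniz_rule_holomorphic)
    fix x and t :: real assume x: "x \<in> ball y d" and t: "t \<in> cbox 0 1"
    have "((\<lambda>x. f x (circlepath z r t)) has_field_derivative deriv (\<lambda>x. f x (circlepath z r t)) x) (at x)"
      using hol[OF circ[OF t]] x S that by (intro holomorphic_derivI[of _ S]) auto
    then show "((\<lambda>x. f x (circlepath z r t) * ?c t) has_field_derivative
        deriv (\<lambda>x. f x (circlepath z r t)) x * ?c t) (at x within ball y d)"
      by (intro DERIV_cmult_right) (rule has_field_derivative_at_within)
  next
    fix x assume x: "x \<in> ball y d"
    have "continuous_on (cbox 0 1) ((\<lambda>(p, t). f p (circlepath z r t) * ?c t) \<circ> (\<lambda>t. (x, t)))"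
      using x that
      by (intro continuous_on_compose continuous_intros continuous_on_subset[OF c1[OF cont]]) auto
    then show "(\<lambda>t. f x (circlepath z r t) * ?c t) integrable_on cbox 0 1"
      by (intro integrable_continuous) (simp add: o_def)
  next
    show "continuous_on (ball y d \<times> cbox 0 (1::real))
            (\<lambda>(x, t). deriv (\<lambda>x. f x (circlepath z r t)) x * ?c t)"
      using that by (intro continuous_on_subset[OF c1[OF continuous_on_deriv_param[OF S cont hol]]]) auto
  qed auto
  have "(\<lambda>x. contour_integral (circlepath z r) (f x)) holomorphic_on ball y d" if "ball y d \<subseteq> S" for y d
    unfolding eq by (rule H[OF that])
  then show ?thesis
    using S unfolding analytic_on_open[OF S, symmetric] analytic_on_def by (meson open_contains_ball)
qed

lemma open_slice_fst: "open U \<Longrightarrow> open {z. (z, y) \<in> U}"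
  using open_vimage[of U "\<lambda>z. (z, y)"] continuous_on_Pair[OF continuous_on_id continuous_on_const, of UNIV y]
  unfolding vimage_def by fast

lemma open_slice_snd: "open U \<Longrightarrow> open {w. (x, w) \<in> U}"
  using open_vimage[of U "\<lambda>w. (x, w)"] continuous_on_Pair[OF continuous_on_const continuous_on_id, of UNIV x]
  unfolding vimage_def by fast

text \<open>An Osgood-type criterion. Separate holomorphy gives both partial derivatives, and
  \<open>continuous_on_deriv_param\<close> makes the one in the second variable jointly continuous,
  which is enough for total differentiability.\<close>

lemma holo2_onI:
  assumes U: "open U" and cont: "continuous_on U f"
    and fst: "\<And>x y. (x, y) \<in> U \<Longrightarrow> (\<lambda>z. f (z, y)) holomorphic_on {z. (z, y) \<in> U}"
    and snd: "\<And>x y. (x, y) \<in> U \<Longrightarrow> (\<lambda>w. f (x, w)) holomorphic_on {w. (x, w) \<in> U}"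
  shows "holo2_on U f"
  unfolding holo2_on_def
proof (safe, fact)
  fix x y assume xy: "(x, y) \<in> U"
  obtain A B where AB: "open A" "open B" "x \<in> A" "y \<in> B" "A \<times> B \<subseteq> U"
    using U xy by (rule open_prod_elim) auto
  obtain d where d: "d > 0" "ball y d \<subseteq> B"
    using AB(2,4) open_contains_ball by blast
  let ?B = "ball y d"
  have AB': "A \<times> ?B \<subseteq> U" using AB d by auto
  have "open {z. (z, y) \<in> U}"
    by (rule open_slice_fst[OF U])
  then have fx: "((\<lambda>z. f (z, y)) has_derivative (\<lambda>h. deriv (\<lambda>z. f (z, y)) x * h)) (at x within A)"
    using holomorphic_derivI[OF fst[OF xy], of x] xy by (simp add: has_field_derivative_def)
  have hB: "(\<lambda>w. f (a, w)) holomorphic_on ?B" if "a \<in> A" for a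
    by (rule holomorphic_on_subset[OF snd[of a y]]) (use AB AB' that d in auto)
  have fy: "((\<lambda>w. f (a, w)) has_derivative blinfun_apply (blinfun_mult_right (deriv (\<lambda>w. f (a, w)) b))) (at b within ?B)"
    if "a \<in> A" "b \<in> ?B" for a b
    using holomorphic_derivI[OF hB[OF that(1)] _ that(2)] 
    by (simp add: has_field_derivative_def blinfun_mult_right.rep_eq)
  have "continuous_on (?B \<times> A) (\<lambda>(b, a). deriv (\<lambda>w. f (a, w)) b)"
  proof (rule continuous_on_deriv_param)
    have "continuous_on (?B \<times> A) (f \<circ> prod.swap)"
      using AB' by (intro continuous_on_compose continuous_on_swap continuous_on_subset[OF cont]) auto
    then show "continuous_on (?B \<times> A) (\<lambda>(b, a). f (a, b))"
      by (simp add: o_def case_prod_unfold prod.swap_def)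
  qed (use hB in auto)
  then have "continuous_on (A \<times> ?B) ((\<lambda>(b, a). deriv (\<lambda>w. f (a, w)) b) \<circ> prod.swap)"
    by (intro continuous_on_compose continuous_on_swap) (simp add: product_swap)
  then have "continuous_on (A \<times> ?B) (\<lambda>(a, b). blinfun_mult_right (deriv (\<lambda>w. f (a, w)) b))"
    by (auto simp: o_def case_prod_unfold intro!: bounded_linear.continuous_on[OF bounded_linear_blinfun_mult_right])
  then have "continuous (at (x, y) within A \<times> ?B) (\<lambda>(a, b). blinfun_mult_right (deriv (\<lambda>w. f (a, w)) b))"
    using AB d by (simp add: continuous_on_eq_continuous_within)
  from has_derivative_partialsI[OF fx fy this] have
    "((\<lambda>(x, y). f (x, y)) has_derivative (\<lambda>(tx, ty). deriv (\<lambda>z. f (z, y)) x * tx +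
       blinfun_mult_right (deriv (\<lambda>w. f (x, w)) y) ty)) (at (x, y) within A \<times> ?B)"
    using d by auto
  moreover have "at (x, y) within A \<times> ?B = at (x, y)"
    using AB d by (intro at_within_open) (auto intro: open_Times)
  ultimately have "(f has_derivative (\<lambda>v. deriv (\<lambda>z. f (z, y)) x * fst v + deriv (\<lambda>w. f (x, w)) y * snd v)) (at (x, y))"
    by (simp add: case_prod_unfold blinfun_mult_right.rep_eq)
  then show "\<exists>a b. (f has_derivative (\<lambda>v. a * fst v + b * snd v)) (at (x, y))"
    by blast
qed

lemma holo2_on_compose:
  assumes g: "holo2_on U g" and "X holomorphic_on S" "Y holomorphic_on S" "open S"
    and U: "\<And>s. s \<in> S \<Longrightarrow> (X s, Y s) \<in> U"
  shows "(\<lambda>s. g (X s, Y s)) holomorphic_on S"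
proof (rule holomorphic_onI)
  fix s assume s: "s \<in> S"
  obtain a b where ab: "(g has_derivative (\<lambda>v. a * fst v + b * snd v)) (at (X s, Y s))"
    using g U[OF s] unfolding holo2_on_def by blast
  have X: "(X has_derivative (\<lambda>h. deriv X s * h)) (at s)"
    using holomorphic_derivI[OF assms(2,4) s] by (simp add: has_field_derivative_def)
  have Y: "(Y has_derivative (\<lambda>h. deriv Y s * h)) (at s)"
    using holomorphic_derivI[OF assms(3,4) s] by (simp add: has_field_derivative_def)
  have "((\<lambda>s. g (X s, Y s)) has_derivative (\<lambda>h. a * (deriv X s * h) + b * (deriv Y s * h))) (at s)"
    using diff_chain_at[OF has_derivative_Pair[OF X Y] ab] by (simp add: o_def)
  then have "((\<lambda>s. g (X s, Y s)) has_field_derivative (a * deriv X s + b * deriv Y s)) (at s)"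
    unfolding has_field_derivative_def by (rule has_derivative_eq_rhs) (auto simp: algebra_simps)
  then show "(\<lambda>s. g (X s, Y s)) field_differentiable at s within S"
    using field_differentiable_at_within field_differentiable_def by blast
qed

lemma holo2_on_imp_continuous_on: "holo2_on U g \<Longrightarrow> continuous_on U g"
  unfolding holo2_on_def
  by (intro continuous_at_imp_continuous_on ballI) (blast intro: has_derivative_continuous)

lemma holo2_on_contour_integral_circlepath:
  fixes f :: "complex \<times> complex \<Rightarrow> complex \<Rightarrow> complex"
  assumes U: "open U" and r: "0 \<le> r"
    and cont: "continuous_on (U \<times> sphere z r) (\<lambda>(x, u). f x u)"
    and hol: "\<And>u. u \<in> sphere z r \<Longrightarrow> holo2_on U (\<lambda>x. f x u)"
  shows "holo2_on U (\<lambda>x. contour_integral (circlepath z r) (f x))"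
proof (rule holo2_onI[OF U])
  show "continuous_on U (\<lambda>x. contour_integral (circlepath z r) (f x))"
    by (rule continuous_on_contour_integral_circlepath[OF cont r])
next
  fix x y
  have o: "open {z. (z, y) \<in> U}"
    by (rule open_slice_fst[OF U])
  show "(\<lambda>z'. contour_integral (circlepath z r) (f (z', y))) holomorphic_on {z. (z, y) \<in> U}"
  proof (rule holomorphic_on_contour_integral_circlepath[OF o r])
    have "continuous_on ({z. (z, y) \<in> U} \<times> sphere z r) ((\<lambda>(x, u). f x u) \<circ> (\<lambda>(z, u). ((z, y), u)))"
    proof (rule continuous_on_compose)
      show "continuous_on ((\<lambda>(v, u). ((v, y), u)) ` ({v. (v, y) \<in> U} \<times> sphere z r)) (\<lambda>(x, u). f x u)"
        by (rule continuous_on_subset[OF cont]) auto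
    qed (auto simp: case_prod_unfold intro!: continuous_intros)
    then show "continuous_on ({z. (z, y) \<in> U} \<times> sphere z r) (\<lambda>(x, u). f (x, y) u)"
      by (simp add: o_def case_prod_unfold)
    show "(\<lambda>x. f (x, y) u) holomorphic_on {z. (z, y) \<in> U}" if "u \<in> sphere z r" for u
      by (rule holo2_on_compose[OF hol[OF that] holomorphic_on_ident holomorphic_on_const o]) auto
  qed
next
  fix x y
  have o: "open {w. (x, w) \<in> U}"
    by (rule open_slice_snd[OF U])
  show "(\<lambda>z'. contour_integral (circlepath z r) (f (x, z'))) holomorphic_on {w. (x, w) \<in> U}"
  proof (rule holomorphic_on_contour_integral_circlepath[OF o r])
    have "continuous_on ({w. (x, w) \<in> U} \<times> sphere z r) ((\<lambda>(x, u). f x u) \<circ> (\<lambda>(w, u). ((x, w), u)))"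
    proof (rule continuous_on_compose)
      show "continuous_on ((\<lambda>(v, u). ((x, v), u)) ` ({v. (x, v) \<in> U} \<times> sphere z r)) (\<lambda>(x, u). f x u)"
        by (rule continuous_on_subset[OF cont]) auto
    qed (auto simp: case_prod_unfold intro!: continuous_intros)
    then show "continuous_on ({w. (x, w) \<in> U} \<times> sphere z r) (\<lambda>(w, u). f (x, w) u)"
      by (simp add: o_def case_prod_unfold)
    show "(\<lambda>w. f (x, w) u) holomorphic_on {w. (x, w) \<in> U}" if "u \<in> sphere z r" for u
      by (rule holo2_on_compose[OF hol[OF that] holomorphic_on_const holomorphic_on_ident o]) auto
  qed
qed

lemma holo2_on_subset: "holo2_on U g \<Longrightarrow> open V \<Longrightarrow> V \<subseteq> U \<Longrightarrow> holo2_on V g"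
  unfolding holo2_on_def by blast

text \<open>Slices are holomorphic curves, so a check along all curves covers both partial
  conditions of \<open>holo2_onI\<close>. The closure properties below thereby reduce to
  one-variable facts.\<close>

lemma holo2_on_curves:
  assumes U: "open U" and cont: "continuous_on U f"
    and hol: "\<And>X Y S. open S \<Longrightarrow> X holomorphic_on S \<Longrightarrow> Y holomorphic_on S \<Longrightarrow>
      (\<And>s. s \<in> S \<Longrightarrow> (X s, Y s) \<in> U) \<Longrightarrow> (\<lambda>s. f (X s, Y s)) holomorphic_on S"
  shows "holo2_on U f"
proof (rule holo2_onI[OF U cont])
  show "(\<lambda>z. f (z, y)) holomorphic_on {z. (z, y) \<in> U}" for y
    by (rule hol[OF open_slice_fst[OF U] holomorphic_on_ident holomorphic_on_const]) auto
  show "(\<lambda>w. f (x, w)) holomorphic_on {w. (x, w) \<in> U}" for x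
    by (rule hol[OF open_slice_snd[OF U] holomorphic_on_const holomorphic_on_ident]) auto
qed

lemma holo2_on_const: "open U \<Longrightarrow> holo2_on U (\<lambda>x. c)"
  by (rule holo2_on_curves) auto

lemma holo2_on_fst: "open U \<Longrightarrow> holo2_on U fst"
  by (rule holo2_on_curves) (auto intro: continuous_intros)

lemma holo2_on_snd: "open U \<Longrightarrow> holo2_on U snd"
  by (rule holo2_on_curves) (auto intro: continuous_intros)

lemma holo2_on_compose2:
  assumes "holo2_on U g" "holo2_on V X" "holo2_on V Y" "\<And>v. v \<in> V \<Longrightarrow> (X v, Y v) \<in> U"
  shows "holo2_on V (\<lambda>v. g (X v, Y v))"
proof (rule holo2_on_curves)
  show "open V" using assms(2) by (simp add: holo2_on_def)
  show "continuous_on V (\<lambda>v. g (X v, Y v))"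
    using continuous_on_compose2[OF holo2_on_imp_continuous_on[OF assms(1)]
        continuous_on_Pair[OF assms(2,3)[THEN holo2_on_imp_continuous_on]]] assms(4) by blast
qed (intro holo2_on_compose[OF assms(1)] holo2_on_compose[OF assms(2)] holo2_on_compose[OF assms(3)]; auto intro: assms(4))

lemma holo2_on_compose1:
  assumes "f holomorphic_on T" "open T" "holo2_on V X" "\<And>v. v \<in> V \<Longrightarrow> X v \<in> T"
  shows "holo2_on V (\<lambda>v. f (X v))"
proof (rule holo2_on_curves)
  show "open V" using assms(3) by (simp add: holo2_on_def)
  show "continuous_on V (\<lambda>v. f (X v))"
    using continuous_on_compose2[OF holomorphic_on_imp_continuous_on[OF assms(1)]
        holo2_on_imp_continuous_on[OF assms(3)]] assms(4) by blast
  fix A B S assume "open S" "A holomorphic_on S" "B holomorphic_on S" "\<And>s. s \<in> S \<Longrightarrow> (A s, B s) \<in> V"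
  then show "(\<lambda>s. f (X (A s, B s))) holomorphic_on S"
    using holomorphic_on_compose_gen[OF holo2_on_compose[OF assms(3)] assms(1), of A S B] assms(4)
    by (auto simp: o_def)
qed

lemma holo2_on_open: "holo2_on U f \<Longrightarrow> open U"
  by (simp add: holo2_on_def)

lemma holo2_on_add:
  assumes "holo2_on U f" "holo2_on U g" shows "holo2_on U (\<lambda>x. f x + g x)"
  by (rule holo2_on_curves)
    (intro assms[THEN holo2_on_open] continuous_on_add holomorphic_on_add
      assms[THEN holo2_on_imp_continuous_on] assms[THEN holo2_on_compose]; assumption)+

lemma holo2_on_mult:
  assumes "holo2_on U f" "holo2_on U g" shows "holo2_on U (\<lambda>x. f x * g x)"
  by (rule holo2_on_curves)
    (intro assms[THEN holo2_on_open] continuous_on_mult holomorphic_on_mult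
      assms[THEN holo2_on_imp_continuous_on] assms[THEN holo2_on_compose]; assumption)+

lemma holo2_on_diff:
  assumes "holo2_on U f" "holo2_on U g" shows "holo2_on U (\<lambda>x. f x - g x)"
  by (rule holo2_on_curves)
    (intro assms[THEN holo2_on_open] continuous_on_diff holomorphic_on_diff
      assms[THEN holo2_on_imp_continuous_on] assms[THEN holo2_on_compose]; assumption)+

lemma holo2_on_divide:
  assumes "holo2_on U f" "holo2_on U g" "\<And>x. x \<in> U \<Longrightarrow> g x \<noteq> 0"
  shows "holo2_on U (\<lambda>x. f x / g x)"
proof -
  have "holo2_on U (\<lambda>x. inverse (g x))"
    by (rule holo2_on_compose1[of _ "- {0}"]) (use assms in \<open>auto intro!: holomorphic_intros\<close>)
  from holo2_on_mult[OF assms(1) this] show ?thesis by (simp add: divide_inverse)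
qed


section \<open>Germs\<close>

lemma germ2_bidisc:
  assumes "germ2 g" obtains r where "r > 0" "holo2_on (ball 0 r \<times> ball 0 r) g"
proof -
  obtain U where U: "0 \<in> U" "holo2_on U g" using assms by (auto simp: germ2_def)
  obtain A B where AB: "open A" "open B" "0 \<in> A" "0 \<in> B" "A \<times> B \<subseteq> U"
    using holo2_on_open[OF U(2)] U(1) by (elim open_prod_elim) (auto simp: zero_prod_def)
  obtain a where a: "a > 0" "ball 0 a \<subseteq> A" using AB by (meson open_contains_ball)
  obtain b where b: "b > 0" "ball 0 b \<subseteq> B" using AB by (meson open_contains_ball)
  have "holo2_on (ball 0 (min a b) \<times> ball 0 (min a b)) g"
    using a b AB by (intro holo2_on_subset[OF U(2)] open_Times) fastforce+
  then show ?thesis using a b by (intro that[of "min a b"]) auto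
qed

lemma germ2I: "r > 0 \<Longrightarrow> holo2_on (ball 0 r \<times> ball 0 r) g \<Longrightarrow> germ2 g"
  unfolding germ2_def by (intro exI[of _ "ball 0 r \<times> ball 0 r"]) (auto simp: zero_prod_def)

lemma germ2_bidisc2:
  assumes "germ2 f" "germ2 g"
  obtains r where "r > 0" "holo2_on (ball 0 r \<times> ball 0 r) f" "holo2_on (ball 0 r \<times> ball 0 r) g"
proof -
  obtain a where a: "a > 0" "holo2_on (ball 0 a \<times> ball 0 a) f" using assms(1) by (rule germ2_bidisc)
  obtain b where b: "b > 0" "holo2_on (ball 0 b \<times> ball 0 b) g" using assms(2) by (rule germ2_bidisc)
  show ?thesis
    by (rule that[of "min a b"]; (rule holo2_on_subset[OF a(2)] holo2_on_subset[OF b(2)])?)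
      (use a b in \<open>auto intro!: open_Times\<close>)
qed

lemma germ2_const: "germ2 (\<lambda>x. c)" and germ2_fst: "germ2 fst" and germ2_snd: "germ2 snd"
  unfolding germ2_def by (intro exI[of _ UNIV]; simp add: holo2_on_const holo2_on_fst holo2_on_snd)+

lemma germ2_add: "germ2 f \<Longrightarrow> germ2 g \<Longrightarrow> germ2 (\<lambda>x. f x + g x)"
  by (erule (1) germ2_bidisc2) (rule germ2I, assumption, rule holo2_on_add)

lemma germ2_diff: "germ2 f \<Longrightarrow> germ2 g \<Longrightarrow> germ2 (\<lambda>x. f x - g x)"
  by (erule (1) germ2_bidisc2) (rule germ2I, assumption, rule holo2_on_diff)

lemma germ2_mult: "germ2 f \<Longrightarrow> germ2 g \<Longrightarrow> germ2 (\<lambda>x. f x * g x)"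
  by (erule (1) germ2_bidisc2) (rule germ2I, assumption, rule holo2_on_mult)

lemma germ2_power: "germ2 f \<Longrightarrow> germ2 (\<lambda>x. f x ^ n)"
  by (induction n) (auto intro: germ2_const germ2_mult)

lemma germ2_isCont:
  assumes "germ2 g" shows "isCont g 0"
proof -
  obtain U where U: "0 \<in> U" "holo2_on U g" using assms by (auto simp: germ2_def)
  then show ?thesis
    using holo2_on_imp_continuous_on holo2_on_open continuous_on_eq_continuous_at by blast
qed

lemma germ2_compose:
  assumes "germ2 g" "germ2 X" "germ2 Y" "X 0 = 0" "Y 0 = 0"
  shows "germ2 (\<lambda>v. g (X v, Y v))"
proof -
  obtain r where r: "r > 0" "holo2_on (ball 0 r \<times> ball 0 r) g" using assms(1) by (rule germ2_bidisc)
  obtain s where s: "s > 0" "holo2_on (ball 0 s \<times> ball 0 s) X" "holo2_on (ball 0 s \<times> ball 0 s) Y"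
    using assms(2,3) by (rule germ2_bidisc2)
  define V where "V = (ball 0 s \<times> ball 0 s) \<inter> (\<lambda>v. (X v, Y v)) -` (ball 0 r \<times> ball 0 r)"
  have V: "open V" unfolding V_def
    by (rule continuous_open_preimage[OF continuous_on_Pair[OF s(2,3)[THEN holo2_on_imp_continuous_on]]])
       (auto intro!: open_Times)
  have "holo2_on V (\<lambda>v. g (X v, Y v))"
    by (rule holo2_on_compose2[OF r(2) holo2_on_subset[OF s(2) V] holo2_on_subset[OF s(3) V]])
       (auto simp: V_def)
  moreover have "0 \<in> V" using r s assms(4,5) by (auto simp: V_def zero_prod_def[symmetric] mem_Times_iff)
  ultimately show ?thesis unfolding germ2_def by blast
qed

lemma germ2_compose1:
  assumes "f holomorphic_on T" "open T" "germ2 X" "X 0 \<in> T"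
  shows "germ2 (\<lambda>v. f (X v))"
proof -
  obtain s where s: "s > 0" "holo2_on (ball 0 s \<times> ball 0 s) X"
    using assms(3) by (rule germ2_bidisc)
  define V where "V = (ball 0 s \<times> ball 0 s) \<inter> X -` T"
  have V: "open V" unfolding V_def
    by (rule continuous_open_preimage[OF s(2)[THEN holo2_on_imp_continuous_on]])
       (auto intro!: open_Times assms)
  have "holo2_on V (\<lambda>v. f (X v))"
    by (rule holo2_on_compose1[OF assms(1,2) holo2_on_subset[OF s(2) V]]) (auto simp: V_def)
  moreover have "0 \<in> V" using s assms(4) by (auto simp: V_def mem_Times_iff)
  ultimately show ?thesis unfolding germ2_def by blast
qed

lemma germ2_divide:
  assumes "germ2 f" "germ2 g" "g 0 \<noteq> 0"
  shows "germ2 (\<lambda>x. f x / g x)"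
proof -
  have "germ2 (\<lambda>x. inverse (g x))"
    by (rule germ2_compose1[OF _ _ assms(2), of _ "- {0}"]) (use assms(3) in \<open>auto intro!: holomorphic_intros\<close>)
  from germ2_mult[OF assms(1) this] show ?thesis by (simp add: divide_inverse)
qed

lemma germ_eq_refl: "germ_eq f f" by (simp add: germ_eq_def)

lemma germ_eq_sym: "germ_eq f g \<Longrightarrow> germ_eq g f" by (simp add: germ_eq_def eq_commute)

lemma germ_eq_trans: "germ_eq f g \<Longrightarrow> germ_eq g h \<Longrightarrow> germ_eq f h"
  unfolding germ_eq_def by (auto elim: eventually_elim2)

lemma germ_eq_at_0: "germ_eq f g \<Longrightarrow> f 0 = g 0"
  unfolding germ_eq_def by (rule eventually_nhds_x_imp_x)

lemma eventually_nhds_bidisc: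
  "(\<forall>\<^sub>F x in nhds (0::complex \<times> complex). P x) \<longleftrightarrow>
     (\<exists>r>0. \<forall>z w. cmod z < r \<longrightarrow> cmod w < r \<longrightarrow> P (z, w))"
proof
  assume "\<forall>\<^sub>F x in nhds (0::complex \<times> complex). P x"
  then obtain U where U: "open U" "0 \<in> U" "\<And>x. x \<in> U \<Longrightarrow> P x"
    unfolding eventually_nhds by blast
  obtain A B where AB: "open A" "open B" "0 \<in> A" "0 \<in> B" "A \<times> B \<subseteq> U"
    using U(1,2) by (elim open_prod_elim) (auto simp: zero_prod_def)
  obtain a where a: "a > 0" "ball 0 a \<subseteq> A" using AB by (meson open_contains_ball)
  obtain b where b: "b > 0" "ball 0 b \<subseteq> B" using AB by (meson open_contains_ball)
  show "\<exists>r>0. \<forall>z w. cmod z < r \<longrightarrow> cmod w < r \<longrightarrow> P (z, w)"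
    using a b AB U by (intro exI[of _ "min a b"]) (auto simp: subset_iff)
next
  assume "\<exists>r>0. \<forall>z w. cmod z < r \<longrightarrow> cmod w < r \<longrightarrow> P (z, w)"
  then obtain r where r: "r > 0" "\<And>z w. cmod z < r \<Longrightarrow> cmod w < r \<Longrightarrow> P (z, w)" by blast
  have "\<forall>\<^sub>F x in nhds (0::complex \<times> complex). x \<in> ball 0 r \<times> ball 0 r"
    using r(1) by (intro eventually_nhds_in_open open_Times) (auto simp: zero_prod_def)
  then show "\<forall>\<^sub>F x in nhds (0::complex \<times> complex). P x"
    by (rule eventually_mono) (use r(2) in auto)
qed

text \<open>From \<open>1/(u - z) - 1/u = z / (u * (u - z))\<close> the quotient has its own Cauchy
  integral, so no removable singularity at \<open>z = 0\<close> has to be filled in.\<close>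

lemma germ2_difference_quotient:
  assumes "germ2 f"
  obtains f' where "germ2 f'" "germ_eq f (\<lambda>x. f (0, snd x) + fst x * f' x)"
proof -
  obtain r where r: "r > 0" "holo2_on (ball 0 r \<times> ball 0 r) f" using assms by (rule germ2_bidisc)
  define s where "s = r / 2"
  have s: "0 < s" "s < r" using r by (auto simp: s_def)
  define f' where "f' = (\<lambda>x. contour_integral (circlepath 0 s) (\<lambda>u. f (u, snd x) / (u * (u - fst x))) / (2 * pi * \<i>))"
  let ?U = "ball 0 s \<times> ball 0 s :: (complex \<times> complex) set"
  have U: "open ?U" by (auto intro: open_Times)
  have "holo2_on ?U (\<lambda>x. contour_integral (circlepath 0 s) (\<lambda>u. f (u, snd x) / (u * (u - fst x))))"
  proof (rule holo2_on_contour_integral_circlepath[OF U])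
    have "continuous_on (?U \<times> sphere 0 s) (f \<circ> (\<lambda>q. (snd q, snd (fst q))))"
    proof (rule continuous_on_compose)
      show "continuous_on ((\<lambda>q. (snd q, snd (fst q))) ` (?U \<times> sphere 0 s)) f"
        using s by (intro continuous_on_subset[OF holo2_on_imp_continuous_on[OF r(2)]]) auto
    qed (intro continuous_intros)
    then show "continuous_on (?U \<times> sphere 0 s) (\<lambda>(x, u). f (u, snd x) / (u * (u - fst x)))"
      unfolding case_prod_unfold o_def using s by (intro continuous_intros) auto
    show "holo2_on ?U (\<lambda>x. f (u, snd x) / (u * (u - fst x)))" if "u \<in> sphere 0 s" for u
      using that s
      by (intro holo2_on_divide holo2_on_mult holo2_on_diff holo2_on_const holo2_on_fst U
          holo2_on_compose2[OF r(2)] holo2_on_snd) auto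
  qed (use s in auto)
  then have "holo2_on ?U f'"
    unfolding f'_def using holo2_on_divide holo2_on_const[OF U] by auto
  then have "germ2 f'" using germ2I s by blast
  moreover have "f (z, w) = f (0, w) + z * f' (z, w)" if z: "cmod z < s" and w: "cmod w < s" for z w
  proof -
    have hol: "(\<lambda>u. f (u, w)) holomorphic_on ball 0 r"
      using w s by (intro holo2_on_compose[OF r(2)] holomorphic_intros) auto
    have h: "continuous_on (cball 0 s) (\<lambda>u. f (u, w))" "(\<lambda>u. f (u, w)) holomorphic_on ball 0 s"
      using s by (auto intro!: holomorphic_on_imp_continuous_on intro: holomorphic_on_subset[OF hol])
    have i1: "((\<lambda>u. f (u, w) / (u - x)) has_contour_integral (2 * pi * \<i> * f (x, w))) (circlepath 0 s)"
      if "cmod x < s" for x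
      using Cauchy_integral_circlepath[OF h, of x] that s by simp
    have "((\<lambda>u. f (u, w) / (u - z) - f (u, w) / (u - 0)) has_contour_integral
        (2 * pi * \<i> * f (z, w) - 2 * pi * \<i> * f (0, w))) (circlepath 0 s)"
      by (intro has_contour_integral_diff i1) (use z s in auto)
    moreover have "f (u, w) / (u - z) - f (u, w) / (u - 0) = z * (f (u, w) / (u * (u - z)))"
      if "u \<in> path_image (circlepath 0 s)" for u
    proof -
      have "u \<noteq> 0" "u \<noteq> z" using that s z by auto
      then show ?thesis by (simp add: field_simps)
    qed
    ultimately have "((\<lambda>u. z * (f (u, w) / (u * (u - z)))) has_contour_integral
        (2 * pi * \<i> * f (z, w) - 2 * pi * \<i> * f (0, w))) (circlepath 0 s)"
      by (rule has_contour_integral_eq)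
    then have e: "contour_integral (circlepath 0 s) (\<lambda>u. z * (f (u, w) / (u * (u - z)))) =
        2 * pi * \<i> * (f (z, w) - f (0, w))"
      by (simp add: contour_integral_unique algebra_simps)
    have "contour_integral (circlepath 0 s) (\<lambda>u. z * (f (u, w) / (u * (u - z)))) =
        z * contour_integral (circlepath 0 s) (\<lambda>u. f (u, w) / (u * (u - z)))"
    proof (rule contour_integral_lmul, rule contour_integrable_continuous_circlepath)
      have "continuous_on (path_image (circlepath 0 s)) (\<lambda>u. f (u, w))"
        using s by (intro continuous_on_subset[OF h(1)]) auto
      then show "continuous_on (path_image (circlepath 0 s)) (\<lambda>u. f (u, w) / (u * (u - z)))"
        using s z by (intro continuous_intros) auto
    qed
    with e show ?thesis by (simp add: f'_def field_simps)
  qed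
  then have "germ_eq f (\<lambda>x. f (0, snd x) + fst x * f' x)"
    unfolding germ_eq_def eventually_nhds_bidisc using s by auto
  ultimately show ?thesis using that by blast
qed

lemma germ2_swap: "germ2 f \<Longrightarrow> germ2 (\<lambda>x. f (snd x, fst x))"
  by (rule germ2_compose) (auto intro: germ2_fst germ2_snd)

lemma germ2_slice_snd': "germ2 f \<Longrightarrow> germ2 (\<lambda>x. f (0, snd x))"
  by (rule germ2_compose) (auto intro: germ2_snd germ2_const)

lemma germ_eq_swap: "germ_eq f g \<Longrightarrow> germ_eq (\<lambda>x. f (snd x, fst x)) (\<lambda>x. g (snd x, fst x))"
  unfolding germ_eq_def eventually_nhds_bidisc by fastforce

lemma germ_eq_compose:
  assumes "germ_eq f g" "isCont P 0" "P 0 = 0"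
  shows "germ_eq (\<lambda>x. f (P x)) (\<lambda>x. g (P x))"
  using assms eventually_compose_filterlim[of "\<lambda>x. f x = g x" "nhds 0" P "nhds 0"]
  unfolding germ_eq_def by (simp add: isCont_def tendsto_nhds_iff)

lemma germ2_difference_quotient_snd:
  assumes "germ2 f"
  obtains f' where "germ2 f'" "germ_eq f (\<lambda>x. f (fst x, 0) + snd x * f' x)"
proof -
  obtain f' where f': "germ2 f'" "germ_eq (\<lambda>x. f (snd x, fst x)) (\<lambda>x. f (snd x, 0) + fst x * f' x)"
    using germ2_difference_quotient[OF germ2_swap[OF assms]] by auto
  have "germ_eq f (\<lambda>x. f (fst x, 0) + snd x * f' (snd x, fst x))"
    using germ_eq_swap[OF f'(2)] by simp
  then show ?thesis using that[OF germ2_swap[OF f'(1)]] by simp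
qed

lemma germ2_hadamard:
  assumes "germ2 f"
  obtains p q where "germ2 p" "germ2 q" "germ_eq f (\<lambda>x. f 0 + fst x * p x + snd x * q x)"
proof -
  obtain p where p: "germ2 p" "germ_eq f (\<lambda>x. f (0, snd x) + fst x * p x)"
    using germ2_difference_quotient[OF assms] .
  obtain q where q: "germ2 q" "germ_eq (\<lambda>x. f (0, snd x)) (\<lambda>x. f (0, 0) + snd x * q x)"
    using germ2_difference_quotient_snd[OF germ2_slice_snd'[OF assms]] by auto
  have "germ_eq f (\<lambda>x. f 0 + fst x * p x + snd x * q x)"
    using p(2) q(2) unfolding germ_eq_def zero_prod_def
    by eventually_elim (simp add: algebra_simps)
  with p(1) q(1) show ?thesis using that by blast
qed

lemma germ2_bounded:
  assumes "germ2 f" obtains C where "C > 0" "\<forall>\<^sub>F x in nhds 0. cmod (f x) \<le> C"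
proof -
  have "((\<lambda>x. f x) \<longlongrightarrow> f 0) (nhds 0)"
    using germ2_isCont[OF assms] by (simp add: tendsto_nhds_iff isCont_def)
  then have "\<forall>\<^sub>F x in nhds 0. dist (f x) (f 0) < 1" by (rule tendstoD) simp
  then have "\<forall>\<^sub>F x in nhds 0. cmod (f x) \<le> cmod (f 0) + 1"
    by eventually_elim (metis add.commute dist_norm less_eq_real_def norm_triangle_sub add_left_mono order_trans)
  then show ?thesis by (intro that[of "cmod (f 0) + 1"]) (auto intro: add_nonneg_pos)
qed


section \<open>Invariant curves of perturbed translations\<close>

text \<open>Discs of radius \<open>r / 2\<close> around points of \<open>cball z r\<close> stay
  inside \<open>ball z (2 * r)\<close>, and the Cauchy estimate on them bounds the derivative by
  \<open>2 * B / r\<close>.\<close>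

lemma holomorphic_lipschitz_half_ball:
  assumes f: "f holomorphic_on ball z (2 * r)" and B: "\<And>x. x \<in> ball z (2 * r) \<Longrightarrow> cmod (f x) \<le> B"
    and r: "0 < r" and ab: "a \<in> cball z r" "b \<in> cball z r"
  shows "cmod (f a - f b) \<le> 2 * B / r * cmod (a - b)"
proof (rule field_differentiable_bound[of "cball z r" f "deriv f"])
  fix x assume x: "x \<in> cball z r"
  have sub: "cball x (r / 2) \<subseteq> ball z (2 * r)"
  proof
    fix y assume "y \<in> cball x (r / 2)"
    with x r dist_triangle[of z y x] show "y \<in> ball z (2 * r)" by auto
  qed
  show "(f has_field_derivative deriv f x) (at x within cball z r)"
    using x r by (intro holomorphic_derivI[OF f]) auto
  have "cmod ((deriv ^^ 1) f x) \<le> fact 1 * B / (r / 2) ^ 1"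
  proof (rule Cauchy_inequality)
    show "f holomorphic_on ball x (r / 2)"
      using sub ball_subset_cball by (intro holomorphic_on_subset[OF f]) blast
    show "continuous_on (cball x (r / 2)) f"
      by (rule holomorphic_on_imp_continuous_on[OF holomorphic_on_subset[OF f sub]])
    show "cmod (f y) \<le> B" if "cmod (x - y) = r / 2" for y
      using that sub by (intro B) (auto simp: dist_norm subset_iff)
  qed (use r in auto)
  then show "cmod (deriv f x) \<le> 2 * B / r" by (simp add: mult.commute)
qed (use ab in auto)

text \<open>The slope 3 is what half-size cells need: if \<open>\<bar>Im \<zeta>\<bar> < t\<close>
  and \<open>x\<close> lies within \<open>t / 2\<close> of a point with real part \<open>t\<close>
  and imaginary part \<open>Im \<zeta>\<close>, then
  \<open>\<bar>Im x\<bar> < 3 * t / 2 < 3 * Re x\<close>.\<close>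

definition wide_sector :: "real \<Rightarrow> complex set" where
  "wide_sector R = {\<zeta>. R < Re \<zeta> \<and> \<bar>Im \<zeta>\<bar> < 3 * Re \<zeta>}"

definition sector :: "real \<Rightarrow> complex set" where
  "sector R = {\<zeta>. R < Re \<zeta> \<and> \<bar>Im \<zeta>\<bar> < Re \<zeta>}"

lemma open_sector: "open (sector R)"
  unfolding sector_def by (intro open_Collect_conj open_Collect_less continuous_intros)

definition tube :: "real \<Rightarrow> (real \<Rightarrow> real) \<Rightarrow> (complex \<times> complex) set" where
  "tube R \<theta> = {(\<zeta>, c). \<zeta> \<in> wide_sector R \<and> cmod c < \<theta> (Re \<zeta>)}"

text \<open>Holomorphy in two variables is only needed along holomorphic curves.\<close>

definition curve_holo :: "(complex \<times> complex) set \<Rightarrow> (complex \<times> complex \<Rightarrow> complex) \<Rightarrow> bool" where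
  "curve_holo D f \<longleftrightarrow> (\<forall>S X Y. open S \<longrightarrow> X holomorphic_on S \<longrightarrow> Y holomorphic_on S \<longrightarrow>
     (\<forall>s\<in>S. (X s, Y s) \<in> D) \<longrightarrow> (\<lambda>s. f (X s, Y s)) holomorphic_on S)"

text \<open>The explicit rate matters: it later makes the convergence of the Picard iterates uniform
  over the sector.\<close>

lemma geometric_convergence:
  fixes a :: "nat \<Rightarrow> 'a::banach"
  assumes "\<And>i. norm (a (Suc i) - a i) \<le> (1/2)^i * C"
  obtains L where "a \<longlonglongrightarrow> L" "\<And>i. norm (a i - L) \<le> 2 * (1/2)^i * C"
proof -
  have sC: "summable (\<lambda>i. (1/2)^i * C)" by (intro summable_mult2 summable_geometric) auto
  have s: "summable (\<lambda>i. a (Suc i) - a i)"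
    by (rule summable_comparison_test'[OF sC, of 0]) (use assms in auto)
  have eq: "a n = a 0 + (\<Sum>i<n. a (Suc i) - a i)" for n
    using sum_lessThan_telescope[of a n] by (simp only:) simp
  define L where "L = a 0 + (\<Sum>i. a (Suc i) - a i)"
  have lim: "a \<longlonglongrightarrow> L"
    unfolding L_def using tendsto_add[OF tendsto_const summable_LIMSEQ[OF s], of "a 0"]
    by (simp only: eq[symmetric])
  have "norm (a i - L) \<le> 2 * (1/2)^i * C" for i
  proof -
    have "norm (a i - a (i + m)) \<le> 2 * (1/2)^i * C" for m
    proof -
      have C0: "0 \<le> C" using order_trans[OF norm_ge_zero assms[of 0]] by simp
      have "norm (a i - a (i + m)) \<le> (2 * (1/2)^i - 2 * (1/2)^(i + m)) * C"
      proof (induction m)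
        case (Suc m)
        have "norm (a i - a (i + Suc m)) \<le> norm (a i - a (i + m)) + norm (a (Suc (i + m)) - a (i + m))"
          using norm_triangle_ineq4[of "a i - a (i + m)" "a (Suc (i + m)) - a (i + m)"] by simp
        also have "\<dots> \<le> (2 * (1/2)^i - 2 * (1/2)^(i + m)) * C + (1/2)^(i + m) * C"
          by (intro add_mono Suc assms)
        finally show ?case by (simp add: algebra_simps)
      qed simp
      also have "\<dots> \<le> 2 * (1/2)^i * C" using C0 by (intro mult_right_mono) auto
      finally show ?thesis .
    qed
    moreover have "(\<lambda>m. a i - a (i + m)) \<longlonglongrightarrow> a i - L"
      using LIMSEQ_ignore_initial_segment[OF lim, of i] by (intro tendsto_diff tendsto_const) (simp add: add.commute)
    ultimately show ?thesis by (intro Lim_norm_ubound[of sequentially "\<lambda>m. a i - a (i + m)"]) auto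
  qed
  with lim show ?thesis by (rule that)
qed

text \<open>The map is \<open>(\<zeta>, c) \<mapsto> (\<zeta> + 1 + g, c + h)\<close>. Along an orbit the real part of \<open>\<zeta>\<close> stays above
  \<open>(t + j) / 2\<close> after \<open>j\<close> steps, so the hypothesis on \<open>\<Sum>\<delta>\<close> keeps the total drift of \<open>c\<close> inside the tube;
  the constants \<open>1/64\<close> leave room for Cauchy estimates on half-size cells.\<close>

locale nearly_unit_shift =
  fixes g h :: "complex \<times> complex \<Rightarrow> complex" and \<theta> \<delta> :: "real \<Rightarrow> real" and R :: real
  assumes R_pos: "0 < R"
    and \<theta>_pos: "R < t \<Longrightarrow> 0 < \<theta> t"
    and \<theta>_anti: "R < s \<Longrightarrow> s \<le> t \<Longrightarrow> \<theta> t \<le> \<theta> s"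
    and \<delta>_nonneg: "R \<le> t \<Longrightarrow> 0 \<le> \<delta> t"
    and \<delta>_anti: "R \<le> s \<Longrightarrow> s \<le> t \<Longrightarrow> \<delta> t \<le> \<delta> s"
    and \<delta>_summable: "2 * R \<le> t \<Longrightarrow> summable (\<lambda>j. \<delta> ((t + real j) / 2))"
    and \<delta>_suminf: "2 * R \<le> t \<Longrightarrow> (\<Sum>j. \<delta> ((t + real j) / 2)) \<le> \<theta> (2 * t)"
    and g_holo: "curve_holo (tube R \<theta>) g"
    and h_holo: "curve_holo (tube R \<theta>) h"
    and g_bound: "(\<zeta>, c) \<in> tube R \<theta> \<Longrightarrow> cmod (g (\<zeta>, c)) \<le> 1 / 64"
    and h_bound: "(\<zeta>, c) \<in> tube R \<theta> \<Longrightarrow> cmod (h (\<zeta>, c)) \<le> \<delta> (Re \<zeta>) / 64"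
begin

lemma sum_\<delta>_le:
  assumes "2 * R \<le> t" shows "(\<Sum>j<m. \<delta> ((t + real j) / 2)) \<le> \<theta> (2 * t)"
proof -
  have "(\<Sum>j<m. \<delta> ((t + real j) / 2)) \<le> (\<Sum>j. \<delta> ((t + real j) / 2))"
    by (rule sum_le_suminf[OF \<delta>_summable[OF assms]]) (use assms in \<open>auto intro!: \<delta>_nonneg\<close>)
  then show ?thesis using \<delta>_suminf[OF assms] by linarith
qed

text \<open>The region reserved for the \<open>n\<close>-th point of an orbit, a quarter of the
  natural scale \<open>t = Re \<zeta> + n\<close>. The width is taken at \<open>2 * t\<close>
  because \<open>\<theta>\<close> is antitone and real parts in the cell stay below
  \<open>2 * t\<close>; so the cell lies in the tube with room for Cauchy estimates.\<close>

definition cell :: "complex \<Rightarrow> nat \<Rightarrow> (complex \<times> complex) set" where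
  "cell \<zeta> n = {(x, c). cmod (x - (\<zeta> + of_nat n)) \<le> (Re \<zeta> + n) / 4 \<and> cmod c \<le> \<theta> (2 * (Re \<zeta> + n)) / 4}"

lemma wide_cell_subset:
  assumes \<zeta>: "\<zeta> \<in> sector (2 * R)"
    and "cmod (x - (\<zeta> + of_nat n)) < (Re \<zeta> + n) / 2" "cmod c < \<theta> (2 * (Re \<zeta> + n))"
  shows "(x, c) \<in> tube R \<theta>" "(Re \<zeta> + n) / 2 < Re x"
proof -
  define t where "t = Re \<zeta> + n"
  have t: "2 * R < t" "\<bar>Im \<zeta>\<bar> < t" using \<zeta> by (auto simp: sector_def t_def)
  have re: "\<bar>Re x - t\<bar> < t / 2" and im: "\<bar>Im x - Im \<zeta>\<bar> < t / 2"
    using abs_Re_le_cmod[of "x - (\<zeta> + of_nat n)"] abs_Im_le_cmod[of "x - (\<zeta> + of_nat n)"] assms(2)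
    by (auto simp: t_def)
  have x: "t / 2 < Re x" "Re x \<le> 2 * t" "\<bar>Im x\<bar> < 3 * Re x"
    using re im t R_pos by (auto simp: abs_if split: if_splits)
  show "(Re \<zeta> + n) / 2 < Re x" using x by (simp add: t_def)
  have "\<theta> (2 * t) \<le> \<theta> (Re x)" using x t by (intro \<theta>_anti) auto
  with assms(3) x t show "(x, c) \<in> tube R \<theta>"
    by (auto simp: tube_def wide_sector_def t_def)
qed

lemma cell_subset:
  assumes "\<zeta> \<in> sector (2 * R)" "(x, c) \<in> cell \<zeta> n"
  shows "(x, c) \<in> tube R \<theta>" "(Re \<zeta> + n) / 2 < Re x"
proof -
  have t: "0 < Re \<zeta> + n" "0 < \<theta> (2 * (Re \<zeta> + n))"
    using assms(1) R_pos by (auto simp: sector_def intro!: \<theta>_pos)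
  have "cmod (x - (\<zeta> + of_nat n)) \<le> (Re \<zeta> + n) / 4" "cmod c \<le> \<theta> (2 * (Re \<zeta> + n)) / 4"
    using assms(2) by (auto simp: cell_def)
  then have "cmod (x - (\<zeta> + of_nat n)) < (Re \<zeta> + n) / 2" "cmod c < \<theta> (2 * (Re \<zeta> + n))"
    using t by - argo+
  then show "(x, c) \<in> tube R \<theta>" "(Re \<zeta> + n) / 2 < Re x"
    by (rule wide_cell_subset[OF assms(1)])+
qed

text \<open>Each variable is measured in units of its own cell size, so \<open>N\<close> is a
  relative distance. Moving one variable at a time costs \<open>8 * B * N\<close> by
  \<open>holomorphic_lipschitz_half_ball\<close> with radius a quarter of the unit.\<close>

lemma cell_lipschitz:
  assumes \<zeta>: "\<zeta> \<in> sector (2 * R)" and f: "curve_holo (tube R \<theta>) f"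
    and B: "\<And>x c. (x, c) \<in> tube R \<theta> \<Longrightarrow> (Re \<zeta> + n) / 2 < Re x \<Longrightarrow> cmod (f (x, c)) \<le> B"
    and p: "(x, c) \<in> cell \<zeta> n" and q: "(x', c') \<in> cell \<zeta> n"
    and N: "cmod (x - x') \<le> N * (Re \<zeta> + n)" "cmod (c - c') \<le> N * \<theta> (2 * (Re \<zeta> + n))"
  shows "cmod (f (x, c) - f (x', c')) \<le> 16 * B * N"
proof -
  define t where "t = Re \<zeta> + n"
  define T where "T = \<theta> (2 * t)"
  have t: "0 < t" "0 < T"
    using \<zeta> R_pos by (auto simp: sector_def t_def T_def intro!: \<theta>_pos)
  have p': "cmod (x - (\<zeta> + of_nat n)) \<le> t / 4" "cmod c \<le> T / 4"
    and q': "cmod (x' - (\<zeta> + of_nat n)) \<le> t / 4" "cmod c' \<le> T / 4"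
    using p q by (auto simp: cell_def t_def T_def)
  have B0: "0 \<le> B"
    using B[OF cell_subset[OF \<zeta> p]] norm_ge_zero order_trans by blast
  have sub: "(y, d) \<in> tube R \<theta>" "t / 2 < Re y" if "cmod (y - (\<zeta> + of_nat n)) < t / 2" "cmod d < T" for y d
    using wide_cell_subset[OF \<zeta>, of y n d] that by (auto simp: t_def T_def)
  have "cmod (f (x, c) - f (x', c)) \<le> 2 * B / (t / 4) * cmod (x - x')"
  proof (rule holomorphic_lipschitz_half_ball[where z = "\<zeta> + of_nat n"])
    show "(\<lambda>x. f (x, c)) holomorphic_on ball (\<zeta> + of_nat n) (2 * (t / 4))"
      using f[unfolded curve_holo_def, rule_format, of "ball (\<zeta> + of_nat n) (2 * (t / 4))" "\<lambda>x. x" "\<lambda>_. c"] p' t sub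
      by (auto simp: dist_norm norm_minus_commute)
    show "cmod (f (y, c)) \<le> B" if "y \<in> ball (\<zeta> + of_nat n) (2 * (t / 4))" for y
      using that p' t sub[of y c] by (intro B) (auto simp: dist_norm norm_minus_commute t_def)
  qed (use p' q' t in \<open>auto simp: dist_norm norm_minus_commute\<close>)
  also have "\<dots> \<le> 2 * B / (t / 4) * (N * t)"
    using N B0 t by (intro mult_left_mono) (auto simp: t_def)
  finally have 1: "cmod (f (x, c) - f (x', c)) \<le> 8 * B * N" using t by simp
  have "cmod (f (x', c) - f (x', c')) \<le> 2 * B / (T / 4) * cmod (c - c')"
  proof (rule holomorphic_lipschitz_half_ball[where z = 0])
    show "(\<lambda>c. f (x', c)) holomorphic_on ball 0 (2 * (T / 4))"
      using f[unfolded curve_holo_def, rule_format, of "ball 0 (2 * (T / 4))" "\<lambda>_. x'" "\<lambda>c. c"] q' t sub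
      by (auto simp: dist_norm norm_minus_commute)
    show "cmod (f (x', d)) \<le> B" if "d \<in> ball 0 (2 * (T / 4))" for d
      using that q' t sub[of x' d] by (intro B) (auto simp: dist_norm norm_minus_commute t_def)
  qed (use p' q' t in \<open>auto simp: dist_norm norm_minus_commute\<close>)
  also have "\<dots> \<le> 2 * B / (T / 4) * (N * T)"
    using N B0 t by (intro mult_left_mono) (auto simp: t_def T_def)
  finally have 2: "cmod (f (x', c) - f (x', c')) \<le> 8 * B * N" using t by simp
  show ?thesis using 1 2 norm_triangle_ineq[of "f (x, c) - f (x', c)" "f (x', c) - f (x', c')"] by simp
qed

text \<open>The contraction by 1/2 behind both uniqueness and convergence. The bounds with
  \<open>1/64\<close> and the factor 16 give 1/4 per term. The \<open>n\<close> terms of the first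
  sum are absorbed by the scale \<open>Re \<zeta> + n\<close>; the second sum is a piece of the tail
  of \<open>\<delta>\<close>, which \<open>sum_\<delta>_le\<close> bounds by the tube width at step
  \<open>n\<close>.\<close>

lemma
  assumes \<zeta>: "\<zeta> \<in> sector (2 * R)"
    and p: "\<And>n. (X n, Y n) \<in> cell \<zeta> n" and q: "\<And>n. (X' n, Y' n) \<in> cell \<zeta> n"
    and N: "\<And>n. cmod (X n - X' n) \<le> N * (Re \<zeta> + n)" "\<And>n. cmod (Y n - Y' n) \<le> N * \<theta> (2 * (Re \<zeta> + n))"
  shows sum_g_contraction: "cmod ((\<Sum>j<n. g (X j, Y j)) - (\<Sum>j<n. g (X' j, Y' j))) \<le> N / 2 * (Re \<zeta> + n)"
    and sum_h_contraction: "cmod ((\<Sum>j<m. h (X (n + j), Y (n + j))) - (\<Sum>j<m. h (X' (n + j), Y' (n + j)))) \<le> N / 2 * \<theta> (2 * (Re \<zeta> + n))"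
proof -
  have \<zeta>': "2 * R < Re \<zeta>" using \<zeta> by (simp add: sector_def)
  have "0 \<le> N * Re \<zeta>" using order_trans[OF norm_ge_zero N(1)[of 0]] by simp
  then have N0: "0 \<le> N" using \<zeta>' R_pos by (simp add: zero_le_mult_iff)
  have "cmod (\<Sum>j<n. g (X j, Y j) - g (X' j, Y' j)) \<le> (\<Sum>j<n. 16 * (1 / 64) * N)"
    by (rule sum_norm_le, rule cell_lipschitz[OF \<zeta> g_holo _ p q N]) (rule g_bound)
  also have "\<dots> \<le> N / 2 * real n" using N0 by (simp add: field_simps mult_nonneg_nonneg)
  also have "\<dots> \<le> N / 2 * (Re \<zeta> + n)" using N0 \<zeta>' R_pos by (intro mult_left_mono) auto
  finally show "cmod ((\<Sum>j<n. g (X j, Y j)) - (\<Sum>j<n. g (X' j, Y' j))) \<le> N / 2 * (Re \<zeta> + n)"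
    by (simp add: sum_subtractf)
  have "cmod (\<Sum>j<m. h (X (n + j), Y (n + j)) - h (X' (n + j), Y' (n + j)))
      \<le> (\<Sum>j<m. 16 * (\<delta> ((Re \<zeta> + real n + real j) / 2) / 64) * N)"
  proof (intro sum_norm_le cell_lipschitz[OF \<zeta> h_holo _ p q N])
    fix j x c assume "(x, c) \<in> tube R \<theta>" "(Re \<zeta> + real (n + j)) / 2 < Re x"
    then show "cmod (h (x, c)) \<le> \<delta> ((Re \<zeta> + real n + real j) / 2) / 64"
      using \<zeta>' by (intro order_trans[OF h_bound] divide_right_mono \<delta>_anti) auto
  qed
  also have "\<dots> = N / 4 * (\<Sum>j<m. \<delta> ((Re \<zeta> + real n + real j) / 2))"
    by (simp add: sum_distrib_left sum_divide_distrib field_simps)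
  also have "\<dots> \<le> N / 4 * \<theta> (2 * (Re \<zeta> + n))"
    using N0 \<zeta>' by (intro mult_left_mono sum_\<delta>_le) auto
  also have "\<dots> \<le> N / 2 * \<theta> (2 * (Re \<zeta> + n))"
    using N0 \<zeta>' R_pos less_imp_le[OF \<theta>_pos[of "2 * (Re \<zeta> + n)"]] by (intro mult_right_mono) auto
  finally show "cmod ((\<Sum>j<m. h (X (n + j), Y (n + j))) - (\<Sum>j<m. h (X' (n + j), Y' (n + j)))) \<le> N / 2 * \<theta> (2 * (Re \<zeta> + n))"
    by (simp add: sum_subtractf)
qed

text \<open>Only the first initial coordinate is prescribed. The second one is pinned down by the
  requirement that \<open>Y\<close> tend to 0, as on a stable manifold.\<close>

definition orbit :: "complex \<Rightarrow> (nat \<Rightarrow> complex) \<Rightarrow> (nat \<Rightarrow> complex) \<Rightarrow> bool" where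
  "orbit \<zeta> X Y \<longleftrightarrow> X 0 = \<zeta> \<and> (\<forall>n. (X n, Y n) \<in> tube R \<theta> \<and> X (Suc n) = X n + 1 + g (X n, Y n) \<and>
     Y (Suc n) = Y n + h (X n, Y n)) \<and> Y \<longlonglongrightarrow> 0"

text \<open>Since \<open>Y\<close> tends to 0, \<open>Y n\<close> is minus the tail of the
  \<open>h\<close>-sum and so obeys the summed bound. Every orbit therefore lies in the cells of its
  own accord, which makes the contraction applicable to arbitrary orbits and not only to Picard
  limits.\<close>

lemma orbit_cell:
  assumes \<zeta>: "\<zeta> \<in> sector (2 * R)" and o: "orbit \<zeta> X Y"
  shows "(X n, Y n) \<in> cell \<zeta> n"
proof -
  have \<zeta>': "2 * R < Re \<zeta>" using \<zeta> by (simp add: sector_def)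
  have X: "cmod (X n - (\<zeta> + of_nat n)) \<le> n / 64" for n
  proof (induction n)
    case (Suc n)
    have "X (Suc n) - (\<zeta> + of_nat (Suc n)) = (X n - (\<zeta> + of_nat n)) + g (X n, Y n)"
      using o by (simp add: orbit_def)
    then have "cmod (X (Suc n) - (\<zeta> + of_nat (Suc n))) \<le> cmod (X n - (\<zeta> + of_nat n)) + cmod (g (X n, Y n))"
      using norm_triangle_ineq by metis
    moreover have "cmod (g (X n, Y n)) \<le> 1 / 64" using o by (intro g_bound) (simp add: orbit_def)
    ultimately show ?case using Suc by simp
  qed (use o in \<open>simp add: orbit_def\<close>)
  have Xre: "(Re \<zeta> + n) / 2 \<le> Re (X n)" for n
    using X[of n] abs_Re_le_cmod[of "X n - (\<zeta> + of_nat n)"] \<zeta>' R_pos by auto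
  have Yd: "Y (n + m) = Y n + (\<Sum>j<m. h (X (n + j), Y (n + j)))" for m
    using o by (induction m) (auto simp: orbit_def)
  have "cmod (Y n - Y (n + m)) \<le> \<theta> (2 * (Re \<zeta> + n)) / 64" for m
  proof -
    have "cmod (\<Sum>j<m. h (X (n + j), Y (n + j))) \<le> (\<Sum>j<m. \<delta> ((Re \<zeta> + real n + real j) / 2) / 64)"
    proof (rule sum_norm_le)
      fix j
      have "cmod (h (X (n + j), Y (n + j))) \<le> \<delta> (Re (X (n + j))) / 64"
        using o by (intro h_bound) (simp add: orbit_def)
      also have "\<dots> \<le> \<delta> ((Re \<zeta> + real n + real j) / 2) / 64"
        using Xre[of "n + j"] \<zeta>' by (intro divide_right_mono \<delta>_anti) auto
      finally show "cmod (h (X (n + j), Y (n + j))) \<le> \<delta> ((Re \<zeta> + real n + real j) / 2) / 64" .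
    qed
    also have "\<dots> = (\<Sum>j<m. \<delta> ((Re \<zeta> + real n + real j) / 2)) / 64"
      by (simp add: sum_divide_distrib)
    also have "\<dots> \<le> \<theta> (2 * (Re \<zeta> + n)) / 64"
      using sum_\<delta>_le[of "Re \<zeta> + n" m] \<zeta>' by simp
    finally show ?thesis by (simp add: Yd[of m])
  qed
  moreover have "(\<lambda>m. Y n - Y (n + m)) \<longlonglongrightarrow> Y n - 0"
    using o LIMSEQ_ignore_initial_segment[of Y 0 n]
    by (intro tendsto_diff tendsto_const) (simp add: orbit_def add.commute)
  ultimately have "cmod (Y n - 0) \<le> \<theta> (2 * (Re \<zeta> + n)) / 64"
    by (intro Lim_norm_ubound[of sequentially "\<lambda>m. Y n - Y (n + m)"]) auto
  moreover have "0 \<le> \<theta> (2 * (Re \<zeta> + n))" using \<zeta>' R_pos by (intro less_imp_le[OF \<theta>_pos]) auto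
  ultimately show ?thesis using X[of n] \<zeta>' R_pos by (auto simp: cell_def)
qed

text \<open>Two orbits in the same cells are at relative distance at most 1, and both satisfy the
  same summed equations. The contraction can thus be applied \<open>k\<close> times, giving distance
  at most \<open>(1/2)^k\<close> for every \<open>k\<close>.\<close>

lemma orbit_unique:
  assumes \<zeta>: "\<zeta> \<in> sector (2 * R)" and o: "orbit \<zeta> X Y" and o': "orbit \<zeta> X' Y'"
  shows "Y n = Y' n"
proof -
  have Xs: "X n = \<zeta> + of_nat n + (\<Sum>j<n. g (X j, Y j))" "X' n = \<zeta> + of_nat n + (\<Sum>j<n. g (X' j, Y' j))" for n
    using o o' by (induction n) (auto simp: orbit_def)
  have Yd: "Y (n + m) = Y n + (\<Sum>j<m. h (X (n + j), Y (n + j)))"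
           "Y' (n + m) = Y' n + (\<Sum>j<m. h (X' (n + j), Y' (n + j)))" for n m
    using o o' by (induction m) (auto simp: orbit_def)
  have lim: "(\<lambda>m. Y (n + m) - Y' (n + m)) \<longlonglongrightarrow> 0" for n
    using tendsto_diff[of Y 0 sequentially Y' 0] o o'
      LIMSEQ_ignore_initial_segment[of "\<lambda>n. Y n - Y' n" 0 n]
    by (simp add: orbit_def add.commute)
  have cells: "(X n, Y n) \<in> cell \<zeta> n" "(X' n, Y' n) \<in> cell \<zeta> n" for n
    using orbit_cell[OF \<zeta>] o o' by auto
  have "(\<forall>n. cmod (X n - X' n) \<le> (1/2)^k * (Re \<zeta> + n)) \<and> (\<forall>n. cmod (Y n - Y' n) \<le> (1/2)^k * \<theta> (2 * (Re \<zeta> + n)))" for k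
  proof (induction k)
    case 0
    have "cmod (X n - X' n) \<le> Re \<zeta> + n \<and> cmod (Y n - Y' n) \<le> \<theta> (2 * (Re \<zeta> + n))" for n
    proof -
      have "0 \<le> Re \<zeta> + real n" "0 \<le> \<theta> (2 * (Re \<zeta> + n))"
        using \<zeta> R_pos by (auto simp: sector_def intro!: less_imp_le[OF \<theta>_pos])
      moreover have "cmod (X n - X' n) \<le> cmod (X n - (\<zeta> + of_nat n)) + cmod (X' n - (\<zeta> + of_nat n))"
        using norm_triangle_ineq4[of "X n - (\<zeta> + of_nat n)" "X' n - (\<zeta> + of_nat n)"] by simp
      moreover note norm_triangle_ineq4[of "Y n" "Y' n"]
      moreover have "cmod (X n - (\<zeta> + of_nat n)) \<le> (Re \<zeta> + n) / 4" "cmod (X' n - (\<zeta> + of_nat n)) \<le> (Re \<zeta> + n) / 4"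
        "cmod (Y n) \<le> \<theta> (2 * (Re \<zeta> + n)) / 4" "cmod (Y' n) \<le> \<theta> (2 * (Re \<zeta> + n)) / 4"
        using cells[of n] by (auto simp: cell_def)
      ultimately show ?thesis by - (intro conjI; argo)
    qed
    then show ?case by simp
  next
    case (Suc k)
    note H = sum_g_contraction[OF \<zeta> cells conjunct1[OF Suc, rule_format] conjunct2[OF Suc, rule_format]]
      sum_h_contraction[OF \<zeta> cells conjunct1[OF Suc, rule_format] conjunct2[OF Suc, rule_format]]
    have "cmod (X n - X' n) \<le> (1/2) ^ Suc k * (Re \<zeta> + n)" for n
      using H(1)[of n] unfolding Xs[of n] by simp
    moreover have "cmod (Y n - Y' n) \<le> (1/2) ^ Suc k * \<theta> (2 * (Re \<zeta> + n))" for n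
    proof -
      have "cmod (Y n - Y' n - (Y (n + m) - Y' (n + m))) \<le> (1/2) ^ Suc k * \<theta> (2 * (Re \<zeta> + n))" for m
      proof -
        have "Y n - Y' n - (Y (n + m) - Y' (n + m)) =
            (\<Sum>j<m. h (X' (n + j), Y' (n + j))) - (\<Sum>j<m. h (X (n + j), Y (n + j)))"
          unfolding Yd[of n m] by simp
        then show ?thesis using H(2)[where n = n and m = m] by (simp add: norm_minus_commute)
      qed
      moreover have "(\<lambda>m. Y n - Y' n - (Y (n + m) - Y' (n + m))) \<longlonglongrightarrow> Y n - Y' n - 0"
        by (intro tendsto_diff[OF tendsto_const lim])
      ultimately have "cmod (Y n - Y' n - 0) \<le> (1/2) ^ Suc k * \<theta> (2 * (Re \<zeta> + n))"
        by (intro Lim_norm_ubound[of sequentially "\<lambda>m. Y n - Y' n - (Y (n + m) - Y' (n + m))"]) auto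
      then show ?thesis by simp
    qed
    ultimately show ?case by blast
  qed
  then have "cmod (Y n - Y' n) \<le> (1/2)^k * \<theta> (2 * (Re \<zeta> + n))" for k by blast
  moreover have "(\<lambda>k. (1/2)^k * \<theta> (2 * (Re \<zeta> + n))) \<longlonglongrightarrow> 0 * \<theta> (2 * (Re \<zeta> + n))"
    by (intro tendsto_mult tendsto_const LIMSEQ_power_zero) auto
  ultimately have "cmod (Y n - Y' n) \<le> 0 * \<theta> (2 * (Re \<zeta> + n))"
    by (intro tendsto_lowerbound[of _ _ sequentially "cmod (Y n - Y' n)"]) auto
  then show ?thesis by simp
qed

lemma orbit_Suc:
  assumes \<zeta>: "\<zeta> \<in> sector (2 * R)" and o: "orbit \<zeta> X Y"
  shows "X 1 \<in> sector (2 * R)" "orbit (X 1) (\<lambda>n. X (Suc n)) (\<lambda>n. Y (Suc n))" "Re \<zeta> + 1 / 2 \<le> Re (X 1)"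
proof -
  have g: "cmod (g (\<zeta>, Y 0)) \<le> 1 / 64" and X: "X 1 = \<zeta> + 1 + g (\<zeta>, Y 0)"
    using o g_bound by (auto simp: orbit_def)
  have "\<bar>Re (g (\<zeta>, Y 0))\<bar> \<le> 1 / 64" "\<bar>Im (g (\<zeta>, Y 0))\<bar> \<le> 1 / 64"
    using g abs_Re_le_cmod abs_Im_le_cmod order_trans by blast+
  then show "X 1 \<in> sector (2 * R)" "Re \<zeta> + 1 / 2 \<le> Re (X 1)"
    using \<zeta> unfolding X sector_def by auto
  show "orbit (X 1) (\<lambda>n. X (Suc n)) (\<lambda>n. Y (Suc n))"
    unfolding orbit_def
  proof (intro conjI allI)
    fix n
    have "(X (Suc n), Y (Suc n)) \<in> tube R \<theta>" "X (Suc (Suc n)) = X (Suc n) + 1 + g (X (Suc n), Y (Suc n))"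
      "Y (Suc (Suc n)) = Y (Suc n) + h (X (Suc n), Y (Suc n))"
      using o unfolding orbit_def by blast+
    then show "(X (Suc n), Y (Suc n)) \<in> tube R \<theta>" "X (Suc (Suc n)) = X (Suc n) + 1 + g (X (Suc n), Y (Suc n))"
      "Y (Suc (Suc n)) = Y (Suc n) + h (X (Suc n), Y (Suc n))" .
  next
    show "(\<lambda>n. Y (Suc n)) \<longlonglongrightarrow> 0" using o by (intro LIMSEQ_Suc) (simp add: orbit_def)
  qed simp
qed


text \<open>An orbit with \<open>c \<rightarrow> 0\<close> satisfies \<open>X n = \<zeta> + n + \<Sum>j<n. g(X j, Y j)\<close> and
  \<open>Y n = - \<Sum>j\<ge>n. h(X j, Y j)\<close>; the invariant curve is \<open>\<zeta> \<mapsto> Y 0\<close>.\<close>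

primrec picard :: "nat \<Rightarrow> complex \<Rightarrow> nat \<Rightarrow> complex \<times> complex" where
  "picard 0 \<zeta> n = (\<zeta> + of_nat n, 0)"
| "picard (Suc i) \<zeta> n = (\<zeta> + of_nat n + (\<Sum>j<n. g (picard i \<zeta> j)), - (\<Sum>j. h (picard i \<zeta> (n + j))))"

declare picard.simps(2) [simp del]

lemma h_on_cell:
  assumes \<zeta>: "\<zeta> \<in> sector (2 * R)" and p: "p \<in> cell \<zeta> n"
  shows "cmod (h p) \<le> \<delta> ((Re \<zeta> + n) / 2) / 64"
proof -
  obtain x c where [simp]: "p = (x, c)" by force
  have "cmod (h p) \<le> \<delta> (Re x) / 64"
    using cell_subset[OF \<zeta>, of x c n] p h_bound by auto
  also have "\<dots> \<le> \<delta> ((Re \<zeta> + n) / 2) / 64"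
    using cell_subset[OF \<zeta>, of x c n] p \<zeta> by (intro divide_right_mono \<delta>_anti) (auto simp: sector_def)
  finally show ?thesis .
qed

lemma h_summable:
  assumes \<zeta>: "\<zeta> \<in> sector (2 * R)" and p: "\<And>n. p n \<in> cell \<zeta> n"
  shows "summable (\<lambda>j. cmod (h (p (n + j))))" "summable (\<lambda>j. h (p (n + j)))"
    "cmod (\<Sum>j. h (p (n + j))) \<le> (\<Sum>j. \<delta> ((Re \<zeta> + real n + real j) / 2)) / 64"
    "(\<Sum>j. \<delta> ((Re \<zeta> + real n + real j) / 2)) \<le> \<theta> (2 * (Re \<zeta> + n))"
proof -
  have \<zeta>': "2 * R < Re \<zeta>" using \<zeta> by (simp add: sector_def)
  have le: "cmod (h (p (n + j))) \<le> \<delta> ((Re \<zeta> + real n + real j) / 2) / 64" for j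
    using h_on_cell[OF \<zeta> p[of "n + j"]] by (simp add: add.assoc)
  have sd: "summable (\<lambda>j. \<delta> ((Re \<zeta> + real n + real j) / 2) / 64)"
    using \<zeta>' by (intro summable_divide \<delta>_summable) auto
  show 1: "summable (\<lambda>j. cmod (h (p (n + j))))"
    by (rule summable_comparison_test'[OF sd, of 0]) (use le in auto)
  then show 2: "summable (\<lambda>j. h (p (n + j)))" by (rule summable_norm_cancel)
  have "cmod (\<Sum>j. h (p (n + j))) \<le> (\<Sum>j. cmod (h (p (n + j))))" by (rule summable_norm[OF 1])
  also have "\<dots> \<le> (\<Sum>j. \<delta> ((Re \<zeta> + real n + real j) / 2) / 64)" by (rule suminf_le[OF le 1 sd])
  also have "\<dots> = (\<Sum>j. \<delta> ((Re \<zeta> + real n + real j) / 2)) / 64"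
    using \<zeta>' by (intro suminf_divide \<delta>_summable) auto
  finally show "cmod (\<Sum>j. h (p (n + j))) \<le> (\<Sum>j. \<delta> ((Re \<zeta> + real n + real j) / 2)) / 64" .
  show "(\<Sum>j. \<delta> ((Re \<zeta> + real n + real j) / 2)) \<le> \<theta> (2 * (Re \<zeta> + n))"
    using \<zeta>' by (intro \<delta>_suminf) auto
qed

lemma picard_cell:
  assumes \<zeta>: "\<zeta> \<in> sector (2 * R)"
  shows "picard i \<zeta> n \<in> cell \<zeta> n"
proof (induction i arbitrary: n)
  case 0
  have "0 \<le> Re \<zeta> + n" "0 \<le> \<theta> (2 * (Re \<zeta> + n))"
    using \<zeta> R_pos by (auto simp: sector_def intro!: less_imp_le[OF \<theta>_pos])
  then show ?case by (simp add: cell_def)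
next
  case (Suc i)
  have pos: "0 \<le> Re \<zeta>" "0 \<le> \<theta> (2 * (Re \<zeta> + n))"
    using \<zeta> R_pos by (auto simp: sector_def intro!: less_imp_le[OF \<theta>_pos])
  have "cmod (\<Sum>j<n. g (picard i \<zeta> j)) \<le> (\<Sum>j<n. 1 / 64)"
  proof (rule sum_norm_le)
    fix j
    show "cmod (g (picard i \<zeta> j)) \<le> 1 / 64"
      using cell_subset(1)[OF \<zeta>, of "fst (picard i \<zeta> j)" "snd (picard i \<zeta> j)" j] Suc[of j]
        g_bound[of "fst (picard i \<zeta> j)" "snd (picard i \<zeta> j)"] by simp
  qed
  then have 1: "cmod (\<Sum>j<n. g (picard i \<zeta> j)) \<le> (Re \<zeta> + n) / 4"
    using pos by simp
  have "cmod (\<Sum>j. h (picard i \<zeta> (n + j))) \<le> \<theta> (2 * (Re \<zeta> + n)) / 64"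
    using h_summable(3,4)[OF \<zeta> Suc, of n] by simp
  with pos have 2: "cmod (\<Sum>j. h (picard i \<zeta> (n + j))) \<le> \<theta> (2 * (Re \<zeta> + n)) / 4"
    by simp
  show ?case using 1 2 by (simp add: cell_def picard.simps(2))
qed

lemma picard_contraction:
  assumes \<zeta>: "\<zeta> \<in> sector (2 * R)"
  shows "cmod (fst (picard (Suc i) \<zeta> n) - fst (picard i \<zeta> n)) \<le> (1/2)^i * (Re \<zeta> + n)"
    "cmod (snd (picard (Suc i) \<zeta> n) - snd (picard i \<zeta> n)) \<le> (1/2)^i * \<theta> (2 * (Re \<zeta> + n))"
proof (induction i arbitrary: n)
  case 0
  have *: "picard (Suc 0) \<zeta> n \<in> cell \<zeta> n" and pos: "0 \<le> Re \<zeta> + n" "0 \<le> \<theta> (2 * (Re \<zeta> + n))" for n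
    using picard_cell[OF \<zeta>, of "Suc 0" n] \<zeta> R_pos by (auto simp: sector_def intro!: less_imp_le[OF \<theta>_pos])
  have "cmod (fst (picard (Suc 0) \<zeta> n) - (\<zeta> + of_nat n)) \<le> (Re \<zeta> + n) / 4"
    "cmod (snd (picard (Suc 0) \<zeta> n)) \<le> \<theta> (2 * (Re \<zeta> + n)) / 4" for n
    using *[of n] by (auto simp: cell_def simp del: picard.simps)
  note b = this pos
  show "cmod (fst (picard (Suc 0) \<zeta> n) - fst (picard 0 \<zeta> n)) \<le> (1/2)^0 * (Re \<zeta> + n)" for n
    using b[of n] unfolding picard.simps(1) fst_conv power_0 mult_1 by argo
  show "cmod (snd (picard (Suc 0) \<zeta> n) - snd (picard 0 \<zeta> n)) \<le> (1/2)^0 * \<theta> (2 * (Re \<zeta> + n))" for n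
    using b[of n] unfolding picard.simps(1) snd_conv power_0 mult_1 diff_zero by argo
next
  case (Suc i)
  have cells: "(fst (picard i \<zeta> n), snd (picard i \<zeta> n)) \<in> cell \<zeta> n" for i n
    using picard_cell[OF \<zeta>] by simp
  note H = sum_g_contraction[OF \<zeta> cells cells Suc] sum_h_contraction[OF \<zeta> cells cells Suc]
  show "cmod (fst (picard (Suc (Suc i)) \<zeta> n) - fst (picard (Suc i) \<zeta> n)) \<le> (1/2) ^ Suc i * (Re \<zeta> + n)" for n
    using H(1)[of n] by (simp only: picard.simps(2)[of "Suc i"] picard.simps(2)[of i \<zeta> n] fst_conv prod.collapse) simp
  have "(\<lambda>m. (\<Sum>j<m. h (picard i \<zeta> (n + j))) - (\<Sum>j<m. h (picard (Suc i) \<zeta> (n + j))))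
      \<longlonglongrightarrow> (\<Sum>j. h (picard i \<zeta> (n + j))) - (\<Sum>j. h (picard (Suc i) \<zeta> (n + j)))" for n
    by (intro tendsto_diff summable_LIMSEQ h_summable[OF \<zeta> picard_cell[OF \<zeta>]])
  moreover have "cmod ((\<Sum>j<m. h (picard i \<zeta> (n + j))) - (\<Sum>j<m. h (picard (Suc i) \<zeta> (n + j)))) \<le> (1/2) ^ Suc i * \<theta> (2 * (Re \<zeta> + n))" for n m
    using H(2)[where n = n and m = m] by (simp only: prod.collapse norm_minus_commute) simp
  ultimately have "cmod ((\<Sum>j. h (picard i \<zeta> (n + j))) - (\<Sum>j. h (picard (Suc i) \<zeta> (n + j)))) \<le> (1/2) ^ Suc i * \<theta> (2 * (Re \<zeta> + n))" for n
    by (intro Lim_norm_ubound[of sequentially "\<lambda>m. (\<Sum>j<m. h (picard i \<zeta> (n + j))) - (\<Sum>j<m. h (picard (Suc i) \<zeta> (n + j)))"]) auto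
  then show "cmod (snd (picard (Suc (Suc i)) \<zeta> n) - snd (picard (Suc i) \<zeta> n)) \<le> (1/2) ^ Suc i * \<theta> (2 * (Re \<zeta> + n))" for n
    by (simp only: picard.simps(2)[of "Suc i"] picard.simps(2)[of i \<zeta> n] snd_conv) simp
qed

lemma picard_holomorphic:
  "(\<lambda>\<zeta>. fst (picard i \<zeta> n)) holomorphic_on sector (2 * R) \<and>
   (\<lambda>\<zeta>. snd (picard i \<zeta> n)) holomorphic_on sector (2 * R)"
proof (induction i arbitrary: n)
  case (Suc i)
  have 1: "(\<lambda>\<zeta>. f (picard i \<zeta> n)) holomorphic_on sector (2 * R)" if "curve_holo (tube R \<theta>) f" for f n
    using that[unfolded curve_holo_def, rule_format, OF open_sector, of "\<lambda>\<zeta>. fst (picard i \<zeta> n)" "2 * R" "\<lambda>\<zeta>. snd (picard i \<zeta> n)"]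
      Suc[of n] cell_subset(1)[of \<zeta> "fst (picard i \<zeta> n)" "snd (picard i \<zeta> n)" n for \<zeta>] picard_cell[of _ i n] by auto
  have "(\<lambda>\<zeta>. \<Sum>j. h (picard i \<zeta> (n + j))) holomorphic_on sector (2 * R)"
  proof (rule holomorphic_uniform_sequence[OF open_sector])
    show "(\<lambda>\<zeta>. \<Sum>j<m. h (picard i \<zeta> (n + j))) holomorphic_on sector (2 * R)" for m
      by (intro holomorphic_intros 1 h_holo)
    fix x assume x: "x \<in> sector (2 * R)"
    then obtain d where d: "0 < d" "cball x d \<subseteq> sector (2 * R)"
      using open_sector by (meson open_contains_cball)
    have "uniform_limit (sector (2 * R)) (\<lambda>m \<zeta>. \<Sum>j<m. h (picard i \<zeta> (n + j))) (\<lambda>\<zeta>. \<Sum>j. h (picard i \<zeta> (n + j))) sequentially"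
    proof (rule Weierstrass_m_test)
      \<comment> \<open>The comparison series is taken at the left edge
        \<open>Re \<zeta> = 2 * R\<close> and with \<open>n = 0\<close>, so the convergence is
        uniform on the whole sector.\<close>
      show "summable (\<lambda>j. \<delta> ((2 * R + real j) / 2) / 64)"
        by (intro summable_divide \<delta>_summable) auto
      fix j \<zeta> assume \<zeta>: "\<zeta> \<in> sector (2 * R)"
      have "cmod (h (picard i \<zeta> (n + j))) \<le> \<delta> ((Re \<zeta> + (n + j)) / 2) / 64"
        by (rule h_on_cell[OF \<zeta> picard_cell[OF \<zeta>]])
      also have "\<dots> \<le> \<delta> ((2 * R + real j) / 2) / 64"
        using \<zeta> by (intro divide_right_mono \<delta>_anti) (auto simp: sector_def)
      finally show "cmod (h (picard i \<zeta> (n + j))) \<le> \<delta> ((2 * R + real j) / 2) / 64" .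
    qed
    then have "uniform_limit (cball x d) (\<lambda>m \<zeta>. \<Sum>j<m. h (picard i \<zeta> (n + j))) (\<lambda>\<zeta>. \<Sum>j. h (picard i \<zeta> (n + j))) sequentially"
      using d(2) by (rule uniform_limit_on_subset)
    with d show "\<exists>d>0. cball x d \<subseteq> sector (2 * R) \<and>
        uniform_limit (cball x d) (\<lambda>m \<zeta>. \<Sum>j<m. h (picard i \<zeta> (n + j))) (\<lambda>\<zeta>. \<Sum>j. h (picard i \<zeta> (n + j))) sequentially"
      by blast
  qed
  then show ?case by (auto simp: picard.simps(2) intro!: holomorphic_intros 1 g_holo)
qed (auto intro: holomorphic_intros)


lemma picard_limit:
  assumes \<zeta>: "\<zeta> \<in> sector (2 * R)"
  obtains X Y where "orbit \<zeta> X Y"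
    "\<And>i. cmod (snd (picard i \<zeta> 0) - Y 0) \<le> 2 * (1/2)^i * \<theta> (2 * Re \<zeta>)"
proof -
  have "\<exists>x. (\<lambda>i. fst (picard i \<zeta> n)) \<longlonglongrightarrow> x \<and> (\<forall>i. cmod (fst (picard i \<zeta> n) - x) \<le> 2 * (1/2)^i * (Re \<zeta> + n))" for n
    using picard_contraction(1)[OF \<zeta>, of _ n] by (rule geometric_convergence) blast
  then obtain X where X: "\<And>n. (\<lambda>i. fst (picard i \<zeta> n)) \<longlonglongrightarrow> X n"
    "\<And>n i. cmod (fst (picard i \<zeta> n) - X n) \<le> 2 * (1/2)^i * (Re \<zeta> + n)" by metis
  have "\<exists>x. (\<lambda>i. snd (picard i \<zeta> n)) \<longlonglongrightarrow> x \<and> (\<forall>i. cmod (snd (picard i \<zeta> n) - x) \<le> 2 * (1/2)^i * \<theta> (2 * (Re \<zeta> + n)))" for n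
    using picard_contraction(2)[OF \<zeta>, of _ n] by (rule geometric_convergence) blast
  then obtain Y where Y: "\<And>n. (\<lambda>i. snd (picard i \<zeta> n)) \<longlonglongrightarrow> Y n"
    "\<And>n i. cmod (snd (picard i \<zeta> n) - Y n) \<le> 2 * (1/2)^i * \<theta> (2 * (Re \<zeta> + n))" by metis
  have pc: "cmod (fst (picard i \<zeta> n) - (\<zeta> + of_nat n)) \<le> (Re \<zeta> + n) / 4"
    "cmod (snd (picard i \<zeta> n)) \<le> \<theta> (2 * (Re \<zeta> + n)) / 4" for i n
    using picard_cell[OF \<zeta>, of i n] by (auto simp: cell_def)
  have cell: "(X n, Y n) \<in> cell \<zeta> n" for n
    unfolding cell_def
    using Lim_norm_ubound[OF _ tendsto_diff[OF X(1)[of n] tendsto_const[of "\<zeta> + of_nat n"]], of "(Re \<zeta> + n) / 4"]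
      Lim_norm_ubound[OF _ Y(1)[of n], of "\<theta> (2 * (Re \<zeta> + n)) / 4"] pc by simp
  have cont: "(\<lambda>i. f (picard i \<zeta> n)) \<longlonglongrightarrow> f (X n, Y n)"
    if f: "curve_holo (tube R \<theta>) f" and B: "\<And>x c. (x, c) \<in> tube R \<theta> \<Longrightarrow> (Re \<zeta> + n) / 2 < Re x \<Longrightarrow> cmod (f (x, c)) \<le> B"
    for f n B
  proof -
    have "cmod (f (picard i \<zeta> n) - f (X n, Y n)) \<le> 16 * B * (2 * (1/2)^i)" for i
      using cell_lipschitz[OF \<zeta> f B, of n "fst (picard i \<zeta> n)" "snd (picard i \<zeta> n)" "X n" "Y n" "2 * (1/2)^i"]
        cell[of n] picard_cell[OF \<zeta>, of i n] X(2) Y(2) by simp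
    then have "\<forall>\<^sub>F i in sequentially. cmod (f (picard i \<zeta> n) - f (X n, Y n)) \<le> 16 * B * (2 * (1/2)^i)"
      by simp
    moreover have "(\<lambda>i. 16 * B * (2 * (1/2)^i)) \<longlonglongrightarrow> 16 * B * (2 * 0)"
      by (intro tendsto_mult tendsto_const LIMSEQ_power_zero) simp
    then have "(\<lambda>i. 16 * B * (2 * (1/2)^i)) \<longlonglongrightarrow> 0" by simp
    ultimately have "(\<lambda>i. f (picard i \<zeta> n) - f (X n, Y n)) \<longlonglongrightarrow> 0"
      by (rule Lim_null_comparison)
    then show ?thesis by (simp add: LIM_zero_iff)
  qed
  have gc: "(\<lambda>i. g (picard i \<zeta> n)) \<longlonglongrightarrow> g (X n, Y n)" for n
    by (rule cont[OF g_holo g_bound])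
  have hc: "(\<lambda>i. h (picard i \<zeta> n)) \<longlonglongrightarrow> h (X n, Y n)" for n
  proof (rule cont[OF h_holo])
    fix x c assume "(x, c) \<in> tube R \<theta>" "(Re \<zeta> + n) / 2 < Re x"
    then show "cmod (h (x, c)) \<le> \<delta> ((Re \<zeta> + n) / 2) / 64"
      using \<zeta> by (intro order_trans[OF h_bound] divide_right_mono \<delta>_anti) (auto simp: sector_def)
  qed
  have "X (Suc n) = X n + 1 + g (X n, Y n)" for n
  proof (rule LIMSEQ_unique)
    show "(\<lambda>i. fst (picard (Suc i) \<zeta> (Suc n))) \<longlonglongrightarrow> X (Suc n)" by (rule LIMSEQ_Suc[OF X(1)[of "Suc n"]])
    have "(\<lambda>i. fst (picard (Suc i) \<zeta> n) + 1 + g (picard i \<zeta> n)) \<longlonglongrightarrow> X n + 1 + g (X n, Y n)"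
      by (intro tendsto_add tendsto_const gc LIMSEQ_Suc[OF X(1)])
    then show "(\<lambda>i. fst (picard (Suc i) \<zeta> (Suc n))) \<longlonglongrightarrow> X n + 1 + g (X n, Y n)"
      by (simp add: picard.simps(2) algebra_simps)
  qed
  moreover have "Y (Suc n) = Y n + h (X n, Y n)" for n
  proof (rule LIMSEQ_unique)
    show "(\<lambda>i. snd (picard (Suc i) \<zeta> (Suc n))) \<longlonglongrightarrow> Y (Suc n)" by (rule LIMSEQ_Suc[OF Y(1)[of "Suc n"]])
    \<comment> \<open>Splitting off the first term of the tail sum turns the formula for the second
      coordinate into the one-step recursion.\<close>
    have "snd (picard (Suc i) \<zeta> (Suc n)) = snd (picard (Suc i) \<zeta> n) + h (picard i \<zeta> n)" for i
      using suminf_split_head[OF h_summable(2)[OF \<zeta> picard_cell[OF \<zeta>, of i], of n]]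
      by (simp add: picard.simps(2))
    moreover have "(\<lambda>i. snd (picard (Suc i) \<zeta> n) + h (picard i \<zeta> n)) \<longlonglongrightarrow> Y n + h (X n, Y n)"
      by (intro tendsto_add hc LIMSEQ_Suc[OF Y(1)])
    ultimately show "(\<lambda>i. snd (picard (Suc i) \<zeta> (Suc n))) \<longlonglongrightarrow> Y n + h (X n, Y n)" by simp
  qed
  moreover have "X 0 = \<zeta>"
  proof -
    have "fst (picard i \<zeta> 0) = \<zeta>" for i by (cases i) (auto simp: picard.simps(2))
    then show ?thesis using X(1)[of 0] by (simp add: LIMSEQ_const_iff)
  qed
  \<comment> \<open>At step \<open>n\<close> all iterates from the first on have second coordinate
    bounded by the same tail of a convergent series in \<open>\<delta>\<close>. The bound survives
    the limit in \<open>i\<close>.\<close>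
  moreover have "Y \<longlonglongrightarrow> 0"
  proof -
    define d where "d j = \<delta> ((Re \<zeta> + real j) / 2)" for j
    have s: "summable d" unfolding d_def using \<zeta> by (intro \<delta>_summable) (auto simp: sector_def)
    define tail where "tail n = (\<Sum>j. d (j + n)) / 64" for n
    have le: "cmod (Y n) \<le> tail n" for n
    proof -
      have "d (j + n) = \<delta> ((Re \<zeta> + real n + real j) / 2)" for j
        unfolding d_def of_nat_add by (simp only: add.assoc add.commute[of "real j"])
      then have "tail n = (\<Sum>j. \<delta> ((Re \<zeta> + real n + real j) / 2)) / 64"
        by (simp only: tail_def)
      then have b: "cmod (snd (picard (Suc i) \<zeta> n)) \<le> tail n" for i
        using h_summable(3)[OF \<zeta> picard_cell[OF \<zeta>, of i], of n]
        by (simp only: picard.simps(2) snd_conv norm_minus_cancel)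
      have l: "(\<lambda>i. snd (picard (Suc i) \<zeta> n)) \<longlonglongrightarrow> Y n"
        by (rule LIMSEQ_Suc[OF Y(1)[of n]])
      show ?thesis
        by (rule Lim_norm_ubound[OF _ l]) (simp_all add: b)
    qed
    have "(\<lambda>n. (suminf d - (\<Sum>j<n. d j)) / 64) \<longlonglongrightarrow> (suminf d - suminf d) / 64"
      by (intro tendsto_divide tendsto_diff tendsto_const summable_LIMSEQ[OF s]) simp
    then have "tail \<longlonglongrightarrow> 0"
      unfolding tail_def suminf_minus_initial_segment[OF s] by (simp only: diff_self div_0)
    then show ?thesis
      by (rule Lim_null_comparison[rotated]) (simp add: le)
  qed
  ultimately have "orbit \<zeta> X Y"
    unfolding orbit_def using cell_subset(1)[OF \<zeta> cell] by (intro conjI allI)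
  with Y(2)[of _ 0] show ?thesis by (intro that[of X Y]) simp_all
qed

text \<open>An orbit shifted by one step is again an orbit, starting at \<open>X 1\<close>; by
  uniqueness its second coordinate is \<open>\<psi> (X 1)\<close>, and this is the invariance
  equation. Holomorphy comes from the uniform bound \<open>2 * (1/2)^i * \<theta> (4 * R)\<close> on
  the Picard error.\<close>

proposition invariant_curve:
  obtains \<psi> where "\<psi> holomorphic_on sector (2 * R)"
    "\<And>\<zeta>. \<zeta> \<in> sector (2 * R) \<Longrightarrow> (\<zeta>, \<psi> \<zeta>) \<in> tube R \<theta>"
    "\<And>\<zeta>. \<zeta> \<in> sector (2 * R) \<Longrightarrow> \<zeta> + 1 + g (\<zeta>, \<psi> \<zeta>) \<in> sector (2 * R)"
    "\<And>\<zeta>. \<zeta> \<in> sector (2 * R) \<Longrightarrow> Re \<zeta> + 1 / 2 \<le> Re (\<zeta> + 1 + g (\<zeta>, \<psi> \<zeta>))"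
    "\<And>\<zeta>. \<zeta> \<in> sector (2 * R) \<Longrightarrow> \<psi> (\<zeta> + 1 + g (\<zeta>, \<psi> \<zeta>)) = \<psi> \<zeta> + h (\<zeta>, \<psi> \<zeta>)"
proof -
  have "\<exists>y. (\<exists>X Y. orbit \<zeta> X Y \<and> Y 0 = y) \<and> (\<forall>i. cmod (snd (picard i \<zeta> 0) - y) \<le> 2 * (1/2)^i * \<theta> (2 * Re \<zeta>))"
    if "\<zeta> \<in> sector (2 * R)" for \<zeta>
    using that by (rule picard_limit) blast
  then obtain \<psi> where \<psi>: "\<And>\<zeta>. \<zeta> \<in> sector (2 * R) \<Longrightarrow> \<exists>X Y. orbit \<zeta> X Y \<and> Y 0 = \<psi> \<zeta>"
    "\<And>\<zeta> i. \<zeta> \<in> sector (2 * R) \<Longrightarrow> cmod (snd (picard i \<zeta> 0) - \<psi> \<zeta>) \<le> 2 * (1/2)^i * \<theta> (2 * Re \<zeta>)"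
    by metis
  have \<psi>_eq: "Y 0 = \<psi> \<zeta>" if "\<zeta> \<in> sector (2 * R)" "orbit \<zeta> X Y" for \<zeta> X Y
    using \<psi>(1)[OF that(1)] by (elim exE conjE) (simp add: orbit_unique[OF that])
  have ul: "uniform_limit (sector (2 * R)) (\<lambda>i \<zeta>. snd (picard i \<zeta> 0)) \<psi> sequentially"
  proof (rule uniform_limitI)
    fix e :: real assume e: "0 < e"
    have "(\<lambda>i. 2 * (1/2)^i * \<theta> (4 * R)) \<longlonglongrightarrow> 2 * 0 * \<theta> (4 * R)"
      by (intro tendsto_mult tendsto_const LIMSEQ_power_zero) auto
    then have "\<forall>\<^sub>F i in sequentially. 2 * (1/2)^i * \<theta> (4 * R) < e"
      using e by (intro order_tendstoD(2)) auto
    then show "\<forall>\<^sub>F i in sequentially. \<forall>\<zeta>\<in>sector (2 * R). dist (snd (picard i \<zeta> 0)) (\<psi> \<zeta>) < e"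
    proof eventually_elim
      case (elim i)
      show ?case
      proof
        fix \<zeta> assume \<zeta>: "\<zeta> \<in> sector (2 * R)"
        have "cmod (snd (picard i \<zeta> 0) - \<psi> \<zeta>) \<le> 2 * (1/2)^i * \<theta> (2 * Re \<zeta>)" by (rule \<psi>(2)[OF \<zeta>])
        also have "\<dots> \<le> 2 * (1/2)^i * \<theta> (4 * R)"
          using \<zeta> R_pos by (intro mult_left_mono \<theta>_anti) (auto simp: sector_def)
        finally show "dist (snd (picard i \<zeta> 0)) (\<psi> \<zeta>) < e" using elim by (simp add: dist_norm)
      qed
    qed
  qed
  have "\<psi> holomorphic_on sector (2 * R)"
  proof (rule holomorphic_uniform_sequence[OF open_sector])
    show "(\<lambda>\<zeta>. snd (picard i \<zeta> 0)) holomorphic_on sector (2 * R)" for i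
      using picard_holomorphic by blast
    fix x assume "x \<in> sector (2 * R)"
    then obtain d where d: "0 < d" "cball x d \<subseteq> sector (2 * R)"
      using open_sector by (meson open_contains_cball)
    then show "\<exists>d>0. cball x d \<subseteq> sector (2 * R) \<and> uniform_limit (cball x d) (\<lambda>i \<zeta>. snd (picard i \<zeta> 0)) \<psi> sequentially"
      using uniform_limit_on_subset[OF ul] by blast
  qed
  moreover have "(\<zeta>, \<psi> \<zeta>) \<in> tube R \<theta> \<and> \<zeta> + 1 + g (\<zeta>, \<psi> \<zeta>) \<in> sector (2 * R) \<and>
      Re \<zeta> + 1 / 2 \<le> Re (\<zeta> + 1 + g (\<zeta>, \<psi> \<zeta>)) \<and> \<psi> (\<zeta> + 1 + g (\<zeta>, \<psi> \<zeta>)) = \<psi> \<zeta> + h (\<zeta>, \<psi> \<zeta>)"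
    if \<zeta>: "\<zeta> \<in> sector (2 * R)" for \<zeta>
  proof -
    obtain X Y where o: "orbit \<zeta> X Y" "Y 0 = \<psi> \<zeta>" using \<psi>(1)[OF \<zeta>] by (elim exE conjE)
    have s: "X 0 = \<zeta>" "(X 0, Y 0) \<in> tube R \<theta>" "X 1 = X 0 + 1 + g (X 0, Y 0)" "Y 1 = Y 0 + h (X 0, Y 0)"
      using o(1)[unfolded orbit_def, THEN conjunct1]
        o(1)[unfolded orbit_def, THEN conjunct2, THEN conjunct1, THEN spec, of 0] by simp_all
    have "Y 1 = \<psi> (X 1)" using \<psi>_eq[OF orbit_Suc(1,2)[OF \<zeta> o(1)]] by simp
    with orbit_Suc(1,3)[OF \<zeta> o(1)] s o(2) show ?thesis by simp
  qed
  ultimately show ?thesis by (intro that[of \<psi>]) auto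
qed

end


section \<open>Parabolic curves from perturbed translations\<close>

text \<open>Curves are demanded in every neighbourhood so that the property depends on the germ only
  and can be transported by local maps. The condition on \<open>fst\<close> keeps the curve off the
  exceptional divisor, where blow-down maps fail to be injective.\<close>

definition has_parabolic_curves :: "(complex \<times> complex \<Rightarrow> complex \<times> complex) \<Rightarrow> bool" where
  "has_parabolic_curves F \<longleftrightarrow> (\<forall>U. open U \<longrightarrow> 0 \<in> U \<longrightarrow>
     (\<exists>\<Delta> \<phi>. parabolic_curve U F \<Delta> \<phi> \<and> (\<forall>s\<in>\<Delta>. fst (\<phi> s) \<noteq> 0)))"

lemma convex_sector: "convex (sector R)"
proof -
  have "sector R = {z. Re z > R} \<inter> {z. inner (Complex 1 1) z > 0} \<inter> {z. inner (Complex 1 (-1)) z > 0}"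
    by (auto simp: sector_def inner_complex_def)
  then show ?thesis by (simp add: convex_Int convex_halfspace_Re_gt convex_halfspace_gt)
qed

text \<open>\<open>\<Phi>\<close> plays the role of a parametrization at infinity. The curve is
  \<open>s \<mapsto> \<Phi> (1/s, \<psi> (1/s))\<close>, and inversion carries the convex sector to
  a simply connected domain with 0 on its boundary. Real parts grow by at least 1/2 per step, so
  iterates are pushed to infinity in \<open>\<zeta>\<close>, that is, to the origin.\<close>

lemma parabolic_curves_from_unit_shift:
  fixes g h :: "complex \<times> complex \<Rightarrow> complex" and \<Phi> :: "complex \<times> complex \<Rightarrow> complex \<times> complex"
  assumes R0: "0 < R0"
    and \<theta>_pos: "\<And>t. R0 < t \<Longrightarrow> 0 < \<theta> t"
    and \<theta>_anti: "\<And>s t. R0 < s \<Longrightarrow> s \<le> t \<Longrightarrow> \<theta> t \<le> \<theta> s"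
    and \<delta>_nonneg: "\<And>t. R0 \<le> t \<Longrightarrow> 0 \<le> \<delta> t"
    and \<delta>_anti: "\<And>s t. R0 \<le> s \<Longrightarrow> s \<le> t \<Longrightarrow> \<delta> t \<le> \<delta> s"
    and K: "0 < K"
    and \<delta>_summable: "\<And>t. 2 * R0 \<le> t \<Longrightarrow> summable (\<lambda>j. \<delta> ((t + real j) / 2))"
    and \<delta>_suminf: "\<And>t. 2 * R0 \<le> t \<Longrightarrow> (\<Sum>j. \<delta> ((t + real j) / 2)) \<le> K * \<theta> (2 * t)"
    and g_holo: "curve_holo (tube R0 \<theta>) g"
    and h_holo: "curve_holo (tube R0 \<theta>) h"
    and g_small: "\<And>e. 0 < e \<Longrightarrow> \<exists>R\<ge>R0. \<forall>p\<in>tube R \<theta>. cmod (g p) \<le> e"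
    and h_small: "\<And>e. 0 < e \<Longrightarrow> \<exists>R\<ge>R0. \<forall>p\<in>tube R \<theta>. cmod (h p) \<le> e * \<delta> (Re (fst p))"
    and \<Phi>_holo: "curve_holo (tube R0 \<theta>) (\<lambda>p. fst (\<Phi> p))" "curve_holo (tube R0 \<theta>) (\<lambda>p. snd (\<Phi> p))"
    and \<Phi>_inj: "inj_on \<Phi> (tube R0 \<theta>)"
    and \<Phi>_small: "\<And>e. 0 < e \<Longrightarrow> \<exists>R\<ge>R0. \<forall>p\<in>tube R \<theta>. norm (\<Phi> p) < e"
    and \<Phi>_nz: "\<And>p. p \<in> tube R0 \<theta> \<Longrightarrow> fst (\<Phi> p) \<noteq> 0"
    and conj: "\<And>\<zeta> c. (\<zeta>, c) \<in> tube R0 \<theta> \<Longrightarrow> (\<zeta> + 1 + g (\<zeta>, c), c + h (\<zeta>, c)) \<in> tube R0 \<theta> \<Longrightarrow>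
      F (\<Phi> (\<zeta>, c)) = \<Phi> (\<zeta> + 1 + g (\<zeta>, c), c + h (\<zeta>, c))"
  shows "has_parabolic_curves F"
  unfolding has_parabolic_curves_def
proof (intro allI impI)
  fix U :: "(complex \<times> complex) set" assume U: "open U" "0 \<in> U"
  obtain e where e: "0 < e" "ball 0 e \<subseteq> U" using U by (meson open_contains_ball)
  obtain R1 where R1: "R0 \<le> R1" "\<And>p. p \<in> tube R1 \<theta> \<Longrightarrow> cmod (g p) \<le> 1 / 64"
    using g_small[of "1/64"] by auto
  obtain R2 where R2: "R0 \<le> R2" "\<And>p. p \<in> tube R2 \<theta> \<Longrightarrow> cmod (h p) \<le> 1 / (64 * K) * \<delta> (Re (fst p))"
    using h_small[of "1/(64 * K)"] K by auto
  obtain R3 where R3: "R0 \<le> R3" "\<And>p. p \<in> tube R3 \<theta> \<Longrightarrow> norm (\<Phi> p) < e"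
    using \<Phi>_small[OF e(1)] by auto
  define R where "R = max R1 (max R2 R3)"
  have R: "R0 \<le> R" "R1 \<le> R" "R2 \<le> R" "R3 \<le> R" using R1 by (auto simp: R_def)
  have mono: "tube R \<theta> \<subseteq> tube S \<theta>" if "S \<le> R" for S R
    using that by (auto simp: tube_def wide_sector_def)
  have holo: "curve_holo (tube R \<theta>) f" if "curve_holo (tube R0 \<theta>) f" for f
    using that mono[OF R(1)] unfolding curve_holo_def by blast
  \<comment> \<open>Replacing \<open>\<delta>\<close> by \<open>\<delta> / K\<close> turns the
    summation bound with constant \<open>K\<close> into the normalized one of the locale; this is
    why \<open>h\<close> was required to be below \<open>1 / (64 * K)\<close> times
    \<open>\<delta>\<close>.\<close>
  interpret nearly_unit_shift g h \<theta> "\<lambda>t. \<delta> t / K" R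
  proof
    show "0 < R" using R0 R by simp
    show "0 < \<theta> t" if "R < t" for t using that R by (intro \<theta>_pos) auto
    show "\<theta> t \<le> \<theta> s" if "R < s" "s \<le> t" for s t using that R by (intro \<theta>_anti) auto
    show "0 \<le> \<delta> t / K" if "R \<le> t" for t using that R K \<delta>_nonneg[of t] by simp
    show "\<delta> t / K \<le> \<delta> s / K" if "R \<le> s" "s \<le> t" for s t
      using that R K \<delta>_anti[of s t] by (simp add: divide_right_mono)
    show "summable (\<lambda>j. \<delta> ((t + real j) / 2) / K)" if "2 * R \<le> t" for t
      using that R by (intro summable_divide \<delta>_summable) auto
    show "(\<Sum>j. \<delta> ((t + real j) / 2) / K) \<le> \<theta> (2 * t)" if "2 * R \<le> t" for t
      using that R K \<delta>_suminf[of t] \<delta>_summable[of t] by (subst suminf_divide) (auto simp: field_simps)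
    show "curve_holo (tube R \<theta>) g" "curve_holo (tube R \<theta>) h" using g_holo h_holo holo by auto
    show "cmod (g (\<zeta>, c)) \<le> 1 / 64" if "(\<zeta>, c) \<in> tube R \<theta>" for \<zeta> c
      using that mono[OF R(2)] by (intro R1) auto
    show "cmod (h (\<zeta>, c)) \<le> \<delta> (Re \<zeta>) / K / 64" if "(\<zeta>, c) \<in> tube R \<theta>" for \<zeta> c
      using that mono[OF R(3)] R2(2)[of "(\<zeta>, c)"] by (auto simp: mult.commute)
  qed
  obtain \<psi> where \<psi>: "\<psi> holomorphic_on sector (2 * R)"
    "\<And>\<zeta>. \<zeta> \<in> sector (2 * R) \<Longrightarrow> (\<zeta>, \<psi> \<zeta>) \<in> tube R \<theta>"
    "\<And>\<zeta>. \<zeta> \<in> sector (2 * R) \<Longrightarrow> \<zeta> + 1 + g (\<zeta>, \<psi> \<zeta>) \<in> sector (2 * R)"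
    "\<And>\<zeta>. \<zeta> \<in> sector (2 * R) \<Longrightarrow> Re \<zeta> + 1 / 2 \<le> Re (\<zeta> + 1 + g (\<zeta>, \<psi> \<zeta>))"
    "\<And>\<zeta>. \<zeta> \<in> sector (2 * R) \<Longrightarrow> \<psi> (\<zeta> + 1 + g (\<zeta>, \<psi> \<zeta>)) = \<psi> \<zeta> + h (\<zeta>, \<psi> \<zeta>)"
    using invariant_curve by blast
  define D where "D = inverse ` sector (2 * R)"
  define \<gamma> where "\<gamma> \<zeta> = \<Phi> (\<zeta>, \<psi> \<zeta>)" for \<zeta>
  \<comment> \<open>The value at 0 is set by hand: \<open>inverse 0 = 0\<close> in HOL, and 0 is not
    a point of the sector.\<close>
  define \<phi> where "\<phi> s = (if s = 0 then 0 else \<gamma> (inverse s))" for s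
  define T where "T \<zeta> = \<zeta> + 1 + g (\<zeta>, \<psi> \<zeta>)" for \<zeta>
  have nz: "\<zeta> \<noteq> 0" if "\<zeta> \<in> sector (2 * R)" for \<zeta>
    using that R_pos by (auto simp: sector_def)
  have in0: "(\<zeta>, \<psi> \<zeta>) \<in> tube R0 \<theta>" if "\<zeta> \<in> sector (2 * R)" for \<zeta>
    using \<psi>(2)[OF that] mono[OF R(1)] by auto
  have D_iff: "s \<in> D \<longleftrightarrow> s \<noteq> 0 \<and> inverse s \<in> sector (2 * R)" for s
    unfolding D_def using nz by (metis (no_types, lifting) image_iff inverse_inverse_eq inverse_nonzero_iff_nonzero)
  have F\<gamma>: "F (\<gamma> \<zeta>) = \<gamma> (T \<zeta>)" if "\<zeta> \<in> sector (2 * R)" for \<zeta>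
    using conj[OF in0[OF that]] in0[OF \<psi>(3)[OF that]] \<psi>(5)[OF that] by (simp add: \<gamma>_def T_def)
  have T_in: "T \<zeta> \<in> sector (2 * R)" if "\<zeta> \<in> sector (2 * R)" for \<zeta>
    using \<psi>(3)[OF that] by (simp add: T_def)
  have iter: "(F ^^ k) (\<gamma> \<zeta>) = \<gamma> ((T ^^ k) \<zeta>) \<and> (T ^^ k) \<zeta> \<in> sector (2 * R) \<and> Re \<zeta> + k / 2 \<le> Re ((T ^^ k) \<zeta>)"
    if "\<zeta> \<in> sector (2 * R)" for \<zeta> k
  proof (induction k)
    case (Suc k)
    have "Re ((T ^^ k) \<zeta>) + 1 / 2 \<le> Re (T ((T ^^ k) \<zeta>))"
      using \<psi>(4)[of "(T ^^ k) \<zeta>"] Suc by (simp add: T_def)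
    with Suc show ?case using F\<gamma> T_in by (simp add: field_simps)
  qed (use that in simp)
  have \<gamma>_small: "norm (\<gamma> \<zeta>) < r" if "\<zeta> \<in> sector (2 * R)" "S < Re \<zeta>" "\<forall>p\<in>tube S \<theta>. norm (\<Phi> p) < r" for \<zeta> S r
  proof -
    have "(\<zeta>, \<psi> \<zeta>) \<in> tube S \<theta>" using \<psi>(2)[OF that(1)] that(2) by (auto simp: tube_def wide_sector_def)
    with that(3) show ?thesis by (auto simp: \<gamma>_def)
  qed
  have hol_inv: "inverse holomorphic_on D" "\<psi> \<circ> inverse holomorphic_on D"
  proof -
    show 1: "inverse holomorphic_on D" using D_iff by (intro holomorphic_intros) auto
    show "\<psi> \<circ> inverse holomorphic_on D"
      using D_iff by (intro holomorphic_on_compose_gen[OF 1 \<psi>(1)]) auto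
  qed
  have cont_inv: "continuous_on (sector (2 * R)) inverse" "continuous_on D inverse"
    using nz D_iff by (auto intro!: continuous_intros)
  have oD: "open D"
  proof -
    have "open (- {0} \<inter> inverse -` sector (2 * R) :: complex set)"
      by (intro continuous_open_preimage open_sector continuous_intros) auto
    moreover have "D = - {0} \<inter> inverse -` sector (2 * R)" using D_iff by auto
    ultimately show ?thesis by simp
  qed
  have "parabolic_curve U F D \<phi>"
    unfolding parabolic_curve_def
  proof (intro conjI ballI)
    show "open D" by (fact oD)
    show "connected D" unfolding D_def
      by (intro connected_continuous_image cont_inv convex_connected convex_sector)
    have "homeomorphism (sector (2 * R)) D inverse inverse"
      using cont_inv by (auto simp: homeomorphism_def D_def image_image)
    then have "sector (2 * R) homeomorphic D" unfolding homeomorphic_def by blast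
    then show "simply_connected D"
      using homeomorphic_simply_connected convex_imp_simply_connected[OF convex_sector] by blast
    have "0 \<in> closure D"
      unfolding closure_approachable
    proof (intro allI impI)
      fix r :: real assume r: "0 < r"
      define x where "x = 2 * R + 2 / r"
      have x: "2 * R < x" "2 / r \<le> x" "0 < x" using r R_pos by (auto simp: x_def add_pos_pos)
      have "inverse (complex_of_real x) \<in> D" unfolding D_def using x by (intro imageI) (auto simp: sector_def)
      have "1 / x \<le> 1 / (2 / r)" using x(2) r by (intro divide_left_mono) (auto simp: x(3))
      also have "\<dots> < r" using r by simp
      finally have "1 / x < r" .
      then have "dist (inverse (complex_of_real x)) 0 < r" using x by (simp add: norm_inverse divide_inverse)
      with \<open>inverse (complex_of_real x) \<in> D\<close> show "\<exists>y\<in>D. dist y 0 < r" by blast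
    qed
    moreover have "0 \<notin> interior D" using interior_subset D_iff by blast
    ultimately show "0 \<in> frontier D" by (simp add: frontier_def)
    show "inj_on \<phi> D"
    proof (rule inj_onI)
      fix s t assume st: "s \<in> D" "t \<in> D" "\<phi> s = \<phi> t"
      have s: "s \<noteq> 0" "inverse s \<in> sector (2 * R)" and t: "t \<noteq> 0" "inverse t \<in> sector (2 * R)"
        using st(1,2) D_iff by blast+
      have "\<Phi> (inverse s, \<psi> (inverse s)) = \<Phi> (inverse t, \<psi> (inverse t))"
        using st(3) s(1) t(1) by (simp add: \<phi>_def \<gamma>_def)
      from inj_onD[OF \<Phi>_inj this in0[OF s(2)] in0[OF t(2)]] show "s = t" by simp
    qed
    have eq: "\<phi> s = \<Phi> (inverse s, (\<psi> \<circ> inverse) s)" if "s \<in> D" for s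
      using that D_iff by (simp add: \<phi>_def \<gamma>_def)
    have in1: "(inverse s, (\<psi> \<circ> inverse) s) \<in> tube R0 \<theta>" if "s \<in> D" for s
      using that D_iff in0 by simp
    show "(\<lambda>s. fst (\<phi> s)) holomorphic_on D"
      by (rule holomorphic_transform[OF \<Phi>_holo(1)[unfolded curve_holo_def, rule_format, OF oD hol_inv in1]])
         (simp_all add: eq)
    show "(\<lambda>s. snd (\<phi> s)) holomorphic_on D"
      by (rule holomorphic_transform[OF \<Phi>_holo(2)[unfolded curve_holo_def, rule_format, OF oD hol_inv in1]])
         (simp_all add: eq)
    show "\<phi> 0 = 0" by (simp add: \<phi>_def)
    show "continuous (at 0 within insert 0 D) \<phi>"
      unfolding continuous_within_eps_delta
    proof (intro allI impI)
      fix r :: real assume r: "0 < r"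
      obtain S where S: "R0 \<le> S" "\<forall>p\<in>tube S \<theta>. norm (\<Phi> p) < r" using \<Phi>_small[OF r] by blast
      have "dist (\<phi> s) (\<phi> 0) < r" if "s \<in> insert 0 D" "dist s 0 < 1 / (2 * S)" for s
      proof (cases "s = 0")
        case False
        with that D_iff have s: "inverse s \<in> sector (2 * R)" by auto
        have "2 * S < cmod (inverse s)"
        proof -
          have "0 < S" using S(1) R0 by simp
          moreover have "cmod s < 1 / (2 * S)" using that(2) by simp
          ultimately show ?thesis using False by (simp add: norm_inverse norm_divide field_simps)
        qed
        also have "\<dots> \<le> \<bar>Re (inverse s)\<bar> + \<bar>Im (inverse s)\<bar>" by (rule cmod_le)
        also have "\<dots> \<le> 2 * Re (inverse s)"
          using s R_pos unfolding sector_def mem_Collect_eq by linarith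
        finally have "S < Re (inverse s)" by simp
        from \<gamma>_small[OF s this S(2)] show ?thesis using False by (simp add: \<phi>_def)
      qed (use r in \<open>simp add: \<phi>_def\<close>)
      then show "\<exists>d>0. \<forall>x'\<in>insert 0 D. dist x' 0 < d \<longrightarrow> dist (\<phi> x') (\<phi> 0) < r"
        using S(1) R0 by (intro exI[of _ "1 / (2 * S)"]) auto
    qed
    show "\<phi> ` D \<subseteq> U"
    proof (rule image_subsetI)
      fix s assume "s \<in> D"
      then have s: "inverse s \<in> sector (2 * R)" "s \<noteq> 0" using D_iff by blast+
      have "norm (\<gamma> (inverse s)) < e"
        using R3(2) R(4) s(1) R_pos by (intro \<gamma>_small[OF s(1), of R3]) (auto simp: sector_def simp del: inverse_complex.simps)
      then have "\<phi> s \<in> ball 0 e" using s by (simp add: \<phi>_def)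
      then show "\<phi> s \<in> U" using e(2) by (rule rev_subsetD)
    qed
    show "F ` \<phi> ` D \<subseteq> \<phi> ` D"
      unfolding image_image
    proof (rule image_subsetI)
      fix s assume "s \<in> D"
      then have s: "inverse s \<in> sector (2 * R)" "s \<noteq> 0" using D_iff by blast+
      have "F (\<phi> s) = \<phi> (inverse (T (inverse s)))"
        using F\<gamma>[OF s(1)] nz[OF T_in[OF s(1)]] s(2) by (simp add: \<phi>_def)
      moreover have "inverse (T (inverse s)) \<in> D" using T_in[OF s(1)] by (simp add: D_def)
      ultimately show "F (\<phi> s) \<in> \<phi> ` D" by (simp only: imageI)
    qed
    fix x assume "x \<in> \<phi> ` D"
    then obtain s where s: "s \<in> D" "x = \<phi> s" by blast
    then have \<zeta>: "inverse s \<in> sector (2 * R)" and x: "x = \<gamma> (inverse s)" using D_iff by (auto simp: \<phi>_def)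
    show "(\<lambda>k. (F ^^ k) x) \<longlonglongrightarrow> 0"
    proof (rule LIMSEQ_I)
      fix r :: real assume r: "0 < r"
      obtain S where S: "R0 \<le> S" "\<forall>p\<in>tube S \<theta>. norm (\<Phi> p) < r" using \<Phi>_small[OF r] by blast
      obtain n where n: "2 * S < real n" using reals_Archimedean2 by blast
      have "norm ((F ^^ k) x - 0) < r" if "n \<le> k" for k
      proof -
        have "2 * S < real k" using n that by linarith
        then have "S < Re ((T ^^ k) (inverse s))"
          using iter[OF \<zeta>, of k] \<zeta> R_pos unfolding sector_def mem_Collect_eq by argo
        then show ?thesis using \<gamma>_small[OF _ _ S(2)] iter[OF \<zeta>, of k] by (simp add: x)
      qed
      then show "\<exists>n. \<forall>k\<ge>n. norm ((F ^^ k) x - 0) < r" by blast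
    qed
  qed
  moreover have "fst (\<phi> s) \<noteq> 0" if "s \<in> D" for s
    using that D_iff \<Phi>_nz in0 by (auto simp: \<phi>_def \<gamma>_def)
  ultimately show "\<exists>\<Delta> \<phi>. parabolic_curve U F \<Delta> \<phi> \<and> (\<forall>s\<in>\<Delta>. fst (\<phi> s) \<noteq> 0)" by blast
qed

lemma telescoping_summable:
  fixes d u :: "nat \<Rightarrow> real"
  assumes "\<And>j. 0 \<le> d j" "\<And>j. d j \<le> u j - u (Suc j)" "\<And>j. 0 \<le> u j"
  shows "summable d" "suminf d \<le> u 0"
proof -
  have le: "(\<Sum>j<n. d j) \<le> u 0" for n
  proof -
    have "(\<Sum>j<n. d j) \<le> (\<Sum>j<n. u j - u (Suc j))" by (intro sum_mono assms(2))
    also have "\<dots> = u 0 - u n" by (simp add: sum_lessThan_telescope')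
    finally show ?thesis using assms(3)[of n] by simp
  qed
  show "summable d" by (rule summableI_nonneg_bounded[OF assms(1) le])
  then show "suminf d \<le> u 0" by (rule suminf_le_const[OF _ le])
qed

text \<open>Comparison with a telescoping sum of \<open>s powr (-q) / q\<close> through the mean
  value theorem. The factor \<open>2 powr (1 + q)\<close> undoes the division by 2 in the argument,
  and \<open>4 powr q\<close> comes from \<open>t - 1 \<ge> t / 2 = (2 * t) / 4\<close>.\<close>

lemma powr_weight_sum:
  fixes q t :: real
  assumes q: "0 < q" and t: "2 \<le> t"
  shows "summable (\<lambda>j. ((t + real j) / 2) powr (- q - 1))"
    and "(\<Sum>j. ((t + real j) / 2) powr (- q - 1)) \<le> 2 powr (1 + q) / q * 4 powr q * (2 * t) powr (-q)"
proof -
  let ?d = "\<lambda>j. ((t + real j) / 2) powr (- q - 1)"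
  let ?u = "\<lambda>j. 2 powr (1 + q) / q * (t - 1 + real j) powr (-q)"
  have le: "?d j \<le> ?u j - ?u (Suc j)" for j
  proof -
    define s where "s = t - 1 + real j"
    have s: "1 \<le> s" using t by (simp add: s_def)
    have "\<exists>z. s < z \<and> z < s + 1 \<and> (s + 1) powr (-q) - s powr (-q) = (s + 1 - s) * ((-q) * z powr (-q - 1))"
      using s by (intro MVT2) (auto intro!: derivative_eq_intros)
    then obtain z where z: "s < z" "z < s + 1" "s powr (-q) - (s + 1) powr (-q) = q * z powr (-q - 1)"
      by (auto simp: algebra_simps)
    have "(s + 1) powr (- q - 1) \<le> z powr (- q - 1)"
      using z s q by (intro powr_mono2') auto
    then have "(s + 1) powr (- q - 1) \<le> (s powr (-q) - (s + 1) powr (-q)) / q"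
      using z(3) q by (simp add: pos_le_divide_eq mult.commute)
    then have "2 powr (1 + q) * (s + 1) powr (- q - 1) \<le> 2 powr (1 + q) * ((s powr (-q) - (s + 1) powr (-q)) / q)"
      by (rule mult_left_mono) simp
    moreover have "?d j = 2 powr (1 + q) * (s + 1) powr (- q - 1)"
    proof -
      have "((s + 1) / 2) powr (- q - 1) = (s + 1) powr (- q - 1) / 2 powr (- q - 1)"
        by (rule powr_divide)
      moreover have "2 powr (- q - 1) = 1 / (2 powr (1 + q) :: real)"
        by (simp add: powr_diff powr_add powr_minus_divide)
      moreover have "t + real j = s + 1" by (simp add: s_def)
      ultimately show ?thesis by simp
    qed
    moreover have "t - 1 + real (Suc j) = s + 1" by (simp add: s_def)
    ultimately show ?thesis by (simp only: s_def[symmetric] right_diff_distrib times_divide_eq_left times_divide_eq_right diff_divide_distrib)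
  qed
  have nn: "0 \<le> ?d j" "0 \<le> ?u j" for j using q by auto
  show "summable ?d" by (rule telescoping_summable[of ?d ?u]) (use nn le in auto)
  have "suminf ?d \<le> ?u 0" by (rule telescoping_summable[of ?d ?u]) (use nn le in auto)
  also have "\<dots> \<le> 2 powr (1 + q) / q * (4 powr q * (2 * t) powr (-q))"
  proof (rule mult_left_mono)
    have "(t - 1 + real 0) powr (-q) \<le> (t / 2) powr (-q)"
      using t q by (auto intro!: powr_mono2')
    also have "t / 2 = 1 / 4 * (2 * t)" by simp
    also have "(1 / 4 * (2 * t)) powr (-q) = (1/4) powr (-q) * (2 * t) powr (-q)"
      by (rule powr_mult)
    also have "(1 / 4 :: real) powr (-q) = 4 powr q"
      by (simp add: powr_divide powr_minus_divide)
    finally show "(t - 1 + real 0) powr (-q) \<le> 4 powr q * (2 * t) powr (-q)" .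
  qed (use q in auto)
  finally show "suminf ?d \<le> 2 powr (1 + q) / q * 4 powr q * (2 * t) powr (-q)" by simp
qed

text \<open>The filter of real parts tending to infinity inside the tube. It lets all asymptotic
  estimates be stated as limits; a single radius is extracted only at the end.\<close>

definition tubes :: "real \<Rightarrow> (real \<Rightarrow> real) \<Rightarrow> (complex \<times> complex) filter" where
  "tubes R \<theta> = inf (filtercomap (\<lambda>p. Re (fst p)) at_top) (principal (tube R \<theta>))"

lemma tube_mono: "S \<le> R \<Longrightarrow> tube R \<theta> \<subseteq> tube S \<theta>"
  by (auto simp: tube_def wide_sector_def)

lemma eventually_tubes:
  "eventually P (tubes R0 \<theta>) \<longleftrightarrow> (\<exists>R\<ge>R0. \<forall>p\<in>tube R \<theta>. P p)"
proof
  assume "eventually P (tubes R0 \<theta>)"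
  then obtain Q where Q: "eventually Q at_top" "\<And>p. Q (Re (fst p)) \<Longrightarrow> p \<in> tube R0 \<theta> \<Longrightarrow> P p"
    by (auto simp: tubes_def eventually_inf_principal eventually_filtercomap)
  then obtain R where R: "\<And>x. R \<le> x \<Longrightarrow> Q x" by (auto simp: eventually_at_top_linorder)
  have "P p" if "p \<in> tube (max R R0) \<theta>" for p
    using that R[of "Re (fst p)"] tube_mono[of R0 "max R R0" \<theta>]
    by (intro Q) (auto simp: tube_def wide_sector_def)
  then show "\<exists>R\<ge>R0. \<forall>p\<in>tube R \<theta>. P p" by (intro exI[of _ "max R R0"]) auto
next
  assume "\<exists>R\<ge>R0. \<forall>p\<in>tube R \<theta>. P p"
  then obtain R where R: "R0 \<le> R" "\<And>p. p \<in> tube R \<theta> \<Longrightarrow> P p" by blast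
  have "p \<in> tube R \<theta>" if "R < Re (fst p)" "p \<in> tube R0 \<theta>" for p
    using that by (auto simp: tube_def wide_sector_def)
  then have "\<forall>x. R < x \<longrightarrow> (\<forall>p. Re (fst p) = x \<longrightarrow> p \<in> tube R0 \<theta> \<longrightarrow> P p)" using R(2) by blast
  then show "eventually P (tubes R0 \<theta>)"
    unfolding tubes_def eventually_inf_principal eventually_filtercomap
    by (intro exI[of _ "\<lambda>x. R < x"] conjI eventually_gt_at_top allI) blast
qed

lemma tubes_eventually_in: "\<forall>\<^sub>F p in tubes R0 \<theta>. p \<in> tube R \<theta>"
proof -
  have "p \<in> tube R \<theta>" if "p \<in> tube (max R R0) \<theta>" for p
    using tube_mono[of R "max R R0" \<theta>] that by auto
  then show ?thesis unfolding eventually_tubes by (intro exI[of _ "max R R0"]) auto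
qed

lemma filterlim_tubes: "filterlim (\<lambda>p. Re (fst p)) at_top (tubes R0 \<theta>)"
  unfolding tubes_def by (rule filterlim_mono[OF filterlim_filtercomap order_refl inf_le1])

lemma tendsto_tubes_real:
  assumes "(f \<longlongrightarrow> l) at_top" shows "((\<lambda>p. f (Re (fst p))) \<longlongrightarrow> l) (tubes R0 \<theta>)"
  by (rule filterlim_compose[OF assms filterlim_tubes])

lemma tubes_bounds:
  assumes "(\<zeta>, c) \<in> tube R \<theta>" "0 < R"
  shows "R < Re \<zeta>" "Re \<zeta> \<le> cmod \<zeta>" "cmod \<zeta> \<le> 4 * Re \<zeta>" "\<bar>Im (Ln \<zeta>)\<bar> < pi / 2" "\<zeta> \<noteq> 0" "\<zeta> \<notin> \<real>\<^sub>\<le>\<^sub>0" "cmod c < \<theta> (Re \<zeta>)"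
proof -
  show R: "R < Re \<zeta>" and "cmod c < \<theta> (Re \<zeta>)" using assms by (auto simp: tube_def wide_sector_def)
  show "Re \<zeta> \<le> cmod \<zeta>" by (rule complex_Re_le_cmod)
  show "cmod \<zeta> \<le> 4 * Re \<zeta>" using cmod_le[of \<zeta>] assms by (auto simp: tube_def wide_sector_def)
  have "0 < Re \<zeta>" using R assms(2) by simp
  then show "\<bar>Im (Ln \<zeta>)\<bar> < pi / 2" "\<zeta> \<noteq> 0" "\<zeta> \<notin> \<real>\<^sub>\<le>\<^sub>0"
    using Re_Ln_pos_lt_imp by (auto simp: complex_nonpos_Reals_iff)
qed

text \<open>Inside the tube \<open>cmod \<zeta>\<close> and \<open>Re \<zeta>\<close> agree up to
  the factor 4, and the argument of \<open>\<zeta>\<close> is below \<open>pi / 2 < 2\<close>. A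
  complex power is therefore comparable with a real power of \<open>Re \<zeta>\<close>, whatever the
  sign of \<open>Re E\<close>.\<close>

lemma norm_exp_Ln_le:
  assumes "(\<zeta>, c) \<in> tube R \<theta>" "0 < R"
  shows "cmod (exp (E * Ln \<zeta>)) \<le> 4 powr \<bar>Re E\<bar> * exp (2 * cmod E) * Re \<zeta> powr Re E"
proof -
  note b = tubes_bounds[OF assms]
  have "cmod (exp (E * Ln \<zeta>)) = exp (Re E * ln (cmod \<zeta>)) * exp (- Im E * Im (Ln \<zeta>))"
    using b(5) by (simp add: norm_exp_eq_Re exp_add[symmetric])
  also have "exp (Re E * ln (cmod \<zeta>)) \<le> 4 powr \<bar>Re E\<bar> * Re \<zeta> powr Re E"
  proof (cases "0 \<le> Re E")
    case True
    have "exp (Re E * ln (cmod \<zeta>)) = cmod \<zeta> powr Re E" using b(5) by (simp add: powr_def)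
    also have "\<dots> \<le> (4 * Re \<zeta>) powr Re E" using b True by (intro powr_mono2) auto
    also have "\<dots> = 4 powr \<bar>Re E\<bar> * Re \<zeta> powr Re E" using b assms True by (simp add: powr_mult)
    finally show ?thesis .
  next
    case False
    have "exp (Re E * ln (cmod \<zeta>)) = cmod \<zeta> powr Re E" using b(5) by (simp add: powr_def)
    also have "\<dots> \<le> Re \<zeta> powr Re E" using b False assms by (intro powr_mono2') auto
    also have "\<dots> \<le> 4 powr \<bar>Re E\<bar> * Re \<zeta> powr Re E"
      using ge_one_powr_ge_zero[of 4 "\<bar>Re E\<bar>"] by (simp add: mult_le_cancel_right1)
    finally show ?thesis .
  qed
  also have "exp (- Im E * Im (Ln \<zeta>)) \<le> exp (2 * cmod E)"
  proof -
    have "- Im E * Im (Ln \<zeta>) \<le> \<bar>Im E\<bar> * \<bar>Im (Ln \<zeta>)\<bar>" by (metis abs_ge_self abs_minus_cancel abs_mult mult_minus_left)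
    also have "\<dots> \<le> cmod E * 2"
      using b(4) pi_less_4 abs_Im_le_cmod[of E] by (intro mult_mono) auto
    finally show ?thesis by simp
  qed
  finally show ?thesis by (simp add: mult_right_mono ac_simps)
qed

lemma tendsto_mult_bounded_zero:
  fixes f g :: "'a \<Rightarrow> complex"
  assumes "\<forall>\<^sub>F x in F. cmod (f x) \<le> C" "(g \<longlongrightarrow> 0) F"
  shows "((\<lambda>x. f x * g x) \<longlongrightarrow> 0) F"
proof -
  have "((\<lambda>x. C * cmod (g x)) \<longlongrightarrow> C * cmod 0) F" by (intro tendsto_intros assms(2))
  moreover have "\<forall>\<^sub>F x in F. cmod (f x * g x) \<le> C * cmod (g x)"
    using assms(1) by eventually_elim (simp add: norm_mult mult_right_mono)
  ultimately show ?thesis by (simp add: Lim_null_comparison)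
qed

lemma germ2_tendsto:
  assumes "germ2 f" "(X \<longlongrightarrow> 0) F" "(Y \<longlongrightarrow> 0) F"
  shows "((\<lambda>p. f (X p, Y p)) \<longlongrightarrow> f 0) F"
  using isCont_tendsto_compose[OF germ2_isCont[OF assms(1)], of "\<lambda>p. (X p, Y p)" F] tendsto_Pair[OF assms(2,3)]
  by (simp add: zero_prod_def)


section \<open>Small exponents\<close>

text \<open>Caratheodory's form of differentiability: a remainder becomes a factor with a limit
  along any filter, so exact formulas can be kept until the limit is taken.\<close>

lemma derivative_factor:
  fixes f :: "complex \<Rightarrow> complex"
  assumes "(f has_field_derivative D) (at 0)"
  obtains \<rho> where "\<And>v. f v = f 0 + v * \<rho> v" "\<And>X F. (X \<longlongrightarrow> 0) F \<Longrightarrow> ((\<lambda>p. \<rho> (X p)) \<longlongrightarrow> D) F"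
proof -
  obtain \<rho> where \<rho>: "\<And>v. f v - f 0 = \<rho> v * (v - 0)" "isCont \<rho> 0" "\<rho> 0 = D"
    using assms unfolding CARAT_DERIV by blast
  show ?thesis
  proof (rule that[of \<rho>])
    show "f v = f 0 + v * \<rho> v" for v using \<rho>(1)[of v] by (simp add: algebra_simps)
    show "((\<lambda>p. \<rho> (X p)) \<longlongrightarrow> D) F" if "(X \<longlongrightarrow> 0) F" for X and F :: "'a filter"
      using isCont_tendsto_compose[OF \<rho>(2) that] \<rho>(3) by simp
  qed
qed

lemma Ln_mult_right_half_planes:
  assumes "z \<noteq> 0" "w \<noteq> 0" "\<bar>Im (Ln z)\<bar> < pi / 2" "\<bar>Im (Ln w)\<bar> < pi / 2"
  shows "Ln (z * w) = Ln z + Ln w"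
  using assms by (intro Ln_times_simple) auto

text \<open>In the coordinates below the increment of \<open>c\<close> is
  \<open>\<zeta>^(E - 1)\<close> times a combination of \<open>y\<close> and \<open>x\<close>. The
  coefficient of \<open>y\<close> tends to 0 by the choice of \<open>E\<close>, and \<open>x\<close>
  is of size \<open>\<zeta>^(-1/k)\<close>. A decay rate for \<open>y\<close> strictly between
  \<open>Re E\<close> and \<open>1/k\<close> makes both contributions negligible against a summable
  weight.\<close>

proposition parabolic_curves_of_small_exponent:
  fixes a b p q :: "complex \<times> complex \<Rightarrow> complex"
  assumes a: "germ2 a" and b: "germ2 b" and p: "germ2 p" and q: "germ2 q"
    and b_eq: "germ_eq b (\<lambda>x. fst x * p x + snd x * q x)"
    and k: "0 < k" and a0: "a 0 \<noteq> 0" and e: "Re (q 0 / a 0) < 1"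
  shows "has_parabolic_curves (\<lambda>x. (fst x + fst x ^ (k + 1) * a x, snd x + fst x ^ k * b x))"
proof -
  define E where "E = q 0 / a 0 / of_nat k"
  have ReE: "Re E < 1 / k" using divide_strict_right_mono[OF e, of "real k"] k
    by (simp add: E_def Re_divide_of_nat del: divide_divide_eq_left)
  \<comment> \<open>\<open>\<sigma>\<close> is the decay rate imposed on \<open>y\<close>.
    Positivity makes \<open>y\<close> tend to 0, \<open>\<sigma> > Re E\<close> makes
    \<open>\<delta>\<close> summable with sum comparable to \<open>\<theta>\<close>, and
    \<open>\<sigma> < 1/k\<close> makes \<open>x\<close> small against the bound for
    \<open>y\<close>.\<close>
  obtain \<sigma> where \<sigma>: "0 < \<sigma>" "Re E < \<sigma>" "\<sigma> < 1 / k"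
    using dense[of "max 0 (Re E)" "1 / k"] ReE k by auto
  define m where "m = \<sigma> - Re E"
  have m: "0 < m" using \<sigma> by (simp add: m_def)
  define \<theta> where "\<theta> t = t powr (- m)" for t :: real
  define \<delta> where "\<delta> t = t powr (- m - 1)" for t :: real
  \<comment> \<open>Chosen so that \<open>x^k = -1 / (k * a 0 * \<zeta>)\<close>; then the leading
    part of the map in \<open>x\<close> becomes
    \<open>\<zeta> \<mapsto> \<zeta> + 1\<close>.\<close>
  obtain \<omega> where "- 1 / (of_nat k * a 0) = \<omega> ^ k"
    by (rule exists_complex_root[of k "- 1 / (of_nat k * a 0)"]) (use k in auto)
  then have \<omega>: "\<omega> ^ k = - 1 / (of_nat k * a 0)" by (rule sym)
  have \<omega>0: "\<omega> \<noteq> 0" using \<omega> a0 k by (auto simp: power_0_left split: if_splits)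
  \<comment> \<open>\<open>x = \<omega> \<zeta>\<^bsup>-1/k\<^esup>\<close>, \<open>y = c \<zeta>\<^bsup>-E\<^esup>\<close> solves the leading part of the flow with \<open>c\<close> constant.\<close>
  define x where "x P = \<omega> * exp (- (Ln (fst P) / of_nat k))" for P :: "complex \<times> complex"
  define y where "y P = snd P * exp (- E * Ln (fst P))" for P :: "complex \<times> complex"
  define T where "T = tubes 1 \<theta>"
  have xk: "x P ^ k = - 1 / (of_nat k * a 0 * fst P)" if "fst P \<noteq> 0" for P
  proof -
    have "exp (- (Ln (fst P) / of_nat k)) ^ k = exp (- Ln (fst P))"
      using k by (simp add: exp_of_nat_mult[symmetric])
    then show ?thesis using that by (simp add: x_def power_mult_distrib \<omega> exp_minus divide_simps)
  qed

  \<comment> \<open>Decay of the coordinates along the tube\<close>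
  obtain Kx where Kx: "cmod (x P) \<le> Kx * Re (fst P) powr (- (1 / k))" if "P \<in> tube 1 \<theta>" for P
  proof
    fix P assume "P \<in> tube 1 \<theta>"
    then show "cmod (x P) \<le> cmod \<omega> * (4 powr \<bar>Re (- (1 / of_nat k))\<bar> * exp (2 * cmod (- (1 / of_nat k)))) * Re (fst P) powr (- (1 / k))"
      using norm_exp_Ln_le[of "fst P" "snd P" 1 \<theta> "- (1 / of_nat k)"]
      by (simp add: x_def norm_mult mult_left_mono mult.assoc Re_divide_of_nat)
  qed
  obtain Ky where Ky: "0 \<le> Ky" "\<And>P. P \<in> tube 1 \<theta> \<Longrightarrow> cmod (y P) \<le> Ky * Re (fst P) powr (- \<sigma>)"
  proof
    let ?K = "4 powr \<bar>Re (- E)\<bar> * exp (2 * cmod (- E))"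
    show "0 \<le> ?K" by simp
    fix P assume P: "P \<in> tube 1 \<theta>"
    then have "cmod (snd P) \<le> Re (fst P) powr (- m)" "1 < Re (fst P)"
      using tubes_bounds[of "fst P" "snd P" 1 \<theta>] by (auto simp: \<theta>_def)
    moreover have "cmod (exp (- E * Ln (fst P))) \<le> ?K * Re (fst P) powr (- Re E)"
      using norm_exp_Ln_le[of "fst P" "snd P" 1 \<theta> "- E"] P by simp
    ultimately have "cmod (y P) \<le> Re (fst P) powr (- m) * (?K * Re (fst P) powr (- Re E))"
      unfolding y_def norm_mult by (intro mult_mono) auto
    also have "\<dots> = ?K * (Re (fst P) powr (- m) * Re (fst P) powr (- Re E))" by simp
    also have "Re (fst P) powr (- m) * Re (fst P) powr (- Re E) = Re (fst P) powr (- \<sigma>)"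
      by (simp add: powr_add[symmetric] m_def)
    finally show "cmod (y P) \<le> ?K * Re (fst P) powr (- \<sigma>)" .
  qed
  obtain Ke where Ke: "0 \<le> Ke" "\<And>P. P \<in> tube 1 \<theta> \<Longrightarrow> cmod (exp (E * Ln (fst P))) \<le> Ke * Re (fst P) powr Re E"
    using norm_exp_Ln_le[of _ _ 1 \<theta> E] by (intro that[of "4 powr \<bar>Re E\<bar> * exp (2 * cmod E)"]) auto
  have in1: "\<forall>\<^sub>F P in T. P \<in> tube 1 \<theta>" unfolding T_def by (rule tubes_eventually_in)
  have pw: "((\<lambda>P. C * Re (fst P) powr c) \<longlongrightarrow> 0) T" if "c < 0" for C c
    unfolding T_def by (intro tendsto_mult_right_zero tendsto_neg_powr[OF that] filterlim_tubes)
  let ?ts = "\<lambda>P. complex_of_real (Re (fst P) powr \<sigma>)"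
  have tsx: "((\<lambda>P. ?ts P * x P) \<longlongrightarrow> 0) T"
  proof (rule Lim_null_comparison[OF _ pw[of "\<sigma> - 1 / k" Kx]])
    show "\<forall>\<^sub>F P in T. cmod (?ts P * x P) \<le> Kx * Re (fst P) powr (\<sigma> - 1 / k)"
      using in1
    proof eventually_elim
      case (elim P)
      have "cmod (?ts P * x P) \<le> Re (fst P) powr \<sigma> * (Kx * Re (fst P) powr (- (1 / k)))"
        using Kx[OF elim] by (simp add: norm_mult mult_left_mono)
      also have "\<dots> = Kx * Re (fst P) powr (\<sigma> - 1 / k)" by (simp add: powr_add[symmetric])
      finally show ?case .
    qed
  qed (use \<sigma> in simp)
  have tsy: "\<forall>\<^sub>F P in T. cmod (?ts P * y P) \<le> Ky"
    using in1
  proof eventually_elim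
    case (elim P)
    have "1 < Re (fst P)" using elim tubes_bounds[of "fst P" "snd P" 1 \<theta>] by auto
    have "cmod (?ts P * y P) \<le> Re (fst P) powr \<sigma> * (Ky * Re (fst P) powr (- \<sigma>))"
      using Ky(2)[OF elim] by (simp add: norm_mult mult_left_mono)
    also have "\<dots> = Ky" using \<open>1 < Re (fst P)\<close> by (simp add: powr_add[symmetric] powr_minus)
    finally show ?case .
  qed
  have x0: "(x \<longlongrightarrow> 0) T"
    by (rule Lim_null_comparison[OF eventually_mono[OF in1] pw[of "- (1 / k)" Kx]]) (use Kx k in auto)
  have y0: "(y \<longlongrightarrow> 0) T"
    by (rule Lim_null_comparison[OF eventually_mono[OF in1] pw[of "- \<sigma>" Ky]]) (use Ky \<sigma> in auto)
  have iz: "((\<lambda>P. 1 / fst P) \<longlongrightarrow> 0) T"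
  proof (rule Lim_null_comparison[OF eventually_mono[OF in1] pw[of "- 1" 1]])
    fix P assume "P \<in> tube 1 \<theta>"
    then have "1 < Re (fst P)" "Re (fst P) \<le> cmod (fst P)"
      using tubes_bounds[of "fst P" "snd P" 1 \<theta>] by auto
    then show "cmod (1 / fst P) \<le> 1 * Re (fst P) powr - 1"
      by (simp add: norm_divide powr_minus_divide frac_le)
  qed simp
  have nz: "\<forall>\<^sub>F P in T. fst P \<noteq> 0"
    using in1 by eventually_elim (use tubes_bounds[of _ _ 1 \<theta>] in force)
  have lim: "((\<lambda>P. f (x P, y P)) \<longlongrightarrow> f 0) T" if "germ2 f" for f
    by (rule germ2_tendsto[OF that x0 y0])

  \<comment> \<open>The exact increments of \<open>\<zeta>\<close> and \<open>c\<close>, and their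
    limits\<close>
  define s where "s P = a (x P, y P) / a 0" for P
  define v where "v P = s P * (1 / fst P)" for P
  have s1: "(s \<longlongrightarrow> 1) T" unfolding s_def using tendsto_divide[OF lim[OF a] tendsto_const a0] a0 by simp
  have v0: "(v \<longlongrightarrow> 0) T" unfolding v_def using tendsto_mult[OF s1 iz] by simp
  \<comment> \<open>As \<open>x^k * a = - v / k\<close>, the map multiplies \<open>x\<close> by
    \<open>1 - v / k\<close>, hence \<open>\<zeta>\<close> by \<open>f1 v\<close>.\<close>
  define f1 where "f1 w = inverse ((1 - w / of_nat k) ^ k)" for w :: complex
  have "(f1 has_field_derivative 1) (at 0)"
  proof -
    have "((\<lambda>w. 1 - w / of_nat k) has_field_derivative (- 1 / of_nat k :: complex)) (at 0)"
      using k by (auto intro!: derivative_eq_intros)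
    note D = DERIV_inverse'[OF DERIV_power[OF this, of k]]
    show ?thesis
      unfolding f1_def by (rule DERIV_cong[OF D]) (use k in auto)
  qed
  then obtain \<rho>1 where \<rho>1: "\<And>w. f1 w = 1 + w * \<rho>1 w" "\<And>X. (X \<longlongrightarrow> 0) T \<Longrightarrow> ((\<lambda>P. \<rho>1 (X P)) \<longlongrightarrow> 1) T"
    by (rule derivative_factor) (auto simp: f1_def)
  define f2 where "f2 w = exp (E * Ln (1 + w))" for w :: complex
  have "(f2 has_field_derivative E) (at 0)"
    unfolding f2_def by (auto intro!: derivative_eq_intros)
  then obtain \<rho>2 where \<rho>2: "\<And>w. f2 w = 1 + w * \<rho>2 w" "\<And>X. (X \<longlongrightarrow> 0) T \<Longrightarrow> ((\<lambda>P. \<rho>2 (X P)) \<longlongrightarrow> E) T"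
    by (rule derivative_factor) (auto simp: f2_def)
  define u where "u P = v P * \<rho>1 (v P)" for P
  have u0: "(u \<longlongrightarrow> 0) T" unfolding u_def using tendsto_mult[OF v0 \<rho>1(2)[OF v0]] by simp
  define g where "g P = fst P * f1 (v P) - fst P - 1" for P
  define y1 where "y1 P = y P + x P ^ k * b (x P, y P)" for P
  \<comment> \<open>The new \<open>\<zeta>\<close> is the old one times \<open>1 + u\<close>, so its
    power with exponent \<open>E\<close> is \<open>exp (E * Ln \<zeta>) * f2 u\<close>. With this
    \<open>h\<close> the conjugacy is an identity, not an approximation.\<close>
  define h where "h P = y1 P * exp (E * Ln (fst P)) * f2 (f1 (v P) - 1) - snd P" for P
  have u_eq: "f1 (v P) - 1 = u P" for P by (simp add: u_def \<rho>1(1))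
  have g_eq: "g P = s P * \<rho>1 (v P) - 1" if "fst P \<noteq> 0" for P
    using that by (simp add: g_def \<rho>1(1) v_def field_simps)
  have g0: "(g \<longlongrightarrow> 0) T"
  proof (rule Lim_transform_eventually)
    show "((\<lambda>P. s P * \<rho>1 (v P) - 1) \<longlongrightarrow> 0) T"
      using tendsto_diff[OF tendsto_mult[OF s1 \<rho>1(2)[OF v0]] tendsto_const[of 1]] by simp
    show "\<forall>\<^sub>F P in T. s P * \<rho>1 (v P) - 1 = g P" using nz by eventually_elim (simp add: g_eq)
  qed
  \<comment> \<open>\<open>W\<close> collects the part of the increment proportional to
    \<open>y\<close>. Its limit is \<open>E - q 0 / (k * a 0) = 0\<close>, which is what determines
    \<open>E\<close>. The part proportional to \<open>x\<close>, collected in \<open>V\<close>, only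
    has to converge.\<close>
  define W where "W P = (1 + g P) * \<rho>2 (u P) - q (x P, y P) * f2 (u P) / (of_nat k * a 0)" for P
  define V where "V P = p (x P, y P) * f2 (u P) / (of_nat k * a 0)" for P
  have f2l: "((\<lambda>P. f2 (u P)) \<longlongrightarrow> 1) T"
    unfolding \<rho>2(1) using tendsto_add[OF tendsto_const[of 1] tendsto_mult[OF u0 \<rho>2(2)[OF u0]]] by simp
  have W0: "(W \<longlongrightarrow> 0) T"
  proof -
    have "(W \<longlongrightarrow> (1 + 0) * E - q 0 * 1 / (of_nat k * a 0)) T"
      unfolding W_def using a0 k
      by (intro tendsto_diff tendsto_mult tendsto_add tendsto_const g0 \<rho>2(2) u0 tendsto_divide lim q f2l) auto
    then show ?thesis by (simp add: E_def mult.commute)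
  qed
  have Vl: "(V \<longlongrightarrow> p 0 * 1 / (of_nat k * a 0)) T"
    unfolding V_def using a0 k by (intro tendsto_mult tendsto_const tendsto_divide lim p f2l) auto
  have br0: "((\<lambda>P. ?ts P * (y P * W P - x P * V P)) \<longlongrightarrow> 0) T"
    using tendsto_diff[OF tendsto_mult_bounded_zero[OF tsy W0] tendsto_mult[OF tsx Vl]]
    by (simp add: algebra_simps)
  have b_ev: "\<forall>\<^sub>F P in T. b (x P, y P) = x P * p (x P, y P) + y P * q (x P, y P)"
  proof -
    have "filterlim (\<lambda>P. (x P, y P)) (nhds 0) T"
      using tendsto_Pair[OF x0 y0] by (simp add: zero_prod_def)
    from eventually_compose_filterlim[OF b_eq[unfolded germ_eq_def] this] show ?thesis by simp
  qed
  have h_eq: "h P = exp (E * Ln (fst P)) / fst P * (y P * W P - x P * V P)"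
    if "fst P \<noteq> 0" "b (x P, y P) = x P * p (x P, y P) + y P * q (x P, y P)" for P
  proof -
    have snd: "snd P = y P * exp (E * Ln (fst P))" by (simp add: y_def exp_minus)
    have u: "u P = (1 + g P) / fst P" using that(1) by (simp add: g_def u_eq[symmetric] field_simps)
    define e' where "e' = exp (E * Ln (fst P))"
    have "h P = e' * (y1 P * f2 (u P) - y P)"
      unfolding h_def u_eq snd e'_def by (simp add: algebra_simps)
    also have "y1 P = y P - (x P * p (x P, y P) + y P * q (x P, y P)) / (of_nat k * a 0 * fst P)"
      unfolding y1_def xk[OF that(1)] that(2) by simp
    also have "(y P - (x P * p (x P, y P) + y P * q (x P, y P)) / (of_nat k * a 0 * fst P)) * f2 (u P) - y P =
        y P * (f2 (u P) - 1) - (x P * p (x P, y P) + y P * q (x P, y P)) * f2 (u P) / (of_nat k * a 0 * fst P)"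
      by (simp add: algebra_simps)
    also have "f2 (u P) - 1 = (1 + g P) / fst P * \<rho>2 (u P)" by (simp only: u[symmetric] \<rho>2(1)[of "u P"]) simp
    also have "e' * (y P * ((1 + g P) / fst P * \<rho>2 (u P)) - (x P * p (x P, y P) + y P * q (x P, y P)) * f2 (u P) / (of_nat k * a 0 * fst P)) =
        e' / fst P * (y P * W P - x P * V P)"
      unfolding W_def V_def using that(1) a0 k by (simp add: field_simps)
    finally show ?thesis by (simp add: e'_def)
  qed
  have h_small: "\<forall>\<^sub>F P in T. cmod (h P) \<le> \<epsilon> * \<delta> (Re (fst P))" if \<epsilon>: "0 < \<epsilon>" for \<epsilon>
  proof -
    have "0 < \<epsilon> / (Ke + 1)" using \<epsilon> Ke(1) by simp
    from tendstoD[OF br0 this]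
    have "\<forall>\<^sub>F P in T. cmod (?ts P * (y P * W P - x P * V P)) < \<epsilon> / (Ke + 1)"
      by (simp add: dist_norm)
    then show ?thesis using in1 b_ev
    proof eventually_elim
      case (elim P)
      let ?t = "Re (fst P)"
      have t: "1 < ?t" "?t \<le> cmod (fst P)" "fst P \<noteq> 0"
        using elim(2) tubes_bounds[of "fst P" "snd P" 1 \<theta>] by auto
      let ?B = "cmod (y P * W P - x P * V P)"
      have B: "?t powr \<sigma> * ?B \<le> \<epsilon> / (Ke + 1)" using elim(1) by (simp add: norm_mult)
      have "cmod (h P) = cmod (exp (E * Ln (fst P))) / cmod (fst P) * ?B"
        using h_eq[OF t(3) elim(3)] by (simp add: norm_mult norm_divide)
      also have "\<dots> \<le> (Ke * ?t powr Re E) / ?t * ?B"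
        using Ke(2)[OF elim(2)] t Ke(1) by (intro mult_right_mono frac_le) auto
      also have "\<dots> = Ke * ?t powr (- m - 1) * (?t powr \<sigma> * ?B)"
      proof -
        have "?t powr (- m - 1) * ?t powr \<sigma> = ?t powr Re E / ?t"
        proof -
          have "- m - 1 + \<sigma> = Re E - 1" by (simp add: m_def)
          then have "?t powr (- m - 1) * ?t powr \<sigma> = ?t powr (Re E - 1)"
            by (simp only: powr_add[symmetric])
          then show ?thesis using t(1) by (simp only: powr_diff[of ?t "Re E" 1]) simp
        qed
        then have "Ke * ?t powr (- m - 1) * (?t powr \<sigma> * ?B) = Ke * (?t powr Re E / ?t) * ?B"
          by (metis (no_types) mult.assoc)
        then show ?thesis by simp
      qed
      also have "\<dots> \<le> Ke * ?t powr (- m - 1) * (\<epsilon> / (Ke + 1))"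
        using B Ke(1) by (intro mult_left_mono) auto
      also have "\<dots> = Ke / (Ke + 1) * (\<epsilon> * ?t powr (- m - 1))" by simp
      also have "\<dots> \<le> 1 * (\<epsilon> * ?t powr (- m - 1))"
        using Ke(1) \<epsilon> by (intro mult_right_mono) auto
      finally show ?case by (simp add: \<delta>_def)
    qed
  qed

  \<comment> \<open>A common radius, branches of the logarithm and the conjugacy\<close>
  obtain r where r: "r > 0" "holo2_on (ball 0 r \<times> ball 0 r) a" "holo2_on (ball 0 r \<times> ball 0 r) b"
    using a b by (rule germ2_bidisc2)
  have "\<forall>\<^sub>F P in T. cmod (x P) < r \<and> cmod (y P) < r \<and> cmod (v P) < 1 \<and> cmod (u P) < 1 \<and>
      cmod (of_nat k * Ln (1 - v P / of_nat k)) < 1"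
  proof -
    have "((\<lambda>P. of_nat k * Ln (1 - v P / of_nat k)) \<longlongrightarrow> of_nat k * Ln (1 - 0 / of_nat k)) T"
      using k by (intro tendsto_intros v0) auto
    then have "\<forall>\<^sub>F P in T. cmod (of_nat k * Ln (1 - v P / of_nat k)) < 1"
      using tendstoD[of "\<lambda>P. of_nat k * Ln (1 - v P / of_nat k)" 0 T 1] by simp
    moreover have "\<forall>\<^sub>F P in T. cmod (x P) < r" "\<forall>\<^sub>F P in T. cmod (y P) < r" "\<forall>\<^sub>F P in T. cmod (v P) < 1" "\<forall>\<^sub>F P in T. cmod (u P) < 1"
      using tendstoD[OF x0 r(1)] tendstoD[OF y0 r(1)] tendstoD[OF v0, of 1] tendstoD[OF u0, of 1] by auto
    ultimately show ?thesis by eventually_elim simp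
  qed
  then obtain R0 where R0: "1 \<le> R0" and R: "\<And>P. P \<in> tube R0 \<theta> \<Longrightarrow> cmod (x P) < r \<and> cmod (y P) < r \<and> cmod (v P) < 1 \<and>
      cmod (u P) < 1 \<and> cmod (of_nat k * Ln (1 - v P / of_nat k)) < 1"
    unfolding T_def eventually_tubes by blast
  have ev: "\<exists>R\<ge>R0. \<forall>p\<in>tube R \<theta>. Q p" if Q: "eventually Q T" for Q
  proof -
    obtain S where "1 \<le> S" "\<forall>p\<in>tube S \<theta>. Q p"
      using Q unfolding T_def eventually_tubes by (elim exE conjE)
    then show ?thesis using tube_mono[of S "max S R0" \<theta>] by (intro exI[of _ "max S R0"]) auto
  qed
  have tb: "R0 < Re (fst P)" "fst P \<noteq> 0" "fst P \<notin> \<real>\<^sub>\<le>\<^sub>0" "\<bar>Im (Ln (fst P))\<bar> < pi / 2" if "P \<in> tube R0 \<theta>" for P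
    using tubes_bounds[of "fst P" "snd P" R0 \<theta>] that R0 by auto
  have vk: "1 - v P / of_nat k \<notin> \<real>\<^sub>\<le>\<^sub>0" "1 - v P / of_nat k \<noteq> 0" "Re (1 + u P) > 0" if "P \<in> tube R0 \<theta>" for P
  proof -
    have "cmod (v P / of_nat k) \<le> cmod (v P)" using k by (simp add: norm_divide divide_le_eq mult_le_cancel_left1)
    then have "Re (v P / of_nat k) < 1" using R[OF that] complex_Re_le_cmod[of "v P / of_nat k"] by linarith
    then have "0 < Re (1 - v P / of_nat k)" by simp
    then show "1 - v P / of_nat k \<notin> \<real>\<^sub>\<le>\<^sub>0" "1 - v P / of_nat k \<noteq> 0"
      by (auto simp: complex_nonpos_Reals_iff simp del: minus_complex.simps)
    show "Re (1 + u P) > 0" using R[OF that] complex_Re_le_cmod[of "- u P"] by simp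
  qed
  have hxy: "(\<lambda>s. x (X s, Y s)) holomorphic_on S" "(\<lambda>s. y (X s, Y s)) holomorphic_on S"
    if "X holomorphic_on S" "Y holomorphic_on S" "\<And>s. s \<in> S \<Longrightarrow> (X s, Y s) \<in> tube R0 \<theta>" for X Y S
    unfolding x_def y_def using that tb(3) by (auto intro!: holomorphic_intros) fastforce+
  have hab: "(\<lambda>s. f (x (X s, Y s), y (X s, Y s))) holomorphic_on S"
    if "open S" "X holomorphic_on S" "Y holomorphic_on S" "\<And>s. s \<in> S \<Longrightarrow> (X s, Y s) \<in> tube R0 \<theta>"
      "holo2_on (ball 0 r \<times> ball 0 r) f" for X Y S f
    using R that by (intro holo2_on_compose[OF that(5) hxy]) auto
  have hv: "(\<lambda>s. v (X s, Y s)) holomorphic_on S" "(\<lambda>s. f1 (v (X s, Y s))) holomorphic_on S"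
    if "open S" "X holomorphic_on S" "Y holomorphic_on S" "\<And>s. s \<in> S \<Longrightarrow> (X s, Y s) \<in> tube R0 \<theta>" for X Y S
  proof -
    show 1: "(\<lambda>s. v (X s, Y s)) holomorphic_on S"
      unfolding v_def s_def using tb(2)[OF that(4)] a0
      by (intro holomorphic_intros hab[OF that r(2)]) (use that in auto)
    show "(\<lambda>s. f1 (v (X s, Y s))) holomorphic_on S"
      unfolding f1_def using vk(2) that k by (intro holomorphic_intros 1) auto
  qed
  have g_holo: "curve_holo (tube R0 \<theta>) g"
    unfolding curve_holo_def g_def by (auto intro!: holomorphic_intros hv)
  have h_holo: "curve_holo (tube R0 \<theta>) h"
    unfolding curve_holo_def h_def y1_def f2_def
  proof (intro allI impI)
    fix S X Y assume A: "open S" "X holomorphic_on S" "Y holomorphic_on S" "\<forall>s\<in>S. (X s, Y s) \<in> tube R0 \<theta>"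
    have "1 + (f1 (v (X s, Y s)) - 1) \<notin> \<real>\<^sub>\<le>\<^sub>0" if "s \<in> S" for s
      using vk(3)[of "(X s, Y s)"] A(4) that u_eq[of "(X s, Y s)"] by (auto simp: complex_nonpos_Reals_iff)
    then show "(\<lambda>s. (y (X s, Y s) + x (X s, Y s) ^ k * b (x (X s, Y s), y (X s, Y s))) *
         exp (E * Ln (fst (X s, Y s))) * exp (E * Ln (1 + (f1 (v (X s, Y s)) - 1))) - snd (X s, Y s)) holomorphic_on S"
      using A tb(3) by (intro holomorphic_intros hv hab hxy r) (auto dest: tb(3))
  qed
  have conj: "x (\<zeta> + 1 + g (\<zeta>, c), c + h (\<zeta>, c)) = x (\<zeta>, c) + x (\<zeta>, c) ^ (k + 1) * a (x (\<zeta>, c), y (\<zeta>, c))"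
    "y (\<zeta> + 1 + g (\<zeta>, c), c + h (\<zeta>, c)) = y1 (\<zeta>, c)"
    if P: "(\<zeta>, c) \<in> tube R0 \<theta>" for \<zeta> c
  proof -
    let ?P = "(\<zeta>, c)"
    have \<zeta>1: "\<zeta> + 1 + g ?P = \<zeta> * f1 (v ?P)" by (simp add: g_def)
    have \<zeta>: "\<zeta> \<noteq> 0" "\<bar>Im (Ln \<zeta>)\<bar> < pi / 2" using tb[OF P] by auto
    \<comment> \<open>The principal logarithms add:
      \<open>\<bar>Im (Ln \<zeta>)\<bar> < pi / 2\<close>, and the correction was made smaller than
      1 by the choice of \<open>R0\<close>, so the sum stays inside the principal strip.\<close>
    have 1: "Ln (\<zeta> * f1 (v ?P)) = Ln \<zeta> - of_nat k * Ln (1 - v ?P / of_nat k)"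
    proof (rule Ln_unique)
      show "exp (Ln \<zeta> - of_nat k * Ln (1 - v ?P / of_nat k)) = \<zeta> * f1 (v ?P)"
        using \<zeta> vk(2)[OF P] by (simp only: exp_diff exp_of_nat_mult f1_def exp_Ln divide_inverse not_False_eq_True)
      have "\<bar>Im (of_nat k * Ln (1 - v ?P / of_nat k))\<bar> < 1"
        using R[OF P] abs_Im_le_cmod order_le_less_trans by blast
      then show "- pi < Im (Ln \<zeta> - of_nat k * Ln (1 - v ?P / of_nat k))" "Im (Ln \<zeta> - of_nat k * Ln (1 - v ?P / of_nat k)) \<le> pi"
        using \<zeta>(2) pi_ge_two by auto
    qed
    have "x (\<zeta> + 1 + g ?P, c + h ?P) = \<omega> * (exp (- (Ln \<zeta> / of_nat k)) * exp (Ln (1 - v ?P / of_nat k)))"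
      using k unfolding x_def \<zeta>1 fst_conv 1 exp_add[symmetric] by (simp add: diff_divide_distrib)
    also have "\<dots> = x ?P * (1 - v ?P / of_nat k)" using vk(2)[OF P] by (simp add: x_def)
    also have "1 - v ?P / of_nat k = 1 + x ?P ^ k * a (x ?P, y ?P)"
      using xk[of ?P] \<zeta> by (simp add: v_def s_def)
    finally show "x (\<zeta> + 1 + g ?P, c + h ?P) = x ?P + x ?P ^ (k + 1) * a (x ?P, y ?P)"
      by (simp add: algebra_simps)
    have f1u: "f1 (v ?P) = 1 + u ?P" using u_eq[of ?P] by (simp add: algebra_simps)
    have "Ln (\<zeta> * f1 (v ?P)) = Ln \<zeta> + Ln (1 + u ?P)"
      unfolding f1u using \<zeta> vk(3)[OF P] Re_Ln_pos_lt_imp[of "1 + u ?P"]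
      by (intro Ln_mult_right_half_planes) (auto simp del: one_complex.simps plus_complex.simps)
    then have "exp (E * Ln (\<zeta> * f1 (v ?P))) = exp (E * Ln \<zeta>) * f2 (u ?P)"
      by (simp add: f2_def exp_add[symmetric] distrib_left)
    then have "c + h ?P = y1 ?P * exp (E * Ln (\<zeta> * f1 (v ?P)))"
      by (simp add: h_def u_eq mult.assoc)
    then show "y (\<zeta> + 1 + g ?P, c + h ?P) = y1 ?P"
      unfolding y_def[of "(\<zeta> + 1 + g ?P, c + h ?P)"] unfolding \<zeta>1 fst_conv snd_conv
      by (simp only: mult.assoc exp_add[symmetric] mult_minus_left add.right_inverse exp_zero mult_1_right)
  qed
  show ?thesis
  proof (rule parabolic_curves_from_unit_shift[where ?R0.0 = R0 and \<theta> = \<theta> and \<delta> = \<delta> and g = g and h = h and \<Phi> = "\<lambda>P. (x P, y P)"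
        and K = "2 powr (1 + m) / m * 4 powr m"])
    show "0 < R0" using R0 by simp
    show "0 < \<theta> t" if "R0 < t" for t using that R0 by (simp add: \<theta>_def)
    show "\<theta> t \<le> \<theta> s" if "R0 < s" "s \<le> t" for s t
      unfolding \<theta>_def using that R0 m by (intro powr_mono2') auto
    show "0 \<le> \<delta> t" for t by (simp add: \<delta>_def)
    show "\<delta> t \<le> \<delta> s" if "R0 \<le> s" "s \<le> t" for s t
      unfolding \<delta>_def using that R0 m by (intro powr_mono2') auto
    show "0 < 2 powr (1 + m) / m * 4 powr m" using m by simp
    show "summable (\<lambda>j. \<delta> ((t + real j) / 2))" if "2 * R0 \<le> t" for t
      unfolding \<delta>_def using that R0 by (intro powr_weight_sum(1) m) auto
    show "(\<Sum>j. \<delta> ((t + real j) / 2)) \<le> 2 powr (1 + m) / m * 4 powr m * \<theta> (2 * t)" if "2 * R0 \<le> t" for t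
      unfolding \<delta>_def \<theta>_def using that R0 by (intro powr_weight_sum(2) m) auto
    show "curve_holo (tube R0 \<theta>) g" "curve_holo (tube R0 \<theta>) h" by fact+
    show "\<exists>R\<ge>R0. \<forall>p\<in>tube R \<theta>. cmod (g p) \<le> e" if "0 < e" for e
      using tendstoD[OF g0 that] by (intro ev) (auto elim: eventually_mono)
    show "\<exists>R\<ge>R0. \<forall>p\<in>tube R \<theta>. cmod (h p) \<le> e * \<delta> (Re (fst p))" if "0 < e" for e
      by (rule ev[OF h_small[OF that]])
    show "curve_holo (tube R0 \<theta>) (\<lambda>p. fst (x p, y p))" "curve_holo (tube R0 \<theta>) (\<lambda>p. snd (x p, y p))"
      unfolding curve_holo_def by (auto intro!: hxy)
    show "inj_on (\<lambda>P. (x P, y P)) (tube R0 \<theta>)"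
    proof (rule inj_onI)
      fix P Q assume P: "P \<in> tube R0 \<theta>" and Q: "Q \<in> tube R0 \<theta>" and eq: "(x P, y P) = (x Q, y Q)"
      have "x P ^ k = x Q ^ k" using eq by simp
      then have f: "fst P = fst Q"
        using xk[OF tb(2)[OF P]] xk[OF tb(2)[OF Q]] tb(2)[OF P] tb(2)[OF Q] a0 k by (simp add: field_simps)
      moreover have "snd P = snd Q" using eq f by (simp add: y_def)
      ultimately show "P = Q" by (rule prod_eqI)
    qed
    show "\<exists>R\<ge>R0. \<forall>p\<in>tube R \<theta>. norm (x p, y p) < e" if "0 < e" for e
      using tendstoD[OF tendsto_Pair[OF x0 y0] that] by (intro ev) (simp add: zero_prod_def[symmetric])
    show "fst (x p, y p) \<noteq> 0" for p using \<omega>0 by (simp add: x_def)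
    show "(fst (x (\<zeta>, c), y (\<zeta>, c)) + fst (x (\<zeta>, c), y (\<zeta>, c)) ^ (k + 1) * a (x (\<zeta>, c), y (\<zeta>, c)),
         snd (x (\<zeta>, c), y (\<zeta>, c)) + fst (x (\<zeta>, c), y (\<zeta>, c)) ^ k * b (x (\<zeta>, c), y (\<zeta>, c))) =
        (x (\<zeta> + 1 + g (\<zeta>, c), c + h (\<zeta>, c)), y (\<zeta> + 1 + g (\<zeta>, c), c + h (\<zeta>, c)))"
      if "(\<zeta>, c) \<in> tube R0 \<theta>" for \<zeta> c
      using conj[OF that] by (simp add: y1_def)
  qed
qed


section \<open>The resonant case\<close>

text \<open>This is \<open>-2\<close> times the derivative of \<open>1 / sqrt (ln t)\<close>, hence
  summable. The error in the resonant case is about \<open>ln (ln t) / (t * (ln t)^2)\<close>, which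
  is negligible against it.\<close>

definition log_weight :: "real \<Rightarrow> real" where
  "log_weight t = 1 / (t * sqrt (ln t) ^ 3)"

lemma one_le_ln: "3 \<le> t \<Longrightarrow> 1 \<le> ln (t::real)"
  using ln_mono[of "exp 1" t] exp_le by (simp add: order_trans)

lemma log_weight_nonneg: "3 \<le> t \<Longrightarrow> 0 \<le> log_weight t"
  using one_le_ln[of t] by (simp add: log_weight_def)

lemma log_weight_antimono:
  assumes "3 \<le> s" "s \<le> t" shows "log_weight t \<le> log_weight s"
  unfolding log_weight_def
proof (rule divide_left_mono)
  have "1 \<le> ln s" "ln s \<le> ln t" using one_le_ln[of s] assms by auto
  then show "s * sqrt (ln s) ^ 3 \<le> t * sqrt (ln t) ^ 3"
    using assms by (intro mult_mono power_mono real_sqrt_le_mono) auto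
  show "0 < t * sqrt (ln t) ^ 3 * (s * sqrt (ln s) ^ 3)"
    using \<open>1 \<le> ln s\<close> \<open>ln s \<le> ln t\<close> assms by simp
qed simp

lemma log_weight_sum:
  obtains R where "3 \<le> R" "\<And>t. 2 * R \<le> t \<Longrightarrow> summable (\<lambda>j. log_weight ((t + real j) / 2))"
    "\<And>t. 2 * R \<le> t \<Longrightarrow> (\<Sum>j. log_weight ((t + real j) / 2)) \<le> 8"
proof -
  define v where "v s = 1 / sqrt (ln (s / 2))" for s :: real
  \<comment> \<open>By the derivative of \<open>1 / sqrt (ln (s / 2))\<close>, the right side is
    asymptotically \<open>4 / (s * sqrt (ln (s / 2)) ^ 3)\<close>; the constant 8 leaves a factor
    2.\<close>
  have "eventually (\<lambda>s::real. 2 / s / (sqrt (ln (s/2)))^3 \<le> 8 * (1/sqrt (ln ((s-1)/2)) - 1/sqrt (ln (s / 2)))) at_top"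
    by real_asymp
  then obtain S where S: "\<And>s. S \<le> s \<Longrightarrow> 2 / s / (sqrt (ln (s/2)))^3 \<le> 8 * (v (s - 1) - v s)"
    unfolding eventually_at_top_linorder v_def by blast
  define R where "R = max S 4"
  have "summable (\<lambda>j. log_weight ((t + real j) / 2)) \<and> (\<Sum>j. log_weight ((t + real j) / 2)) \<le> 8"
    if t: "2 * R \<le> t" for t
  proof -
    have t8: "8 \<le> t" "S \<le> t" using t by (auto simp: R_def)
    let ?d = "\<lambda>j. log_weight ((t + real j) / 2)" and ?u = "\<lambda>j. 8 * v (t - 1 + real j)"
    have 1: "0 \<le> ?d j" for j using t8 by (intro log_weight_nonneg) simp
    have 2: "?d j \<le> ?u j - ?u (Suc j)" for j
    proof -
      have "?d j = 2 / (t + real j) / sqrt (ln ((t + real j) / 2)) ^ 3"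
        by (simp add: log_weight_def)
      also have "\<dots> \<le> 8 * (v (t + real j - 1) - v (t + real j))" using t8 by (intro S) simp
      finally show ?thesis by (simp add: algebra_simps)
    qed
    have 3: "0 \<le> ?u j" for j
      using one_le_ln[of "(t - 1 + real j) / 2"] t8 by (simp add: v_def)
    have "?u 0 \<le> 8"
      using one_le_ln[of "(t - 1) / 2"] t8 by (simp add: v_def divide_le_eq)
    then show ?thesis using telescoping_summable[of ?d ?u, OF 1 2 3] by (auto intro: order_trans)
  qed
  then show ?thesis by (intro that[of R]) (auto simp: R_def)
qed

text \<open>Since \<open>A 0 = m * B 0\<close>, the function \<open>w^m / z\<close> is constant
  along the leading flow. The term \<open>z * b1\<close> then drives it, at a rate that makes it
  grow like \<open>Ln \<zeta>\<close>, and the width available for \<open>c\<close> is governed by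
  logarithms. The case \<open>m = 1\<close> is the resonance met while lowering exponents; larger
  \<open>m\<close> occurs when the weighted blow-up has no admissible centre.\<close>

proposition parabolic_curves_resonant:
  fixes a b A B a1 b1 :: "complex \<times> complex \<Rightarrow> complex"
  assumes germs: "germ2 a" "germ2 b" "germ2 A" "germ2 B" "germ2 a1" "germ2 b1"
    and a_eq: "germ_eq a (\<lambda>x. snd x ^ (m - 1) * A x + fst x * a1 x)"
    and b_eq: "germ_eq b (\<lambda>x. snd x ^ m * B x + fst x * b1 x)"
    and m: "0 < m" and r: "0 < r" and B0: "B 0 \<noteq> 0" and A0: "A 0 = of_nat m * B 0" and b10: "b1 0 \<noteq> 0"
  shows "has_parabolic_curves (\<lambda>x. (fst x + fst x ^ (r + 1) * a x, snd x + fst x ^ r * b x))"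
proof -
  \<comment> \<open>Eliminating \<open>z\<close> by \<open>z = w^m / (b0 * \<Lambda>)\<close> turns
    \<open>z^r * w^(m-1)\<close> into \<open>w^k / (b0 * \<Lambda>)^r\<close>.\<close>
  define k where "k = m * r + m - 1"
  have k: "0 < k" "k + 1 = m * r + m" using m r by (cases m; cases r; auto simp: k_def)+
  define \<beta> where "\<beta> = B 0"
  \<comment> \<open>Normalizes the leading increment of \<open>\<Lambda>\<close> per step to
    \<open>1 / \<zeta>\<close>, so that \<open>\<Lambda>\<close> grows like
    \<open>Ln \<zeta>\<close> with coefficient 1.\<close>
  define b0 where "b0 = - of_nat m * b1 0 / (of_nat k * \<beta>)"
  have nz0: "\<beta> \<noteq> 0" "b0 \<noteq> 0" "(of_nat k :: complex) \<noteq> 0" "(of_nat m :: complex) \<noteq> 0"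
    using B0 b10 m k by (auto simp: \<beta>_def b0_def)
  \<comment> \<open>The coefficient of the second-order drift: to this order
    \<open>Ln \<zeta>\<close> advances by \<open>(1 - p / \<Lambda>) / \<zeta>\<close> and
    \<open>\<Lambda>\<close> by \<open>1 / \<zeta>\<close>, so \<open>\<Lambda> - Ln \<zeta>\<close>
    grows like \<open>p * Ln (Ln \<zeta>)\<close>.\<close>
  define p :: complex where "p = (of_nat m - 1) / of_nat m"
  obtain R1 where R1: "3 \<le> R1" "\<And>t. 2 * R1 \<le> t \<Longrightarrow> summable (\<lambda>j. log_weight ((t + real j) / 2))"
    "\<And>t. 2 * R1 \<le> t \<Longrightarrow> (\<Sum>j. log_weight ((t + real j) / 2)) \<le> 8"
    using log_weight_sum by blast
  \<comment> \<open>Makes \<open>w^k = - (b0 * \<Lambda>)^r / (k * \<beta> * \<zeta>)\<close>,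
    whence \<open>z^r * w^(m-1) = - 1 / (k * \<beta> * \<zeta>)\<close> without any
    \<open>\<Lambda>\<close>.\<close>
  obtain \<omega> where "- (b0 ^ r) / (of_nat k * \<beta>) = \<omega> ^ k"
    by (rule exists_complex_root[of k "- (b0 ^ r) / (of_nat k * \<beta>)"]) (use k in auto)
  then have \<omega>: "\<omega> ^ k = - (b0 ^ r) / (of_nat k * \<beta>)" by (rule sym)
  have \<omega>0: "\<omega> \<noteq> 0" using \<omega> nz0 k by (auto simp: power_0_left split: if_splits)
  \<comment> \<open>A constant width suffices: \<open>c\<close> is a bounded correction to
    \<open>\<Lambda>\<close>, which tends to infinity, and \<open>z\<close> and \<open>w\<close>
    tend to 0 for any bounded \<open>c\<close>.\<close>
  define \<theta> where "\<theta> = (\<lambda>t::real. 1::real)"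
  define T where "T = tubes R1 \<theta>"
  define l where "l P = Ln (fst P)" for P :: "complex \<times> complex"
  \<comment> \<open>\<open>\<Lambda> = w\<^bsup>m\<^esup> / (b0 z)\<close> drifts logarithmically in \<open>\<zeta>\<close>; \<open>c\<close> is \<open>\<Lambda>\<close> with this drift removed.\<close>
  define \<Lambda> where "\<Lambda> P = l P + p * Ln (l P) + snd P" for P :: "complex \<times> complex"
  define w where "w P = \<omega> * exp (- (l P / of_nat k)) * exp (of_nat r / of_nat k * Ln (\<Lambda> P))" for P
  define z where "z P = w P ^ m / (b0 * \<Lambda> P)" for P
  \<comment> \<open>\<open>S\<close> is the real size of \<open>l\<close> and
    \<open>\<Lambda>\<close>. Its root \<open>s\<close> is introduced because the weight is
    \<open>1 / (Re \<zeta> * s^3)\<close>.\<close>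
  define S where "S P = ln (Re (fst P))" for P :: "complex \<times> complex"
  define s where "s P = complex_of_real (sqrt (S P))" for P

  \<comment> \<open>Size of the logarithms along the tube\<close>
  have in1: "\<forall>\<^sub>F P in T. P \<in> tube R1 \<theta>" unfolding T_def by (rule tubes_eventually_in)
  have tb1: "3 < Re (fst P)" "Re (fst P) \<le> cmod (fst P)" "cmod (fst P) \<le> 4 * Re (fst P)" "\<bar>Im (l P)\<bar> < 2"
    "fst P \<noteq> 0" "fst P \<notin> \<real>\<^sub>\<le>\<^sub>0" "cmod (snd P) < 1" "1 \<le> S P" "S P \<le> Re (l P)" "Re (l P) \<le> S P + 2"
    "l P \<noteq> 0" "cmod (l P) \<le> S P + 4" "s P * s P = of_real (S P)" "s P \<noteq> 0"
    if P: "P \<in> tube R1 \<theta>" for P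
  proof -
    have tp: "(fst P, snd P) \<in> tube R1 \<theta>" "0 < R1" using P R1 by auto
    note b = tubes_bounds[OF tp]
    show t: "3 < Re (fst P)" using b(1) R1(1) by simp
    show "Re (fst P) \<le> cmod (fst P)" "cmod (fst P) \<le> 4 * Re (fst P)" "fst P \<noteq> 0" "fst P \<notin> \<real>\<^sub>\<le>\<^sub>0" "cmod (snd P) < 1"
      using b by (auto simp: \<theta>_def)
    show i: "\<bar>Im (l P)\<bar> < 2" using b(4) pi_less_4 by (simp add: l_def)
    show S: "1 \<le> S P" unfolding S_def using t by (intro one_le_ln) simp
    have re: "Re (l P) = ln (cmod (fst P))" using b(5) by (simp add: l_def)
    show "S P \<le> Re (l P)" unfolding re S_def using b t by simp
    have "Re (l P) \<le> ln (4 * Re (fst P))" unfolding re using b t by simp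
    also have "\<dots> = ln 4 + S P" using t by (simp add: S_def ln_mult)
    also have "ln 4 \<le> (2::real)" using ln_le_minus_one[of 2] ln_mult[of 2 "2::real"] by simp
    finally show re2: "Re (l P) \<le> S P + 2" by simp
    show "l P \<noteq> 0" using S \<open>S P \<le> Re (l P)\<close> by auto
    show "cmod (l P) \<le> S P + 4" using cmod_le[of "l P"] S \<open>S P \<le> Re (l P)\<close> re2 i by linarith
    have "s P * s P = of_real (sqrt (S P) * sqrt (S P))" by (simp only: s_def of_real_mult)
    then show "s P * s P = of_real (S P)" using S by simp
    then show "s P \<noteq> 0" using S by auto
  qed
  have Stop: "filterlim S at_top T"
    unfolding S_def T_def by (rule filterlim_compose[OF ln_at_top filterlim_tubes])
  have Slim: "((\<lambda>P. f (S P)) \<longlongrightarrow> c) T" if "(f \<longlongrightarrow> c) at_top" for f :: "real \<Rightarrow> real" and c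
    by (rule filterlim_compose[OF that Stop])
  have Tlim: "((\<lambda>P. f (Re (fst P))) \<longlongrightarrow> c) T" if "(f \<longlongrightarrow> c) at_top" for f :: "real \<Rightarrow> real" and c
    unfolding T_def by (rule tendsto_tubes_real[OF that])
  have null: "(X \<longlongrightarrow> 0) T" if "(f \<longlongrightarrow> 0) T" "\<And>P. P \<in> tube R1 \<theta> \<Longrightarrow> cmod (X P) \<le> f P" for X f
    by (rule Lim_null_comparison[OF eventually_mono[OF in1] that(1)]) (rule that(2))
  have lS: "((\<lambda>P. l P / of_real (S P)) \<longlongrightarrow> 1) T"
  proof -
    have "((\<lambda>P. l P / of_real (S P) - 1) \<longlongrightarrow> 0) T"
    proof (rule null[OF Slim[of "\<lambda>S. 4 / S" 0]])
      show "((\<lambda>S::real. 4 / S) \<longlongrightarrow> 0) at_top" by real_asymp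
      fix P assume P: "P \<in> tube R1 \<theta>"
      have "l P / of_real (S P) - 1 = (l P - of_real (S P)) / of_real (S P)"
        using tb1(8)[OF P] by (simp add: field_simps)
      moreover have "cmod (l P - of_real (S P)) \<le> 4"
        using cmod_le[of "l P - of_real (S P)"] tb1[OF P] by simp
      ultimately show "cmod (l P / of_real (S P) - 1) \<le> 4 / S P"
        using tb1(8)[OF P] by (simp add: norm_divide divide_right_mono)
    qed
    then show ?thesis by (simp add: LIM_zero_iff)
  qed
  have sM: "((\<lambda>P. s P * (Ln (l P) / of_real (S P))) \<longlongrightarrow> 0) T"
  proof (rule null[OF Slim[of "\<lambda>S. sqrt S * ((ln (S + 4) + 4) / S)" 0]])
    show "((\<lambda>S::real. sqrt S * ((ln (S + 4) + 4) / S)) \<longlongrightarrow> 0) at_top" by real_asymp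
    fix P assume P: "P \<in> tube R1 \<theta>"
    note b = tb1[OF P]
    have "1 \<le> cmod (l P)" using complex_Re_le_cmod[of "l P"] b by linarith
    have "cmod (Ln (l P)) \<le> \<bar>Re (Ln (l P))\<bar> + \<bar>Im (Ln (l P))\<bar>" by (rule cmod_le)
    also have "\<bar>Im (Ln (l P))\<bar> \<le> 4" using Re_Ln_pos_lt_imp[of "l P"] b pi_less_4 by simp
    also have "\<bar>Re (Ln (l P))\<bar> \<le> ln (S P + 4)"
      using \<open>1 \<le> cmod (l P)\<close> b by simp
    finally have "cmod (Ln (l P)) / S P \<le> (ln (S P + 4) + 4) / S P"
      using b(8) by (intro divide_right_mono) auto
    then show "cmod (s P * (Ln (l P) / of_real (S P))) \<le> sqrt (S P) * ((ln (S P + 4) + 4) / S P)"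
    proof -
      have "cmod (s P * (Ln (l P) / of_real (S P))) = sqrt (S P) * (cmod (Ln (l P)) / S P)"
        using b(8) by (simp add: norm_mult norm_divide s_def)
      then show ?thesis
        using mult_left_mono[OF \<open>cmod (Ln (l P)) / S P \<le> (ln (S P + 4) + 4) / S P\<close>, of "sqrt (S P)"] b(8) by simp
    qed
  qed
  have s_inv: "((\<lambda>P. 1 / s P) \<longlongrightarrow> 0) T"
  proof (rule null[OF Slim[of "\<lambda>S. 1 / sqrt S" 0]])
    show "((\<lambda>S::real. 1 / sqrt S) \<longlongrightarrow> 0) at_top" by real_asymp
    fix P assume P: "P \<in> tube R1 \<theta>"
    show "cmod (1 / s P) \<le> 1 / sqrt (S P)" using tb1(8)[OF P] by (simp add: s_def norm_divide)
  qed
  have cS: "((\<lambda>P. s P * (snd P / of_real (S P))) \<longlongrightarrow> 0) T"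
  proof (rule null[OF Slim[of "\<lambda>S. sqrt S / S" 0]])
    show "((\<lambda>S::real. sqrt S / S) \<longlongrightarrow> 0) at_top" by real_asymp
    fix P assume P: "P \<in> tube R1 \<theta>"
    show "cmod (s P * (snd P / of_real (S P))) \<le> sqrt (S P) / S P"
      using tb1(7,8)[OF P] mult_left_mono[of "cmod (snd P)" 1 "sqrt (S P)"]
      by (simp add: norm_mult norm_divide s_def divide_right_mono)
  qed
  have s\<Lambda>l: "((\<lambda>P. s P * ((\<Lambda> P - l P) / of_real (S P))) \<longlongrightarrow> 0) T"
    using tendsto_add[OF tendsto_mult[OF tendsto_const[of p] sM] cS]
    by (simp add: \<Lambda>_def add_divide_distrib algebra_simps)
  have \<Lambda>S: "((\<lambda>P. \<Lambda> P / of_real (S P)) \<longlongrightarrow> 1) T"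
  proof (rule Lim_transform_eventually)
    show "((\<lambda>P. l P / of_real (S P) + 1 / s P * (s P * ((\<Lambda> P - l P) / of_real (S P)))) \<longlongrightarrow> 1) T"
      using tendsto_add[OF lS tendsto_mult[OF s_inv s\<Lambda>l]] by (simp only: mult_zero_left add_0_right)
    show "\<forall>\<^sub>F P in T. l P / of_real (S P) + 1 / s P * (s P * ((\<Lambda> P - l P) / of_real (S P))) = \<Lambda> P / of_real (S P)"
      using in1 by eventually_elim (use tb1(14) in \<open>simp add: diff_divide_distrib\<close>)
  qed
  have \<Lambda>_ev: "\<forall>\<^sub>F P in T. 0 < Re (\<Lambda> P) \<and> cmod (\<Lambda> P) \<le> 2 * S P"
    using tendstoD[OF \<Lambda>S half_gt_zero[OF zero_less_one]] in1
  proof eventually_elim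
    case (elim P)
    have S: "1 \<le> S P" using tb1(8) elim by blast
    have d: "cmod (\<Lambda> P / of_real (S P) - 1) < 1/2" using elim by (simp add: dist_norm)
    have "\<Lambda> P - of_real (S P) = of_real (S P) * (\<Lambda> P / of_real (S P) - 1)"
      using S by (simp add: field_simps)
    then have "cmod (\<Lambda> P - of_real (S P)) = S P * cmod (\<Lambda> P / of_real (S P) - 1)"
      using S by (simp add: norm_mult)
    also have "\<dots> \<le> S P * (1/2)" using d S by (intro mult_left_mono) auto
    finally have d2: "cmod (\<Lambda> P - of_real (S P)) \<le> S P * (1/2)" .
    then show ?case
      using abs_Re_le_cmod[of "\<Lambda> P - of_real (S P)"] S norm_triangle_sub[of "\<Lambda> P" "of_real (S P)"] by auto
  qed
  have Sl: "((\<lambda>P. of_real (S P) / l P) \<longlongrightarrow> 1) T"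
    using tendsto_inverse[OF lS] by (simp add: inverse_eq_divide)
  have S\<Lambda>: "((\<lambda>P. of_real (S P) / \<Lambda> P) \<longlongrightarrow> 1) T"
    using tendsto_inverse[OF \<Lambda>S] by (simp add: inverse_eq_divide)
  have iS: "((\<lambda>P. 1 / complex_of_real (S P)) \<longlongrightarrow> 0) T"
  proof (rule Lim_transform_eventually)
    show "((\<lambda>P. 1 / s P * (1 / s P)) \<longlongrightarrow> 0) T" using tendsto_mult[OF s_inv s_inv] by simp
    show "\<forall>\<^sub>F P in T. 1 / s P * (1 / s P) = 1 / complex_of_real (S P)"
      using in1 by eventually_elim (simp add: tb1(13))
  qed
  have il: "((\<lambda>P. 1 / l P) \<longlongrightarrow> 0) T"
  proof (rule Lim_transform_eventually)
    show "((\<lambda>P. 1 / of_real (S P) * (of_real (S P) / l P)) \<longlongrightarrow> 0) T" using tendsto_mult[OF iS Sl] by simp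
    show "\<forall>\<^sub>F P in T. 1 / of_real (S P) * (of_real (S P) / l P) = 1 / l P"
      using in1 by eventually_elim (use tb1(8) in force)
  qed
  have i\<Lambda>: "((\<lambda>P. 1 / \<Lambda> P) \<longlongrightarrow> 0) T"
  proof (rule Lim_transform_eventually)
    show "((\<lambda>P. 1 / of_real (S P) * (of_real (S P) / \<Lambda> P)) \<longlongrightarrow> 0) T" using tendsto_mult[OF iS S\<Lambda>] by simp
    show "\<forall>\<^sub>F P in T. 1 / of_real (S P) * (of_real (S P) / \<Lambda> P) = 1 / \<Lambda> P"
      using in1 by eventually_elim (use tb1(8) in force)
  qed
  have \<Lambda>nz: "\<forall>\<^sub>F P in T. \<Lambda> P \<noteq> 0" using \<Lambda>_ev by eventually_elim auto

  \<comment> \<open>\<open>sm\<close> means small against \<open>S^(-3/2)\<close>, the accuracy that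
    \<open>log_weight\<close> demands of \<open>h / \<eta>\<close>. \<open>tiny\<close> means small
    against \<open>S^(-5/2)\<close>: it leaves one power of \<open>S\<close> to spare, so that a
    factor \<open>\<Lambda>\<close> turns \<open>tiny\<close> into \<open>sm\<close>.\<close>
  define sm where "sm X \<longleftrightarrow> ((\<lambda>P. s P ^ 3 * X P) \<longlongrightarrow> 0) T" for X
  define tiny where "tiny X \<longleftrightarrow> ((\<lambda>P. s P ^ 5 * X P) \<longlongrightarrow> 0) T" for X
  have sm_add: "sm (\<lambda>P. X P + Y P)" if "sm X" "sm Y" for X Y
    using tendsto_add[OF that[unfolded sm_def]] by (simp add: sm_def distrib_left)
  have sm_mult: "sm (\<lambda>P. X P * Y P)" if "sm X" "(Y \<longlongrightarrow> c) T" for X Y c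
    using tendsto_mult[OF that[unfolded sm_def]] by (simp add: sm_def mult.assoc)
  have sm_cong: "sm Y" if "sm X" "\<forall>\<^sub>F P in T. X P = Y P" for X Y
    unfolding sm_def
    by (rule Lim_transform_eventually[OF that(1)[unfolded sm_def]]) (use that(2) in eventually_elim, simp)
  have tiny_add: "tiny (\<lambda>P. X P + Y P)" if "tiny X" "tiny Y" for X Y
    using tendsto_add[OF that[unfolded tiny_def]] by (simp add: tiny_def distrib_left)
  have tiny_mult: "tiny (\<lambda>P. X P * Y P)" if "tiny X" "(Y \<longlongrightarrow> c) T" for X Y c
    using tendsto_mult[OF that[unfolded tiny_def]] by (simp add: tiny_def mult.assoc)
  have tiny_cmult: "tiny (\<lambda>P. c * X P)" if "tiny X" for X c
    using tiny_mult[OF that tendsto_const[of c]] by (simp add: mult.commute)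
  have tiny_cong: "tiny Y" if "tiny X" "\<forall>\<^sub>F P in T. X P = Y P" for X Y
    unfolding tiny_def
    by (rule Lim_transform_eventually[OF that(1)[unfolded tiny_def]]) (use that(2) in eventually_elim, simp)
  have tiny_sm: "sm X" if "tiny X" for X
    unfolding sm_def
  proof (rule Lim_transform_eventually)
    show "((\<lambda>P. s P ^ 5 * X P * (1 / s P * (1 / s P))) \<longlongrightarrow> 0) T"
      using tendsto_mult[OF that[unfolded tiny_def] tendsto_mult[OF s_inv s_inv]] by simp
    show "\<forall>\<^sub>F P in T. s P ^ 5 * X P * (1 / s P * (1 / s P)) = s P ^ 3 * X P"
      using in1 by eventually_elim (use tb1(14) in \<open>simp add: eval_nat_numeral\<close>)
  qed
  have sm_0: "(X \<longlongrightarrow> 0) T" if "sm X" for X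
  proof (rule Lim_transform_eventually)
    show "((\<lambda>P. s P ^ 3 * X P * (1 / s P) ^ 3) \<longlongrightarrow> 0) T"
      using tendsto_mult[OF that[unfolded sm_def] tendsto_power[OF s_inv, of 3]] by simp
    show "\<forall>\<^sub>F P in T. s P ^ 3 * X P * (1 / s P) ^ 3 = X P"
      using in1 by eventually_elim (use tb1(14) in \<open>simp add: power_one_over\<close>)
  qed
  have sm_\<Lambda>: "sm (\<lambda>P. \<Lambda> P * X P)" if "tiny X" for X
    unfolding sm_def
  proof (rule Lim_transform_eventually)
    show "((\<lambda>P. s P ^ 5 * X P * (\<Lambda> P / of_real (S P))) \<longlongrightarrow> 0) T"
      using tendsto_mult[OF that[unfolded tiny_def] \<Lambda>S] by simp
    show "\<forall>\<^sub>F P in T. s P ^ 5 * X P * (\<Lambda> P / of_real (S P)) = s P ^ 3 * (\<Lambda> P * X P)"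
      using in1
    proof eventually_elim
      case (elim P)
      have "s P ^ 5 = s P ^ 3 * of_real (S P)" using tb1(13)[OF elim] by (simp add: eval_nat_numeral mult.assoc)
      then show ?case using tb1(8)[OF elim] by simp
    qed
  qed

  \<comment> \<open>Quadratic remainders in the step size \<open>1 / \<zeta>\<close>\<close>
  define \<eta> where "\<eta> P = 1 / fst P" for P :: "complex \<times> complex"
  have tiny_\<eta>: "tiny \<eta>"
    unfolding tiny_def
  proof (rule null[OF Tlim[of "\<lambda>t. sqrt (ln t) ^ 5 * t powr (- 1)" 0]])
    show "((\<lambda>t::real. sqrt (ln t) ^ 5 * t powr (- 1)) \<longlongrightarrow> 0) at_top" by real_asymp
    fix P assume P: "P \<in> tube R1 \<theta>"
    have "1 / cmod (fst P) \<le> Re (fst P) powr (- 1)"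
      using tb1(1,2)[OF P] by (simp add: powr_minus_divide frac_le)
    then show "cmod (s P ^ 5 * \<eta> P) \<le> sqrt (ln (Re (fst P))) ^ 5 * Re (fst P) powr (- 1)"
      using tb1(8)[OF P] mult_left_mono[of "1 / cmod (fst P)" "Re (fst P) powr (- 1)" "sqrt (S P) ^ 5"]
      by (simp add: norm_mult norm_divide norm_power s_def \<eta>_def S_def)
  qed
  have \<eta>0: "(\<eta> \<longlongrightarrow> 0) T" by (rule sm_0[OF tiny_sm[OF tiny_\<eta>]])
  have \<eta>nz: "\<forall>\<^sub>F P in T. \<eta> P \<noteq> 0" using in1 by eventually_elim (simp add: \<eta>_def tb1(5))
  \<comment> \<open>A remainder quadratic in \<open>\<eta> * q\<close> keeps one factor
    \<open>\<eta>\<close> after division by \<open>\<eta>\<close>, and \<open>\<eta>\<close> beats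
    every power of the logarithm.\<close>
  have second_order: "tiny (\<lambda>P. (f (\<eta> P * q P) - \<eta> P * q P) / \<eta> P)"
    if f: "\<And>v. cmod v \<le> 1 / 2 \<Longrightarrow> cmod (f v - v) \<le> 2 * cmod v ^ 2" and q: "(q \<longlongrightarrow> c) T" for f q c
    unfolding tiny_def
  proof (rule Lim_null_comparison)
    show "((\<lambda>P. 2 * cmod (q P) ^ 2 * cmod (s P ^ 5 * \<eta> P)) \<longlongrightarrow> 0) T"
      using tendsto_mult[OF tendsto_mult[OF tendsto_const[of 2] tendsto_power[OF tendsto_norm[OF q], of 2]]
          tendsto_norm[OF tiny_\<eta>[unfolded tiny_def]]] by simp
    have "((\<lambda>P. \<eta> P * q P) \<longlongrightarrow> 0) T" using tendsto_mult[OF \<eta>0 q] by simp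
    from tendstoD[OF this half_gt_zero[OF zero_less_one]] \<eta>nz
    show "\<forall>\<^sub>F P in T. cmod (s P ^ 5 * ((f (\<eta> P * q P) - \<eta> P * q P) / \<eta> P)) \<le> 2 * cmod (q P) ^ 2 * cmod (s P ^ 5 * \<eta> P)"
    proof eventually_elim
      case (elim P)
      have "cmod (f (\<eta> P * q P) - \<eta> P * q P) \<le> 2 * cmod (\<eta> P * q P) ^ 2"
        using elim(1) by (intro f) (simp add: dist_norm)
      then have "cmod (f (\<eta> P * q P) - \<eta> P * q P) / cmod (\<eta> P) \<le> 2 * cmod (\<eta> P * q P) ^ 2 / cmod (\<eta> P)"
        by (rule divide_right_mono) simp
      also have "\<dots> = 2 * cmod (q P) ^ 2 * cmod (\<eta> P)"
        using elim(2) by (simp add: norm_mult power2_eq_square)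
      finally have "cmod (s P ^ 5) * (cmod (f (\<eta> P * q P) - \<eta> P * q P) / cmod (\<eta> P)) \<le> cmod (s P ^ 5) * (2 * cmod (q P) ^ 2 * cmod (\<eta> P))"
        by (rule mult_left_mono) simp
      then show ?case by (simp add: norm_mult norm_divide ac_simps)
    qed
  qed
  have Ln2: "cmod (Ln (1 + v) - v) \<le> 2 * cmod v ^ 2" if "cmod v \<le> 1 / 2" for v
  proof -
    have "cmod (Ln (1 + v) - v) \<le> cmod v ^ 2 / (1 - cmod v)" using Ln_approx_linear[of v] that by simp
    also have "\<dots> \<le> cmod v ^ 2 / (1 / 2)" using that by (intro divide_left_mono) auto
    finally show ?thesis by simp
  qed
  have exp2: "cmod (exp v - 1 - v) \<le> 2 * cmod v ^ 2" if "cmod v \<le> 1 / 2" for v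
  proof -
    have "cmod (exp v - (1 + v)) \<le> exp \<bar>Re v\<bar> * cmod v ^ 2"
      using Taylor_exp[of v 1] by (simp add: power2_eq_square)
    moreover have "exp \<bar>Re v\<bar> \<le> 2"
    proof -
      have "\<bar>Re v\<bar> \<le> 1 / 2" using abs_Re_le_cmod[of v] that by simp
      then have "exp \<bar>Re v\<bar> \<le> exp (1/2)" by simp
      also have "exp (1/2 :: real) \<le> 2" using exp_bound_half[of "1/2 :: real"] by simp
      finally show ?thesis .
    qed
    ultimately show ?thesis
      using mult_right_mono[of "exp \<bar>Re v\<bar>" 2 "cmod v ^ 2"] by (simp add: diff_diff_eq)
  qed

  \<comment> \<open>Decay of \<open>w\<close> and \<open>z\<close>\<close>
  have tiny_w: "tiny w"
    unfolding tiny_def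
  proof (rule Lim_null_comparison)
    let ?f = "\<lambda>t::real. sqrt (ln t) ^ 5 * ((2 * ln t) powr (r / k) * t powr (- (1 / k)))"
    have "0 < 1 / real k" using k by simp
    then have "(?f \<longlongrightarrow> 0) at_top" by real_asymp
    from tendsto_mult[OF tendsto_const[of "cmod \<omega>"] Tlim[OF this]]
    show "((\<lambda>P. cmod \<omega> * ?f (Re (fst P))) \<longlongrightarrow> 0) T" by simp
    show "\<forall>\<^sub>F P in T. cmod (s P ^ 5 * w P) \<le> cmod \<omega> * ?f (Re (fst P))"
      using in1 \<Lambda>_ev
    proof eventually_elim
      case (elim P)
      note b = tb1[OF elim(1)]
      have \<Lambda>: "\<Lambda> P \<noteq> 0" "cmod (\<Lambda> P) \<le> 2 * S P" using elim(2) by auto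
      have "cmod (exp (- (l P / of_nat k))) = exp (- (Re (l P) / k))"
        by (simp add: Re_divide_of_nat)
      also have "\<dots> \<le> exp (- (S P / k))" using b(9) by (simp add: divide_right_mono)
      also have "\<dots> = Re (fst P) powr (- (1 / k))" using b(1) by (simp add: powr_def S_def)
      finally have 1: "cmod (exp (- (l P / of_nat k))) \<le> Re (fst P) powr (- (1 / k))" .
      have "complex_of_nat r / of_nat k = of_real (r / k)" by simp
      then have "cmod (exp (of_nat r / of_nat k * Ln (\<Lambda> P))) = cmod (\<Lambda> P) powr (r / k)"
        using \<Lambda>(1) by (simp only:) (simp add: powr_def)
      also have "\<dots> \<le> (2 * S P) powr (r / k)" using \<Lambda> by (intro powr_mono2) auto
      finally have 2: "cmod (exp (of_nat r / of_nat k * Ln (\<Lambda> P))) \<le> (2 * S P) powr (r / k)" .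
      have "cmod (s P ^ 5 * w P) = sqrt (S P) ^ 5 * (cmod \<omega> * cmod (exp (- (l P / of_nat k))) * cmod (exp (of_nat r / of_nat k * Ln (\<Lambda> P))))"
        unfolding w_def s_def norm_mult norm_power norm_of_real using b(8) by simp
      also have "\<dots> \<le> sqrt (S P) ^ 5 * (cmod \<omega> * Re (fst P) powr (- (1 / k)) * (2 * S P) powr (r / k))"
        using 1 2 b(8) by (intro mult_mono mult_left_mono) auto
      also have "\<dots> = cmod \<omega> * ?f (Re (fst P))" by (simp add: S_def)
      finally show ?case .
    qed
  qed
  have w0: "(w \<longlongrightarrow> 0) T" by (rule sm_0[OF tiny_sm[OF tiny_w]])
  have tiny_z: "tiny z"
  proof (rule tiny_cong)
    show "tiny (\<lambda>P. w P * (w P ^ (m - 1) * (1 / b0 * (1 / \<Lambda> P))))"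
      by (rule tiny_mult[OF tiny_w tendsto_mult[OF tendsto_power[OF w0] tendsto_mult[OF tendsto_const i\<Lambda>]]])
    show "\<forall>\<^sub>F P in T. w P * (w P ^ (m - 1) * (1 / b0 * (1 / \<Lambda> P))) = z P"
      using m by (intro always_eventually allI) (simp add: z_def power_eq_if)
  qed
  have z0: "(z \<longlongrightarrow> 0) T" by (rule sm_0[OF tiny_sm[OF tiny_z]])
  have zw: "filterlim (\<lambda>P. (z P, w P)) (nhds 0) T"
    using tendsto_Pair[OF z0 w0] by (simp add: zero_prod_def)
  have germ_ev: "\<forall>\<^sub>F P in T. f (z P, w P) = g (z P, w P)" if "germ_eq f g" for f g :: "complex \<times> complex \<Rightarrow> complex"
    using eventually_compose_filterlim[OF that[unfolded germ_eq_def] zw] by simp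
  have lim: "((\<lambda>P. f (z P, w P)) \<longlongrightarrow> f 0) T" if "germ2 f" for f
    by (rule germ2_tendsto[OF that z0 w0])
  have tiny_germ: "tiny (\<lambda>P. f (z P, w P) - f 0)" if f: "germ2 f" for f
  proof -
    obtain u v where uv: "germ2 u" "germ2 v" "germ_eq f (\<lambda>x. f 0 + fst x * u x + snd x * v x)"
      by (rule germ2_hadamard[OF f])
    show ?thesis
    proof (rule tiny_cong)
      show "tiny (\<lambda>P. z P * u (z P, w P) + w P * v (z P, w P))"
        by (intro tiny_add tiny_mult[OF tiny_z lim[OF uv(1)]] tiny_mult[OF tiny_w lim[OF uv(2)]])
      show "\<forall>\<^sub>F P in T. z P * u (z P, w P) + w P * v (z P, w P) = f (z P, w P) - f 0"
        using germ_ev[OF uv(3)] by eventually_elim simp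
    qed
  qed

  \<comment> \<open>Relative increments of \<open>z\<close> and \<open>w\<close>\<close>
  define Ah where "Ah P = A (z P, w P) + w P / (b0 * \<Lambda> P) * a1 (z P, w P)" for P
  define Bh where "Bh P = B (z P, w P) + b1 (z P, w P) / (b0 * \<Lambda> P)" for P
  define c0 where "c0 = - 1 / (of_nat k * \<beta>)"
  define p1 where "p1 P = c0 * Ah P" for P
  define q1 where "q1 P = c0 * Bh P" for P
  \<comment> \<open>The map multiplies \<open>z\<close> by \<open>1 + PP\<close> and
    \<open>w\<close> by \<open>1 + QQ\<close>.\<close>
  define PP where "PP P = z P ^ r * a (z P, w P)" for P
  define QQ where "QQ P = z P ^ r * (b (z P, w P) / w P)" for P
  have i\<Lambda>b: "((\<lambda>P. 1 / (b0 * \<Lambda> P)) \<longlongrightarrow> 0) T"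
    using tendsto_mult[OF tendsto_const[of "1 / b0"] i\<Lambda>] by simp
  have Ahl: "(Ah \<longlongrightarrow> of_nat m * \<beta>) T"
    using tendsto_add[OF lim[OF germs(3)] tendsto_mult[OF tendsto_mult[OF w0 i\<Lambda>b] lim[OF germs(5)]]]
    by (simp add: Ah_def[abs_def] A0 \<beta>_def)
  have Bhl: "(Bh \<longlongrightarrow> \<beta>) T"
    using tendsto_add[OF lim[OF germs(4)] tendsto_mult[OF lim[OF germs(6)] i\<Lambda>b]]
    by (simp add: Bh_def[abs_def] \<beta>_def)
  have p1l: "(p1 \<longlongrightarrow> - of_nat m / of_nat k) T"
    using tendsto_mult[OF tendsto_const[of c0] Ahl] nz0 by (simp add: p1_def[abs_def] c0_def)
  have q1l: "(q1 \<longlongrightarrow> - 1 / of_nat k) T"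
    using tendsto_mult[OF tendsto_const[of c0] Bhl] nz0 by (simp add: q1_def[abs_def] c0_def)
  have wk: "w P ^ k = - ((b0 * \<Lambda> P) ^ r) / (of_nat k * \<beta>) * \<eta> P" if "\<Lambda> P \<noteq> 0" "fst P \<noteq> 0" for P
  proof -
    have "exp (- (l P / of_nat k)) ^ k = exp (- l P)" "exp (of_nat r / of_nat k * Ln (\<Lambda> P)) ^ k = exp (Ln (\<Lambda> P)) ^ r"
      using k nz0 by (simp_all add: exp_of_nat_mult[symmetric] mult.assoc)
    then show ?thesis
      using that by (simp add: w_def power_mult_distrib \<omega> l_def exp_minus \<eta>_def divide_simps)
  qed
  have zrw: "z P ^ r * w P ^ (m - 1) = c0 * \<eta> P" if "\<Lambda> P \<noteq> 0" "fst P \<noteq> 0" for P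
  proof -
    have "z P ^ r * w P ^ (m - 1) = w P ^ (m * r + (m - 1)) / (b0 * \<Lambda> P) ^ r"
      by (simp add: z_def power_divide power_mult power_add)
    also have "m * r + (m - 1) = k" using m by (simp add: k_def)
    finally show ?thesis unfolding wk[OF that] using that(1) nz0 by (simp add: c0_def power_mult_distrib)
  qed
  have wnz: "w P \<noteq> 0" for P using \<omega>0 by (simp add: w_def)
  have z_alt: "z P = w P ^ (m - 1) * (w P / (b0 * \<Lambda> P))" for P
    using m by (simp add: z_def power_eq_if)
  have PQ_eq: "PP P = \<eta> P * p1 P" "QQ P = \<eta> P * q1 P"
    if P: "P \<in> tube R1 \<theta>" "\<Lambda> P \<noteq> 0"
      "a (z P, w P) = w P ^ (m - 1) * A (z P, w P) + z P * a1 (z P, w P)"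
      "b (z P, w P) = w P ^ m * B (z P, w P) + z P * b1 (z P, w P)" for P
  proof -
    note zw1 = zrw[OF P(2) tb1(5)[OF P(1)]]
    have "PP P = (z P ^ r * w P ^ (m - 1)) * Ah P"
      unfolding PP_def P(3) Ah_def by (subst (3) z_alt) (simp add: algebra_simps)
    then show "PP P = \<eta> P * p1 P" unfolding zw1 by (simp add: p1_def)
    have "w P ^ m = w P ^ (m - 1) * w P" using m by (simp add: power_eq_if)
    then have "b (z P, w P) / w P = w P ^ (m - 1) * Bh P"
      unfolding P(4) Bh_def by (subst (2) z_alt) (use wnz[of P] in \<open>simp add: field_simps\<close>)
    then have "QQ P = (z P ^ r * w P ^ (m - 1)) * Bh P" by (simp only: QQ_def mult.assoc)
    then show "QQ P = \<eta> P * q1 P" unfolding zw1 by (simp add: q1_def)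
  qed
  have PQ_ev: "\<forall>\<^sub>F P in T. PP P = \<eta> P * p1 P \<and> QQ P = \<eta> P * q1 P"
    using in1 \<Lambda>nz germ_ev[OF a_eq] germ_ev[OF b_eq] by eventually_elim (auto intro: PQ_eq)

  \<comment> \<open>Increments of the logarithms of \<open>\<Lambda>\<close> and
    \<open>\<zeta>\<close>\<close>
  define LP where "LP P = Ln (1 + PP P)" for P
  define LQ where "LQ P = Ln (1 + QQ P)" for P
  \<comment> \<open>Up to constants \<open>Ln \<Lambda> = m * Ln w - Ln z\<close> and
    \<open>Ln \<zeta> = r * Ln \<Lambda> - k * Ln w\<close>. Hence \<open>V\<close> is the increment
    of \<open>Ln \<Lambda>\<close>, and that of \<open>Ln \<zeta>\<close> is
    \<open>r * V - k * LQ\<close>, which equals \<open>D\<close> because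
    \<open>k = m * r + m - 1\<close>.\<close>
  define V where "V P = of_nat m * LQ P - LP P" for P
  define D where "D P = (1 - of_nat m) * LQ P - of_nat r * LP P" for P
  have tLP: "tiny (\<lambda>P. LP P / \<eta> P - p1 P)"
  proof (rule tiny_cong)
    show "tiny (\<lambda>P. (Ln (1 + \<eta> P * p1 P) - \<eta> P * p1 P) / \<eta> P)"
      by (rule second_order[OF Ln2 p1l])
    show "\<forall>\<^sub>F P in T. (Ln (1 + \<eta> P * p1 P) - \<eta> P * p1 P) / \<eta> P = LP P / \<eta> P - p1 P"
      using PQ_ev \<eta>nz by eventually_elim (simp add: LP_def diff_divide_distrib)
  qed
  have tLQ: "tiny (\<lambda>P. LQ P / \<eta> P - q1 P)"
  proof (rule tiny_cong)
    show "tiny (\<lambda>P. (Ln (1 + \<eta> P * q1 P) - \<eta> P * q1 P) / \<eta> P)"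
      by (rule second_order[OF Ln2 q1l])
    show "\<forall>\<^sub>F P in T. (Ln (1 + \<eta> P * q1 P) - \<eta> P * q1 P) / \<eta> P = LQ P / \<eta> P - q1 P"
      using PQ_ev \<eta>nz by eventually_elim (simp add: LQ_def diff_divide_distrib)
  qed
  have tV: "tiny (\<lambda>P. V P / \<eta> P - (of_nat m * q1 P - p1 P))"
    using tiny_add[OF tiny_cmult[OF tLQ, of "of_nat m"] tiny_cmult[OF tLP, of "- 1"]]
    by (rule tiny_cong) (simp add: V_def diff_divide_distrib algebra_simps)
  have tD: "tiny (\<lambda>P. D P / \<eta> P - ((1 - of_nat m) * q1 P - of_nat r * p1 P))"
    using tiny_add[OF tiny_cmult[OF tLQ, of "1 - of_nat m"] tiny_cmult[OF tLP, of "- of_nat r"]]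
    by (rule tiny_cong) (simp add: D_def diff_divide_distrib add_divide_distrib algebra_simps)
  have rk: "of_nat r * of_nat m + of_nat m = (1 + of_nat k :: complex)"
  proof -
    have "of_nat (m * r + m) = (of_nat (k + 1) :: complex)" by (simp only: k(2))
    then show ?thesis by (simp add: ac_simps)
  qed
  have b1c: "of_nat m * b1 0 = - b0 * (of_nat k * \<beta>)" using nz0 by (simp add: b0_def)
  \<comment> \<open>The resonance \<open>A 0 = m * B 0\<close> cancels the constant part of
    \<open>m * q1 - p1\<close>. What survives is the \<open>b1\<close> term, of size
    \<open>1 / \<Lambda>\<close>, and \<open>b0\<close> makes its coefficient 1.\<close>
  have sV: "sm (\<lambda>P. \<Lambda> P * (V P / \<eta> P) - 1)"
  proof (rule sm_cong)
    show "sm (\<lambda>P. \<Lambda> P * (V P / \<eta> P - (of_nat m * q1 P - p1 P)) +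
        (\<Lambda> P * (c0 * (of_nat m * (B (z P, w P) - B 0) + - 1 * (A (z P, w P) - A 0))) +
         c0 / b0 * (of_nat m * (b1 (z P, w P) - b1 0) + - 1 * (w P * a1 (z P, w P)))))"
      by (intro sm_add sm_\<Lambda> tiny_sm tV tiny_cmult tiny_add tiny_germ tiny_mult[OF tiny_w lim] germs)
    show "\<forall>\<^sub>F P in T. \<Lambda> P * (V P / \<eta> P - (of_nat m * q1 P - p1 P)) +
        (\<Lambda> P * (c0 * (of_nat m * (B (z P, w P) - B 0) + - 1 * (A (z P, w P) - A 0))) +
         c0 / b0 * (of_nat m * (b1 (z P, w P) - b1 0) + - 1 * (w P * a1 (z P, w P)))) = \<Lambda> P * (V P / \<eta> P) - 1"
      using \<Lambda>nz
    proof eventually_elim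
      case (elim P)
      have "c0 / b0 * (of_nat m * b1 0) = 1" unfolding b1c using nz0 by (simp add: c0_def)
      moreover have "\<Lambda> P * (of_nat m * q1 P - p1 P) = \<Lambda> P * (c0 * (of_nat m * B (z P, w P) - A (z P, w P))) +
          c0 / b0 * (of_nat m * b1 (z P, w P) - w P * a1 (z P, w P))"
        using elim nz0 by (simp add: q1_def p1_def Ah_def Bh_def field_simps)
      ultimately show ?case by (simp add: A0 algebra_simps)
    qed
  qed
  \<comment> \<open>The leading value 1 uses \<open>r * m + m = k + 1\<close>; the correction
    \<open>p / \<Lambda>\<close> comes from the \<open>b1\<close> term in \<open>q1\<close>
    alone.\<close>
  have tD1: "tiny (\<lambda>P. D P / \<eta> P - (1 - p / \<Lambda> P))"
  proof (rule tiny_cong)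
    show "tiny (\<lambda>P. D P / \<eta> P - ((1 - of_nat m) * q1 P - of_nat r * p1 P) +
       c0 * ((1 - of_nat m) * (B (z P, w P) - B 0) + (((1 - of_nat m) * (b1 (z P, w P) - b1 0)) * (1 / (b0 * \<Lambda> P)) +
         ((- of_nat r) * (A (z P, w P) - A 0) + (- of_nat r) * (w P * (a1 (z P, w P) * (1 / (b0 * \<Lambda> P))))))))"
      by (intro tiny_add tD tiny_cmult tiny_germ germs tiny_mult[OF _ i\<Lambda>b] tiny_mult[OF tiny_w tendsto_mult[OF lim i\<Lambda>b]])
    show "\<forall>\<^sub>F P in T. D P / \<eta> P - ((1 - of_nat m) * q1 P - of_nat r * p1 P) +
       c0 * ((1 - of_nat m) * (B (z P, w P) - B 0) + (((1 - of_nat m) * (b1 (z P, w P) - b1 0)) * (1 / (b0 * \<Lambda> P)) +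
         ((- of_nat r) * (A (z P, w P) - A 0) + (- of_nat r) * (w P * (a1 (z P, w P) * (1 / (b0 * \<Lambda> P))))))) =
       D P / \<eta> P - (1 - p / \<Lambda> P)"
      using \<Lambda>nz
    proof eventually_elim
      case (elim P)
      have c1: "c0 * ((1 - of_nat m) * B 0 - of_nat r * A 0) = 1"
      proof -
        have "(1 - of_nat m) * B 0 - of_nat r * A 0 = - (of_nat k * \<beta>)"
        proof -
          have "(1 - of_nat m) * B 0 - of_nat r * A 0 = \<beta> * (1 - (of_nat r * of_nat m + of_nat m))"
            by (simp add: A0 \<beta>_def algebra_simps)
          then show ?thesis unfolding rk by simp
        qed
        then show ?thesis using nz0 by (simp add: c0_def)
      qed
      have c2: "c0 * ((1 - of_nat m) * b1 0 * (1 / (b0 * \<Lambda> P))) = - p / \<Lambda> P"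
      proof -
        have "c0 / b0 * (of_nat m * b1 0) = 1" unfolding b1c using nz0 by (simp add: c0_def)
        then have "c0 * b1 0 / b0 = 1 / of_nat m" using nz0 by (simp add: field_simps)
        moreover have "c0 * ((1 - of_nat m) * b1 0 * (1 / (b0 * \<Lambda> P))) = (1 - of_nat m) / \<Lambda> P * (c0 * b1 0 / b0)"
          by (simp add: ac_simps)
        ultimately show ?thesis using nz0 by (simp add: p_def minus_divide_left[symmetric] diff_divide_distrib)
      qed
      have "(1 - of_nat m) * q1 P - of_nat r * p1 P =
         c0 * ((1 - of_nat m) * B (z P, w P) + ((1 - of_nat m) * b1 (z P, w P)) * (1 / (b0 * \<Lambda> P)) -
           of_nat r * A (z P, w P) - of_nat r * (w P * (a1 (z P, w P) * (1 / (b0 * \<Lambda> P)))))"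
        by (simp add: q1_def p1_def Ah_def Bh_def divide_inverse algebra_simps)
      moreover have "c0 * ((1 - of_nat m) * (B (z P, w P) - B 0) + (((1 - of_nat m) * (b1 (z P, w P) - b1 0)) * (1 / (b0 * \<Lambda> P)) +
         ((- of_nat r) * (A (z P, w P) - A 0) + (- of_nat r) * (w P * (a1 (z P, w P) * (1 / (b0 * \<Lambda> P))))))) =
         c0 * ((1 - of_nat m) * B (z P, w P) + ((1 - of_nat m) * b1 (z P, w P)) * (1 / (b0 * \<Lambda> P)) -
           of_nat r * A (z P, w P) - of_nat r * (w P * (a1 (z P, w P) * (1 / (b0 * \<Lambda> P))))) -
         c0 * ((1 - of_nat m) * B 0 - of_nat r * A 0) - c0 * ((1 - of_nat m) * b1 0 * (1 / (b0 * \<Lambda> P)))"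
        by (simp add: divide_inverse algebra_simps)
      ultimately show ?case unfolding c1 c2 by simp
    qed
  qed
  have Vl: "((\<lambda>P. V P / \<eta> P) \<longlongrightarrow> 0) T"
  proof (rule Lim_transform_eventually)
    show "((\<lambda>P. V P / \<eta> P - (of_nat m * q1 P - p1 P) + (of_nat m * q1 P - p1 P)) \<longlongrightarrow> 0) T"
      using tendsto_add[OF sm_0[OF tiny_sm[OF tV]] tendsto_diff[OF tendsto_mult[OF tendsto_const[of "of_nat m"] q1l] p1l]]
      by simp
  qed simp
  have Dl: "((\<lambda>P. D P / \<eta> P) \<longlongrightarrow> 1) T"
  proof (rule Lim_transform_eventually)
    show "((\<lambda>P. D P / \<eta> P - (1 - p / \<Lambda> P) + (1 - p * (1 / \<Lambda> P))) \<longlongrightarrow> 1) T"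
      using tendsto_add[OF sm_0[OF tiny_sm[OF tD1]] tendsto_diff[OF tendsto_const[of 1] tendsto_mult[OF tendsto_const[of p] i\<Lambda>]]]
      by simp
  qed simp
  have V0: "(V \<longlongrightarrow> 0) T" and D0: "(D \<longlongrightarrow> 0) T"
  proof -
    show "(V \<longlongrightarrow> 0) T"
      by (rule Lim_transform_eventually[OF tendsto_mult_zero[OF \<eta>0 Vl]])
         (use \<eta>nz in eventually_elim, simp)
    have "((\<lambda>P. \<eta> P * (D P / \<eta> P)) \<longlongrightarrow> 0) T" using tendsto_mult[OF \<eta>0 Dl] by simp
    then show "(D \<longlongrightarrow> 0) T"
      by (rule Lim_transform_eventually) (use \<eta>nz in eventually_elim, simp)
  qed
  have tExp: "tiny (\<lambda>P. (exp (X P) - 1 - X P) / \<eta> P)" if "((\<lambda>P. X P / \<eta> P) \<longlongrightarrow> c) T" for X c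
  proof (rule tiny_cong)
    show "tiny (\<lambda>P. (exp (\<eta> P * (X P / \<eta> P)) - 1 - \<eta> P * (X P / \<eta> P)) / \<eta> P)"
      using second_order[OF exp2 that] .
    show "\<forall>\<^sub>F P in T. (exp (\<eta> P * (X P / \<eta> P)) - 1 - \<eta> P * (X P / \<eta> P)) / \<eta> P = (exp (X P) - 1 - X P) / \<eta> P"
      using \<eta>nz by eventually_elim simp
  qed

  \<comment> \<open>The map in the coordinates \<open>\<zeta>\<close> and \<open>c\<close>\<close>
  define g where "g P = fst P * exp (D P) - fst P - 1" for P
  \<comment> \<open>The new \<open>\<Lambda>\<close> is \<open>\<Lambda> * exp V\<close> and the new
    \<open>l\<close> is \<open>l + D\<close>; solving the definition of \<open>\<Lambda>\<close> for
    the new \<open>c\<close> gives this increment exactly.\<close>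
  define h where "h P = \<Lambda> P * exp (V P) - (l P + D P) - p * Ln (l P + D P) - snd P" for P
  have g0: "(g \<longlongrightarrow> 0) T"
  proof (rule Lim_transform_eventually)
    show "((\<lambda>P. (exp (D P) - 1 - D P) / \<eta> P + D P / \<eta> P - 1) \<longlongrightarrow> 0) T"
      using tendsto_diff[OF tendsto_add[OF sm_0[OF tiny_sm[OF tExp[OF Dl]]] Dl] tendsto_const[of 1]] by simp
    show "\<forall>\<^sub>F P in T. (exp (D P) - 1 - D P) / \<eta> P + D P / \<eta> P - 1 = g P"
      using in1 by eventually_elim (simp add: g_def \<eta>_def algebra_simps)
  qed
  have Dll: "((\<lambda>P. (D P / l P) / \<eta> P) \<longlongrightarrow> 0) T"
    using tendsto_mult[OF Dl il] by (simp add: field_simps)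
  have Dl0: "((\<lambda>P. D P / l P) \<longlongrightarrow> 0) T"
    using tendsto_mult[OF D0 il] by simp
  have Dl_ev: "\<forall>\<^sub>F P in T. cmod (D P / l P) < 1"
    using tendstoD[OF Dl0 zero_less_one] by (simp add: dist_norm)
  have Ln_l: "Ln (l P + D P) = Ln (l P) + Ln (1 + D P / l P)"
    if P: "P \<in> tube R1 \<theta>" and d: "cmod (D P / l P) < 1" for P
  proof -
    have "0 < Re (l P)" using tb1(8,9)[OF P] by simp
    have "0 < Re (1 + D P / l P)" using abs_Re_le_cmod[of "D P / l P"] d by simp
    then have "Ln (l P * (1 + D P / l P)) = Ln (l P) + Ln (1 + D P / l P)"
      using \<open>0 < Re (l P)\<close> Re_Ln_pos_lt_imp
      by (intro Ln_mult_right_half_planes) (auto simp del: plus_complex.simps)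
    then show ?thesis using tb1(11)[OF P] by (simp add: distrib_left)
  qed
  have tLl: "tiny (\<lambda>P. (Ln (1 + D P / l P) - D P / l P) / \<eta> P)"
  proof (rule tiny_cong)
    show "tiny (\<lambda>P. (Ln (1 + \<eta> P * ((D P / l P) / \<eta> P)) - \<eta> P * ((D P / l P) / \<eta> P)) / \<eta> P)"
      by (rule second_order[OF Ln2 Dll])
    show "\<forall>\<^sub>F P in T. (Ln (1 + \<eta> P * ((D P / l P) / \<eta> P)) - \<eta> P * ((D P / l P) / \<eta> P)) / \<eta> P =
        (Ln (1 + D P / l P) - D P / l P) / \<eta> P"
      using \<eta>nz by eventually_elim simp
  qed
  have sm_ll: "sm (\<lambda>P. 1 / (\<Lambda> P * l P))"
    unfolding sm_def
  proof (rule Lim_transform_eventually)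
    show "((\<lambda>P. 1 / s P * (of_real (S P) / \<Lambda> P) * (of_real (S P) / l P)) \<longlongrightarrow> 0) T"
      using tendsto_mult[OF tendsto_mult[OF s_inv S\<Lambda>] Sl] by simp
    show "\<forall>\<^sub>F P in T. 1 / s P * (of_real (S P) / \<Lambda> P) * (of_real (S P) / l P) = s P ^ 3 * (1 / (\<Lambda> P * l P))"
      using in1
    proof eventually_elim
      case (elim P)
      show ?case unfolding tb1(13)[OF elim, symmetric] using tb1(14)[OF elim] by (simp add: eval_nat_numeral)
    qed
  qed
  have sm_diff: "sm (\<lambda>P. (\<Lambda> P - l P) / (\<Lambda> P * l P))"
    unfolding sm_def
  proof (rule Lim_transform_eventually)
    show "((\<lambda>P. s P * ((\<Lambda> P - l P) / of_real (S P)) * (of_real (S P) / \<Lambda> P) * (of_real (S P) / l P)) \<longlongrightarrow> 0) T"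
      using tendsto_mult[OF tendsto_mult[OF s\<Lambda>l S\<Lambda>] Sl] by simp
    show "\<forall>\<^sub>F P in T. s P * ((\<Lambda> P - l P) / of_real (S P)) * (of_real (S P) / \<Lambda> P) * (of_real (S P) / l P) =
        s P ^ 3 * ((\<Lambda> P - l P) / (\<Lambda> P * l P))"
      using in1
    proof eventually_elim
      case (elim P)
      show ?case unfolding tb1(13)[OF elim, symmetric] using tb1(14)[OF elim] by (simp add: eval_nat_numeral)
    qed
  qed
  \<comment> \<open>To leading order \<open>h / \<eta>\<close> is \<open>1 - (1 - p / \<Lambda>) *
    (1 + p / l) = - p * (\<Lambda> - l) / (\<Lambda> * l) + p^2 / (\<Lambda> * l)\<close>. The order
    \<open>1 / l\<close> cancels thanks to the term \<open>p * Ln l\<close> in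
    \<open>\<Lambda>\<close>; the long sum lists these two terms and all remainders.\<close>
  have sm_h: "sm (\<lambda>P. h P / \<eta> P)"
  proof (rule sm_cong)
    show "sm (\<lambda>P. (\<Lambda> P * (V P / \<eta> P) - 1) + (\<Lambda> P * ((exp (V P) - 1 - V P) / \<eta> P) +
       ((D P / \<eta> P - (1 - p / \<Lambda> P)) * (- 1 - p * (1 / l P)) + (((\<Lambda> P - l P) / (\<Lambda> P * l P)) * (- p) +
        ((1 / (\<Lambda> P * l P)) * p ^ 2 + ((Ln (1 + D P / l P) - D P / l P) / \<eta> P) * (- p))))))"
      by (intro sm_add sV sm_\<Lambda> tExp[OF Vl] sm_mult[OF tiny_sm[OF tD1] tendsto_diff[OF tendsto_const tendsto_mult[OF tendsto_const il]]]
          sm_mult[OF sm_diff tendsto_const] sm_mult[OF sm_ll tendsto_const] sm_mult[OF tiny_sm[OF tLl] tendsto_const])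
    show "\<forall>\<^sub>F P in T. (\<Lambda> P * (V P / \<eta> P) - 1) + (\<Lambda> P * ((exp (V P) - 1 - V P) / \<eta> P) +
       ((D P / \<eta> P - (1 - p / \<Lambda> P)) * (- 1 - p * (1 / l P)) + (((\<Lambda> P - l P) / (\<Lambda> P * l P)) * (- p) +
        ((1 / (\<Lambda> P * l P)) * p ^ 2 + ((Ln (1 + D P / l P) - D P / l P) / \<eta> P) * (- p))))) = h P / \<eta> P"
      using in1 Dl_ev \<Lambda>nz \<eta>nz
    proof eventually_elim
      case (elim P)
      have nz: "l P \<noteq> 0" "\<Lambda> P \<noteq> 0" "\<eta> P \<noteq> 0" using tb1(11)[OF elim(1)] elim by auto
      define L where "L = Ln (1 + D P / l P)"
      have h: "h P = \<Lambda> P * (exp (V P) - 1) - D P - p * L"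
        unfolding h_def Ln_l[OF elim(1,2)] by (simp add: \<Lambda>_def L_def algebra_simps)
      show ?case
        unfolding h L_def[symmetric] using nz by (simp add: field_simps power2_eq_square)
    qed
  qed
  have h_small: "\<forall>\<^sub>F P in T. cmod (h P) \<le> e * log_weight (Re (fst P))" if "0 < e" for e
    using tendstoD[OF sm_h[unfolded sm_def] that] in1
  proof eventually_elim
    case (elim P)
    note b = tb1[OF elim(2)]
    have "cmod (s P) ^ 3 * (cmod (h P) * cmod (fst P)) \<le> e"
      using elim(1) by (simp add: \<eta>_def norm_mult norm_power dist_norm)
    moreover have "cmod (s P) ^ 3 * (cmod (h P) * Re (fst P)) \<le> cmod (s P) ^ 3 * (cmod (h P) * cmod (fst P))"
      using b(2) by (intro mult_left_mono) auto
    moreover have s: "cmod (s P) = sqrt (S P)" using b(8) by (simp add: s_def)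
    ultimately have "sqrt (S P) ^ 3 * (cmod (h P) * Re (fst P)) \<le> e" by simp
    moreover have "0 < Re (fst P) * sqrt (S P) ^ 3" using b by simp
    ultimately show ?case
      unfolding log_weight_def S_def[symmetric] by (simp add: pos_le_divide_eq ac_simps)
  qed
  have PP0: "(PP \<longlongrightarrow> 0) T" and QQ0: "(QQ \<longlongrightarrow> 0) T"
  proof -
    have *: "((\<lambda>P. \<eta> P * p1 P) \<longlongrightarrow> 0) T" "((\<lambda>P. \<eta> P * q1 P) \<longlongrightarrow> 0) T"
      using tendsto_mult[OF \<eta>0 p1l] tendsto_mult[OF \<eta>0 q1l] by simp_all
    show "(PP \<longlongrightarrow> 0) T"
      by (rule Lim_transform_eventually[OF *(1)]) (use PQ_ev in eventually_elim, simp)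
    show "(QQ \<longlongrightarrow> 0) T"
      by (rule Lim_transform_eventually[OF *(2)]) (use PQ_ev in eventually_elim, simp)
  qed

  \<comment> \<open>A common radius, branches of the logarithm and holomorphy\<close>
  obtain \<rho> where \<rho>: "\<rho> > 0" "holo2_on (ball 0 \<rho> \<times> ball 0 \<rho>) a" "holo2_on (ball 0 \<rho> \<times> ball 0 \<rho>) b"
    using germs(1,2) by (rule germ2_bidisc2)
  have "\<forall>\<^sub>F P in T. P \<in> tube R1 \<theta> \<and> 0 < Re (\<Lambda> P) \<and> cmod (z P) < \<rho> \<and> cmod (w P) < \<rho> \<and> cmod (PP P) < 1 \<and>
      cmod (QQ P) < 1 \<and> cmod (V P) < 1 \<and> cmod (D P) < 1"
    using in1 \<Lambda>_ev tendstoD[OF z0 \<rho>(1)] tendstoD[OF w0 \<rho>(1)] tendstoD[OF PP0 zero_less_one] tendstoD[OF QQ0 zero_less_one]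
      tendstoD[OF V0 zero_less_one] tendstoD[OF D0 zero_less_one]
    by eventually_elim (simp add: dist_norm)
  then obtain R0 where R0: "R1 \<le> R0" and R: "\<And>P. P \<in> tube R0 \<theta> \<Longrightarrow> P \<in> tube R1 \<theta> \<and> 0 < Re (\<Lambda> P) \<and> cmod (z P) < \<rho> \<and>
      cmod (w P) < \<rho> \<and> cmod (PP P) < 1 \<and> cmod (QQ P) < 1 \<and> cmod (V P) < 1 \<and> cmod (D P) < 1"
    unfolding T_def eventually_tubes by blast
  have ev: "\<exists>R\<ge>R0. \<forall>p\<in>tube R \<theta>. Q p" if Q: "eventually Q T" for Q
  proof -
    obtain S where "R1 \<le> S" "\<forall>p\<in>tube S \<theta>. Q p"
      using Q unfolding T_def eventually_tubes by (elim exE conjE)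
    then show ?thesis using tube_mono[of S "max S R0" \<theta>] by (intro exI[of _ "max S R0"]) auto
  qed
  have pos: "0 < Re (l P)" "0 < Re (1 + PP P)" "0 < Re (1 + QQ P)" "0 < Re (l P + D P)" "0 < Re (\<Lambda> P)"
    if "P \<in> tube R0 \<theta>" for P
  proof -
    note R' = R[OF that]
    have "1 \<le> Re (l P)" using tb1(8,9)[of P] R' by linarith
    then show "0 < Re (l P)" "0 < Re (1 + PP P)" "0 < Re (1 + QQ P)" "0 < Re (l P + D P)" "0 < Re (\<Lambda> P)"
      using R' abs_Re_le_cmod[of "PP P"] abs_Re_le_cmod[of "QQ P"] abs_Re_le_cmod[of "D P"] by auto
  qed
  have slit: "x \<notin> \<real>\<^sub>\<le>\<^sub>0" "x \<noteq> 0" if "0 < Re x" for x :: complex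
    using that by (auto simp: complex_nonpos_Reals_iff)
  have \<zeta>pos: "0 < Re (fst P)" if "P \<in> tube R0 \<theta>" for P using tb1(1)[of P] R[OF that] by simp
  have hol: "curve_holo (tube R0 \<theta>) l" "curve_holo (tube R0 \<theta>) \<Lambda>" "curve_holo (tube R0 \<theta>) w" "curve_holo (tube R0 \<theta>) z"
    "curve_holo (tube R0 \<theta>) LP" "curve_holo (tube R0 \<theta>) LQ"
    "curve_holo (tube R0 \<theta>) g" "curve_holo (tube R0 \<theta>) h"
  proof -
    have "(\<lambda>s. l (X s, Y s)) holomorphic_on U \<and> (\<lambda>s. \<Lambda> (X s, Y s)) holomorphic_on U \<and> (\<lambda>s. w (X s, Y s)) holomorphic_on U \<and>
      (\<lambda>s. z (X s, Y s)) holomorphic_on U \<and> (\<lambda>s. LP (X s, Y s)) holomorphic_on U \<and> (\<lambda>s. LQ (X s, Y s)) holomorphic_on U \<and>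
      (\<lambda>s. g (X s, Y s)) holomorphic_on U \<and> (\<lambda>s. h (X s, Y s)) holomorphic_on U"
      if XY: "open U" "X holomorphic_on U" "Y holomorphic_on U" "\<forall>s\<in>U. (X s, Y s) \<in> tube R0 \<theta>" for U X Y
    proof -
      have t: "(X s, Y s) \<in> tube R0 \<theta>" if "s \<in> U" for s using XY(4) that by blast
      note [holomorphic_intros] = XY(2,3)
      have l: "(\<lambda>s. l (X s, Y s)) holomorphic_on U"
        unfolding l_def fst_conv by (intro holomorphic_intros slit(1)) (use \<zeta>pos[OF t] in simp)
      note [holomorphic_intros] = l
      have \<Lambda>: "(\<lambda>s. \<Lambda> (X s, Y s)) holomorphic_on U"
        unfolding \<Lambda>_def snd_conv by (intro holomorphic_intros slit(1) pos t)
      note [holomorphic_intros] = \<Lambda>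
      have w: "(\<lambda>s. w (X s, Y s)) holomorphic_on U"
        unfolding w_def using nz0 by (intro holomorphic_intros slit(1) pos t) auto
      note [holomorphic_intros] = w
      have z: "(\<lambda>s. z (X s, Y s)) holomorphic_on U"
        unfolding z_def using slit(2)[OF pos(5)[OF t]] nz0 by (intro holomorphic_intros) auto
      note [holomorphic_intros] = z
      have ab: "(\<lambda>s. a (z (X s, Y s), w (X s, Y s))) holomorphic_on U" "(\<lambda>s. b (z (X s, Y s), w (X s, Y s))) holomorphic_on U"
        by (rule holo2_on_compose[OF \<rho>(2) z w XY(1)] holo2_on_compose[OF \<rho>(3) z w XY(1)]; use R[OF t] in simp)+
      note [holomorphic_intros] = ab
      have LP: "(\<lambda>s. LP (X s, Y s)) holomorphic_on U"
        unfolding LP_def PP_def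
        by (intro holomorphic_intros slit(1)) (use pos(2)[OF t] in \<open>simp add: PP_def\<close>)
      have LQ: "(\<lambda>s. LQ (X s, Y s)) holomorphic_on U"
        unfolding LQ_def QQ_def
        by (intro holomorphic_intros slit(1) wnz) (use pos(3)[OF t] in \<open>simp add: QQ_def\<close>)
      note [holomorphic_intros] = LP LQ
      have g: "(\<lambda>s. g (X s, Y s)) holomorphic_on U"
        unfolding g_def D_def fst_conv by (intro holomorphic_intros)
      have h: "(\<lambda>s. h (X s, Y s)) holomorphic_on U"
        unfolding h_def V_def D_def snd_conv
        by (intro holomorphic_intros slit(1)) (use pos(4)[OF t] in \<open>simp add: D_def\<close>)
      show ?thesis by (intro conjI l \<Lambda> w z LP LQ g h)
    qed
    then show "curve_holo (tube R0 \<theta>) l" "curve_holo (tube R0 \<theta>) \<Lambda>" "curve_holo (tube R0 \<theta>) w" "curve_holo (tube R0 \<theta>) z"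
      "curve_holo (tube R0 \<theta>) LP" "curve_holo (tube R0 \<theta>) LQ" "curve_holo (tube R0 \<theta>) g" "curve_holo (tube R0 \<theta>) h"
      unfolding curve_holo_def by meson+
  qed

  \<comment> \<open>The exact conjugacy\<close>
  have conj: "w (\<zeta> + 1 + g (\<zeta>, c), c + h (\<zeta>, c)) = w (\<zeta>, c) + z (\<zeta>, c) ^ r * b (z (\<zeta>, c), w (\<zeta>, c))"
    "z (\<zeta> + 1 + g (\<zeta>, c), c + h (\<zeta>, c)) = z (\<zeta>, c) + z (\<zeta>, c) ^ (r + 1) * a (z (\<zeta>, c), w (\<zeta>, c))"
    if P: "(\<zeta>, c) \<in> tube R0 \<theta>" for \<zeta> c
  proof -
    let ?P = "(\<zeta>, c)" and ?P' = "(\<zeta> + 1 + g (\<zeta>, c), c + h (\<zeta>, c))"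
    note R' = R[OF P] and pos' = pos[OF P]
    have nz: "\<zeta> \<noteq> 0" "\<Lambda> ?P \<noteq> 0" "1 + PP ?P \<noteq> 0" "1 + QQ ?P \<noteq> 0"
      using slit(2) \<zeta>pos[OF P] pos' by auto
    have small: "\<bar>Im (D ?P)\<bar> < 1" "\<bar>Im (V ?P)\<bar> < 1"
      using R' abs_Im_le_cmod[of "D ?P"] abs_Im_le_cmod[of "V ?P"] by auto
    have im: "\<bar>Im (l ?P)\<bar> < pi / 2" "\<bar>Im (Ln (\<Lambda> ?P))\<bar> < pi / 2"
      using Re_Ln_pos_lt_imp[of \<zeta>] Re_Ln_pos_lt_imp[of "\<Lambda> ?P"] \<zeta>pos[OF P] pos' by (auto simp: l_def)
    have l': "l ?P' = l ?P + D ?P"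
      unfolding l_def[of ?P']
    proof (rule Ln_unique)
      show "exp (l ?P + D ?P) = fst ?P'" using nz by (simp add: g_def exp_add l_def)
    qed (use im small pi_ge_two in auto)
    have \<Lambda>': "\<Lambda> ?P' = \<Lambda> ?P * exp (V ?P)"
      unfolding \<Lambda>_def[of ?P'] l' by (simp add: h_def)
    have LnL: "Ln (\<Lambda> ?P') = Ln (\<Lambda> ?P) + V ?P"
      unfolding \<Lambda>'
    proof (rule Ln_unique)
      show "exp (Ln (\<Lambda> ?P) + V ?P) = \<Lambda> ?P * exp (V ?P)" using nz by (simp add: exp_add)
    qed (use im small pi_ge_two in auto)
    have LQ: "of_nat r / of_nat k * V ?P - D ?P / of_nat k = LQ ?P"
    proof -
      have "of_nat r * V ?P - D ?P = (of_nat r * of_nat m + of_nat m - 1) * LQ ?P"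
        by (simp add: V_def D_def algebra_simps)
      also have "\<dots> = of_nat k * LQ ?P" unfolding rk by simp
      finally show ?thesis using nz0 by (simp add: field_simps)
    qed
    have "w ?P' = w ?P * exp (of_nat r / of_nat k * V ?P - D ?P / of_nat k)"
      unfolding w_def[of ?P'] l' LnL unfolding w_def
      by (simp add: distrib_left add_divide_distrib exp_add exp_diff exp_minus divide_inverse ac_simps)
    also have "\<dots> = w ?P * (1 + QQ ?P)" unfolding LQ using nz by (simp add: LQ_def)
    finally have w': "w ?P' = w ?P * (1 + QQ ?P)" .
    then show "w ?P' = w ?P + z ?P ^ r * b (z ?P, w ?P)" using wnz[of ?P] by (simp only: QQ_def distrib_left mult_1_right) simp
    have "z ?P' = z ?P * ((1 + QQ ?P) ^ m / exp (V ?P))"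
      unfolding z_def[of ?P'] w' \<Lambda>' by (simp add: z_def power_mult_distrib)
    also have "(1 + QQ ?P) ^ m = exp (of_nat m * LQ ?P)"
      using nz by (simp add: exp_of_nat_mult LQ_def)
    also have "exp (of_nat m * LQ ?P) / exp (V ?P) = 1 + PP ?P"
      using nz by (simp add: exp_diff[symmetric] V_def LP_def)
    finally show "z ?P' = z ?P + z ?P ^ (r + 1) * a (z ?P, w ?P)" by (simp add: PP_def algebra_simps)
  qed
  show ?thesis
  proof (rule parabolic_curves_from_unit_shift[where ?R0.0 = R0 and \<theta> = \<theta> and \<delta> = log_weight and g = g and h = h
        and \<Phi> = "\<lambda>P. (z P, w P)" and K = 8])
    show "0 < R0" using R0 R1 by simp
    show "0 < \<theta> t" "\<theta> t \<le> \<theta> s" for s t by (simp_all add: \<theta>_def)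
    show "0 \<le> log_weight t" if "R0 \<le> t" for t using that R0 R1 by (intro log_weight_nonneg) auto
    show "log_weight t \<le> log_weight s" if "R0 \<le> s" "s \<le> t" for s t
      using that R0 R1 by (intro log_weight_antimono) auto
    show "summable (\<lambda>j. log_weight ((t + real j) / 2))" if "2 * R0 \<le> t" for t
      using that R0 by (intro R1(2)) auto
    show "(\<Sum>j. log_weight ((t + real j) / 2)) \<le> 8 * \<theta> (2 * t)" if "2 * R0 \<le> t" for t
      using that R0 R1(3)[of t] by (simp add: \<theta>_def)
    show "curve_holo (tube R0 \<theta>) g" "curve_holo (tube R0 \<theta>) h" by (fact hol)+
    show "\<exists>R\<ge>R0. \<forall>p\<in>tube R \<theta>. cmod (g p) \<le> e" if "0 < e" for e
      using tendstoD[OF g0 that] by (intro ev) (auto elim: eventually_mono)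
    show "\<exists>R\<ge>R0. \<forall>p\<in>tube R \<theta>. cmod (h p) \<le> e * log_weight (Re (fst p))" if "0 < e" for e
      by (rule ev[OF h_small[OF that]])
    show "curve_holo (tube R0 \<theta>) (\<lambda>p. fst (z p, w p))" "curve_holo (tube R0 \<theta>) (\<lambda>p. snd (z p, w p))"
      using hol by simp_all
    \<comment> \<open>\<open>\<Lambda>\<close> is recovered from \<open>w^m / z\<close>, then
      \<open>\<zeta>\<close> from \<open>w^k\<close> and \<open>\<Lambda>\<close>, and finally
      \<open>c\<close> from \<open>\<Lambda>\<close> and \<open>\<zeta>\<close>.\<close>
    show "inj_on (\<lambda>P. (z P, w P)) (tube R0 \<theta>)"
    proof (rule inj_onI)
      fix P Q assume P: "P \<in> tube R0 \<theta>" and Q: "Q \<in> tube R0 \<theta>" and eq: "(z P, w P) = (z Q, w Q)"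
      have nz: "\<Lambda> P \<noteq> 0" "\<Lambda> Q \<noteq> 0" "fst P \<noteq> 0" "fst Q \<noteq> 0"
        using pos(5)[OF P] pos(5)[OF Q] \<zeta>pos[OF P] \<zeta>pos[OF Q] by auto
      have "w P ^ m / z P = w Q ^ m / z Q" using eq by simp
      then have \<Lambda>: "\<Lambda> P = \<Lambda> Q" using nz nz0 wnz[of P] wnz[of Q] by (simp add: z_def)
      have "w P ^ k = w Q ^ k" using eq by simp
      then have "\<eta> P = \<eta> Q" using wk[OF nz(1,3)] wk[OF nz(2,4)] nz nz0 \<Lambda> by simp
      then have "fst P = fst Q" by (simp add: \<eta>_def)
      moreover from this have "snd P = snd Q" using \<Lambda> by (simp add: \<Lambda>_def l_def)
      ultimately show "P = Q" by (rule prod_eqI)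
    qed
    show "\<exists>R\<ge>R0. \<forall>p\<in>tube R \<theta>. norm (z p, w p) < e" if "0 < e" for e
      using tendstoD[OF tendsto_Pair[OF z0 w0] that] by (intro ev) (simp add: zero_prod_def[symmetric])
    show "fst (z p, w p) \<noteq> 0" if "p \<in> tube R0 \<theta>" for p
      using wnz[of p] nz0 slit(2)[OF pos(5)[OF that]] by (simp add: z_def)
    show "(fst (z (\<zeta>, c), w (\<zeta>, c)) + fst (z (\<zeta>, c), w (\<zeta>, c)) ^ (r + 1) * a (z (\<zeta>, c), w (\<zeta>, c)),
         snd (z (\<zeta>, c), w (\<zeta>, c)) + fst (z (\<zeta>, c), w (\<zeta>, c)) ^ r * b (z (\<zeta>, c), w (\<zeta>, c))) =
        (z (\<zeta> + 1 + g (\<zeta>, c), c + h (\<zeta>, c)), w (\<zeta> + 1 + g (\<zeta>, c), c + h (\<zeta>, c)))"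
      if "(\<zeta>, c) \<in> tube R0 \<theta>" for \<zeta> c
      using conj[OF that] by simp
  qed simp
qed


section \<open>Blow-ups\<close>

lemma parabolic_curve_cong:
  assumes "parabolic_curve U F \<Delta> \<phi>" "U \<subseteq> U'" and eq: "\<And>x. x \<in> U \<Longrightarrow> F x = F' x"
  shows "parabolic_curve U' F' \<Delta> \<phi>"
proof -
  have U: "\<phi> ` \<Delta> \<subseteq> U" "F ` \<phi> ` \<Delta> \<subseteq> \<phi> ` \<Delta>" using assms(1) by (auto simp: parabolic_curve_def)
  have it: "(F' ^^ k) x = (F ^^ k) x \<and> (F ^^ k) x \<in> \<phi> ` \<Delta>" if "x \<in> \<phi> ` \<Delta>" for x k
  proof (induction k)
    case (Suc k)
    then have "(F ^^ k) x \<in> U" using U(1) by blast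
    moreover have "F ((F ^^ k) x) \<in> \<phi> ` \<Delta>" using Suc U(2) by blast
    ultimately show ?case using Suc eq[of "(F ^^ k) x"] by simp
  qed (use that in simp)
  have "F' ` \<phi> ` \<Delta> = F ` \<phi> ` \<Delta>"
    by (rule image_cong[OF refl], rule eq[symmetric], rule subsetD[OF U(1)])
  moreover have "(\<lambda>k. (F' ^^ k) x) = (\<lambda>k. (F ^^ k) x)" if "x \<in> \<phi> ` \<Delta>" for x
    using it[OF that] by auto
  ultimately show ?thesis using assms(1,2) unfolding parabolic_curve_def by auto
qed

lemma has_parabolic_curves_cong:
  assumes "has_parabolic_curves F" "germ_eq F F'"
  shows "has_parabolic_curves F'"
  unfolding has_parabolic_curves_def
proof (intro allI impI)
  fix U :: "(complex \<times> complex) set" assume U: "open U" "0 \<in> U"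
  obtain V where V: "open V" "0 \<in> V" "\<And>x. x \<in> V \<Longrightarrow> F x = F' x"
    using assms(2) unfolding germ_eq_def eventually_nhds by blast
  obtain \<Delta> \<phi> where "parabolic_curve (U \<inter> V) F \<Delta> \<phi>" "\<forall>s\<in>\<Delta>. fst (\<phi> s) \<noteq> 0"
    using assms(1) U V unfolding has_parabolic_curves_def by (metis IntI open_Int)
  then show "\<exists>\<Delta> \<phi>. parabolic_curve U F' \<Delta> \<phi> \<and> (\<forall>s\<in>\<Delta>. fst (\<phi> s) \<noteq> 0)"
    using V(3) by (intro exI[of _ \<Delta>] exI[of _ \<phi>]) (auto intro: parabolic_curve_cong)
qed

text \<open>\<open>(X, Y)\<close> stands for a blow-down map, injective only where
  \<open>fst\<close> is nonzero. The curves avoid that divisor, so composition keeps them injective,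
  and the first condition on \<open>X\<close> keeps the image off the axis as well, so that the
  lemma can be iterated.\<close>

lemma has_parabolic_curves_semiconj:
  fixes X Y :: "complex \<times> complex \<Rightarrow> complex"
  assumes F': "has_parabolic_curves F'"
    and XY: "germ2 X" "germ2 Y" "X 0 = 0" "Y 0 = 0"
    and conj: "\<forall>\<^sub>F x in nhds 0. F (X x, Y x) = (X (F' x), Y (F' x))"
    and inj: "\<forall>\<^sub>F x in nhds 0. fst x \<noteq> 0 \<longrightarrow> X x \<noteq> 0"
      "\<And>x y. fst x \<noteq> 0 \<Longrightarrow> fst y \<noteq> 0 \<Longrightarrow> X x = X y \<Longrightarrow> Y x = Y y \<Longrightarrow> x = y"
  shows "has_parabolic_curves F"
  unfolding has_parabolic_curves_def
proof (intro allI impI)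
  fix U :: "(complex \<times> complex) set" assume U: "open U" "0 \<in> U"
  define \<pi> where "\<pi> x = (X x, Y x)" for x
  obtain r where r: "r > 0" "holo2_on (ball 0 r \<times> ball 0 r) X" "holo2_on (ball 0 r \<times> ball 0 r) Y"
    using XY(1,2) by (rule germ2_bidisc2)
  obtain V where V: "open V" "0 \<in> V" "\<And>x. x \<in> V \<Longrightarrow> F (\<pi> x) = \<pi> (F' x)" "\<And>x. x \<in> V \<Longrightarrow> fst x \<noteq> 0 \<Longrightarrow> X x \<noteq> 0"
    using eventually_conj[OF conj inj(1)] unfolding eventually_nhds \<pi>_def by blast
  have cont: "continuous_on (ball 0 r \<times> ball 0 r) \<pi>"
    unfolding \<pi>_def by (intro continuous_on_Pair holo2_on_imp_continuous_on r)
  define W where "W = ((ball 0 r \<times> ball 0 r) \<inter> \<pi> -` U) \<inter> V"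
  have "open W" unfolding W_def
    by (intro open_Int continuous_open_preimage[OF cont] U V open_Times) auto
  moreover have \<pi>0: "\<pi> 0 = 0" using XY by (simp add: \<pi>_def zero_prod_def)
  then have "0 \<in> W" unfolding W_def using r U V by (auto simp: mem_Times_iff)
  ultimately have "\<exists>\<Delta> \<phi>. parabolic_curve W F' \<Delta> \<phi> \<and> (\<forall>s\<in>\<Delta>. fst (\<phi> s) \<noteq> 0)"
    using F' by (simp add: has_parabolic_curves_def)
  then obtain \<Delta> \<phi> where pc: "parabolic_curve W F' \<Delta> \<phi>" and nz': "\<forall>s\<in>\<Delta>. fst (\<phi> s) \<noteq> 0"
    by (elim exE conjE)
  have nz: "fst (\<phi> s) \<noteq> 0" if "s \<in> \<Delta>" for s using nz' that by (rule bspec)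
  have 1: "open \<Delta>" "connected \<Delta>" "simply_connected \<Delta>" "0 \<in> frontier \<Delta>" "inj_on \<phi> \<Delta>"
    "(\<lambda>s. fst (\<phi> s)) holomorphic_on \<Delta>" "(\<lambda>s. snd (\<phi> s)) holomorphic_on \<Delta>" "\<phi> 0 = 0"
    "continuous (at 0 within insert 0 \<Delta>) \<phi>" "\<phi> ` \<Delta> \<subseteq> W" "F' ` \<phi> ` \<Delta> \<subseteq> \<phi> ` \<Delta>"
    "\<And>x. x \<in> \<phi> ` \<Delta> \<Longrightarrow> (\<lambda>k. (F' ^^ k) x) \<longlonglongrightarrow> 0"
    using pc unfolding parabolic_curve_def by (simp_all only:)
  have W: "x \<in> ball 0 r \<times> ball 0 r" "\<pi> x \<in> U" "F (\<pi> x) = \<pi> (F' x)" "fst x \<noteq> 0 \<Longrightarrow> X x \<noteq> 0" if "x \<in> W" for x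
    using that V by (auto simp: W_def)
  have \<phi>W: "\<phi> s \<in> W" if "s \<in> \<Delta>" for s using 1(10) that by blast
  have isCont: "isCont \<pi> 0"
    unfolding \<pi>_def by (intro continuous_Pair germ2_isCont XY)
  have it: "(F ^^ k) (\<pi> x) = \<pi> ((F' ^^ k) x) \<and> (F' ^^ k) x \<in> \<phi> ` \<Delta>" if "x \<in> \<phi> ` \<Delta>" for x k
  proof (induction k)
    case (Suc k)
    then have "(F' ^^ k) x \<in> W" using 1(10) by blast
    then show ?case using Suc W(3) 1(11) by auto
  qed (use that in simp)
  have "parabolic_curve U F \<Delta> (\<pi> \<circ> \<phi>)"
    unfolding parabolic_curve_def
  proof (intro conjI ballI 1)
    show "inj_on (\<pi> \<circ> \<phi>) \<Delta>"
    proof (rule inj_onI)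
      fix s t assume st: "s \<in> \<Delta>" "t \<in> \<Delta>" "(\<pi> \<circ> \<phi>) s = (\<pi> \<circ> \<phi>) t"
      then have "\<phi> s = \<phi> t" by (intro inj(2) nz) (auto simp: \<pi>_def)
      then show "s = t" using 1(5) st by (simp add: inj_on_def)
    qed
    show "(\<lambda>s. fst ((\<pi> \<circ> \<phi>) s)) holomorphic_on \<Delta>"
      using holo2_on_compose[OF r(2) 1(6,7) 1(1)] W(1)[OF \<phi>W] by (simp add: \<pi>_def)
    show "(\<lambda>s. snd ((\<pi> \<circ> \<phi>) s)) holomorphic_on \<Delta>"
      using holo2_on_compose[OF r(3) 1(6,7) 1(1)] W(1)[OF \<phi>W] by (simp add: \<pi>_def)
    show "(\<pi> \<circ> \<phi>) 0 = 0" using 1(8) \<pi>0 by simp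
    show "continuous (at 0 within insert 0 \<Delta>) (\<pi> \<circ> \<phi>)"
      by (rule continuous_within_compose[OF 1(9)]) (use isCont 1(8) in \<open>simp add: continuous_at_imp_continuous_at_within\<close>)
    show "(\<pi> \<circ> \<phi>) ` \<Delta> \<subseteq> U" using W(2)[OF \<phi>W] by auto
    show "F ` (\<pi> \<circ> \<phi>) ` \<Delta> \<subseteq> (\<pi> \<circ> \<phi>) ` \<Delta>"
      unfolding image_comp[symmetric] image_image[of F]
    proof (rule image_subsetI)
      fix x assume x: "x \<in> \<phi> ` \<Delta>"
      then have "F (\<pi> x) = \<pi> (F' x)" "F' x \<in> \<phi> ` \<Delta>"
        using W(3)[OF subsetD[OF 1(10) x]] subsetD[OF 1(11) imageI[OF x]] by simp_all
      then show "F (\<pi> x) \<in> \<pi> ` \<phi> ` \<Delta>" by simp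
    qed
    fix x assume "x \<in> (\<pi> \<circ> \<phi>) ` \<Delta>"
    then have "x \<in> \<pi> ` (\<phi> ` \<Delta>)" by (simp only: image_comp)
    then obtain y where y: "y \<in> \<phi> ` \<Delta>" "x = \<pi> y" by (rule imageE) (rule that)
    have "(\<lambda>k. \<pi> ((F' ^^ k) y)) \<longlonglongrightarrow> \<pi> 0" by (rule isCont_tendsto_compose[OF isCont 1(12)[OF y(1)]])
    then show "(\<lambda>k. (F ^^ k) x) \<longlonglongrightarrow> 0" using it[OF y(1)] y(2) \<pi>0 by simp
  qed
  moreover have "fst ((\<pi> \<circ> \<phi>) s) \<noteq> 0" if "s \<in> \<Delta>" for s
    using W(4)[OF \<phi>W[OF that] nz[OF that]] by (simp add: \<pi>_def)
  ultimately show "\<exists>\<Delta> \<phi>. parabolic_curve U F \<Delta> \<phi> \<and> (\<forall>s\<in>\<Delta>. fst (\<phi> s) \<noteq> 0)" by blast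
qed

lemmas germ2_intros = germ2_const germ2_fst germ2_snd germ2_add germ2_diff germ2_mult germ2_power

lemma germ2_tendsto_0: "germ2 f \<Longrightarrow> (f \<longlongrightarrow> f 0) (nhds 0)"
  using germ2_isCont[of f] by (simp add: isCont_def tendsto_nhds_iff)

lemma germ2_eventually_nonzero: "germ2 f \<Longrightarrow> f 0 \<noteq> 0 \<Longrightarrow> \<forall>\<^sub>F x in nhds 0. f x \<noteq> 0"
  by (rule tendsto_imp_eventually_ne[OF germ2_tendsto_0])

lemma germ_eq_compose2:
  assumes "germ_eq f g" "germ2 X" "germ2 Y" "X 0 = 0" "Y 0 = 0"
  shows "\<forall>\<^sub>F x in nhds 0. f (X x, Y x) = g (X x, Y x)"
proof -
  have "isCont (\<lambda>x. (X x, Y x)) 0" by (intro continuous_Pair germ2_isCont assms)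
  from germ_eq_compose[OF assms(1) this] show ?thesis
    using assms(4,5) by (simp add: germ_eq_def zero_prod_def)
qed

text \<open>Induction on an integer bound for \<open>Re (q 0 / a 0)\<close>. Below 1 the
  small-exponent case applies, and a blow-up reduces the rest to it unless \<open>q 0 = a 0\<close>
  and \<open>p 0 \<noteq> 0\<close>, which is the resonant case with \<open>m = 1\<close>.\<close>

theorem parabolic_curves_nondegenerate:
  fixes a b p q :: "complex \<times> complex \<Rightarrow> complex"
  assumes "germ2 a" "germ2 b" "germ2 p" "germ2 q" "germ_eq b (\<lambda>x. fst x * p x + snd x * q x)"
    and k: "0 < k" and "a 0 \<noteq> 0"
  shows "has_parabolic_curves (\<lambda>x. (fst x + fst x ^ (k + 1) * a x, snd x + fst x ^ k * b x))"
proof -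
  have "has_parabolic_curves (\<lambda>x. (fst x + fst x ^ (k + 1) * a x, snd x + fst x ^ k * b x))"
    if "germ2 a" "germ2 b" "germ2 p" "germ2 q" "germ_eq b (\<lambda>x. fst x * p x + snd x * q x)" "a 0 \<noteq> 0"
      "Re (q 0 / a 0) < real n + 1" for n a b p q
    using that
  proof (induction n arbitrary: a b p q)
    case 0
    then show ?case using k by (intro parabolic_curves_of_small_exponent[of a b p q]) auto
  next
    case (Suc n)
    note germs = Suc.prems(1-4) and b_eq = Suc.prems(5) and a0 = Suc.prems(6)
    show ?case
    proof (cases "q 0 = a 0 \<and> p 0 \<noteq> 0")
      case True
      have "germ_eq a (\<lambda>x. snd x ^ (1 - 1) * a x + fst x * 0)" by (simp add: germ_eq_refl)
      moreover have "germ_eq b (\<lambda>x. snd x ^ 1 * q x + fst x * p x)"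
        using b_eq by (simp only: power_one_right add.commute)
      ultimately show ?thesis
        using True a0 k
        by (intro parabolic_curves_resonant[OF germs(1,2,1,4) germ2_const[of 0] germs(3)]) simp_all
    next
      case False
      \<comment> \<open>The blow-up \<open>y = x (\<eta> + v)\<close> lowers \<open>q 0 / a 0\<close> by one.\<close>
      define v where "v = p 0 / (a 0 - q 0)"
      \<comment> \<open>In the remaining case \<open>q 0 = a 0\<close> also \<open>p 0 = 0\<close>,
        and HOL division by 0 gives \<open>v = 0\<close>, which solves the equation too.\<close>
      have v: "p 0 + v * (q 0 - a 0) = 0" using False by (auto simp: v_def field_simps)
      define Y where "Y x = fst x * (snd x + v)" for x :: "complex \<times> complex"
      have Y: "germ2 Y" "Y 0 = 0" unfolding Y_def by (intro germ2_intros) simp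
      have comp: "germ2 (\<lambda>x. f (fst x, Y x))" if "germ2 f" for f
        by (rule germ2_compose[OF that germ2_fst Y(1)]) (use Y in auto)
      define a' where "a' x = a (fst x, Y x)" for x
      \<comment> \<open>The map multiplies the first coordinate by \<open>d\<close>, so the new
        blown-up coordinate is obtained on division by \<open>d\<close>.\<close>
      define d where "d x = 1 + fst x ^ k * a' x" for x
      define b' where "b' x = (p (fst x, Y x) + (snd x + v) * q (fst x, Y x) - a' x * (snd x + v)) / d x" for x
      have a': "germ2 a'" "a' 0 = a 0" using comp[OF germs(1)] Y by (auto simp: a'_def[abs_def] zero_prod_def)
      have d: "germ2 d" "d 0 = 1" using k unfolding d_def by (auto intro!: germ2_intros a')
      have b': "germ2 b'" unfolding b'_def
        by (intro germ2_divide germ2_intros comp germs a' d) (use d in simp)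
      have b'0: "b' 0 = 0" using v Y a' d by (simp add: b'_def zero_prod_def[symmetric] algebra_simps)
      obtain p' q' where pq': "germ2 p'" "germ2 q'" "germ_eq b' (\<lambda>x. b' 0 + fst x * p' x + snd x * q' x)"
        by (rule germ2_hadamard[OF b'])
      \<comment> \<open>The two Hadamard factors are not unique as germs, but the value
        \<open>q' 0\<close> is fixed by the slice \<open>fst = 0\<close>, on which \<open>b'\<close>
        equals \<open>y * (q 0 - a 0)\<close>.\<close>
      have q'0: "q' 0 = q 0 - a 0"
      proof (rule tendsto_unique[of "at 0"])
        have "filterlim (\<lambda>y. (0::complex, y::complex)) (nhds 0) (at 0)"
          unfolding zero_prod_def by (intro tendsto_Pair tendsto_const tendsto_ident_at)
        from eventually_compose_filterlim[OF pq'(3)[unfolded germ_eq_def] this]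
        have ev: "\<forall>\<^sub>F y in at 0. b' (0, y) = y * q' (0, y)" by (simp add: b'0)
        have "\<forall>\<^sub>F y in at (0::complex). q' (0, y) = q 0 - a 0"
          using ev eventually_neq_at_within[of 0 0]
        proof eventually_elim
          case (elim y)
          have "b' (0, y) = p 0 + (y + v) * (q 0 - a 0)"
            using k by (simp add: b'_def d_def a'_def Y_def zero_prod_def[symmetric] power_0_left algebra_simps)
          also have "\<dots> = y * (q 0 - a 0) + (p 0 + v * (q 0 - a 0))" by (simp add: algebra_simps)
          finally have "b' (0, y) = y * (q 0 - a 0)" unfolding v by simp
          then show ?case using elim by simp
        qed
        then show "((\<lambda>y. q' (0, y)) \<longlongrightarrow> q 0 - a 0) (at 0)" by (rule tendsto_eventually)
        show "((\<lambda>y. q' (0, y)) \<longlongrightarrow> q' 0) (at 0)"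
          by (rule germ2_tendsto[OF pq'(2)]) (auto intro: tendsto_ident_at)
      qed simp
      have IH: "has_parabolic_curves (\<lambda>x. (fst x + fst x ^ (k + 1) * a' x, snd x + fst x ^ k * b' x))"
      proof (rule Suc.IH)
        show "germ_eq b' (\<lambda>x. fst x * p' x + snd x * q' x)" using pq'(3) by (simp add: b'0)
        show "Re (q' 0 / a' 0) < real n + 1"
          using Suc.prems(7) a0 unfolding q'0 a'(2) by (simp add: diff_divide_distrib)
      qed (use a' b' pq' a0 in auto)
      show ?thesis
      proof (rule has_parabolic_curves_semiconj[OF IH germ2_fst Y(1) _ Y(2)])
        show "\<forall>\<^sub>F x in nhds 0. (fst (fst x, Y x) + fst (fst x, Y x) ^ (k + 1) * a (fst x, Y x),
             snd (fst x, Y x) + fst (fst x, Y x) ^ k * b (fst x, Y x)) =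
            (fst (fst x + fst x ^ (k + 1) * a' x, snd x + fst x ^ k * b' x),
             Y (fst x + fst x ^ (k + 1) * a' x, snd x + fst x ^ k * b' x))"
          using germ_eq_compose2[OF b_eq germ2_fst Y(1) _ Y(2)] germ2_eventually_nonzero[OF d(1)] d(2)
        proof -
          have "\<forall>\<^sub>F x in nhds 0. b (fst x, Y x) = fst x * p (fst x, Y x) + Y x * q (fst x, Y x)"
            using germ_eq_compose2[OF b_eq germ2_fst Y(1) _ Y(2)] by simp
          moreover have "\<forall>\<^sub>F x in nhds 0. d x \<noteq> 0" using germ2_eventually_nonzero[OF d(1)] d(2) by simp
          ultimately show ?thesis
          proof eventually_elim
            case (elim x)
            have bd: "b' x * d x = p (fst x, Y x) + (snd x + v) * q (fst x, Y x) - a' x * (snd x + v)"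
              using elim by (simp add: b'_def)
            have "Y (fst x + fst x ^ (k + 1) * a' x, snd x + fst x ^ k * b' x) =
                fst x * (d x * (snd x + v) + fst x ^ k * (b' x * d x))"
              by (simp add: Y_def d_def algebra_simps)
            also have "\<dots> = Y x + fst x ^ k * b (fst x, Y x)"
              unfolding bd elim(1) by (simp add: Y_def d_def algebra_simps)
            finally show ?case by (simp add: a'_def)
          qed
        qed
        show "x = y" if "fst x \<noteq> 0" "fst y \<noteq> 0" "fst x = fst y" "Y x = Y y" for x y
          using that by (intro prod_eqI) (auto simp: Y_def)
      qed auto
    qed
  qed
  moreover obtain n :: nat where n: "Re (q 0 / a 0) < real n" using reals_Archimedean2 by blast
  have "Re (q 0 / a 0) < real n + 1" using n by linarith
  ultimately show ?thesis using assms by blast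
qed

text \<open>For \<open>s > 0\<close> the weight \<open>t = s + 1\<close> balances
  \<open>z * b1\<close> against the first component: with \<open>z = u * w^t\<close> the relative
  increments of \<open>z\<close> and of \<open>w^t\<close> are both of order
  \<open>z^r * w^s\<close>, and they agree at first order if
  \<open>A 0 = t * (\<beta> + u * b1 0)\<close>. The number \<open>\<beta>\<close> records whether
  \<open>w^m * B\<close> is of the same order, that is, whether \<open>t = m\<close>. The solution
  has \<open>u = 0\<close> exactly in the resonant case.\<close>

theorem parabolic_curves_local:
  fixes a b A B a1 b1 :: "complex \<times> complex \<Rightarrow> complex"
  assumes germs: "germ2 a" "germ2 b" "germ2 A" "germ2 B" "germ2 a1" "germ2 b1"
    and a_eq: "germ_eq a (\<lambda>x. snd x ^ s * A x + fst x * a1 x)"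
    and b_eq: "germ_eq b (\<lambda>x. snd x ^ m * B x + fst x * b1 x)"
    and sm: "s < m" and r: "0 < r" and A0: "A 0 \<noteq> 0" and B0: "B 0 \<noteq> 0" and simple: "s = 0 \<or> b1 0 \<noteq> 0"
  shows "has_parabolic_curves (\<lambda>x. (fst x + fst x ^ (r + 1) * a x, snd x + fst x ^ r * b x))"
proof (cases "s = 0")
  case True
  have "germ_eq b (\<lambda>x. fst x * b1 x + snd x * (snd x ^ (m - 1) * B x))"
    using b_eq sm by (simp add: power_eq_if ac_simps)
  moreover have "a 0 \<noteq> 0" using germ_eq_at_0[OF a_eq] True A0 by simp
  ultimately show ?thesis
    using germs r by (intro parabolic_curves_nondegenerate[where p = b1 and q = "\<lambda>x. snd x ^ (m - 1) * B x"]) (auto intro!: germ2_intros)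
next
  case False
  then have \<alpha>: "b1 0 \<noteq> 0" using simple by simp
  define t where "t = s + 1"
  have t: "0 < t" "t \<le> m" "t = Suc s" using sm by (auto simp: t_def)
  define \<beta> where "\<beta> = (if t = m then B 0 else 0)"
  show ?thesis
  proof (cases "A 0 = of_nat t * \<beta>")
    case True
    then have "t = m" using A0 by (auto simp: \<beta>_def split: if_splits)
    then show ?thesis
      using parabolic_curves_resonant[of a b A B a1 b1 m r] germs a_eq b_eq True \<alpha> B0 r t
      by (auto simp: \<beta>_def)
  next
    case False
    have tn: "(of_nat t :: complex) \<noteq> 0" using t(1) by simp
    \<comment> \<open>The value for which the blown-up map \<open>z = w\<^bsup>t\<^esup> (u + d)\<close> fixes the origin.\<close>
    define u where "u = (A 0 - of_nat t * \<beta>) / (of_nat t * b1 0)"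
    have u: "u \<noteq> 0" "\<beta> + u * b1 0 = A 0 / of_nat t"
    proof -
      show "u \<noteq> 0" using False \<alpha> tn by (simp add: u_def)
      have "u * b1 0 = (A 0 - of_nat t * \<beta>) / of_nat t" using \<alpha> tn by (simp add: u_def)
      then show "\<beta> + u * b1 0 = A 0 / of_nat t" using tn by (simp add: diff_divide_distrib)
    qed
    define X where "X x = fst x ^ t * (u + snd x)" for x :: "complex \<times> complex"
    have X: "germ2 X" "X 0 = 0" using t unfolding X_def by (auto intro!: germ2_intros)
    have comp: "germ2 (\<lambda>x. f (X x, fst x))" if "germ2 f" for f
      by (rule germ2_compose[OF that X(1) germ2_fst]) (use X in auto)
    have X00: "(X 0, fst 0) = (0 :: complex \<times> complex)" using X by (simp add: zero_prod_def)
    \<comment> \<open>The increment of \<open>w\<close> is \<open>z^r * b\<close>; as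
      \<open>z\<close> is of order \<open>t\<close> in \<open>w\<close> and \<open>b\<close> of
      order at least \<open>t\<close>, it becomes \<open>w^(t * r + t) * a'\<close>.\<close>
    define k where "k = t * r + s"
    have k: "0 < k" "k + 1 = t * r + t" using t r by (auto simp: k_def)
    define a' where "a' x = (u + snd x) ^ r * (fst x ^ (m - t) * B (X x, fst x) + (u + snd x) * b1 (X x, fst x))" for x
    define c where "c x = (u + snd x) ^ r * (A (X x, fst x) + fst x * (u + snd x) * a1 (X x, fst x))" for x
    define d where "d x = 1 + fst x ^ k * a' x" for x
    \<comment> \<open>The new second coordinate satisfies
      \<open>d^t * (u + y') = (u + y) * (1 + w^k * c)\<close>. The geometric sum writes
      \<open>d^t - 1\<close> as a multiple of \<open>d - 1 = w^k * a'\<close>, so that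
      \<open>w^k\<close> can be divided out of \<open>y' - y\<close>.\<close>
    define b' where "b' x = (u + snd x) * (c x - a' x * (\<Sum>i<t. d x ^ i)) / d x ^ t" for x
    have a': "germ2 a'" unfolding a'_def by (intro germ2_intros comp germs)
    \<comment> \<open>Here \<open>0 ^ 0 = 1\<close> matches the case distinction in
      \<open>\<beta>\<close>.\<close>
    have "fst (0 :: complex \<times> complex) ^ (m - t) * B (X 0, fst 0) = \<beta>"
      using t(2) X00 by (auto simp: \<beta>_def power_0_left)
    then have a'0: "a' 0 = u ^ r * A 0 / of_nat t" using u(2) unfolding a'_def X00 by simp
    have a'nz: "a' 0 \<noteq> 0" using a'0 u A0 tn by simp
    have c: "germ2 c" unfolding c_def by (intro germ2_intros comp germs)
    have c0: "c 0 = u ^ r * A 0" unfolding c_def X00 by simp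
    have d: "germ2 d" "d 0 = 1" using k unfolding d_def by (auto intro!: germ2_intros a')
    have ds: "germ2 (\<lambda>x. \<Sum>i<n. d x ^ i)" for n
      by (induction n) (auto intro!: germ2_intros d)
    have b': "germ2 b'" unfolding b'_def
      by (intro germ2_divide germ2_intros a' c d ds) (use d in simp)
    have b'0: "b' 0 = 0" using tn by (simp add: b'_def c0 a'0 d)
    obtain p' q' where pq': "germ2 p'" "germ2 q'" "germ_eq b' (\<lambda>x. b' 0 + fst x * p' x + snd x * q' x)"
      by (rule germ2_hadamard[OF b'])
    have pc: "has_parabolic_curves (\<lambda>x. (fst x + fst x ^ (k + 1) * a' x, snd x + fst x ^ k * b' x))"
      using pq' b'0 a' b' a'nz k by (intro parabolic_curves_nondegenerate[where p = p' and q = q']) auto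
    show ?thesis
    proof (rule has_parabolic_curves_semiconj[OF pc X(1) germ2_fst X(2)])
      have 1: "\<forall>\<^sub>F x in nhds 0. a (X x, fst x) = fst x ^ s * A (X x, fst x) + X x * a1 (X x, fst x)"
        using germ_eq_compose2[OF a_eq X(1) germ2_fst X(2)] by simp
      have 2: "\<forall>\<^sub>F x in nhds 0. b (X x, fst x) = fst x ^ m * B (X x, fst x) + X x * b1 (X x, fst x)"
        using germ_eq_compose2[OF b_eq X(1) germ2_fst X(2)] by simp
      have 3: "\<forall>\<^sub>F x in nhds 0. d x \<noteq> 0" using germ2_eventually_nonzero[OF d(1)] d(2) by simp
      show "\<forall>\<^sub>F x in nhds 0. (fst (X x, fst x) + fst (X x, fst x) ^ (r + 1) * a (X x, fst x),
           snd (X x, fst x) + fst (X x, fst x) ^ r * b (X x, fst x)) =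
          (X (fst x + fst x ^ (k + 1) * a' x, snd x + fst x ^ k * b' x),
           fst (fst x + fst x ^ (k + 1) * a' x, snd x + fst x ^ k * b' x))"
        using 1 2 3
      proof eventually_elim
        case (elim x)
        define w where "w = fst x"
        define y where "y = u + snd x"
        have Xx: "X x = w ^ t * y" by (simp add: X_def w_def y_def)
        have "b (X x, fst x) = w ^ t * (w ^ (m - t) * B (X x, fst x) + y * b1 (X x, fst x))"
          unfolding elim(2) using t(2) by (simp add: Xx w_def[symmetric] distrib_left mult.assoc[symmetric] power_add[symmetric])
        then have "X x ^ r * b (X x, fst x) = w ^ (k + 1) * a' x"
          unfolding k(2) by (simp add: Xx a'_def w_def[symmetric] y_def[symmetric] power_mult_distrib power_mult power_add)
        then have s: "fst x + X x ^ r * b (X x, fst x) = w * d x" by (simp add: d_def w_def[symmetric] algebra_simps)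
        have "a (X x, fst x) = w ^ s * (A (X x, fst x) + w * y * a1 (X x, fst x))"
          unfolding elim(1) by (simp add: Xx t(3) w_def[symmetric] algebra_simps)
        then have "X x ^ r * a (X x, fst x) = w ^ k * c x"
          by (simp add: Xx c_def k_def w_def[symmetric] y_def[symmetric] power_mult_distrib power_mult power_add)
        then have f: "X x + X x ^ (r + 1) * a (X x, fst x) = X x * (1 + w ^ k * c x)"
          by (simp add: algebra_simps)
        have "d x ^ t - 1 = (d x - 1) * (\<Sum>i<t. d x ^ i)" by (rule power_diff_1_eq)
        then have dt: "w ^ k * (a' x * (\<Sum>i<t. d x ^ i)) = d x ^ t - 1" by (simp add: d_def w_def mult.assoc)
        have "d x ^ t * (y + w ^ k * b' x) = y * d x ^ t + y * (w ^ k * c x - w ^ k * (a' x * (\<Sum>i<t. d x ^ i)))"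
          using elim(3) by (simp add: b'_def y_def[symmetric] field_simps)
        also have "\<dots> = y * (1 + w ^ k * c x)" unfolding dt by (simp add: algebra_simps)
        finally have "(w * d x) ^ t * (y + w ^ k * b' x) = X x * (1 + w ^ k * c x)"
          by (simp add: Xx power_mult_distrib)
        moreover have "X (fst x + fst x ^ (k + 1) * a' x, snd x + fst x ^ k * b' x) = (w * d x) ^ t * (y + w ^ k * b' x)"
          by (simp add: X_def w_def y_def d_def algebra_simps)
        moreover have "fst x + fst x ^ (k + 1) * a' x = w * d x" by (simp add: w_def d_def algebra_simps)
        ultimately show ?case using s f by simp
      qed
      have "\<forall>\<^sub>F x :: complex \<times> complex in nhds 0. u + snd x \<noteq> 0"
        using germ2_eventually_nonzero[OF germ2_add[OF germ2_const germ2_snd], of u] u by simp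
      then show "\<forall>\<^sub>F x in nhds 0. fst x \<noteq> 0 \<longrightarrow> X x \<noteq> 0" by eventually_elim (simp add: X_def)
      show "x = y" if "fst x \<noteq> 0" "fst y \<noteq> 0" "X x = X y" "fst x = fst y" for x y
        using that by (intro prod_eqI) (auto simp: X_def)
    qed simp
  qed
qed


section \<open>The order of a germ\<close>

text \<open>A growth condition in place of the order: it passes to products and differences without
  touching coefficients, and \<open>order_at_O_ge_iff\<close> ties it to
  \<open>order_at_O\<close>.\<close>

definition norm_order_ge :: "(complex \<times> complex \<Rightarrow> complex) \<Rightarrow> nat \<Rightarrow> bool" where
  "norm_order_ge g d \<longleftrightarrow> (\<exists>C. \<forall>\<^sub>F x in nhds 0. cmod (g x) \<le> C * norm x ^ d)"

lemma power_series_diff: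
  assumes "power_series_at_O g a" "power_series_at_O h b"
  shows "power_series_at_O (\<lambda>x. g x - h x) (\<lambda>m n. a m n - b m n)"
proof -
  obtain r s where r: "r > 0" "\<And>z w. cmod z < r \<Longrightarrow> cmod w < r \<Longrightarrow> ((\<lambda>(m, n). a m n * z ^ m * w ^ n) has_sum g (z, w)) UNIV"
    and s: "s > 0" "\<And>z w. cmod z < s \<Longrightarrow> cmod w < s \<Longrightarrow> ((\<lambda>(m, n). b m n * z ^ m * w ^ n) has_sum h (z, w)) UNIV"
    using assms unfolding power_series_at_O_def by blast
  have "((\<lambda>(m, n). (a m n - b m n) * z ^ m * w ^ n) has_sum (g (z, w) - h (z, w))) UNIV"
    if "cmod z < min r s" "cmod w < min r s" for z w
    using has_sum_add[OF r(2)[of z w] has_sum_cmult_right[OF s(2)[of z w], of "- 1"]] that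
    by (simp add: case_prod_unfold left_diff_distrib)
  then show ?thesis unfolding power_series_at_O_def using r(1) s(1) by (intro exI[of _ "min r s"]) auto
qed

text \<open>The absolute series is evaluated once, at \<open>(\<rho>, \<rho>)\<close>. At a point
  whose coordinates are at most \<open>t * \<rho>\<close> with \<open>t \<le> 1\<close>, every term
  of degree at least \<open>d\<close> gains the factor \<open>t^d\<close>.\<close>

lemma power_series_norm_order:
  assumes "power_series_at_O g a" "\<And>m n. m + n < d \<Longrightarrow> a m n = 0"
  shows "norm_order_ge g d"
proof -
  obtain r where r: "r > 0" "\<And>z w. cmod z < r \<Longrightarrow> cmod w < r \<Longrightarrow> ((\<lambda>(m, n). a m n * z ^ m * w ^ n) has_sum g (z, w)) UNIV"
    using assms(1) unfolding power_series_at_O_def by blast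
  define \<rho> where "\<rho> = r / 2"
  have \<rho>: "0 < \<rho>" "\<rho> < r" using r(1) by (auto simp: \<rho>_def)
  let ?f = "\<lambda>z w (m, n). a m n * z ^ m * w ^ n"
  have "?f (of_real \<rho>) (of_real \<rho>) summable_on UNIV"
    using r(2)[of "of_real \<rho>" "of_real \<rho>"] \<rho> by (auto simp: summable_on_def)
  then have abs: "(\<lambda>p. norm (?f (of_real \<rho>) (of_real \<rho>) p)) summable_on UNIV"
    by (simp add: summable_on_iff_abs_summable_on_complex)
  define M where "M = infsum (\<lambda>p. norm (?f (of_real \<rho>) (of_real \<rho>) p)) UNIV"
  have "cmod (g (z, w)) \<le> M / \<rho> ^ d * norm (z, w) ^ d" if z: "cmod z < \<rho>" and w: "cmod w < \<rho>" for z w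
  proof -
    define s where "s = norm (z, w) / \<rho>"
    define t where "t = max (cmod z) (cmod w) / \<rho>"
    have t: "0 \<le> t" "t \<le> 1" "cmod z \<le> t * \<rho>" "cmod w \<le> t * \<rho>" "t \<le> s"
      using \<rho> z w norm_fst_le[of z w] norm_snd_le[of w z]
      by (auto simp: t_def s_def divide_right_mono le_max_iff_disj)
    have le: "norm (?f z w p) \<le> t ^ d * norm (?f (of_real \<rho>) (of_real \<rho>) p)" for p
    proof (cases p)
      case (Pair m n)
      show ?thesis
      proof (cases "m + n < d")
        case True then show ?thesis using assms(2) Pair by simp
      next
        case False
        have "cmod z ^ m * cmod w ^ n \<le> (t * \<rho>) ^ m * (t * \<rho>) ^ n"
          using t \<rho> by (intro mult_mono power_mono mult_nonneg_nonneg zero_le_power) auto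
        also have "\<dots> = t ^ (m + n) * (\<rho> ^ m * \<rho> ^ n)" by (simp add: power_mult_distrib power_add)
        also have "\<dots> \<le> t ^ d * (\<rho> ^ m * \<rho> ^ n)"
          using t False \<rho> by (intro mult_right_mono power_decreasing) auto
        finally have "cmod (a m n) * (cmod z ^ m * cmod w ^ n) \<le> cmod (a m n) * (t ^ d * (\<rho> ^ m * \<rho> ^ n))"
          by (rule mult_left_mono) simp
        then show ?thesis using Pair \<rho> by (simp add: norm_mult norm_power ac_simps)
      qed
    qed
    have hs: "(?f z w has_sum g (z, w)) UNIV" using r(2)[of z w] z w \<rho> by simp
    have "((\<lambda>p. t ^ d * norm (?f (of_real \<rho>) (of_real \<rho>) p)) has_sum (t ^ d * M)) UNIV"
      unfolding M_def by (intro has_sum_cmult_right has_sum_infsum abs)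
    moreover have abs': "(\<lambda>p. norm (?f z w p)) summable_on UNIV"
      using hs summable_on_iff_abs_summable_on_complex summable_on_def by blast
    ultimately have "(\<Sum>\<^sub>\<infinity>p. norm (?f z w p)) \<le> t ^ d * M"
      by (intro has_sum_mono[OF has_sum_infsum[OF abs'] _ le])
    then have "cmod (g (z, w)) \<le> t ^ d * M"
      using norm_has_sum_bound[OF has_sum_infsum[OF abs'] hs] by linarith
    also have "\<dots> \<le> s ^ d * M"
      using t by (intro mult_right_mono power_mono) (auto simp: M_def infsum_nonneg)
    finally show ?thesis by (simp add: s_def power_divide mult.commute)
  qed
  then show ?thesis unfolding norm_order_ge_def eventually_nhds_bidisc using \<rho> by blast
qed

text \<open>On the ray through \<open>(z, 1)\<close> the form scales like \<open>t^e\<close> and its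
  bound like \<open>t^(e + 1)\<close>, so its value at \<open>(z, 1)\<close> is 0. This holds for
  every \<open>z\<close>, and a polynomial vanishing everywhere has zero coefficients.\<close>

lemma homogeneous_part_eq_0:
  assumes "norm_order_ge (\<lambda>x. \<Sum>m\<le>e. \<alpha> m * fst x ^ m * snd x ^ (e - m)) (Suc e)" "m \<le> e"
  shows "\<alpha> m = 0"
proof -
  obtain C r where r: "r > 0" "\<And>z w. cmod z < r \<Longrightarrow> cmod w < r \<Longrightarrow>
      cmod (\<Sum>m\<le>e. \<alpha> m * z ^ m * w ^ (e - m)) \<le> C * norm (z, w) ^ Suc e"
    using assms(1) unfolding norm_order_ge_def eventually_nhds_bidisc by auto
  have "(\<Sum>m\<le>e. \<alpha> m * z ^ m) = 0" for z
  proof -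
    let ?q = "\<Sum>m\<le>e. \<alpha> m * z ^ m"
    have le: "cmod ?q \<le> C * norm (z, 1::complex) ^ Suc e * t" if t: "0 < t" "t * (cmod z + 1) < r" for t :: real
    proof -
      have tz: "cmod (of_real t * z) < r" "cmod (of_real t :: complex) < r"
        using t by (simp_all add: norm_mult distrib_left) (smt (verit) mult_nonneg_nonneg norm_ge_zero)+
      have "(of_real t) ^ e * ?q = (\<Sum>m\<le>e. \<alpha> m * (of_real t * z) ^ m * (of_real t) ^ (e - m))"
        unfolding sum_distrib_left
      proof (rule sum.cong)
        fix m assume "m \<in> {..e}"
        then have "(of_real t :: complex) ^ e = of_real t ^ m * of_real t ^ (e - m)"
          by (simp add: power_add[symmetric])
        then show "of_real t ^ e * (\<alpha> m * z ^ m) = \<alpha> m * (of_real t * z) ^ m * of_real t ^ (e - m)"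
          by (simp add: power_mult_distrib)
      qed simp
      then have "cmod ((of_real t) ^ e * ?q) \<le> C * norm (of_real t * z, of_real t :: complex) ^ Suc e"
        using r(2)[OF tz] by simp
      also have "(of_real t * z, of_real t :: complex) = t *\<^sub>R (z, 1)" by (simp add: scaleR_conv_of_real)
      also have "norm (t *\<^sub>R (z, 1::complex)) = t * norm (z, 1::complex)"
        using t norm_scaleR[of t "(z, 1::complex)"] by (simp del: scaleR_Pair)
      finally have "t ^ e * cmod ?q \<le> t ^ e * (C * norm (z, 1::complex) ^ Suc e * t)"
        using t by (simp add: norm_mult norm_power power_mult_distrib ac_simps)
      then show ?thesis using t by simp
    qed
    have "((\<lambda>t. C * norm (z, 1::complex) ^ Suc e * t) \<longlongrightarrow> C * norm (z, 1::complex) ^ Suc e * 0) (at_right 0)"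
      by (intro tendsto_intros)
    moreover have "\<forall>\<^sub>F t in at_right 0. cmod ?q \<le> C * norm (z, 1::complex) ^ Suc e * t"
    proof -
      have "0 < r / (cmod z + 1)" using r(1) by (simp add: add_nonneg_pos)
      then have "\<forall>\<^sub>F t in at_right 0. t \<in> {0<..<r / (cmod z + 1)}" by (rule eventually_at_right_real)
      then show ?thesis
        by eventually_elim (intro le, auto simp: pos_less_divide_eq add_nonneg_pos)
    qed
    ultimately have "cmod ?q \<le> C * norm (z, 1::complex) ^ Suc e * 0"
      by (intro tendsto_lowerbound) auto
    then show ?thesis by simp
  qed
  then show ?thesis using assms(2) polyfun_eq_0[where c = \<alpha> and n = e] by blast
qed

lemma norm_order_ge_mono: "norm_order_ge g d \<Longrightarrow> e \<le> d \<Longrightarrow> norm_order_ge g e"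
proof -
  assume "norm_order_ge g d" and ed: "e \<le> d"
  then obtain C where "\<forall>\<^sub>F x in nhds 0. cmod (g x) \<le> C * norm x ^ d" unfolding norm_order_ge_def by blast
  moreover have "\<forall>\<^sub>F x :: complex \<times> complex in nhds 0. x \<in> ball 0 1" by (intro eventually_nhds_in_open) auto
  ultimately have "\<forall>\<^sub>F x in nhds 0. cmod (g x) \<le> \<bar>C\<bar> * norm x ^ e"
  proof eventually_elim
    case (elim x)
    have "C * norm x ^ d \<le> \<bar>C\<bar> * norm x ^ d" by (intro mult_right_mono) auto
    also have "\<dots> \<le> \<bar>C\<bar> * norm x ^ e" using elim ed by (intro mult_left_mono power_decreasing) auto
    finally show ?case using elim by simp
  qed
  then show "norm_order_ge g e" unfolding norm_order_ge_def by blast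
qed

lemma norm_order_ge_diff:
  assumes "norm_order_ge g d" "norm_order_ge h d" shows "norm_order_ge (\<lambda>x. g x - h x) d"
proof -
  obtain C D where "\<forall>\<^sub>F x in nhds 0. cmod (g x) \<le> C * norm x ^ d" "\<forall>\<^sub>F x in nhds 0. cmod (h x) \<le> D * norm x ^ d"
    using assms unfolding norm_order_ge_def by blast
  then have "\<forall>\<^sub>F x in nhds 0. cmod (g x - h x) \<le> (C + D) * norm x ^ d"
  proof eventually_elim
    case (elim x)
    then show ?case using norm_triangle_ineq4[of "g x" "h x"] by (simp add: distrib_right)
  qed
  then show ?thesis unfolding norm_order_ge_def by blast
qed

text \<open>Induction on the degree: once the lower coefficients vanish, subtracting the form of
  degree \<open>e\<close> leaves order at least \<open>e + 1\<close>, so the form itself has that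
  order.\<close>

lemma norm_order_ge_coeff:
  assumes "power_series_at_O g a" "norm_order_ge g d" "m + n < d"
  shows "a m n = 0"
proof -
  have "\<forall>m n. m + n = e \<longrightarrow> a m n = 0" if "e < d" for e
    using that
  proof (induction e rule: less_induct)
    case (less e)
    define P where "P x = (\<Sum>m\<le>e. a m (e - m) * fst x ^ m * snd x ^ (e - m))" for x :: "complex \<times> complex"
    have "((\<lambda>(m, n). (if m + n = e then a m n else 0) * z ^ m * w ^ n) has_sum P (z, w)) UNIV" for z w
    proof (rule has_sum_finite_neutralI)
      show "finite ((\<lambda>m. (m, e - m)) ` {..e})" by simp
      show "P (z, w) = (\<Sum>p\<in>(\<lambda>m. (m, e - m)) ` {..e}. case p of (m, n) \<Rightarrow> (if m + n = e then a m n else 0) * z ^ m * w ^ n)"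
        by (subst sum.reindex) (auto simp: inj_on_def P_def)
      show "(case p of (m, n) \<Rightarrow> (if m + n = e then a m n else 0) * z ^ m * w ^ n) = 0"
        if "p \<in> UNIV - (\<lambda>m. (m, e - m)) ` {..e}" for p
      proof (cases p)
        case (Pair m n)
        have "m + n \<noteq> e" using that Pair by (force simp: image_iff)
        then show ?thesis using Pair by simp
      qed
    qed auto
    then have P: "power_series_at_O P (\<lambda>m n. if m + n = e then a m n else 0)"
      unfolding power_series_at_O_def by (intro exI[of _ 1]) auto
    have "norm_order_ge (\<lambda>x. g x - P x) (Suc e)"
      by (rule power_series_norm_order[OF power_series_diff[OF assms(1) P]])
         (use less in \<open>auto simp: less_Suc_eq\<close>)
    moreover have "norm_order_ge g (Suc e)" using norm_order_ge_mono[OF assms(2)] less by simp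
    ultimately have "norm_order_ge P (Suc e)" using norm_order_ge_diff[of g "Suc e" "\<lambda>x. g x - P x"] by simp
    then have "a m (e - m) = 0" if "m \<le> e" for m
      using homogeneous_part_eq_0[where \<alpha> = "\<lambda>m. a m (e - m)" and e = e] that unfolding P_def[abs_def] by blast
    then show ?case by (metis add_diff_cancel_left' le_add1)
  qed
  then show ?thesis using assms(3) by blast
qed

text \<open>Gives meaning to the definite description in \<open>coeff_at_O\<close>. The difference
  of the two series represents 0, which has every order.\<close>

lemma power_series_unique:
  assumes "power_series_at_O g a" "power_series_at_O g b" shows "a = b"
proof (intro ext)
  fix m n
  have "norm_order_ge (\<lambda>x. g x - g x) (Suc (m + n))"
    unfolding norm_order_ge_def by (intro exI[of _ 0]) simp
  then have "a m n - b m n = 0"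
    by (intro norm_order_ge_coeff[OF power_series_diff[OF assms], of "Suc (m + n)"]) auto
  then show "a m n = b m n" by simp
qed

text \<open>Expansion in \<open>z\<close> with coefficients \<open>c m w\<close>, which are Cauchy
  integrals and thus holomorphic in \<open>w\<close>, followed by expansion in \<open>w\<close>. The
  Cauchy bounds \<open>M / s^m / s^n\<close> give absolute summability, which turns the iterated sum
  into a sum over pairs.\<close>

lemma germ2_power_series:
  assumes "germ2 g" obtains a where "power_series_at_O g a"
proof -
  obtain r where r: "r > 0" "holo2_on (ball 0 r \<times> ball 0 r) g" using assms by (rule germ2_bidisc)
  define s where "s = r / 2"
  have s: "0 < s" "s < r" using r by (auto simp: s_def)
  have "compact (g ` (cball 0 s \<times> cball 0 s))"
    using s by (intro compact_continuous_image compact_Times continuous_on_subset[OF holo2_on_imp_continuous_on[OF r(2)]]) auto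
  then obtain M where M: "\<And>z w. cmod z \<le> s \<Longrightarrow> cmod w \<le> s \<Longrightarrow> cmod (g (z, w)) \<le> M"
    using compact_imp_bounded bounded_iff by (metis (no_types, lifting) SigmaI image_eqI mem_cball_0)
  define c where "c m w = (deriv ^^ m) (\<lambda>z. g (z, w)) 0 / fact m" for m w
  have hz: "(\<lambda>z. g (z, w)) holomorphic_on ball 0 r" if "cmod w < r" for w
    using that by (intro holo2_on_compose[OF r(2)] holomorphic_intros) auto
  have hz': "(\<lambda>z. g (z, w)) holomorphic_on ball 0 s" "continuous_on (cball 0 s) (\<lambda>z. g (z, w))" if "cmod w < r" for w
    using s by (auto intro!: holomorphic_on_imp_continuous_on holomorphic_on_subset[OF hz[OF that]])
  have c_sums: "(\<lambda>m. c m w * z ^ m) sums g (z, w)" if "cmod z < s" "cmod w < r" for z w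
    using holomorphic_power_series[OF hz'(1)[OF that(2)], of z] that by (simp add: c_def)
  have c_bound: "cmod (c m w) \<le> M / s ^ m" if "cmod w \<le> s" for m w
  proof -
    have "cmod ((deriv ^^ m) (\<lambda>z. g (z, w)) 0) \<le> fact m * M / s ^ m"
      using that s by (intro Cauchy_inequality hz' M) auto
    then show ?thesis by (simp add: c_def norm_divide field_simps)
  qed
  have c_hol: "c m holomorphic_on ball 0 r" for m
  proof -
    have eq: "contour_integral (circlepath 0 s) (\<lambda>u. g (u, w) / u ^ Suc m) / (2 * pi * \<i>) = c m w" if "w \<in> ball 0 r" for w
      using Cauchy_has_contour_integral_higher_derivative_circlepath[OF hz'(2,1), of w 0 m, THEN contour_integral_unique] that s
      by (simp add: c_def field_simps)
    have "(\<lambda>w. contour_integral (circlepath 0 s) (\<lambda>u. g (u, w) / u ^ Suc m)) holomorphic_on ball 0 r"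
    proof (rule holomorphic_on_contour_integral_circlepath)
      have "continuous_on (ball 0 r \<times> sphere 0 s) (g \<circ> prod.swap)"
      proof (rule continuous_on_compose[OF continuous_on_swap])
        show "continuous_on (prod.swap ` (ball 0 r \<times> sphere 0 s)) g"
          using s by (intro continuous_on_subset[OF holo2_on_imp_continuous_on[OF r(2)]]) auto
      qed
      then show "continuous_on (ball 0 r \<times> sphere 0 s) (\<lambda>(w, u). g (u, w) / u ^ Suc m)"
        unfolding case_prod_unfold o_def prod.swap_def using s by (intro continuous_intros) auto
      fix u :: complex assume "u \<in> sphere 0 s"
      then show "(\<lambda>w. g (u, w) / u ^ Suc m) holomorphic_on ball 0 r"
        using s by (intro holomorphic_intros holo2_on_compose[OF r(2)]) auto
    qed (use s in auto)
    then have "(\<lambda>w. contour_integral (circlepath 0 s) (\<lambda>u. g (u, w) / u ^ Suc m) / (2 * pi * \<i>)) holomorphic_on ball 0 r"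
      by (intro holomorphic_intros) auto
    then show ?thesis by (rule holomorphic_transform) (rule eq)
  qed
  define a where "a m n = (deriv ^^ n) (c m) 0 / fact n" for m n
  have a_sums: "(\<lambda>n. a m n * w ^ n) sums c m w" if "cmod w < s" for m w
  proof -
    have "c m holomorphic_on ball 0 s" using s by (intro holomorphic_on_subset[OF c_hol] subset_ball) auto
    from holomorphic_power_series[OF this, of w] that show ?thesis by (simp add: a_def)
  qed
  have a_bound: "cmod (a m n) \<le> M / s ^ m / s ^ n" for m n
  proof -
    have "cmod ((deriv ^^ n) (c m) 0) \<le> fact n * (M / s ^ m) / s ^ n"
      using s by (intro Cauchy_inequality c_bound holomorphic_on_imp_continuous_on holomorphic_on_subset[OF c_hol]) auto
    then show ?thesis by (simp add: a_def norm_divide field_simps)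
  qed
  have "((\<lambda>(m, n). a m n * z ^ m * w ^ n) has_sum g (z, w)) UNIV" if z: "cmod z < s" and w: "cmod w < s" for z w
  proof -
    let ?x = "cmod z / s" and ?y = "cmod w / s"
    have xy: "0 \<le> ?x" "?x < 1" "0 \<le> ?y" "?y < 1" using z w s by auto
    have M0: "0 \<le> M" using order_trans[OF norm_ge_zero M[of 0 0]] s by simp
    have tb: "cmod (a m n * z ^ m * w ^ n) \<le> M * (?x ^ m * ?y ^ n)" for m n
      using mult_right_mono[OF a_bound[of m n], of "cmod z ^ m * cmod w ^ n"]
      by (simp add: norm_mult norm_power power_divide ac_simps)
    have gx: "summable (\<lambda>m. norm (?x ^ m))" "summable (\<lambda>m. norm (?y ^ m))"
      using xy by (simp_all add: norm_power summable_geometric)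
    have geo: "((\<lambda>n. q ^ n) has_sum (1 / (1 - q))) UNIV" if "0 \<le> q" "q < 1" for q :: real
      using that by (intro norm_summable_imp_has_sum geometric_sums) (auto simp: norm_power summable_geometric)
    have row: "((\<lambda>n. M * (?x ^ m * ?y ^ n)) has_sum (M / (1 - ?y)) * ?x ^ m) UNIV" for m
      using has_sum_cmult_right[OF geo[OF xy(3,4)], of "M * ?x ^ m"] by (simp add: ac_simps)
    have rows: "((\<lambda>m. (M / (1 - ?y)) * ?x ^ m) has_sum (M / (1 - ?y)) * (1 / (1 - ?x))) UNIV"
      by (intro has_sum_cmult_right geo xy)
    have nn: "norm (M * (?x ^ m * ?y ^ n)) = M * (?x ^ m * ?y ^ n)" for m n
      using M0 xy by (simp only: real_norm_def abs_of_nonneg mult_nonneg_nonneg zero_le_power)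
    have inf: "(\<Sum>\<^sub>\<infinity>n. norm (M * (?x ^ m * ?y ^ n))) = (M / (1 - ?y)) * ?x ^ m" for m
      unfolding nn by (rule infsumI[OF row])
    have rown: "(\<lambda>n. norm (M * (?x ^ m * ?y ^ n))) summable_on UNIV" for m
      unfolding nn by (rule has_sum_imp_summable[OF row])
    have "(\<lambda>p. norm (M * (?x ^ fst p * ?y ^ snd p))) summable_on UNIV \<times> UNIV"
      unfolding Infinite_Sum.abs_summable_on_Sigma_iff fst_conv snd_conv inf
      using rown iffD1[OF summable_on_iff_abs_summable_on_real has_sum_imp_summable[OF rows]] by simp
    then have "(\<lambda>p. norm (a (fst p) (snd p) * z ^ fst p * w ^ snd p)) summable_on UNIV \<times> UNIV"
      by (rule Infinite_Sum.abs_summable_on_comparison_test) (simp only: nn tb)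
    then have sm: "(\<lambda>p. a (fst p) (snd p) * z ^ fst p * w ^ snd p) summable_on UNIV \<times> UNIV"
      by (rule abs_summable_summable)
    have 1: "((\<lambda>n. a m n * z ^ m * w ^ n) has_sum (c m w * z ^ m)) UNIV" for m
    proof (rule norm_summable_imp_has_sum)
      show "summable (\<lambda>n. norm (a m n * z ^ m * w ^ n))"
        by (rule summable_comparison_test'[where g = "\<lambda>n. M * (?x ^ m * ?y ^ n)" and N = 0])
          (use tb summable_mult[OF summable_mult[OF summable_norm_cancel[OF gx(2)]], of M "?x ^ m"] in \<open>simp_all only: real_norm_def abs_norm_cancel\<close>)
      show "(\<lambda>n. a m n * z ^ m * w ^ n) sums (c m w * z ^ m)"
        using sums_mult2[OF a_sums[OF w], of m "z ^ m"] by (simp add: ac_simps)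
    qed
    have 2: "((\<lambda>m. c m w * z ^ m) has_sum g (z, w)) UNIV"
    proof (rule norm_summable_imp_has_sum)
      have cb: "norm (c m w * z ^ m) \<le> M * ?x ^ m" for m
        using mult_right_mono[OF c_bound[of w m], of "cmod z ^ m"] w
        by (simp add: norm_mult norm_power power_divide)
      show "summable (\<lambda>m. norm (c m w * z ^ m))"
        by (rule summable_comparison_test'[where g = "\<lambda>m. M * ?x ^ m" and N = 0])
          (use cb summable_mult[OF summable_norm_cancel[OF gx(1)], of M] in \<open>simp_all only: real_norm_def abs_norm_cancel\<close>)
      show "(\<lambda>m. c m w * z ^ m) sums g (z, w)" using c_sums[of z w] z w s by simp
    qed
    have "((\<lambda>m. c m w * z ^ m) has_sum (\<Sum>\<^sub>\<infinity>p. a (fst p) (snd p) * z ^ fst p * w ^ snd p)) UNIV"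
      using has_sum_SigmaD[OF has_sum_infsum[OF sm], of "\<lambda>m. c m w * z ^ m"] 1 by simp
    then have "(\<Sum>\<^sub>\<infinity>p. a (fst p) (snd p) * z ^ fst p * w ^ snd p) = g (z, w)" using 2 has_sum_unique by blast
    then show ?thesis using has_sum_infsum[OF sm] by (simp add: case_prod_unfold)
  qed
  then have "power_series_at_O g a" unfolding power_series_at_O_def using s by blast
  then show ?thesis by (rule that)
qed

lemma order_at_O_ge_iff:
  assumes "germ2 g"
  shows "enat d \<le> order_at_O g \<longleftrightarrow> norm_order_ge g d"
proof -
  obtain a where a: "power_series_at_O g a" using assms by (rule germ2_power_series)
  have c: "coeff_at_O g = a"
    unfolding coeff_at_O_def using a power_series_unique by blast
  have "enat d \<le> order_at_O g \<longleftrightarrow> (\<forall>m n. a m n \<noteq> 0 \<longrightarrow> d \<le> m + n)"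
    unfolding order_at_O_def c le_Inf_iff by (auto; metis enat_ord_simps(1))
  also have "\<dots> \<longleftrightarrow> norm_order_ge g d"
    using power_series_norm_order[OF a, of d] norm_order_ge_coeff[OF a, of d] by (meson not_le)
  finally show ?thesis .
qed


section \<open>Zero branches of a germ\<close>

lemma holomorphic_on_deriv_slice:
  assumes b: "holo2_on (ball 0 R \<times> ball 0 R) b" and w: "w \<in> ball 0 R"
  shows "(\<lambda>z. deriv (\<lambda>u. b (z, u)) w) holomorphic_on ball 0 R"
proof -
  obtain s where s: "0 < s" "cball w s \<subseteq> ball 0 R"
    using w open_contains_cball_eq[OF open_ball] by blast
  have s': "ball w s \<subseteq> ball 0 R" using ball_subset_cball s(2) by blast
  have eq: "contour_integral (circlepath w s) (\<lambda>u. b (z, u) / (u - w) ^ Suc 1) / (2 * pi * \<i>) = deriv (\<lambda>u. b (z, u)) w"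
    if z: "z \<in> ball 0 R" for z
  proof -
    have h: "(\<lambda>u. b (z, u)) holomorphic_on ball 0 R"
      using z by (intro holo2_on_compose[OF b] holomorphic_intros) auto
    have "((\<lambda>u. b (z, u) / (u - w) ^ Suc 1) has_contour_integral (2 * pi * \<i>) / fact 1 * (deriv ^^ 1) (\<lambda>u. b (z, u)) w)
        (circlepath w s)"
      using s s' by (intro Cauchy_has_contour_integral_higher_derivative_circlepath)
        (auto intro: holomorphic_on_imp_continuous_on holomorphic_on_subset[OF h])
    then show ?thesis by (simp add: contour_integral_unique)
  qed
  have "(\<lambda>z. contour_integral (circlepath w s) (\<lambda>u. b (z, u) / (u - w) ^ Suc 1)) holomorphic_on ball 0 R"
  proof (rule holomorphic_on_contour_integral_circlepath)
    have "continuous_on (ball 0 R \<times> sphere w s) b"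
      using s(2) by (intro continuous_on_subset[OF holo2_on_imp_continuous_on[OF b]]) auto
    then show "continuous_on (ball 0 R \<times> sphere w s) (\<lambda>(z, u). b (z, u) / (u - w) ^ Suc 1)"
      unfolding case_prod_unfold using s(1) by (intro continuous_intros) auto
    show "(\<lambda>z. b (z, u) / (u - w) ^ Suc 1) holomorphic_on ball 0 R" if "u \<in> sphere w s" for u
      using that s by (intro holomorphic_intros holo2_on_compose[OF b]) auto
  qed (use s in auto)
  then have "(\<lambda>z. contour_integral (circlepath w s) (\<lambda>u. b (z, u) / (u - w) ^ Suc 1) / (2 * pi * \<i>)) holomorphic_on ball 0 R"
    by (intro holomorphic_intros) auto
  then show ?thesis by (rule holomorphic_transform) (rule eq)
qed

text \<open>The argument principle with a holomorphic weight \<open>h\<close>. It is applied on a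
  disc slightly larger than the circle, where the zeros are still finite in number; those outside
  the circle have winding number 0.\<close>

lemma zeros_in_disc:
  assumes g: "g holomorphic_on ball 0 R" and e: "0 < \<epsilon>" "\<epsilon> < R"
    and nz: "\<And>w. cmod w = \<epsilon> \<Longrightarrow> g w \<noteq> 0"
  defines "Z \<equiv> {w. cmod w < \<epsilon> \<and> g w = 0}"
  shows "finite Z" "\<And>w. w \<in> Z \<Longrightarrow> 0 < zorder g w"
    "\<And>h. h holomorphic_on ball 0 R \<Longrightarrow>
       contour_integral (circlepath 0 \<epsilon>) (\<lambda>w. deriv g w * h w / g w) =
         of_real (2 * pi) * \<i> * (\<Sum>w\<in>Z. h w * of_int (zorder g w))"
proof -
  define \<rho> where "\<rho> = (\<epsilon> + R) / 2"
  have \<rho>: "\<epsilon> < \<rho>" "\<rho> < R" using e by (auto simp: \<rho>_def)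
  have eR: "(of_real \<epsilon> :: complex) \<in> ball 0 R" "g (of_real \<epsilon>) \<noteq> 0" using e nz[of "of_real \<epsilon>"] by (auto simp: dist_norm)
  have fin: "finite {w \<in> cball 0 \<rho>. g w = 0}"
  proof (cases "g constant_on ball 0 R")
    case True
    then have "g w \<noteq> 0" if "w \<in> cball 0 \<rho>" for w
      using eR that \<rho> unfolding constant_on_def by (metis mem_ball_0 mem_cball_0 le_less_trans)
    then have "{w \<in> cball 0 \<rho>. g w = 0} = {}" by blast
    then show ?thesis by (metis finite.emptyI)
  next
    case False
    show ?thesis
      using \<rho> by (intro holomorphic_compact_finite_zeros[OF g _ _ _ _ False]) auto
  qed
  have Z: "Z \<subseteq> {w \<in> cball 0 \<rho>. g w = 0}" using \<rho> by (auto simp: Z_def)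
  show finZ: "finite Z" by (rule finite_subset[OF Z fin])
  show "0 < zorder g w" if w: "w \<in> Z" for w
  proof -
    have wR: "w \<in> ball 0 R" using w e by (auto simp: Z_def)
    have "\<forall>\<^sub>F u in at w. g u \<noteq> 0 \<and> u \<in> ball 0 R"
      by (rule non_zero_neighbour_alt[OF g open_ball convex_connected[OF convex_ball] wR eR])
    then have "\<forall>\<^sub>F u in at w. g u \<noteq> 0" by eventually_elim simp
    then have "\<exists>\<^sub>F u in at w. g u \<noteq> 0" by (intro eventually_frequently) auto
    from zorder_pos_iff[OF g open_ball wR this] w show ?thesis by (simp add: Z_def)
  qed
  fix h assume h: "h holomorphic_on ball 0 R"
  let ?S = "ball (0::complex) \<rho>"
  have sub: "ball (0::complex) \<rho> \<subseteq> ball 0 R" using \<rho> by (intro subset_ball) auto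
  have fin': "finite {w \<in> ?S. g w = 0 \<or> w \<in> {}}"
    by (rule finite_subset[OF _ fin]) auto
  have "contour_integral (circlepath 0 \<epsilon>) (\<lambda>w. deriv g w * h w / g w) =
      2 * pi * \<i> * (\<Sum>p\<in>{w \<in> ?S. g w = 0 \<or> w \<in> {}}. winding_number (circlepath 0 \<epsilon>) p * h p * zorder g p)"
  proof (rule argument_principle)
    show "path_image (circlepath 0 \<epsilon>) \<subseteq> ?S - {w \<in> ?S. g w = 0 \<or> w \<in> {}}"
      using e \<rho> nz by auto
    show "\<forall>z. z \<notin> ?S \<longrightarrow> winding_number (circlepath 0 \<epsilon>) z = 0"
      using e \<rho> by (auto intro!: winding_number_zero_outside[of _ "cball 0 \<epsilon>"])
  qed (use g h sub fin' in \<open>auto intro: holomorphic_on_subset\<close>)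
  also have "(\<Sum>p\<in>{w \<in> ?S. g w = 0 \<or> w \<in> {}}. winding_number (circlepath 0 \<epsilon>) p * h p * zorder g p) =
      (\<Sum>w\<in>Z. h w * zorder g w)"
  proof (rule sum.mono_neutral_cong_right[OF fin'])
    show "Z \<subseteq> {w \<in> ?S. g w = 0 \<or> w \<in> {}}" using \<rho> by (auto simp: Z_def)
    show "\<forall>p\<in>{w \<in> ?S. g w = 0 \<or> w \<in> {}} - Z. winding_number (circlepath 0 \<epsilon>) p * h p * zorder g p = 0"
    proof
      fix p assume p: "p \<in> {w \<in> ?S. g w = 0 \<or> w \<in> {}} - Z"
      then have "cmod p > \<epsilon>" using nz[of p] by (fastforce simp: Z_def)
      then have "winding_number (circlepath 0 \<epsilon>) p = 0"
        using e by (intro winding_number_zero_outside[of _ "cball 0 \<epsilon>"]) auto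
      then show "winding_number (circlepath 0 \<epsilon>) p * h p * zorder g p = 0" by simp
    qed
    show "winding_number (circlepath 0 \<epsilon>) p * h p * zorder g p = h p * zorder g p" if "p \<in> Z" for p
      using that winding_number_circlepath[of p 0 \<epsilon>] by (simp add: Z_def)
  qed
  finally show "contour_integral (circlepath 0 \<epsilon>) (\<lambda>w. deriv g w * h w / g w) =
      of_real (2 * pi) * \<i> * (\<Sum>w\<in>Z. h w * of_int (zorder g w))" by simp
qed

lemma contour_integral_poly_coeff:
  assumes "0 < s"
  shows "contour_integral (circlepath 0 s) (\<lambda>u. poly q u / u ^ Suc k) = of_real (2 * pi) * \<i> * coeff q k"
proof -
  have *: "(deriv ^^ k) (poly q) = poly ((pderiv ^^ k) q)"
  proof (induction k)
    case (Suc k)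
    show ?case unfolding funpow.simps o_def Suc.IH by (intro ext DERIV_imp_deriv poly_DERIV)
  qed simp
  have "((\<lambda>u. poly q u / (u - 0) ^ Suc k) has_contour_integral (2 * pi * \<i>) / fact k * (deriv ^^ k) (poly q) 0) (circlepath 0 s)"
    using assms by (intro Cauchy_has_contour_integral_higher_derivative_circlepath)
      (auto intro!: continuous_intros holomorphic_intros)
  moreover have "(deriv ^^ k) (poly q) 0 = fact k * coeff q k"
    unfolding * poly_0_coeff_0 coeff_higher_pderiv by (simp add: pochhammer_fact)
  ultimately show ?thesis by (simp add: contour_integral_unique)
qed

text \<open>The regularity assumption of Weierstrass preparation: 0 is the only possible zero of
  \<open>b (0, _)\<close> in the closed disc of radius \<open>\<epsilon>\<close>. The zeros of
  \<open>b (z, _)\<close> in this disc then tend to 0 as \<open>z\<close> does.\<close>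

locale zero_branches =
  fixes b :: "complex \<times> complex \<Rightarrow> complex" and R \<epsilon> :: real
  assumes b: "holo2_on (ball 0 R \<times> ball 0 R) b" and e: "0 < \<epsilon>" "\<epsilon> < R"
    and nz: "\<And>w. w \<noteq> 0 \<Longrightarrow> cmod w \<le> \<epsilon> \<Longrightarrow> b (0, w) \<noteq> 0"
begin

definition "roots z = {w. cmod w < \<epsilon> \<and> b (z, w) = 0}"
definition "wt z w = nat (zorder (\<lambda>u. b (z, u)) w)"

lemma eventually_nonzero:
  assumes K: "compact K" "K \<subseteq> cball 0 \<epsilon> - {0}"
  shows "\<forall>\<^sub>F z in nhds 0. \<forall>w\<in>K. b (z, w) \<noteq> 0"
proof (cases "K = {}")
  case False
  have KR: "K \<subseteq> ball 0 R" using K(2) e by auto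
  have cont: "continuous_on (K \<times> ball 0 R) (\<lambda>(w, z). b (z, w))"
  proof -
    have "continuous_on (K \<times> ball 0 R) (b \<circ> prod.swap)"
    proof (rule continuous_on_compose[OF continuous_on_swap])
      show "continuous_on (prod.swap ` (K \<times> ball 0 R)) b"
        using KR by (intro continuous_on_subset[OF holo2_on_imp_continuous_on[OF b]]) auto
    qed
    then show ?thesis unfolding o_def prod.swap_def by (simp add: case_prod_unfold)
  qed
  have "openin (top_of_set (K \<times> ball 0 R)) ((K \<times> ball 0 R) \<inter> (\<lambda>(w, z). b (z, w)) -` (- {0}))"
    by (rule continuous_openin_preimage_gen[OF cont]) auto
  moreover have "(\<lambda>x. (x, 0)) ` K \<subseteq> (K \<times> ball 0 R) \<inter> (\<lambda>(w, z). b (z, w)) -` (- {0})"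
  proof -
    have "b (0, x) \<noteq> 0" if "x \<in> K" for x using K(2) that by (intro nz) auto
    then show ?thesis using e by auto
  qed
  ultimately obtain V where V: "openin (top_of_set (ball 0 R)) V" "0 \<in> V"
      "K \<times> V \<subseteq> (K \<times> ball 0 R) \<inter> (\<lambda>(w, z). b (z, w)) -` (- {0})"
    using tube_lemma[OF K(1) False] by metis
  have "open V" using V(1) openin_open_eq[OF open_ball] by blast
  then have "\<forall>\<^sub>F z in nhds 0. z \<in> V" using V(2) eventually_nhds_in_open by blast
  then show ?thesis by eventually_elim (use V(3) in auto)
qed simp

definition "good z \<longleftrightarrow> z \<in> ball 0 R \<and> (\<forall>w\<in>sphere 0 \<epsilon>. b (z, w) \<noteq> 0)"

lemma eventually_good: "\<forall>\<^sub>F z in nhds 0. good z"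
proof -
  have "\<forall>\<^sub>F z in nhds 0. z \<in> ball 0 R" using e by (intro eventually_nhds_in_open) auto
  moreover have "\<forall>\<^sub>F z in nhds 0. \<forall>w\<in>sphere 0 \<epsilon>. b (z, w) \<noteq> 0" using e by (intro eventually_nonzero) auto
  ultimately show ?thesis by eventually_elim (simp add: good_def)
qed

lemma roots_shrink:
  assumes "0 < \<eta>" shows "\<forall>\<^sub>F z in nhds 0. roots z \<subseteq> ball 0 \<eta>"
proof -
  have "\<forall>\<^sub>F z in nhds 0. \<forall>w\<in>cball 0 \<epsilon> - ball 0 \<eta>. b (z, w) \<noteq> 0"
    using assms by (intro eventually_nonzero compact_diff) auto
  then show ?thesis by eventually_elim (fastforce simp: roots_def)
qed

text \<open>All roots move into any given disc around 0, so a statement on germs at the origin holds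
  at every root for small \<open>z\<close>.\<close>

lemma roots_near:
  assumes "\<forall>\<^sub>F x in nhds 0. P x"
  shows "\<forall>\<^sub>F z in nhds 0. \<forall>w\<in>roots z. P (z, w)"
proof -
  obtain r where r: "r > 0" "\<And>z w. cmod z < r \<Longrightarrow> cmod w < r \<Longrightarrow> P (z, w)"
    using assms unfolding eventually_nhds_bidisc by blast
  have "\<forall>\<^sub>F z in nhds 0. z \<in> ball 0 r" using r by (intro eventually_nhds_in_open) auto
  with roots_shrink[OF r(1)] show ?thesis by eventually_elim (use r(2) in auto)
qed

lemma slice_holomorphic: "z \<in> ball 0 R \<Longrightarrow> (\<lambda>w. b (z, w)) holomorphic_on ball 0 R"
  by (intro holo2_on_compose[OF b] holomorphic_intros) auto

lemma
  assumes "good z"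
  shows finite_roots: "finite (roots z)" and wt_pos: "\<And>w. w \<in> roots z \<Longrightarrow> 0 < wt z w"
    and contour_integral_roots: "\<And>h. h holomorphic_on ball 0 R \<Longrightarrow>
       contour_integral (circlepath 0 \<epsilon>) (\<lambda>w. deriv (\<lambda>u. b (z, u)) w * h w / b (z, w)) =
       of_real (2 * pi) * \<i> * (\<Sum>w\<in>roots z. of_nat (wt z w) * h w)"
proof -
  have z: "z \<in> ball 0 R" and nz: "\<And>w. cmod w = \<epsilon> \<Longrightarrow> b (z, w) \<noteq> 0" using assms by (auto simp: good_def)
  note Z = zeros_in_disc[OF slice_holomorphic[OF z] e nz, folded roots_def, simplified]
  show "finite (roots z)" "\<And>w. w \<in> roots z \<Longrightarrow> 0 < wt z w" using Z(1,2) by (auto simp: wt_def)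
  fix h assume "h holomorphic_on ball 0 R"
  from Z(3)[OF this]
  show "contour_integral (circlepath 0 \<epsilon>) (\<lambda>w. deriv (\<lambda>u. b (z, u)) w * h w / b (z, w)) =
       of_real (2 * pi) * \<i> * (\<Sum>w\<in>roots z. of_nat (wt z w) * h w)"
    using Z(2) by (simp add: wt_def mult.commute[of "h _"] less_imp_le)
qed

lemma good_disc: obtains \<delta> where "0 < \<delta>" "\<delta> \<le> R" "\<And>z. cmod z < \<delta> \<Longrightarrow> good z"
proof -
  obtain \<delta> where "0 < \<delta>" "\<And>z. cmod z < \<delta> \<Longrightarrow> good z"
    using eventually_good unfolding eventually_nhds_metric by (auto simp: dist_norm)
  then show ?thesis using e by (intro that[of "min \<delta> R"]) auto
qed

text \<open>All power sums of the roots are contour integrals, hence so is the logarithm of the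
  polynomial \<open>\<Prod>(1 - \<sigma> f(z, w))\<close>, whose coefficients therefore depend holomorphically on \<open>z\<close>.\<close>

lemma root_polynomial_coeffs:
  assumes f: "holo2_on (ball 0 R \<times> ball 0 R) f" and K: "0 < K" "\<And>x. x \<in> ball 0 R \<times> ball 0 R \<Longrightarrow> cmod (f x) \<le> K"
    and \<delta>: "0 < \<delta>" "\<delta> \<le> R" "\<And>z. cmod z < \<delta> \<Longrightarrow> good z"
  shows "(\<lambda>z. coeff (\<Prod>w\<in>roots z. [:1, - f (z, w):] ^ wt z w) k) holomorphic_on ball 0 \<delta>"
proof -
  \<comment> \<open>This radius gives \<open>cmod (\<sigma> * f x) \<le> 1/2\<close>, so the
    principal logarithm of \<open>1 - \<sigma> * f x\<close> is holomorphic.\<close>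
  define s where "s = 1 / (2 * K)"
  have s: "0 < s" using K by (simp add: s_def)
  have small: "cmod (\<sigma> * f x) < 1" if "cmod \<sigma> \<le> s" "x \<in> ball 0 R \<times> ball 0 R" for \<sigma> x
  proof -
    have "cmod (\<sigma> * f x) \<le> s * K" unfolding norm_mult using that K s by (intro mult_mono) auto
    also have "\<dots> < 1" using K by (simp add: s_def)
    finally show ?thesis .
  qed
  have Re: "1 - u \<notin> \<real>\<^sub>\<le>\<^sub>0" if "cmod u < 1" for u
  proof
    assume "1 - u \<in> \<real>\<^sub>\<le>\<^sub>0"
    then have "Re (1 - u) \<le> 0" by (auto simp: complex_nonpos_Reals_iff)
    then show False using that complex_Re_le_cmod[of u] by simp
  qed
  define q where "q z = (\<Prod>w\<in>roots z. [:1, - f (z, w):] ^ wt z w)" for z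
  define g where "g p w = deriv (\<lambda>u. b (fst p, u)) w * Ln (1 - snd p * f (fst p, w)) / b (fst p, w)" for p w
  \<comment> \<open>The contour integral is the sum of \<open>wt * Ln (1 - \<sigma> * f)\<close>
    over the roots; its exponential is the polynomial in \<open>\<sigma>\<close>, written without
    reference to individual roots.\<close>
  define P where "P p = exp (contour_integral (circlepath 0 \<epsilon>) (g p) / (2 * pi * \<i>))" for p
  have sl: "(\<lambda>w. f (z, w)) holomorphic_on ball 0 R" if "z \<in> ball 0 R" for z
    using that by (intro holo2_on_compose[OF f] holomorphic_intros) auto
  have P_eq: "P (z, \<sigma>) = poly (q z) \<sigma>" if z: "cmod z < \<delta>" and \<sigma>: "cmod \<sigma> \<le> s" for z \<sigma>
  proof -
    have gz: "good z" and zR: "z \<in> ball 0 R" using \<delta> z by auto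
    have "(\<lambda>w. Ln (1 - \<sigma> * f (z, w))) holomorphic_on ball 0 R"
      using Re small[OF \<sigma>] zR by (intro holomorphic_intros sl) auto
    from contour_integral_roots[OF gz this]
    have "P (z, \<sigma>) = exp (\<Sum>w\<in>roots z. of_nat (wt z w) * Ln (1 - \<sigma> * f (z, w)))"
      unfolding P_def g_def fst_conv snd_conv by simp
    also have "\<dots> = (\<Prod>w\<in>roots z. (1 - \<sigma> * f (z, w)) ^ wt z w)"
      unfolding exp_sum[OF finite_roots[OF gz]]
    proof (rule prod.cong)
      fix w assume "w \<in> roots z"
      then have "(z, w) \<in> ball 0 R \<times> ball 0 R" using zR e by (auto simp: roots_def)
      from small[OF \<sigma> this] have "1 - \<sigma> * f (z, w) \<noteq> 0" by (metis norm_one less_irrefl right_minus_eq)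
      then show "exp (of_nat (wt z w) * Ln (1 - \<sigma> * f (z, w))) = (1 - \<sigma> * f (z, w)) ^ wt z w"
        by (simp add: exp_of_nat_mult)
    qed simp
    also have "\<dots> = poly (q z) \<sigma>" by (simp add: q_def poly_prod)
    finally show ?thesis .
  qed
  have contd: "continuous_on (ball 0 R \<times> ball 0 R) (\<lambda>(w, z). deriv (\<lambda>u. b (z, u)) w)"
  proof (rule continuous_on_deriv_param)
    have "continuous_on (ball 0 R \<times> ball 0 R) (b \<circ> prod.swap)"
      by (intro continuous_on_compose continuous_on_swap) (simp add: holo2_on_imp_continuous_on[OF b] product_swap)
    then show "continuous_on (ball 0 R \<times> ball 0 R) (\<lambda>(w, z). b (z, w))"
      unfolding o_def prod.swap_def by (simp add: case_prod_unfold)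
  qed (auto intro: slice_holomorphic)
  have cont_g: "continuous_on ((ball 0 \<delta> \<times> cball 0 s) \<times> sphere 0 \<epsilon>) (\<lambda>(p, w). g p w)"
  proof -
    let ?X = "(ball 0 \<delta> \<times> cball 0 s) \<times> sphere (0::complex) \<epsilon>"
    have 1: "continuous_on ?X (\<lambda>x. (\<lambda>(w, z). deriv (\<lambda>u. b (z, u)) w) (snd x, fst (fst x)))"
      by (rule continuous_on_compose2[OF contd]) (use \<delta> e in \<open>auto intro!: continuous_intros\<close>)
    have 2: "continuous_on ?X (\<lambda>x. b (fst (fst x), snd x))" "continuous_on ?X (\<lambda>x. f (fst (fst x), snd x))"
      using \<delta> e
      by (auto intro!: continuous_intros continuous_on_compose2[OF holo2_on_imp_continuous_on[OF b]]
          continuous_on_compose2[OF holo2_on_imp_continuous_on[OF f]])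
    show ?thesis unfolding case_prod_unfold g_def
      using 1 2 \<delta> e by (intro continuous_intros) (auto simp: good_def case_prod_unfold intro!: Re small)
  qed
  have "continuous_on (ball 0 \<delta> \<times> cball 0 s) (\<lambda>p. contour_integral (circlepath 0 \<epsilon>) (g p))"
    using e by (intro continuous_on_contour_integral_circlepath cont_g) auto
  then have cont_P: "continuous_on (ball 0 \<delta> \<times> cball 0 s) P" unfolding P_def by (intro continuous_intros) auto
  have hol_P: "(\<lambda>z. P (z, \<sigma>)) holomorphic_on ball 0 \<delta>" if \<sigma>: "cmod \<sigma> \<le> s" for \<sigma>
  proof -
    have "(\<lambda>z. contour_integral (circlepath 0 \<epsilon>) (g (z, \<sigma>))) holomorphic_on ball 0 \<delta>"
    proof (rule holomorphic_on_contour_integral_circlepath)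
      show "continuous_on (ball 0 \<delta> \<times> sphere 0 \<epsilon>) (\<lambda>(z, w). g (z, \<sigma>) w)"
        unfolding case_prod_unfold
        by (rule continuous_on_compose2[OF cont_g[unfolded case_prod_unfold], where f = "\<lambda>x. ((fst x, \<sigma>), snd x)", unfolded fst_conv snd_conv])
          (use \<sigma> in \<open>auto intro!: continuous_intros\<close>)
      show "(\<lambda>z. g (z, \<sigma>) w) holomorphic_on ball 0 \<delta>" if w: "w \<in> sphere 0 \<epsilon>" for w
      proof -
        have "w \<in> ball 0 R" using w e by auto
        moreover have "(\<lambda>z. deriv (\<lambda>u. b (z, u)) w) holomorphic_on ball 0 \<delta>"
          using \<delta> by (intro holomorphic_on_subset[OF holomorphic_on_deriv_slice[OF b \<open>w \<in> ball 0 R\<close>]]) auto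
        ultimately show ?thesis unfolding g_def fst_conv snd_conv using w \<delta> e
          by (intro holomorphic_intros holo2_on_compose[OF b] holo2_on_compose[OF f] Re small[OF \<sigma>]) (auto simp: good_def)
      qed
    qed (use e in auto)
    then show ?thesis unfolding P_def by (intro holomorphic_intros) auto
  qed
  \<comment> \<open>A second Cauchy integral, over \<open>\<sigma>\<close>, extracts the coefficient
    and preserves holomorphy in \<open>z\<close>.\<close>
  have "(\<lambda>z. contour_integral (circlepath 0 s) (\<lambda>\<sigma>. P (z, \<sigma>) / \<sigma> ^ Suc k)) holomorphic_on ball 0 \<delta>"
  proof (rule holomorphic_on_contour_integral_circlepath)
    have "continuous_on (ball 0 \<delta> \<times> sphere 0 s) P" by (rule continuous_on_subset[OF cont_P]) auto
    then show "continuous_on (ball 0 \<delta> \<times> sphere 0 s) (\<lambda>(z, \<sigma>). P (z, \<sigma>) / \<sigma> ^ Suc k)"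
      unfolding case_prod_unfold using s by (intro continuous_intros) auto
    show "(\<lambda>z. P (z, \<sigma>) / \<sigma> ^ Suc k) holomorphic_on ball 0 \<delta>" if "\<sigma> \<in> sphere 0 s" for \<sigma>
      using that s by (intro holomorphic_intros hol_P) auto
  qed (use s in auto)
  then have "(\<lambda>z. contour_integral (circlepath 0 s) (\<lambda>\<sigma>. P (z, \<sigma>) / \<sigma> ^ Suc k) / (2 * pi * \<i>)) holomorphic_on ball 0 \<delta>"
    by (intro holomorphic_intros) auto
  then show ?thesis
  proof (rule holomorphic_transform)
    fix z :: complex assume "z \<in> ball 0 \<delta>"
    then have "contour_integral (circlepath 0 s) (\<lambda>\<sigma>. P (z, \<sigma>) / \<sigma> ^ Suc k) =
        contour_integral (circlepath 0 s) (\<lambda>\<sigma>. poly (q z) \<sigma> / \<sigma> ^ Suc k)"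
      using s by (intro contour_integral_cong) (auto simp: P_eq)
    also have "\<dots> = of_real (2 * pi) * \<i> * coeff (q z) k" by (rule contour_integral_poly_coeff[OF s])
    finally show "contour_integral (circlepath 0 s) (\<lambda>\<sigma>. P (z, \<sigma>) / \<sigma> ^ Suc k) / (2 * pi * \<i>) =
        coeff (\<Prod>w\<in>roots z. [:1, - f (z, w):] ^ wt z w) k"
      by (simp add: q_def)
  qed
qed


definition deg :: "complex \<Rightarrow> nat" where "deg z = (\<Sum>w\<in>roots z. wt z w)"
definition "cnt B z = (\<Sum>w\<in>{w \<in> roots z. (z, w) \<in> B}. wt z w)"

text \<open>With \<open>f = 1\<close> the root polynomial is \<open>(1 - \<sigma>)^deg\<close>,
  whose linear coefficient is \<open>- deg\<close>. Hence \<open>deg\<close> depends continuously on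
  \<open>z\<close>, and being an integer it is constant near 0.\<close>

lemma deg_eventually_const: "\<forall>\<^sub>F z in nhds 0. deg z = deg 0"
proof -
  obtain \<delta> where \<delta>: "0 < \<delta>" "\<delta> \<le> R" "\<And>z. cmod z < \<delta> \<Longrightarrow> good z" by (rule good_disc) blast
  have c1: "coeff ([:1, - 1:] ^ n) (Suc 0) = - complex_of_nat n" for n :: nat
    using coeff_pderiv[of "[:1, - 1 :: complex:] ^ n" 0]
    by (simp add: pderiv_power pderiv_pCons coeff_0_power)
  have "(\<Prod>w\<in>roots z. [:1, - 1 :: complex:] ^ wt z w) = [:1, - 1:] ^ deg z" for z
    by (simp add: deg_def power_sum)
  then have "(\<lambda>z. - of_nat (deg z) :: complex) holomorphic_on ball 0 \<delta>"
    using root_polynomial_coeffs[of "\<lambda>x. 1" 1 \<delta> 1, OF holo2_on_const _ _ \<delta>] c1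
    by (simp add: open_Times \<open>\<And>z. (\<Prod>w\<in>roots z. [:1, - 1 :: complex:] ^ wt z w) = [:1, - 1:] ^ deg z\<close>)
  then have "continuous_on (ball 0 \<delta>) (\<lambda>z. - of_nat (deg z) :: complex)" by (rule holomorphic_on_imp_continuous_on)
  then have "isCont (\<lambda>z. - of_nat (deg z) :: complex) 0" using \<delta> by (simp add: continuous_on_eq_continuous_at)
  then have "((\<lambda>z. - of_nat (deg z) :: complex) \<longlongrightarrow> - of_nat (deg 0)) (nhds 0)"
    using isCont_def tendsto_at_iff_tendsto_nhds by blast
  then have "\<forall>\<^sub>F z in nhds 0. dist (- of_nat (deg z)) (- of_nat (deg 0) :: complex) < 1"
    by (rule tendstoD) simp
  then show ?thesis
  proof eventually_elim
    case (elim z)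
    then have "cmod (of_int (int (deg z) - int (deg 0))) < 1"
      by (simp add: dist_norm norm_minus_commute)
    then show ?case unfolding norm_of_int by linarith
  qed
qed

text \<open>The degree of the root polynomial counts the roots at which \<open>f\<close> does not
  vanish. Each coefficient is holomorphic in \<open>z\<close>, so it is identically 0 or nonzero for
  all small \<open>z \<noteq> 0\<close>; the degree is then constant there, and so is its complement
  in \<open>deg\<close>.\<close>

lemma cnt_eventually_const_holo:
  assumes f: "holo2_on (ball 0 R \<times> ball 0 R) f" and K: "0 < K" "\<And>x. x \<in> ball 0 R \<times> ball 0 R \<Longrightarrow> cmod (f x) \<le> K"
  shows "\<exists>N. \<forall>\<^sub>F z in at 0. cnt {x. f x = 0} z = N"
proof -
  obtain \<delta> where \<delta>: "0 < \<delta>" "\<delta> \<le> R" "\<And>z. cmod z < \<delta> \<Longrightarrow> good z" by (rule good_disc) blast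
  define q where "q z = (\<Prod>w\<in>roots z. [:1, - f (z, w):] ^ wt z w)" for z
  have hol: "(\<lambda>z. coeff (q z) k) holomorphic_on ball 0 \<delta>" for k
    unfolding q_def by (rule root_polynomial_coeffs[OF f K \<delta>])
  define A where "A = {k. k \<le> deg 0 \<and> (\<exists>z\<in>ball 0 \<delta>. coeff (q z) k \<noteq> 0)}"
  have coef: "\<forall>\<^sub>F z in at 0. coeff (q z) k \<noteq> 0 \<longleftrightarrow> k \<in> A" if "k \<le> deg 0" for k
  proof (cases "k \<in> A")
    case True
    then obtain \<beta> where "\<beta> \<in> ball 0 \<delta>" "coeff (q \<beta>) k \<noteq> 0" by (auto simp: A_def)
    from non_zero_neighbour_alt[OF hol open_ball convex_connected[OF convex_ball] _ this, of 0] \<delta>(1)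
    show ?thesis using True by (auto elim: eventually_mono)
  next
    case False
    have "\<forall>\<^sub>F z in at 0. z \<in> ball 0 \<delta>" using \<delta>(1) by (intro eventually_at_in_open') auto
    then show ?thesis by eventually_elim (use False that in \<open>auto simp: A_def\<close>)
  qed
  have "\<forall>\<^sub>F z in at 0. \<forall>k\<in>{..deg 0}. coeff (q z) k \<noteq> 0 \<longleftrightarrow> k \<in> A"
    by (intro eventually_ball_finite) (use coef in auto)
  moreover have "\<forall>\<^sub>F z in at 0. deg z = deg 0" "\<forall>\<^sub>F z in at 0. good z"
    using deg_eventually_const eventually_good eventually_nhds_conv_at by auto
  ultimately have "\<forall>\<^sub>F z in at 0. cnt {x. f x = 0} z = deg 0 - Max A"
  proof eventually_elim
    case (elim z)
    have fin: "finite (roots z)" using finite_roots elim by blast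
    have split: "deg z = cnt {x. f x = 0} z + (\<Sum>w\<in>{w \<in> roots z. f (z, w) \<noteq> 0}. wt z w)"
      unfolding deg_def cnt_def using fin
      by (subst sum.union_disjoint[symmetric]) (auto intro: arg_cong2[where f = sum])
    have q0: "q z \<noteq> 0" using fin by (simp add: q_def)
    have "degree (q z) = (\<Sum>w\<in>roots z. degree ([:1, - f (z, w):] ^ wt z w))"
      unfolding q_def by (rule degree_prod_eq_sum_degree) simp
    also have "\<dots> = (\<Sum>w\<in>{w \<in> roots z. f (z, w) \<noteq> 0}. wt z w)"
      using fin by (intro sum.mono_neutral_cong_right) (auto simp: degree_power_eq)
    finally have deg: "degree (q z) = (\<Sum>w\<in>{w \<in> roots z. f (z, w) \<noteq> 0}. wt z w)" .
    have dle: "degree (q z) \<le> deg 0" using split deg elim by simp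
    have "Max A = degree (q z)"
    proof (rule Max_eqI)
      have "A \<subseteq> {..deg 0}" by (auto simp: A_def)
      then show "finite A" by (rule finite_subset) simp
      show "degree (q z) \<in> A" using bspec[OF elim(1), of "degree (q z)"] dle q0 by (simp add: leading_coeff_0_iff)
      show "y \<le> degree (q z)" if "y \<in> A" for y
        using that elim(1) by (intro le_degree) (auto simp: A_def)
    qed
    then show ?case using split deg elim by simp
  qed
  then show ?thesis by blast
qed

lemma cnt_cong:
  assumes "\<forall>\<^sub>F x in nhds 0. b x = 0 \<longrightarrow> (x \<in> B \<longleftrightarrow> x \<in> C)"
  shows "\<forall>\<^sub>F z in nhds 0. cnt B z = cnt C z"
  using roots_near[OF assms]
  by eventually_elim (auto simp: cnt_def roots_def intro!: sum.cong)

text \<open>Both radii are shrunk until \<open>f\<close> is defined and bounded. For small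
  \<open>z\<close> this loses no root, because the roots tend to 0.\<close>

lemma cnt_eventually_const_germ:
  assumes "germ2 f" shows "\<exists>N. \<forall>\<^sub>F z in at 0. cnt {x. f x = 0} z = N"
proof -
  obtain r where r: "r > 0" "holo2_on (ball 0 r \<times> ball 0 r) f" using assms by (rule germ2_bidisc)
  define R' where "R' = min R (r / 2)"
  have R': "0 < R'" "R' \<le> R" "R' < r" using r e by (auto simp: R'_def)
  have "compact (f ` (cball 0 R' \<times> cball 0 R'))"
    using R' by (intro compact_continuous_image compact_Times continuous_on_subset[OF holo2_on_imp_continuous_on[OF r(2)]]) auto
  then obtain K where K: "0 < K" "\<And>x. x \<in> f ` (cball 0 R' \<times> cball 0 R') \<Longrightarrow> cmod x \<le> K"
    using compact_imp_bounded bounded_pos by metis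
  define \<epsilon>' where "\<epsilon>' = min \<epsilon> (R' / 2)"
  have e': "0 < \<epsilon>'" "\<epsilon>' \<le> \<epsilon>" "\<epsilon>' < R'" using e R' by (auto simp: \<epsilon>'_def)
  interpret s: zero_branches b R' \<epsilon>'
  proof
    show "holo2_on (ball 0 R' \<times> ball 0 R') b"
      using R' by (intro holo2_on_subset[OF b] open_Times Sigma_mono subset_ball) auto
  qed (use e' nz in auto)
  have "holo2_on (ball 0 R' \<times> ball 0 R') f"
    using R' by (intro holo2_on_subset[OF r(2)] open_Times Sigma_mono subset_ball) auto
  moreover have "cmod (f x) \<le> K" if "x \<in> ball 0 R' \<times> ball 0 R'" for x
  proof (rule K(2), rule imageI)
    show "x \<in> cball 0 R' \<times> cball 0 R'" using that by (cases x) auto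
  qed
  ultimately obtain N where N: "\<forall>\<^sub>F z in at 0. s.cnt {x. f x = 0} z = N"
    using s.cnt_eventually_const_holo[OF _ K(1)] by blast
  have "\<forall>\<^sub>F z in at 0. roots z \<subseteq> ball 0 \<epsilon>'"
    using roots_shrink[OF e'(1)] eventually_nhds_conv_at by blast
  with N have "\<forall>\<^sub>F z in at 0. cnt {x. f x = 0} z = N"
  proof eventually_elim
    case (elim z)
    have "roots z = s.roots z" using elim(2) e' by (auto simp: roots_def s.roots_def)
    then show ?case using elim(1) by (simp add: cnt_def s.cnt_def)
  qed
  then show ?thesis by blast
qed

lemma cnt_inter_union:
  assumes "good z" shows "cnt (B \<inter> C) z + cnt (B \<union> C) z = cnt B z + cnt C z"
proof -
  let ?S = "\<lambda>B. {w \<in> roots z. (z, w) \<in> B}"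
  have fin: "finite (?S B)" for B using finite_roots[OF assms] by simp
  have "sum (wt z) (?S B \<union> ?S C) + sum (wt z) (?S B \<inter> ?S C) = sum (wt z) (?S B) + sum (wt z) (?S C)"
    by (rule sum.union_inter[OF fin fin])
  moreover have "?S B \<union> ?S C = ?S (B \<union> C)" "?S B \<inter> ?S C = ?S (B \<inter> C)" by auto
  ultimately show ?thesis by (simp add: cnt_def)
qed

text \<open>Inclusion-exclusion: the union of the zero sets of \<open>G\<close> and of \<open>g\<close> is the zero set of
  the products \<open>h g\<close> with \<open>h \<in> G\<close>, so no new kind of set arises in the induction.\<close>

lemma cnt_eventually_const_zero_set:
  assumes "finite G" "\<forall>g\<in>G. germ2 g"
  shows "\<exists>N. \<forall>\<^sub>F z in at 0. cnt {x. \<forall>g\<in>G. g x = 0} z = N"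
  using assms
proof (induction "card G" arbitrary: G rule: less_induct)
  case less
  show ?case
  proof (cases "G = {}")
    case True
    then have "cnt {x. \<forall>g\<in>G. g x = 0} z = deg z" for z by (simp add: cnt_def deg_def)
    then show ?thesis using deg_eventually_const eventually_nhds_conv_at by auto
  next
    case False
    then obtain g where g: "g \<in> G" by blast
    define H where "H = G - {g}"
    define H' where "H' = (\<lambda>h x. h x * g x) ` H"
    have H: "card H < card G" "card H' < card G" "finite H" "finite H'" "\<forall>h\<in>H. germ2 h" "\<forall>h\<in>H'. germ2 h"
    proof -
      show 1: "finite H" and "finite H'" using less.prems by (simp_all add: H_def H'_def)
      show 2: "card H < card G" unfolding H_def by (rule card_Diff1_less[OF less.prems(1) g])
      show "card H' < card G" unfolding H'_def using card_image_le[OF 1] 2 by (rule le_less_trans)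
      show "\<forall>h\<in>H. germ2 h" "\<forall>h\<in>H'. germ2 h" using less.prems g by (auto simp: H_def H'_def intro: germ2_mult)
    qed
    obtain N1 where N1: "\<forall>\<^sub>F z in at 0. cnt {x. \<forall>h\<in>H. h x = 0} z = N1" using less.hyps[OF H(1,3,5)] by blast
    obtain N2 where N2: "\<forall>\<^sub>F z in at 0. cnt {x. \<forall>h\<in>H'. h x = 0} z = N2" using less.hyps[OF H(2,4,6)] by blast
    obtain N3 where N3: "\<forall>\<^sub>F z in at 0. cnt {x. g x = 0} z = N3"
      using cnt_eventually_const_germ g less.prems by blast
    have eq: "{x. \<forall>h\<in>H. h x = 0} \<inter> {x. g x = 0} = {x. \<forall>g\<in>G. g x = 0}"
      "{x. \<forall>h\<in>H. h x = 0} \<union> {x. g x = 0} = {x. \<forall>h\<in>H'. h x = 0}"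
      using g by (auto simp: H_def H'_def)
    have "\<forall>\<^sub>F z in at 0. good z" using eventually_good eventually_nhds_conv_at by blast
    with N1 N2 N3 have "\<forall>\<^sub>F z in at 0. cnt {x. \<forall>g\<in>G. g x = 0} z = N1 + N3 - N2"
      by eventually_elim (use cnt_inter_union[of _ "{x. \<forall>h\<in>H. h x = 0}" "{x. g x = 0}", unfolded eq] in \<open>force\<close>)
    then show ?thesis by blast
  qed
qed

text \<open>The eventual value of \<open>cnt B\<close>: the number of branches of the zero set of
  \<open>b\<close> that lie in \<open>B\<close>, with the multiplicity they have in
  \<open>b\<close>. It is meaningful for analytic germs.\<close>

definition "branches B = (THE N. \<forall>\<^sub>F z in at 0. cnt B z = N)"

lemma branches:
  assumes "analytic_set_germ B" shows "\<forall>\<^sub>F z in at 0. cnt B z = branches B"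
proof -
  obtain G where G: "finite G" "\<forall>g\<in>G. germ2 g" "germ_set_eq B {x. \<forall>g\<in>G. g x = 0}"
    using assms by (auto simp: analytic_set_germ_def)
  obtain N where N: "\<forall>\<^sub>F z in at 0. cnt {x. \<forall>g\<in>G. g x = 0} z = N"
    using cnt_eventually_const_zero_set[OF G(1,2)] by blast
  have "\<forall>\<^sub>F x in nhds 0. b x = 0 \<longrightarrow> (x \<in> B \<longleftrightarrow> x \<in> {x. \<forall>g\<in>G. g x = 0})"
    using G(3) unfolding germ_set_eq_def germ_subset_def by (auto elim: eventually_elim2)
  from cnt_cong[OF this] have "\<forall>\<^sub>F z in at 0. cnt B z = cnt {x. \<forall>g\<in>G. g x = 0} z"
    using eventually_nhds_conv_at by blast
  with N have N': "\<forall>\<^sub>F z in at 0. cnt B z = N" by eventually_elim simp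
  moreover have "M = N" if "\<forall>\<^sub>F z in at 0. cnt B z = M" for M
  proof -
    have "\<forall>\<^sub>F z in at (0::complex). M = N" using that N' by eventually_elim simp
    then show ?thesis by simp
  qed
  ultimately show ?thesis unfolding branches_def by (rule theI)
qed

lemma germ_subset_roots: "germ_subset B C \<Longrightarrow> \<forall>\<^sub>F z in at 0. \<forall>w\<in>roots z. (z, w) \<in> B \<longrightarrow> (z, w) \<in> C"
  unfolding germ_subset_def eventually_nhds_conv_at
  using roots_near[of "\<lambda>x. x \<in> B \<longrightarrow> x \<in> C"] by (simp add: eventually_nhds_conv_at)

lemma branches_mono:
  assumes "analytic_set_germ B" "analytic_set_germ C" "germ_subset B C"
  shows "branches B \<le> branches C"
proof -
  have "\<forall>\<^sub>F z in at 0. good z" using eventually_good eventually_nhds_conv_at by blast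
  with branches[OF assms(1)] branches[OF assms(2)] germ_subset_roots[OF assms(3)]
  have "\<forall>\<^sub>F z in at (0::complex). branches B \<le> branches C"
  proof eventually_elim
    case (elim z)
    have "cnt B z \<le> cnt C z"
      unfolding cnt_def using elim(3) finite_roots[OF elim(4)] by (intro sum_mono2) auto
    then show ?case using elim by simp
  qed
  then show ?thesis by simp
qed

lemma eventually_off_axis:
  assumes "\<forall>\<^sub>F z in at 0. \<forall>w\<in>roots z. P (z, w)" "\<forall>\<^sub>F x in nhds 0. Q x \<longrightarrow> b x = 0"
  shows "\<forall>\<^sub>F x in nhds 0. fst x \<noteq> 0 \<longrightarrow> Q x \<longrightarrow> P x"
proof -
  obtain d where d: "0 < d" "\<And>z w. z \<noteq> 0 \<Longrightarrow> cmod z < d \<Longrightarrow> w \<in> roots z \<Longrightarrow> P (z, w)"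
    using assms(1) unfolding eventually_at by (auto simp: dist_norm)
  have "\<forall>\<^sub>F x in nhds 0. x \<in> ball 0 d \<times> ball 0 \<epsilon>"
    using d e by (intro eventually_nhds_in_open open_Times) (auto simp: zero_prod_def)
  with assms(2) show ?thesis
    by eventually_elim (use d(2) in \<open>auto simp: roots_def\<close>)
qed

text \<open>All weights are positive, so nested finite sets of roots with the same total weight
  coincide.\<close>

lemma branches_eq:
  assumes "analytic_set_germ B" "analytic_set_germ C" "germ_subset B C" "branches C \<le> branches B"
    and C: "\<forall>\<^sub>F x in nhds 0. x \<in> C \<longrightarrow> b x = 0"
  shows "\<forall>\<^sub>F x in nhds 0. fst x \<noteq> 0 \<longrightarrow> x \<in> C \<longrightarrow> x \<in> B"
proof (rule eventually_off_axis[OF _ C, of "\<lambda>x. x \<in> C \<longrightarrow> x \<in> B", THEN eventually_mono])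
  have "\<forall>\<^sub>F z in at 0. good z" using eventually_good eventually_nhds_conv_at by blast
  with branches[OF assms(1)] branches[OF assms(2)] germ_subset_roots[OF assms(3)]
  show "\<forall>\<^sub>F z in at 0. \<forall>w\<in>roots z. (z, w) \<in> C \<longrightarrow> (z, w) \<in> B"
  proof eventually_elim
    case (elim z)
    let ?S = "\<lambda>B. {w \<in> roots z. (z, w) \<in> B}"
    have sub: "?S B \<subseteq> ?S C" using elim(3) by auto
    have fin: "finite (?S C)" using finite_roots[OF elim(4)] by simp
    have "?S C = ?S B"
    proof (rule ccontr)
      assume "?S C \<noteq> ?S B"
      then obtain w where "w \<in> ?S C - ?S B" using sub by blast
      then have "sum (wt z) (?S B) < sum (wt z) (?S C)"
        using wt_pos[OF elim(4)] by (intro sum_strict_mono2[OF fin sub, of w]) auto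
      then show False using elim assms(4) by (simp add: cnt_def)
    qed
    then show ?case by blast
  qed
qed auto

lemma branches_eq_0:
  assumes "analytic_set_germ B" "branches B = 0" "\<forall>\<^sub>F x in nhds 0. x \<in> B \<longrightarrow> b x = 0"
  shows "\<forall>\<^sub>F x in nhds 0. x \<in> B \<longrightarrow> fst x = 0"
proof -
  have "analytic_set_germ {}"
    unfolding analytic_set_germ_def germ_set_eq_def germ_subset_def
    by (intro exI[of _ "{\<lambda>x. 1}"]) (simp add: germ2_const)
  from branches_eq[OF this assms(1) _ _ assms(3)] assms(2)
  have "\<forall>\<^sub>F x in nhds 0. fst x \<noteq> 0 \<longrightarrow> x \<in> B \<longrightarrow> x \<in> {}" by (simp add: germ_subset_def)
  then show ?thesis by eventually_elim auto
qed

lemma branches_pos: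
  assumes "analytic_set_germ B" "branches B \<noteq> 0"
  shows "\<exists>\<^sub>F x in nhds 0. x \<in> B \<and> fst x \<noteq> 0"
proof -
  have "\<not> (\<forall>\<^sub>F x in nhds 0. x \<in> B \<longrightarrow> fst x = 0)"
  proof
    assume "\<forall>\<^sub>F x in nhds 0. x \<in> B \<longrightarrow> fst x = 0"
    from roots_near[OF this] have "\<forall>\<^sub>F z in at 0. \<forall>w\<in>roots z. (z, w) \<in> B \<longrightarrow> z = 0"
      by (simp add: eventually_nhds_conv_at)
    moreover have "\<forall>\<^sub>F z in at (0::complex). z \<noteq> 0" by (simp add: eventually_at_filter)
    ultimately have "\<forall>\<^sub>F z in at (0::complex). branches B = 0"
      using branches[OF assms(1)]
    proof eventually_elim
      case (elim z)
      then have *: "{w \<in> roots z. (z, w) \<in> B} = {}" by auto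
      show ?case using elim(3) by (simp add: cnt_def *)
    qed
    then show False using assms(2) by simp
  qed
  then show ?thesis unfolding not_eventually by (rule frequently_elim1) auto
qed

text \<open>The root 0 at \<open>z = 0\<close> makes \<open>deg 0\<close> positive, and
  \<open>deg\<close> is constant near 0.\<close>

lemma roots_nonempty:
  assumes "b 0 = 0" shows "\<forall>\<^sub>F z in nhds 0. roots z \<noteq> {}"
proof -
  have g0: "good 0" using e nz by (auto simp: good_def)
  have 0: "0 \<in> roots 0" using assms e by (simp add: roots_def zero_prod_def)
  have "0 < deg 0"
    unfolding deg_def using wt_pos[OF g0 0] 0 finite_roots[OF g0] by (intro sum_pos2[OF _ 0]) auto
  with deg_eventually_const show ?thesis by (auto simp: deg_def elim!: eventually_mono)
qed

end

text \<open>If \<open>fst\<close> does not divide \<open>b\<close>, the difference quotient shows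
  that \<open>b (0, _)\<close> is not identically 0, and its zeros are then isolated.\<close>

lemma zero_branches_exists:
  assumes "germ2 b" "\<not> germ_dvd fst b" obtains R \<epsilon> where "zero_branches b R \<epsilon>"
proof -
  obtain R where R: "R > 0" "holo2_on (ball 0 R \<times> ball 0 R) b" using assms(1) by (rule germ2_bidisc)
  obtain b' where b': "germ2 b'" "germ_eq b (\<lambda>x. b (0, snd x) + fst x * b' x)"
    using assms(1) by (rule germ2_difference_quotient)
  have h: "(\<lambda>w. b (0, w)) holomorphic_on ball 0 R"
    using R by (intro holo2_on_compose[OF R(2)] holomorphic_intros) auto
  have "\<exists>\<beta>\<in>ball 0 R. b (0, \<beta>) \<noteq> 0"
  proof (rule ccontr)
    assume *: "\<not> ?thesis"
    have "\<forall>\<^sub>F x in nhds 0. x \<in> ball 0 R \<times> ball (0::complex) R"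
      using R by (intro eventually_nhds_in_open open_Times) (auto simp: zero_prod_def)
    with b'(2) have "germ_eq b (\<lambda>x. fst x * b' x)"
      unfolding germ_eq_def by eventually_elim (use * in auto)
    then show False using assms(2) b'(1) unfolding germ_dvd_def by blast
  qed
  then obtain \<beta> where "\<beta> \<in> ball 0 R" "b (0, \<beta>) \<noteq> 0" by blast
  from non_zero_neighbour_alt[OF h open_ball convex_connected[OF convex_ball] _ this, of 0] R(1)
  obtain d where d: "0 < d" "\<And>w. w \<noteq> 0 \<Longrightarrow> cmod w < d \<Longrightarrow> b (0, w) \<noteq> 0"
    unfolding eventually_at by (auto simp: dist_norm)
  have "zero_branches b R (min d R / 2)"
    by unfold_locales (use R d in \<open>auto simp: min_def split: if_splits\<close>)
  then show ?thesis by (rule that)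
qed


section \<open>Irreducible components and the pure order\<close>

text \<open>Continuity in \<open>z\<close> extends an identity across the axis. This is how powers
  of \<open>fst\<close> are cancelled from germ equations.\<close>

lemma germ_eq_cancel_fst:
  assumes f: "germ2 f" and g: "germ2 g" and eq: "\<forall>\<^sub>F x in nhds 0. fst x \<noteq> 0 \<longrightarrow> f x = g x"
  shows "germ_eq f g"
proof -
  obtain r where r: "r > 0" "holo2_on (ball 0 r \<times> ball 0 r) f" "holo2_on (ball 0 r \<times> ball 0 r) g"
    using germ2_bidisc2[OF f g] by blast
  obtain s where s: "s > 0" "\<And>z w. cmod z < s \<Longrightarrow> cmod w < s \<Longrightarrow> z \<noteq> 0 \<Longrightarrow> f (z, w) = g (z, w)"
    using eq unfolding eventually_nhds_bidisc by auto
  have "f (z, w) = g (z, w)" if z: "cmod z < min r s" and w: "cmod w < min r s" for z w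
  proof (cases "z = 0")
    case True
    have hf: "(\<lambda>z. f (z, w)) holomorphic_on ball 0 r" "(\<lambda>z. g (z, w)) holomorphic_on ball 0 r"
      using w by (intro holo2_on_compose[OF r(2)] holo2_on_compose[OF r(3)] holomorphic_intros; simp)+
    then have "isCont (\<lambda>z. f (z, w)) 0" "isCont (\<lambda>z. g (z, w)) 0"
      using r(1) by (auto dest!: holomorphic_on_imp_continuous_on simp: continuous_on_eq_continuous_at)
    then have l: "((\<lambda>z. f (z, w)) \<longlongrightarrow> f (0, w)) (at 0)" "((\<lambda>z. g (z, w)) \<longlongrightarrow> g (0, w)) (at 0)"
      by (auto simp: isCont_def)
    have "\<forall>\<^sub>F z in at 0. f (z, w) = g (z, w)"
      unfolding eventually_at using s w by (intro exI[of _ s]) (auto simp: dist_norm)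
    from Lim_transform_eventually[OF l(1) this] l(2) show ?thesis
      using True tendsto_unique[OF trivial_limit_at] by blast
  next
    case False
    then show ?thesis using z w s(2) by simp
  qed
  then show ?thesis unfolding germ_eq_def eventually_nhds_bidisc using r(1) s(1) by (intro exI[of _ "min r s"]) auto
qed

text \<open>By \<open>roots_nonempty\<close> every small \<open>z \<noteq> 0\<close> carries a zero
  of \<open>d\<close> near 0, so the hypothesis on \<open>P\<close> cannot hold vacuously.\<close>

lemma zero_branches_frequently:
  assumes d: "germ2 d" "\<not> germ_dvd fst d" "d 0 = 0"
    and P: "\<forall>\<^sub>F x in nhds 0. fst x \<noteq> 0 \<longrightarrow> d x = 0 \<longrightarrow> P x"
  shows "\<exists>\<^sub>F x in nhds 0. fst x \<noteq> 0 \<and> P x"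
  unfolding frequently_def
proof
  assume N: "\<forall>\<^sub>F x in nhds 0. \<not> (fst x \<noteq> 0 \<and> P x)"
  obtain R \<epsilon> where "zero_branches d R \<epsilon>" using d(1,2) by (rule zero_branches_exists)
  then interpret zero_branches d R \<epsilon> .
  from P N have "\<forall>\<^sub>F x in nhds 0. d x = 0 \<longrightarrow> fst x = 0" by eventually_elim auto
  from roots_near[OF this] roots_nonempty[OF d(3)] have "\<forall>\<^sub>F z in nhds (0::complex). z = 0"
    by eventually_elim (auto simp: roots_def)
  then have "\<forall>\<^sub>F z in at (0::complex). False" unfolding eventually_at_filter by eventually_elim auto
  then show False by simp
qed

text \<open>Induction on \<open>r\<close> strips factors \<open>fst\<close> from \<open>d\<close>.
  When \<open>fst\<close> no longer divides \<open>d\<close>, either \<open>d\<close> is a unit and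
  divides everything, or \<open>d\<close> has zeros off the axis arbitrarily near 0; there
  \<open>fst\<close> can be cancelled, so they are common zeros of \<open>a\<close> and
  \<open>b\<close>.\<close>

lemma common_divisor_dichotomy:
  assumes "germ2 a" "germ2 b" "\<not> germ_dvd fst b"
    and "germ2 d" "germ_dvd d (\<lambda>x. fst x ^ r * (fst x * a x))" "germ_dvd d (\<lambda>x. fst x ^ r * b x)"
  shows "germ_dvd d (\<lambda>x. fst x ^ r) \<or> (\<exists>\<^sub>F x in nhds 0. fst x \<noteq> 0 \<and> a x = 0 \<and> b x = 0)"
  using assms(4-6)
proof (induction r arbitrary: d)
  case (0 d)
  then show ?case
  proof (cases "d 0 = 0")
    case True
    obtain q where q: "germ2 q" "germ_eq b (\<lambda>x. d x * q x)" using 0(3) by (auto simp: germ_dvd_def)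
    obtain q1 where q1: "germ2 q1" "germ_eq (\<lambda>x. fst x * a x) (\<lambda>x. d x * q1 x)" using 0(2) by (auto simp: germ_dvd_def)
    have "\<not> germ_dvd fst d"
    proof
      assume "germ_dvd fst d"
      then obtain d1 where "germ2 d1" "germ_eq d (\<lambda>x. fst x * d1 x)" by (auto simp: germ_dvd_def)
      then have "germ2 (\<lambda>x. d1 x * q x)" "germ_eq b (\<lambda>x. fst x * (d1 x * q x))"
        using q unfolding germ_eq_def by (auto intro: germ2_mult elim: eventually_elim2 simp: mult.assoc)
      then show False using assms(3) unfolding germ_dvd_def by blast
    qed
    moreover have "\<forall>\<^sub>F x in nhds 0. fst x \<noteq> 0 \<longrightarrow> d x = 0 \<longrightarrow> a x = 0 \<and> b x = 0"
      using q(2) q1(2) unfolding germ_eq_def by eventually_elim auto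
    ultimately show ?thesis using zero_branches_frequently[OF 0(1) _ True, of "\<lambda>x. a x = 0 \<and> b x = 0"] by blast
  next
    case False
    have "germ_eq (\<lambda>x. fst x ^ 0) (\<lambda>x. d x * (1 / d x))"
      using germ2_eventually_nonzero[OF 0(1) False] unfolding germ_eq_def by eventually_elim simp
    moreover have "germ2 (\<lambda>x. 1 / d x)" by (intro germ2_divide germ2_const 0 False)
    ultimately show ?thesis unfolding germ_dvd_def by blast
  qed
next
  case (Suc r d)
  obtain q where q: "germ2 q" "germ_eq (\<lambda>x. fst x ^ Suc r * b x) (\<lambda>x. d x * q x)" using Suc.prems(3) by (auto simp: germ_dvd_def)
  obtain q1 where q1: "germ2 q1" "germ_eq (\<lambda>x. fst x ^ Suc r * (fst x * a x)) (\<lambda>x. d x * q1 x)"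
    using Suc.prems(2) by (auto simp: germ_dvd_def)
  consider "d 0 \<noteq> 0" | "d 0 = 0" "\<not> germ_dvd fst d" | "germ_dvd fst d" by blast
  then show ?case
  proof cases
    case 1
    have "germ_eq (\<lambda>x. fst x ^ Suc r) (\<lambda>x. d x * (fst x ^ Suc r / d x))"
      using germ2_eventually_nonzero[OF Suc.prems(1) 1] unfolding germ_eq_def by eventually_elim simp
    moreover have "germ2 (\<lambda>x. fst x ^ Suc r / d x)"
      by (intro germ2_divide germ2_power germ2_fst Suc.prems 1)
    ultimately show ?thesis unfolding germ_dvd_def by blast
  next
    case 2
    have "\<forall>\<^sub>F x in nhds 0. fst x \<noteq> 0 \<longrightarrow> d x = 0 \<longrightarrow> a x = 0 \<and> b x = 0"
      using q(2) q1(2) unfolding germ_eq_def by eventually_elim auto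
    then show ?thesis using zero_branches_frequently[OF Suc.prems(1) 2(2,1), of "\<lambda>x. a x = 0 \<and> b x = 0"] by blast
  next
    case 3
    then obtain d1 where d1: "germ2 d1" "germ_eq d (\<lambda>x. fst x * d1 x)" by (auto simp: germ_dvd_def)
    have "germ_eq (\<lambda>x. fst x ^ r * b x) (\<lambda>x. d1 x * q x)"
      by (rule germ_eq_cancel_fst)
        (use q d1 assms in \<open>auto intro!: germ2_intros elim: eventually_elim2 simp: germ_eq_def\<close>)
    moreover have "germ_eq (\<lambda>x. fst x ^ r * (fst x * a x)) (\<lambda>x. d1 x * q1 x)"
      by (rule germ_eq_cancel_fst)
        (use q1 d1 assms in \<open>auto intro!: germ2_intros elim: eventually_elim2 simp: germ_eq_def\<close>)
    ultimately have "germ_dvd d1 (\<lambda>x. fst x ^ r) \<or> (\<exists>\<^sub>F x in nhds 0. fst x \<noteq> 0 \<and> a x = 0 \<and> b x = 0)"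
      using q q1 by (intro Suc.IH[OF d1(1)]) (auto simp: germ_dvd_def)
    moreover have "germ_dvd d (\<lambda>x. fst x ^ Suc r)" if D: "germ_dvd d1 (\<lambda>x. fst x ^ r)"
    proof -
      obtain e where e: "germ2 e" "germ_eq (\<lambda>x. fst x ^ r) (\<lambda>x. d1 x * e x)" using D by (auto simp: germ_dvd_def)
      have "germ_eq (\<lambda>x. fst x ^ Suc r) (\<lambda>x. d x * e x)"
        using e(2) d1(2) unfolding germ_eq_def by eventually_elim simp
      then show ?thesis using e(1) unfolding germ_dvd_def by blast
    qed
    ultimately show ?thesis by blast
  qed
qed

lemma analytic_set_germ_zero_set: "finite G \<Longrightarrow> \<forall>g\<in>G. germ2 g \<Longrightarrow> analytic_set_germ {x. \<forall>g\<in>G. g x = 0}"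
  unfolding analytic_set_germ_def germ_set_eq_def germ_subset_def by (intro exI[of _ G]) simp

lemma analytic_set_germ_Int:
  assumes "analytic_set_germ B" "analytic_set_germ C" shows "analytic_set_germ (B \<inter> C)"
proof -
  obtain G H where G: "finite G" "\<forall>g\<in>G. germ2 g" "germ_set_eq B {x. \<forall>g\<in>G. g x = 0}"
    and H: "finite H" "\<forall>g\<in>H. germ2 g" "germ_set_eq C {x. \<forall>g\<in>H. g x = 0}"
    using assms unfolding analytic_set_germ_def by blast
  have ev: "\<forall>\<^sub>F x in nhds 0. (x \<in> B \<longleftrightarrow> (\<forall>g\<in>G. g x = 0)) \<and> (x \<in> C \<longleftrightarrow> (\<forall>g\<in>H. g x = 0))"
    using G(3) H(3) unfolding germ_set_eq_def germ_subset_def eventually_conj_iff[symmetric]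
    by (rule eventually_elim2) blast
  have "germ_set_eq (B \<inter> C) {x. \<forall>g\<in>G \<union> H. g x = 0}"
    unfolding germ_set_eq_def germ_subset_def using ev by (intro conjI; eventually_elim) auto
  moreover have "\<forall>g\<in>G \<union> H. germ2 g" using G(2) H(2) by blast
  ultimately show ?thesis unfolding analytic_set_germ_def using G(1) H(1) finite_UnI by blast
qed

lemma analytic_set_germ_0:
  assumes "analytic_set_germ B" "\<exists>\<^sub>F x in nhds 0. x \<in> B" shows "0 \<in> B"
proof -
  obtain G where G: "finite G" "\<forall>g\<in>G. germ2 g" "germ_set_eq B {x. \<forall>g\<in>G. g x = 0}"
    using assms(1) by (auto simp: analytic_set_germ_def)
  have "g 0 = 0" if g: "g \<in> G" for g
  proof (rule ccontr)
    assume "g 0 \<noteq> 0"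
    then have "\<forall>\<^sub>F x in nhds 0. g x \<noteq> 0" using G(2) g by (intro germ2_eventually_nonzero) auto
    moreover have "\<forall>\<^sub>F x in nhds 0. x \<in> B \<longrightarrow> g x = 0"
      using G(3) g unfolding germ_set_eq_def germ_subset_def by (auto elim: eventually_mono)
    ultimately have "\<forall>\<^sub>F x in nhds 0. x \<notin> B" by eventually_elim auto
    then show False using assms(2) by (simp add: frequently_def)
  qed
  moreover have "\<forall>\<^sub>F x in nhds 0. x \<in> {x. \<forall>g\<in>G. g x = 0} \<longrightarrow> x \<in> B"
    using G(3) unfolding germ_set_eq_def germ_subset_def by blast
  ultimately show ?thesis using eventually_nhds_x_imp_x by fastforce
qed

lemma analytic_set_germ_axis: "analytic_set_germ {x. fst x = 0}"
  using analytic_set_germ_zero_set[of "{fst}"] germ2_fst by simp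

text \<open>An analytic germ inside the axis is the whole axis or misses the punctured axis near 0,
  by isolated zeros of some \<open>g (0, _)\<close>. Two germs of the second kind cannot cover the
  axis.\<close>

lemma irreducible_axis: "irreducible_set_germ {x. fst x = 0}"
  unfolding irreducible_set_germ_def
proof (intro conjI allI impI)
  show "analytic_set_germ {x. fst x = 0}" by (rule analytic_set_germ_axis)
  show "0 \<in> {x. fst x = (0::complex)}" by simp
  fix B C assume an: "analytic_set_germ B" "analytic_set_germ C" and BC: "germ_set_eq {x. fst x = 0} (B \<union> C)"
  have *: "germ_set_eq {x. fst x = 0} D \<or> (\<forall>\<^sub>F w in at 0. (0, w) \<notin> D)"
    if D: "analytic_set_germ D" "germ_subset D {x. fst x = 0}" for D
  proof -
    obtain G where G: "finite G" "\<forall>g\<in>G. germ2 g" "germ_set_eq D {x. \<forall>g\<in>G. g x = 0}"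
      using D(1) by (auto simp: analytic_set_germ_def)
    show ?thesis
    proof (cases "\<forall>g\<in>G. germ_dvd fst g")
      case True
      have "\<forall>\<^sub>F x in nhds 0. fst x = 0 \<longrightarrow> g x = 0" if "g \<in> G" for g
        using True that unfolding germ_dvd_def germ_eq_def by (auto elim!: ballE eventually_mono)
      then have "\<forall>\<^sub>F x in nhds 0. \<forall>g\<in>G. fst x = 0 \<longrightarrow> g x = 0" by (intro eventually_ball_finite G(1)) auto
      then have "germ_subset {x. fst x = 0} D"
        using G(3) unfolding germ_set_eq_def germ_subset_def by (auto elim: eventually_elim2)
      then show ?thesis using D(2) by (simp add: germ_set_eq_def)
    next
      case False
      then obtain g where g: "g \<in> G" "\<not> germ_dvd fst g" by blast
      then obtain R \<epsilon> where "zero_branches g R \<epsilon>" using G(2) zero_branches_exists by blast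
      then interpret zero_branches g R \<epsilon> .
      have "\<forall>\<^sub>F x in nhds 0. x \<in> D \<longrightarrow> g x = 0"
        using G(3) g unfolding germ_set_eq_def germ_subset_def by (auto elim: eventually_mono)
      then obtain r where r: "r > 0" "\<And>z w. cmod z < r \<Longrightarrow> cmod w < r \<Longrightarrow> (z, w) \<in> D \<Longrightarrow> g (z, w) = 0"
        unfolding eventually_nhds_bidisc by blast
      have "\<forall>\<^sub>F w in at 0. (0, w) \<notin> D"
        unfolding eventually_at using r e nz
        by (intro exI[of _ "min r \<epsilon>"]) (auto simp: dist_norm, metis norm_zero less_imp_le)
      then show ?thesis ..
    qed
  qed
  have sub: "germ_subset B {x. fst x = 0}" "germ_subset C {x. fst x = 0}"
    using BC unfolding germ_set_eq_def germ_subset_def by (auto elim: eventually_mono)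
  have "False" if "\<forall>\<^sub>F w in at 0. (0, w) \<notin> B" "\<forall>\<^sub>F w in at 0. (0, w) \<notin> C"
  proof -
    have "\<forall>\<^sub>F x in nhds 0. fst x = 0 \<longrightarrow> x \<in> B \<union> C"
      using BC unfolding germ_set_eq_def germ_subset_def by simp
    then obtain r where r: "r > 0" "\<And>z w. cmod z < r \<Longrightarrow> cmod w < r \<Longrightarrow> z = 0 \<Longrightarrow> (z, w) \<in> B \<union> C"
      unfolding eventually_nhds_bidisc by force
    have "\<forall>\<^sub>F w in at 0. (0, w) \<in> B \<union> C"
      unfolding eventually_at using r(1) r(2)[of 0] by (intro exI[of _ r]) (simp add: dist_norm)
    with that have "\<forall>\<^sub>F w in at (0::complex). False" by eventually_elim auto
    then show False by simp
  qed
  then show "germ_set_eq {x. fst x = 0} B \<or> germ_set_eq {x. fst x = 0} C"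
    using *[OF an(1) sub(1)] *[OF an(2) sub(2)] by blast
qed

text \<open>The count \<open>branches\<close> takes the place of a factorization into irreducibles:
  it is monotone, and nested germs in the common zero set with equal positive counts coincide. The
  axis is a further component, since an irreducible germ of fixed points lies in the axis or in the
  common zero set.\<close>

theorem corner_of_common_zeros:
  assumes a: "germ2 a" and gb: "germ2 b" "\<not> germ_dvd fst b"
    and Fix: "\<forall>\<^sub>F x in nhds 0. F x = x \<longleftrightarrow> fst x = 0 \<or> (a x = 0 \<and> b x = 0)"
    and freq: "\<exists>\<^sub>F x in nhds 0. fst x \<noteq> 0 \<and> a x = 0 \<and> b x = 0"
  shows "corner_germ F"
proof -
  obtain R \<epsilon> where "zero_branches b R \<epsilon>" using gb by (rule zero_branches_exists)
  then interpret zero_branches b R \<epsilon> .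
  let ?L = "{x. fst x = (0::complex)}" and ?V = "{x. a x = 0 \<and> b x = 0}"
  have V: "analytic_set_germ ?V" using analytic_set_germ_zero_set[of "{a, b}"] a gb by simp
  note sub_defs = germ_set_eq_def germ_subset_def
  \<comment> \<open>On the axis \<open>b\<close> vanishes near 0 at most at the origin, so comparing
    germs in the common zero set off the axis misses only the origin itself.\<close>
  have axis: "\<forall>\<^sub>F x in nhds 0. b x = 0 \<longrightarrow> fst x = 0 \<longrightarrow> x = 0"
  proof -
    have "\<forall>\<^sub>F x in nhds (0::complex \<times> complex). x \<in> UNIV \<times> ball 0 \<epsilon>"
      using e by (intro eventually_nhds_in_open open_Times) (auto simp: zero_prod_def)
    then show ?thesis
    proof eventually_elim
      case (elim x)
      then show ?case using nz[of "snd x"] by (cases x) (auto simp: zero_prod_def)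
    qed
  qed
  have inV: "\<forall>\<^sub>F x in nhds 0. x \<in> B \<longrightarrow> b x = 0" if "germ_subset B ?V" for B
    using that unfolding germ_subset_def by eventually_elim simp
  have pos: "branches B \<noteq> 0 \<longleftrightarrow> (\<exists>\<^sub>F x in nhds 0. x \<in> B \<and> fst x \<noteq> 0)"
    if "analytic_set_germ B" "germ_subset B ?V" for B
  proof
    show "branches B \<noteq> 0 \<Longrightarrow> \<exists>\<^sub>F x in nhds 0. x \<in> B \<and> fst x \<noteq> 0" by (rule branches_pos[OF that(1)])
    assume *: "\<exists>\<^sub>F x in nhds 0. x \<in> B \<and> fst x \<noteq> 0"
    show "branches B \<noteq> 0"
    proof
      assume "branches B = 0"
      from branches_eq_0[OF that(1) this inV[OF that(2)]] have "\<forall>\<^sub>F x in nhds 0. \<not> (x \<in> B \<and> fst x \<noteq> 0)"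
        by eventually_elim auto
      then show False using * by (simp add: frequently_def)
    qed
  qed
  have zero: "0 \<in> B" if "analytic_set_germ B" "branches B \<noteq> 0" for B
    by (rule analytic_set_germ_0[OF that(1)], rule frequently_elim1[OF branches_pos[OF that]]) auto
  have eqI: "germ_set_eq B C"
    if "analytic_set_germ B" "analytic_set_germ C" "germ_subset B C" "germ_subset C ?V"
      "branches C \<le> branches B" "branches B \<noteq> 0" for B C
  proof -
    have "\<forall>\<^sub>F x in nhds 0. fst x \<noteq> 0 \<longrightarrow> x \<in> C \<longrightarrow> x \<in> B"
      by (rule branches_eq[OF that(1,2,3,5) inV[OF that(4)]])
    with axis inV[OF that(4)] have "germ_subset C B"
      unfolding germ_subset_def by eventually_elim (use zero[OF that(1,6)] in auto)
    then show ?thesis using that(3) by (simp add: germ_set_eq_def)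
  qed
  define P where "P B \<longleftrightarrow> analytic_set_germ B \<and> germ_subset B ?V \<and> branches B \<noteq> 0" for B
  have "P ?V"
    unfolding P_def using V freq pos[OF V] by (auto simp: germ_subset_def elim: frequently_elim1)
  \<comment> \<open>A branch set with the least positive number of branches is irreducible, and an irreducible one with the
    greatest number is a component.\<close>
  then obtain B where B: "P B" "\<And>C. P C \<Longrightarrow> branches B \<le> branches C"
    using ex_has_least_nat[of P "?V" branches] by blast
  have "irreducible_set_germ B"
    unfolding irreducible_set_germ_def
  proof (intro conjI allI impI)
    show anB: "analytic_set_germ B" using B by (simp add: P_def)
    show "0 \<in> B" using zero B by (simp add: P_def)
    fix C D assume CD: "analytic_set_germ C" "analytic_set_germ D" "germ_set_eq B (C \<union> D)"
    have sub: "germ_subset C B" "germ_subset D B"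
      using CD(3) unfolding sub_defs by (auto elim: eventually_mono)
    have V': "germ_subset B ?V" using B by (simp add: P_def)
    have subV: "germ_subset C ?V" "germ_subset D ?V"
      using sub V' unfolding germ_subset_def by - (erule eventually_elim2, assumption, blast)+
    have *: "germ_set_eq B E" if "analytic_set_germ E" "germ_subset E B" "germ_subset E ?V" "branches E \<noteq> 0" for E
      using eqI[OF that(1) anB that(2) V' _ that(4)] B(2)[of E] that by (auto simp: P_def germ_set_eq_def)
    have "branches C \<noteq> 0 \<or> branches D \<noteq> 0"
    proof -
      have "\<exists>\<^sub>F x in nhds 0. x \<in> B \<and> fst x \<noteq> 0" using B(1) pos[of B] unfolding P_def by blast
      moreover have "\<forall>\<^sub>F x in nhds 0. x \<in> B \<longrightarrow> x \<in> C \<union> D" using CD(3) by (simp add: sub_defs)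
      ultimately have "\<exists>\<^sub>F x in nhds 0. (x \<in> C \<and> fst x \<noteq> 0) \<or> (x \<in> D \<and> fst x \<noteq> 0)"
        by (rule frequently_rev_mp[OF _ eventually_mono]) auto
      then show ?thesis using pos CD subV by (auto simp: frequently_disj_iff)
    qed
    then show "germ_set_eq B C \<or> germ_set_eq B D" using * CD sub subV by blast
  qed
  then have ex: "irreducible_set_germ B \<and> P B" using B by blast
  have bd: "\<forall>C. irreducible_set_germ C \<and> P C \<longrightarrow> branches C < Suc (branches ?V)"
    using branches_mono[OF _ V] by (auto simp: P_def less_Suc_eq_le)
  obtain C where C: "irreducible_set_germ C" "P C" "\<And>D. irreducible_set_germ D \<Longrightarrow> P D \<Longrightarrow> branches D \<le> branches C"
    using ex_has_greatest_nat[OF ex bd] by blast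
  have split: "germ_set_eq Y (Y \<inter> ?L) \<or> germ_set_eq Y (Y \<inter> ?V)"
    if Y: "irreducible_set_germ Y" "germ_subset Y {x. F x = x}" for Y
  proof -
    have anY: "analytic_set_germ Y" using Y(1) by (simp add: irreducible_set_germ_def)
    have "germ_set_eq Y ((Y \<inter> ?L) \<union> (Y \<inter> ?V))"
      using Y(2) Fix unfolding sub_defs by (auto elim: eventually_elim2)
    then show ?thesis
      using Y(1) analytic_set_germ_Int[OF anY analytic_set_germ_axis] analytic_set_germ_Int[OF anY V]
      unfolding irreducible_set_germ_def by blast
  qed
  have C': "local_component C {x. F x = x}"
    unfolding local_component_def
  proof (intro conjI allI impI C(1))
    show "germ_subset C {x. F x = x}"
      using C(2) Fix unfolding P_def germ_subset_def by (auto elim: eventually_elim2)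
    fix Y assume Y: "irreducible_set_germ Y" "germ_subset Y {x. F x = x}" "germ_subset C Y"
    have "\<not> germ_set_eq Y (Y \<inter> ?L)"
    proof
      assume "germ_set_eq Y (Y \<inter> ?L)"
      then have "\<forall>\<^sub>F x in nhds 0. \<not> (x \<in> C \<and> fst x \<noteq> 0)"
        using Y(3) unfolding sub_defs by (auto elim: eventually_elim2)
      then show False using C(2) pos by (auto simp: P_def frequently_def)
    qed
    then have "germ_set_eq Y (Y \<inter> ?V)" using split Y by blast
    then have YV: "germ_subset Y ?V" unfolding sub_defs by (auto elim: eventually_mono)
    have anY: "analytic_set_germ Y" using Y(1) by (simp add: irreducible_set_germ_def)
    have le: "branches C \<le> branches Y" using C(2) anY Y(3) by (intro branches_mono) (auto simp: P_def)
    then have "P Y" using anY YV C(2) by (auto simp: P_def)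
    then show "germ_set_eq C Y"
      using eqI[OF _ anY Y(3) YV C(3)[OF Y(1)]] C(2) by (simp add: P_def)
  qed
  have L': "local_component ?L {x. F x = x}"
    unfolding local_component_def
  proof (intro conjI allI impI irreducible_axis)
    show "germ_subset ?L {x. F x = x}" using Fix unfolding germ_subset_def by eventually_elim auto
    fix Y assume Y: "irreducible_set_germ Y" "germ_subset Y {x. F x = x}" "germ_subset ?L Y"
    have "\<not> germ_set_eq Y (Y \<inter> ?V)"
    proof
      assume "germ_set_eq Y (Y \<inter> ?V)"
      then have "germ_subset Y (Y \<inter> ?V)" by (simp add: germ_set_eq_def)
      with Y(3) axis have "\<forall>\<^sub>F x in nhds (0::complex \<times> complex). fst x = 0 \<longrightarrow> x = 0"
        unfolding germ_subset_def by eventually_elim auto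
      then obtain r where r: "r > 0" "\<And>z w. cmod z < r \<Longrightarrow> cmod w < r \<Longrightarrow> z = 0 \<Longrightarrow> (z, w) = 0"
        unfolding eventually_nhds_bidisc by force
      from r(2)[of 0 "of_real (r / 2)"] r(1) show False by (simp add: zero_prod_def)
    qed
    then have "germ_set_eq Y (Y \<inter> ?L)" using split Y by blast
    then show "germ_set_eq ?L Y" using Y(3) unfolding sub_defs by (auto elim: eventually_mono)
  qed
  have "\<not> germ_set_eq ?L C"
  proof
    assume "germ_set_eq ?L C"
    then have "\<forall>\<^sub>F x in nhds 0. \<not> (x \<in> C \<and> fst x \<noteq> 0)" unfolding sub_defs by (auto elim: eventually_mono)
    then show False using C(2) pos by (auto simp: P_def frequently_def)
  qed
  then show ?thesis using L' C' unfolding corner_germ_def by blast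
qed

lemma norm_order_ge_mult_bounded:
  assumes "norm_order_ge g d" "germ2 u" "germ_eq h (\<lambda>x. u x * g x)" shows "norm_order_ge h d"
proof -
  obtain C where C: "\<forall>\<^sub>F x in nhds 0. cmod (g x) \<le> C * norm x ^ d" using assms(1) unfolding norm_order_ge_def by blast
  obtain K where K: "K > 0" "\<forall>\<^sub>F x in nhds 0. cmod (u x) \<le> K" using germ2_bounded[OF assms(2)] by blast
  have "\<forall>\<^sub>F x in nhds 0. cmod (h x) \<le> (K * C) * norm x ^ d"
    using C K(2) assms(3)[unfolded germ_eq_def]
  proof eventually_elim
    case (elim x)
    have "cmod (h x) \<le> K * (C * norm x ^ d)"
      unfolding elim(3) norm_mult using elim K(1) by (intro mult_mono) auto
    then show ?case by (simp add: mult.assoc)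
  qed
  then show ?thesis unfolding norm_order_ge_def by blast
qed

lemma enat_eqI: "(\<And>d. enat d \<le> X \<longleftrightarrow> enat d \<le> Y) \<Longrightarrow> X = Y"
  by (cases X; cases Y) (auto simp: not_le intro: le_antisym, (metis Suc_n_not_le_n)+)

lemma order_at_O_mult_unit:
  assumes "germ2 g" "germ2 h" "germ2 u" "germ2 v" "germ_eq h (\<lambda>x. u x * g x)" "germ_eq g (\<lambda>x. v x * h x)"
  shows "order_at_O g = order_at_O h"
  using norm_order_ge_mult_bounded[OF _ assms(3,5)] norm_order_ge_mult_bounded[OF _ assms(4,6)]
  by (intro enat_eqI) (auto simp: order_at_O_ge_iff assms(1,2))

text \<open>Any gcd \<open>l\<close> divides and is divided by \<open>fst x ^ r\<close>; cancelling
  shows the two cofactors to be mutually inverse units, which do not change orders. Hence the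
  definite description is satisfied by one value only.\<close>

lemma pure_order_eq:
  assumes a: "germ2 a" and b: "germ2 b"
    and gcd: "is_germ_gcd (\<lambda>x. fst x ^ r) (\<lambda>x. fst (F x) - fst x) (\<lambda>x. snd (F x) - snd x)"
    and F: "germ_eq (\<lambda>x. fst (F x) - fst x) (\<lambda>x. fst x ^ r * a x)"
      "germ_eq (\<lambda>x. snd (F x) - snd x) (\<lambda>x. fst x ^ r * b x)"
  shows "pure_order F = min (order_at_O a) (order_at_O b)"
  unfolding pure_order_def
proof (rule the_equality)
  show "\<exists>l g\<^sub>0 h\<^sub>0. is_germ_gcd l (\<lambda>x. fst (F x) - fst x) (\<lambda>x. snd (F x) - snd x) \<and>
     germ2 g\<^sub>0 \<and> germ_eq (\<lambda>x. fst (F x) - fst x) (\<lambda>x. l x * g\<^sub>0 x) \<and>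
     germ2 h\<^sub>0 \<and> germ_eq (\<lambda>x. snd (F x) - snd x) (\<lambda>x. l x * h\<^sub>0 x) \<and>
     min (order_at_O a) (order_at_O b) = min (order_at_O g\<^sub>0) (order_at_O h\<^sub>0)"
    using assms by blast
  fix n
  assume "\<exists>l g\<^sub>0 h\<^sub>0. is_germ_gcd l (\<lambda>x. fst (F x) - fst x) (\<lambda>x. snd (F x) - snd x) \<and>
     germ2 g\<^sub>0 \<and> germ_eq (\<lambda>x. fst (F x) - fst x) (\<lambda>x. l x * g\<^sub>0 x) \<and>
     germ2 h\<^sub>0 \<and> germ_eq (\<lambda>x. snd (F x) - snd x) (\<lambda>x. l x * h\<^sub>0 x) \<and>
     n = min (order_at_O g\<^sub>0) (order_at_O h\<^sub>0)"
  then obtain l g h where l: "is_germ_gcd l (\<lambda>x. fst (F x) - fst x) (\<lambda>x. snd (F x) - snd x)"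
    and g: "germ2 g" "germ_eq (\<lambda>x. fst (F x) - fst x) (\<lambda>x. l x * g x)"
    and h: "germ2 h" "germ_eq (\<lambda>x. snd (F x) - snd x) (\<lambda>x. l x * h x)"
    and n: "n = min (order_at_O g) (order_at_O h)" by blast
  obtain q where q: "germ2 q" "germ_eq l (\<lambda>x. fst x ^ r * q x)"
  proof -
    have "germ_dvd (\<lambda>x. fst x ^ r) l" using gcd l unfolding is_germ_gcd_def by blast
    then show ?thesis using that unfolding germ_dvd_def by blast
  qed
  obtain q' where q': "germ2 q'" "germ_eq (\<lambda>x. fst x ^ r) (\<lambda>x. l x * q' x)"
  proof -
    have "germ_dvd l (\<lambda>x. fst x ^ r)" using gcd l unfolding is_germ_gcd_def by blast
    then show ?thesis using that unfolding germ_dvd_def by blast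
  qed
  have qq: "germ_eq (\<lambda>x. q x * q' x) (\<lambda>x. 1)"
    using q(2) q'(2) by (intro germ_eq_cancel_fst germ2_intros q q') (auto elim: eventually_elim2 simp: germ_eq_def)
  have *: "order_at_O c = order_at_O k"
    if c: "germ2 c" and k: "germ2 k" and f: "germ_eq f (\<lambda>x. fst x ^ r * c x)" "germ_eq f (\<lambda>x. l x * k x)" for c k f
  proof (rule order_at_O_mult_unit[OF c k q'(1) q(1)])
    show cq: "germ_eq c (\<lambda>x. q x * k x)"
    proof (rule germ_eq_cancel_fst)
      show "\<forall>\<^sub>F x in nhds 0. fst x \<noteq> 0 \<longrightarrow> c x = q x * k x"
        using f[unfolded germ_eq_def] q(2)[unfolded germ_eq_def] by eventually_elim auto
    qed (intro germ2_intros c k q)+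
    show "germ_eq k (\<lambda>x. q' x * c x)"
      using cq qq unfolding germ_eq_def by eventually_elim (metis mult.assoc mult.commute mult_1)
  qed
  show "n = min (order_at_O a) (order_at_O b)"
    unfolding n using *[OF a g(1) F(1) g(2)] *[OF b h(1) F(2) h(2)] by simp
qed

text \<open>Away from corners \<open>a\<close> and \<open>b\<close> have no common zeros off the
  axis, so \<open>common_divisor_dichotomy\<close> makes \<open>fst x ^ r\<close> a gcd. The pure
  order is then the minimum of the orders of \<open>fst x * a x\<close> and \<open>b\<close>, and it
  would be at least 2 if both were.\<close>

theorem pure_order_one_not_corner:
  assumes a: "germ2 a" and b: "germ2 b" "\<not> germ_dvd fst b" and r: "0 < r"
    and F: "germ_eq (\<lambda>x. fst (F x) - fst x) (\<lambda>x. fst x ^ (r + 1) * a x)"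
      "germ_eq (\<lambda>x. snd (F x) - snd x) (\<lambda>x. fst x ^ r * b x)"
    and nc: "\<not> corner_germ F" and po: "pure_order F = 1"
  shows "\<not> (norm_order_ge (\<lambda>x. fst x * a x) 2 \<and> norm_order_ge b 2)"
proof -
  have F': "germ_eq (\<lambda>x. fst (F x) - fst x) (\<lambda>x. fst x ^ r * (fst x * a x))"
    using F(1) by (simp add: mult.assoc mult.left_commute)
  have za: "germ2 (\<lambda>x. fst x * a x)" by (intro germ2_intros a)
  have "\<forall>\<^sub>F x in nhds 0. F x = x \<longleftrightarrow> fst x = 0 \<or> (a x = 0 \<and> b x = 0)"
    using F[unfolded germ_eq_def]
  proof eventually_elim
    case (elim x)
    have "F x = x \<longleftrightarrow> fst (F x) - fst x = 0 \<and> snd (F x) - snd x = 0" by (auto simp: prod_eq_iff)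
    then show ?case unfolding elim using r by auto
  qed
  then have nf: "\<not> (\<exists>\<^sub>F x in nhds 0. fst x \<noteq> 0 \<and> a x = 0 \<and> b x = 0)"
    using corner_of_common_zeros[OF a b] nc by blast
  have dvd_cong: "germ_dvd d f \<Longrightarrow> germ_eq f g \<Longrightarrow> germ_dvd d g" for d f g
    unfolding germ_dvd_def by (meson germ_eq_sym germ_eq_trans)
  have "is_germ_gcd (\<lambda>x. fst x ^ r) (\<lambda>x. fst (F x) - fst x) (\<lambda>x. snd (F x) - snd x)"
    unfolding is_germ_gcd_def
  proof (intro conjI allI impI)
    show "germ2 (\<lambda>x. fst x ^ r)" by (intro germ2_intros)
    show "germ_dvd (\<lambda>x. fst x ^ r) (\<lambda>x. fst (F x) - fst x)" using F' za unfolding germ_dvd_def by blast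
    show "germ_dvd (\<lambda>x. fst x ^ r) (\<lambda>x. snd (F x) - snd x)" using F(2) b unfolding germ_dvd_def by blast
    fix d assume "germ2 d" "germ_dvd d (\<lambda>x. fst (F x) - fst x)" "germ_dvd d (\<lambda>x. snd (F x) - snd x)"
    then show "germ_dvd d (\<lambda>x. fst x ^ r)"
      using common_divisor_dichotomy[OF a b, of d r] nf dvd_cong[OF _ F'] dvd_cong[OF _ F(2)] by blast
  qed
  from pure_order_eq[OF za b(1) this F' F(2)] po
  have "\<not> (enat 2 \<le> order_at_O (\<lambda>x. fst x * a x) \<and> enat 2 \<le> order_at_O b)"
    by (metis enat_ord_simps(1) min.bounded_iff not_less_eq_eq numeral_2_eq_2 one_enat_def One_nat_def order_refl)
  then show ?thesis using order_at_O_ge_iff za b(1) by blast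
qed


section \<open>The residual index\<close>

lemma norm_order_ge_1:
  assumes "germ2 f" "f 0 = 0" shows "norm_order_ge f 1"
proof -
  obtain p q where pq: "germ2 p" "germ2 q" "germ_eq f (\<lambda>x. f 0 + fst x * p x + snd x * q x)"
    using germ2_hadamard[OF assms(1)] by metis
  obtain P where P: "P > 0" "\<forall>\<^sub>F x in nhds 0. cmod (p x) \<le> P" using germ2_bounded[OF pq(1)] by blast
  obtain Q where Q: "Q > 0" "\<forall>\<^sub>F x in nhds 0. cmod (q x) \<le> Q" using germ2_bounded[OF pq(2)] by blast
  have "\<forall>\<^sub>F x in nhds 0. cmod (f x) \<le> (P + Q) * norm x ^ 1"
    using P(2) Q(2) pq(3)[unfolded germ_eq_def]
  proof eventually_elim
    case (elim x)
    have "cmod (f x) \<le> cmod (fst x) * cmod (p x) + cmod (snd x) * cmod (q x)"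
      unfolding elim(3) using assms(2) by (metis add_0 norm_mult norm_triangle_ineq)
    also have "\<dots> \<le> norm x * P + norm x * Q"
      using elim P(1) Q(1) norm_fst_le[of "fst x" "snd x"] norm_snd_le[of "snd x" "fst x"]
      by (intro add_mono mult_mono) auto
    finally show ?case by (simp add: algebra_simps)
  qed
  then show ?thesis unfolding norm_order_ge_def by blast
qed

lemma norm_order_ge_mult:
  assumes "norm_order_ge f d" "norm_order_ge g e" shows "norm_order_ge (\<lambda>x. f x * g x) (d + e)"
proof -
  obtain C D where C: "\<forall>\<^sub>F x in nhds 0. cmod (f x) \<le> C * norm x ^ d" and D: "\<forall>\<^sub>F x in nhds 0. cmod (g x) \<le> D * norm x ^ e"
    using assms unfolding norm_order_ge_def by blast
  from C D have "\<forall>\<^sub>F x in nhds 0. cmod (f x * g x) \<le> (C * D) * norm x ^ (d + e)"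
  proof eventually_elim
    case (elim x)
    have "cmod (f x * g x) \<le> (C * norm x ^ d) * (D * norm x ^ e)"
      unfolding norm_mult using elim by (intro mult_mono) (auto intro: order_trans[OF norm_ge_zero])
    then show ?case by (simp add: power_add ac_simps)
  qed
  then show ?thesis unfolding norm_order_ge_def by blast
qed

lemma norm_order_ge_cong: "norm_order_ge f d \<Longrightarrow> germ_eq g f \<Longrightarrow> norm_order_ge g d"
  using norm_order_ge_mult_bounded[of f d "\<lambda>x. 1" g] by (simp add: germ2_const)

lemma holomorphic_factor_power:
  assumes f: "f holomorphic_on ball 0 R" and \<beta>: "\<beta> \<in> ball 0 R" "f \<beta> \<noteq> (0::complex)" and R: "0 < R"
  obtains n g r where "0 < r" "r \<le> R" "g holomorphic_on ball 0 r"
    "\<And>w. cmod w < r \<Longrightarrow> f w = w ^ n * g w" "\<And>w. cmod w < r \<Longrightarrow> g w \<noteq> 0"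
proof (cases "f 0 = 0")
  case True
  have nc: "\<not> f constant_on ball 0 R"
    using True \<beta> R unfolding constant_on_def by (metis centre_in_ball)
  have 0: "0 \<in> ball (0::complex) R" using R by simp
  show ?thesis
  proof (rule holomorphic_factor_zero_nonconstant[OF f open_ball convex_connected[OF convex_ball] 0 True nc])
    fix g r n assume g: "0 < (n::nat)" "0 < r" "ball 0 r \<subseteq> ball (0::complex) R" "g holomorphic_on ball 0 r"
      "\<And>w. w \<in> ball 0 r \<Longrightarrow> f w = (w - 0) ^ n * g w" "\<And>w. w \<in> ball 0 r \<Longrightarrow> g w \<noteq> 0"
    show thesis
    proof (rule that)
      show "r \<le> R" using g(2,3) by (simp add: ball_subset_ball_iff)
    qed (use g in auto)
  qed
next
  case False
  have "isCont f 0"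
    using f R by (auto dest!: holomorphic_on_imp_continuous_on simp: continuous_on_eq_continuous_at)
  from continuous_at_avoid[OF this False] obtain e where e: "e > 0" "\<And>w. dist 0 w < e \<Longrightarrow> f w \<noteq> 0" by auto
  have "f holomorphic_on ball 0 (min e R)" by (rule holomorphic_on_subset[OF f]) auto
  then show ?thesis using e R by (intro that[of "min e R" f 0]) auto
qed

text \<open>Here \<open>r = \<nu> + 1\<close>. The offsets 2 and 1 in \<open>z_form\<close> together
  with \<open>\<mu> \<ge> \<nu>\<close> give one more factor \<open>fst\<close> in the first
  component; \<open>\<nu> = \<infinity>\<close> would force \<open>\<mu> = \<infinity>\<close>, that
  is, the identity germ.\<close>

lemma tangential_germ_normal_form:
  assumes "tangential_germ F" "\<not> germ_eq F (\<lambda>x. x)"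
  obtains r a b where "0 < r" "germ2 a" "germ2 b" "\<not> germ_dvd fst b"
    "germ_eq (\<lambda>x. fst (F x) - fst x) (\<lambda>x. fst x ^ (r + 1) * a x)"
    "germ_eq (\<lambda>x. snd (F x) - snd x) (\<lambda>x. fst x ^ r * b x)"
proof -
  obtain \<mu> \<nu> where z: "z_form (\<lambda>x. fst (F x) - fst x) 2 \<mu>" "z_form (\<lambda>x. snd (F x) - snd x) 1 \<nu>" "\<not> \<mu> < \<nu>"
    using assms(1) unfolding tangential_germ_def by blast
  show ?thesis
  proof (cases \<nu>)
    case infinity
    then have "\<mu> = \<infinity>" using z(3) by (cases \<mu>) auto
    with z(1,2) infinity have "germ_eq (\<lambda>x. fst (F x) - fst x) (\<lambda>x. 0)" "germ_eq (\<lambda>x. snd (F x) - snd x) (\<lambda>x. 0)"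
      by (simp_all add: z_form_def)
    then have "germ_eq F (\<lambda>x. x)" unfolding germ_eq_def by eventually_elim (simp add: prod_eq_iff)
    then show ?thesis using assms(2) by blast
  next
    case (enat n)
    then obtain b where b: "germ2 b" "germ_eq (\<lambda>x. snd (F x) - snd x) (\<lambda>x. fst x ^ (n + 1) * b x)" "\<not> germ_dvd fst b"
      using z(2) by (auto simp: z_form_def)
    have "\<exists>a. germ2 a \<and> germ_eq (\<lambda>x. fst (F x) - fst x) (\<lambda>x. fst x ^ (n + 1 + 1) * a x)"
    proof (cases \<mu>)
      case infinity
      then show ?thesis using z(1) by (intro exI[of _ "\<lambda>x. 0"]) (simp add: z_form_def germ2_const)
    next
      case (enat m)
      then obtain g where g: "germ2 g" "germ_eq (\<lambda>x. fst (F x) - fst x) (\<lambda>x. fst x ^ (m + 2) * g x)"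
        using z(1) by (auto simp: z_form_def)
      have "n \<le> m" using z(3) \<open>\<nu> = enat n\<close> enat by simp
      then obtain k where "m = n + k" using le_Suc_ex by blast
      then have "(\<lambda>x. fst x ^ (m + 2) * g x) = (\<lambda>x. fst x ^ (n + 1 + 1) * (fst x ^ (m - n) * g x))"
        by (simp add: power_add ac_simps)
      then have "germ_eq (\<lambda>x. fst (F x) - fst x) (\<lambda>x. fst x ^ (n + 1 + 1) * (fst x ^ (m - n) * g x))"
        using g(2) by metis
      moreover have "germ2 (\<lambda>x. fst x ^ (m - n) * g x)" by (intro germ2_intros g)
      ultimately show ?thesis by blast
    qed
    then show ?thesis using b by (auto intro: that[of "n + 1"])
  qed
qed

text \<open>For small \<open>w \<noteq> 0\<close> the denominator \<open>b (0, w)\<close> is nonzero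
  and the powers of \<open>z\<close> cancel, so the limit in \<open>k_fun\<close> is a value of a
  continuous quotient. The residue ignores the point \<open>w = 0\<close>.\<close>

lemma residual_index_eq:
  assumes a: "germ2 a" and b: "germ2 b" "\<not> germ_dvd fst b"
    and F: "germ_eq (\<lambda>x. fst (F x) - fst x) (\<lambda>x. fst x ^ (r + 1) * a x)"
      "germ_eq (\<lambda>x. snd (F x) - snd x) (\<lambda>x. fst x ^ r * b x)"
  shows "residual_index F = residue (\<lambda>w. a (0, w) / b (0, w)) 0"
proof -
  obtain R \<epsilon> where "zero_branches b R \<epsilon>" using b by (rule zero_branches_exists)
  then interpret zb: zero_branches b R \<epsilon> .
  obtain s where s: "s > 0" "holo2_on (ball 0 s \<times> ball 0 s) a" "holo2_on (ball 0 s \<times> ball 0 s) b"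
    using germ2_bidisc2[OF a b(1)] by blast
  have "\<forall>\<^sub>F x in nhds 0. fst (F x) - fst x = fst x ^ (r + 1) * a x \<and> snd (F x) - snd x = fst x ^ r * b x"
    using F unfolding germ_eq_def by (rule eventually_conj)
  then obtain t where t: "t > 0" "\<And>z w. cmod z < t \<Longrightarrow> cmod w < t \<Longrightarrow>
      fst (F (z, w)) - z = z ^ (r + 1) * a (z, w) \<and> snd (F (z, w)) - w = z ^ r * b (z, w)"
    unfolding eventually_nhds_bidisc by auto
  have "k_fun F w = a (0, w) / b (0, w)" if w: "w \<noteq> 0" "cmod w < Min {s, t, \<epsilon>}" for w
    unfolding k_fun_def
  proof (rule tendsto_Lim)
    have b0: "b (0, w) \<noteq> 0" using w by (intro zb.nz) auto
    have "(\<lambda>z. a (z, w)) holomorphic_on ball 0 s" "(\<lambda>z. b (z, w)) holomorphic_on ball 0 s"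
      using w by (intro holo2_on_compose[OF s(2)] holo2_on_compose[OF s(3)] holomorphic_intros; simp)+
    then have "isCont (\<lambda>z. a (z, w)) 0" "isCont (\<lambda>z. b (z, w)) 0"
      using s(1) by (auto dest!: holomorphic_on_imp_continuous_on simp: continuous_on_eq_continuous_at)
    then have lim: "((\<lambda>z. a (z, w) / b (z, w)) \<longlongrightarrow> a (0, w) / b (0, w)) (at 0)"
      using b0 by (intro tendsto_divide) (auto simp: isCont_def)
    have "\<forall>\<^sub>F z in at 0. a (z, w) / b (z, w) = (fst (F (z, w)) - z) / (z * (snd (F (z, w)) - w))"
      unfolding eventually_at
    proof (intro exI[of _ t] conjI ballI impI t(1))
      fix z :: complex assume "z \<noteq> 0 \<and> dist z 0 < t"
      then show "a (z, w) / b (z, w) = (fst (F (z, w)) - z) / (z * (snd (F (z, w)) - w))"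
        using t(2)[of z w] w by simp
    qed
    then show "((\<lambda>z. (fst (F (z, w)) - z) / (z * (snd (F (z, w)) - w))) \<longlongrightarrow> a (0, w) / b (0, w)) (at 0)"
      by (rule Lim_transform_eventually[OF lim])
  qed simp
  then have "\<forall>\<^sub>F w in at 0. k_fun F w = a (0, w) / b (0, w)"
    unfolding eventually_at using s t zb.e by (intro exI[of _ "Min {s, t, \<epsilon>}"]) (auto simp: dist_norm)
  then show ?thesis unfolding residual_index_def by (rule residue_cong) simp
qed

theorem has_parabolic_curves_local:
  assumes "tangential_germ F" "\<not> germ_eq F (\<lambda>x. x)" "\<not> corner_germ F" "pure_order F = 1" "residual_index F \<noteq> 0"
  shows "has_parabolic_curves F"
proof -
  obtain r a b where r: "0 < r" and a: "germ2 a" and b: "germ2 b" "\<not> germ_dvd fst b"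
    and F: "germ_eq (\<lambda>x. fst (F x) - fst x) (\<lambda>x. fst x ^ (r + 1) * a x)"
      "germ_eq (\<lambda>x. snd (F x) - snd x) (\<lambda>x. fst x ^ r * b x)"
    using assms(1,2) by (rule tangential_germ_normal_form)
  have res: "residue (\<lambda>w. a (0, w) / b (0, w)) 0 \<noteq> 0"
    using assms(5) residual_index_eq[OF a b F] by simp
  obtain R \<epsilon> where "zero_branches b R \<epsilon>" using b by (rule zero_branches_exists)
  then interpret zb: zero_branches b R \<epsilon> .
  obtain R1 where R1: "R1 > 0" "holo2_on (ball 0 R1 \<times> ball 0 R1) a" using a by (rule germ2_bidisc)
  have ha: "(\<lambda>w. a (0, w)) holomorphic_on ball 0 R1"
    using R1 by (intro holo2_on_compose[OF R1(2)] holomorphic_intros) auto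
  have hb: "(\<lambda>w. b (0, w)) holomorphic_on ball 0 R" using zb.e by (intro zb.slice_holomorphic) auto
  \<comment> \<open>If \<open>a (0, _)\<close> vanished identically, so would the quotient, and the
    residue would be 0.\<close>
  have "\<exists>\<alpha>\<in>ball 0 R1. a (0, \<alpha>) \<noteq> 0"
  proof (rule ccontr)
    assume "\<not> ?thesis"
    then have "\<forall>\<^sub>F w in at 0. a (0, w) / b (0, w) = 0"
      unfolding eventually_at using R1(1) by (intro exI[of _ R1]) (auto simp: dist_norm)
    then have "residue (\<lambda>w. a (0, w) / b (0, w)) 0 = residue (\<lambda>w. 0) 0" by (rule residue_cong) simp
    then show False using res by (simp add: residue_const)
  qed
  then obtain \<alpha> where "\<alpha> \<in> ball 0 R1" "a (0, \<alpha>) \<noteq> 0" by blast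
  from holomorphic_factor_power[OF ha this R1(1)]
  obtain s A ra where A: "0 < ra" "A holomorphic_on ball 0 ra" "\<And>w. cmod w < ra \<Longrightarrow> a (0, w) = w ^ s * A w"
      "\<And>w. cmod w < ra \<Longrightarrow> A w \<noteq> 0" by metis
  have "of_real \<epsilon> \<in> ball (0::complex) R" "b (0, of_real \<epsilon>) \<noteq> 0" using zb.e zb.nz[of "of_real \<epsilon>"] by auto
  moreover have "0 < R" using zb.e by simp
  ultimately obtain m B rb where B: "0 < rb" "B holomorphic_on ball 0 rb" "\<And>w. cmod w < rb \<Longrightarrow> b (0, w) = w ^ m * B w"
      "\<And>w. cmod w < rb \<Longrightarrow> B w \<noteq> 0"
    using holomorphic_factor_power[OF hb] by metis
  \<comment> \<open>For \<open>m \<le> s\<close> the quotient would extend holomorphically to 0 and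
    have residue 0.\<close>
  have sm: "s < m"
  proof (rule ccontr)
    assume "\<not> s < m"
    define \<rho> where "\<rho> = min ra rb"
    have \<rho>: "0 < \<rho>" using A B by (simp add: \<rho>_def)
    have "a (0, w) / b (0, w) = w ^ (s - m) * A w / B w" if "w \<noteq> 0" "cmod w < \<rho>" for w
      using that \<open>\<not> s < m\<close> A(3)[of w] B(3,4)[of w] by (simp add: \<rho>_def power_diff)
    then have "\<forall>\<^sub>F w in at 0. a (0, w) / b (0, w) = w ^ (s - m) * A w / B w"
      unfolding eventually_at using \<rho> by (intro exI[of _ \<rho>]) (auto simp: dist_norm)
    then have "residue (\<lambda>w. a (0, w) / b (0, w)) 0 = residue (\<lambda>w. w ^ (s - m) * A w / B w) 0"
      by (rule residue_cong) simp
    also have "(\<lambda>w. w ^ (s - m) * A w / B w) holomorphic_on ball 0 \<rho>"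
      using B(4) by (intro holomorphic_intros holomorphic_on_subset[OF A(2)] holomorphic_on_subset[OF B(2)]) (auto simp: \<rho>_def)
    then have "residue (\<lambda>w. w ^ (s - m) * A w / B w) 0 = 0"
      using \<rho> by (intro residue_holo[of "ball 0 \<rho>"]) auto
    finally show False using res by simp
  qed
  have germA: "germ2 (\<lambda>x. A (snd x))" "germ2 (\<lambda>x. B (snd x))"
    using A(1) B(1) by (auto intro!: germ2_compose1[OF A(2)] germ2_compose1[OF B(2)] germ2_snd)
  obtain a1 where a1: "germ2 a1" "germ_eq a (\<lambda>x. a (0, snd x) + fst x * a1 x)" using a by (rule germ2_difference_quotient)
  obtain b1 where b1: "germ2 b1" "germ_eq b (\<lambda>x. b (0, snd x) + fst x * b1 x)" using b(1) by (rule germ2_difference_quotient)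
  have near: "\<forall>\<^sub>F x :: complex \<times> complex in nhds 0. x \<in> UNIV \<times> ball 0 (min ra rb)"
    using A(1) B(1) by (intro eventually_nhds_in_open open_Times) (auto simp: zero_prod_def)
  have a_eq: "germ_eq a (\<lambda>x. snd x ^ s * A (snd x) + fst x * a1 x)"
    using a1(2) near unfolding germ_eq_def by eventually_elim (auto simp: A(3))
  have b_eq: "germ_eq b (\<lambda>x. snd x ^ m * B (snd x) + fst x * b1 x)"
    using b1(2) near unfolding germ_eq_def by eventually_elim (auto simp: B(3))
  \<comment> \<open>If \<open>s > 0\<close> then \<open>a 0 = 0\<close> and
    \<open>m \<ge> 2\<close>. With \<open>b1 0 = 0\<close> in addition, both
    \<open>fst x * a x\<close> and \<open>b\<close> have order at least 2, against
    \<open>pure_order_one_not_corner\<close>.\<close>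
  have "s = 0 \<or> b1 0 \<noteq> 0"
  proof (rule ccontr)
    assume "\<not> ?thesis"
    then have s: "0 < s" and b10: "b1 0 = 0" by auto
    have "a 0 = 0" using A(3)[of 0] A(1) s by (simp add: zero_prod_def)
    then have "norm_order_ge (\<lambda>x. fst x * a x) (1 + 1)"
      by (intro norm_order_ge_mult norm_order_ge_1 germ2_fst a) auto
    moreover have "norm_order_ge b (1 + 1)"
    proof (rule norm_order_ge_cong)
      have m: "m = Suc (Suc (m - 2))" using sm s by simp
      have "norm_order_ge (\<lambda>x. snd x * (snd x ^ (m - 1) * B (snd x)) - fst x * (0 - b1 x)) (1 + 1)"
        using m b10 by (intro norm_order_ge_diff norm_order_ge_mult norm_order_ge_1 germ2_intros germA b1) auto
      moreover have "snd x * (snd x ^ (m - 1) * B (snd x)) - fst x * (0 - b1 x) = snd x ^ m * B (snd x) + fst x * b1 x" for x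
        using sm by (simp add: power_eq_if)
      ultimately show "norm_order_ge (\<lambda>x. snd x ^ m * B (snd x) + fst x * b1 x) (1 + 1)" by (simp only:)
    qed (rule b_eq)
    ultimately show False
      using pure_order_one_not_corner[OF a b r F assms(3,4)] by (simp add: numeral_2_eq_2)
  qed
  from parabolic_curves_local[OF a b(1) germA a1(1) b1(1) a_eq b_eq sm r _ _ this]
  have "has_parabolic_curves (\<lambda>x. (fst x + fst x ^ (r + 1) * a x, snd x + fst x ^ r * b x))"
    using A(1) A(4)[of 0] B(1) B(4)[of 0] by simp
  moreover have "germ_eq (\<lambda>x. (fst x + fst x ^ (r + 1) * a x, snd x + fst x ^ r * b x)) F"
    using F unfolding germ_eq_def by eventually_elim (simp add: prod_eq_iff algebra_simps)
  ultimately show ?thesis by (rule has_parabolic_curves_cong)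
qed

lemma open_local_dom:
  assumes c: "chart_on X c" and f: "holo_into_manifold X A N f"
  shows "open (local_dom c N f)"
proof -
  have U: "openin X (fst c)" "open (snd c ` fst c)"
    "homeomorphic_map (subtopology X (fst c)) (top_of_set (snd c ` fst c)) (snd c)"
    using c by (auto simp: chart_on_def)
  have N: "openin X N" "continuous_map (subtopology X N) X f" using f by (auto simp: holo_into_manifold_def)
  have "openin (subtopology X N) {x \<in> topspace (subtopology X N). f x \<in> fst c}"
    by (rule openin_continuous_map_preimage[OF N(2) U(1)])
  then have "openin X {x \<in> topspace (subtopology X N). f x \<in> fst c}"
    using openin_trans_full N(1) by blast
  then have "openin X (fst c \<inter> {x \<in> topspace (subtopology X N). f x \<in> fst c})" using U(1) by blast
  moreover have "fst c \<inter> {x \<in> topspace (subtopology X N). f x \<in> fst c} = {x \<in> fst c \<inter> N. f x \<in> fst c}"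
    using openin_subset[OF U(1)] by (auto simp: topspace_subtopology)
  ultimately have "openin X {x \<in> fst c \<inter> N. f x \<in> fst c}" by simp
  then have "openin (subtopology X (fst c)) {x \<in> fst c \<inter> N. f x \<in> fst c}"
    by (intro openin_subtopology_Int2[of _ _ "fst c", THEN back_subst[of "openin _"]] ) auto
  then have "openin (top_of_set (snd c ` fst c)) (local_dom c N f)"
    using homeomorphic_imp_open_map[OF U(3)] unfolding open_map_def local_dom_def by blast
  then show ?thesis using U(2) openin_open_eq by blast
qed

theorem theorem1p6:
  fixes M :: "'a topology" and A :: "'a chart set" and S N :: "'a set"
    and f :: "'a \<Rightarrow> 'a" and p :: 'a
  assumes "complex_2_manifold M A"
    and "complex_1_submanifold M A S"
    and "S \<subseteq> N"
    and "holo_into_manifold M A N f"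
    and "f ` S \<subseteq> S"
    and "\<forall>q\<in>S. f q = q"
    and "id_on_normal_bundle M A S f"
    and "tangential_to M A S f"
    and "p \<in> S"
    and "singular_germ (germ_at M A S f p)"
    and "\<not> corner_germ (germ_at M A S f p)"
    and "pure_order (germ_at M A S f p) = 1"
    and "residual_index (germ_at M A S f p) \<noteq> 0"
  shows "\<exists>\<Delta> \<phi>. parabolic_curve_at M A N f p \<Delta> \<phi>"
proof -
  \<comment> \<open>The adapted chart that \<open>germ_at\<close> selects serves as the chart of the
    conclusion; \<open>local_dom\<close> in it is the neighbourhood in which the curve is
    requested.\<close>
  define c where "c = (SOME c. adapted_chart M A S p c)"
  have F: "germ_at M A S f p = local_expr c f" by (simp add: germ_at_def c_def)
  have "\<exists>c. adapted_chart M A S p c" using assms(2,9) by (simp add: complex_1_submanifold_def)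
  then have "adapted_chart M A S p c" unfolding c_def by (rule someI_ex)
  then have c: "chart_centered_at M A p c" by (simp add: adapted_chart_def)
  then have ch: "chart_on M c" "p \<in> fst c" "snd c p = 0" by (auto simp: chart_centered_at_def)
  have "has_parabolic_curves (local_expr c f)"
    using assms(8-13) unfolding F[symmetric]
    by (intro has_parabolic_curves_local) (auto simp: tangential_to_def singular_germ_def)
  moreover have "open (local_dom c N f)" by (rule open_local_dom[OF ch(1) assms(4)])
  moreover have "0 \<in> local_dom c N f"
    unfolding local_dom_def ch(3)[symmetric] using ch(2) assms(3,6,9) by (intro imageI) auto
  ultimately show ?thesis
    using c unfolding has_parabolic_curves_def parabolic_curve_at_def by blast
qed

end
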